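(* Let $S\subset\mathbb{CP}_4$ be a Segre surface whose Segre symbol is one of $[11111]$, $[1112]$, $[113]$, $[122]$, $[14]$, $[23]$, $[5]$. Then the branch divisor of the generically finite double covering $\boldsymbol D_S\to S$ consists of the lines on $S$ which pass through at most one singular point of $S$; that is, its irreducible components are precisely these lines.
   Context: A Segre surface is a non-degenerate irreducible 2-dimensional subvariety $S\subset\mathbb{CP}_4$ of degree four which is neither a cone over a quartic curve in $\mathbb{CP}_3$ nor a projection of a quartic surface in $\mathbb{CP}_5$. (Every Segre surface is a complete intersection of two quadrics, its singularities are finitely many rational double points, and it contains only finitely many straight lines.) $S_{\rm reg}$ denotes the smooth locus. Segre symbol: write $S=\{{}^tXPX={}^tXQX=0\}$ with symmetric $5\times5$ matrices $P,Q$, the generators of the pencil of quadrics being chosen with $Q$ invertible. The Segre symbol lists the sizes of the Jordan blocks of $Q^{-1}P$, with the sizes of blocks belonging to the same eigenvalue grouped in parentheses when there is more than one block; the order of entries is irrelevant. Tangent planes $T_pS$, $p\in S_{\rm reg}$, are regarded as projective 2-planes in $\mathbb{CP}_4$. The incidence variety $I(S)\subset\mathbb{CP}_4\times\mathbb{CP}_4^*$ is the closure of the set of pairs $(p,H)$ with $p\in S_{\rm reg}$ and $H$ a hyperplane containing $T_pS$; $\pi_1:I(S)\to S$ is the projection. Divisors $\boldsymbol D,\boldsymbol D_1,\boldsymbol D_S$: near a point of $S_{\rm reg}$ choose affine coordinates $(x,y,z,w)$ on $\mathbb{CP}_4$ such that $S$ is locally $\{z=F(x,y),\ w=G(x,y)\}$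 with $F,G$ holomorphic. A hyperplane containing $T_qS$, $q=(a,b)\in S_{\rm reg}$, has the form $\lambda\{z-F(q)-F_x(q)(x-a)-F_y(q)(y-b)\}+\mu\{w-G(q)-G_x(q)(x-a)-G_y(q)(y-b)\}=0$, and $(\lambda:\mu)$ are homogeneous coordinates on the fiber $\pi_1^{-1}(q)\simeq\mathbb{CP}_1$. Let $\mathbf H=\operatorname{Hess}(\lambda F+\mu G)=\operatorname{Hess}(F)\lambda^2+(F_{xx}G_{yy}+G_{xx}F_{yy}-2F_{xy}G_{xy})\lambda\mu+\operatorname{Hess}(G)\mu^2$, where $\operatorname{Hess}$ is the determinant of the Hessian matrix in $(x,y)$. The equation $\mathbf H=0$ is independent of coordinate choices; $\boldsymbol D$ is the divisor on $I(S)$ obtained as the closure of $\{\mathbf H=0\}$ (counted with multiplicities). $\boldsymbol D_1$ is the sum (with multiplicities) of all components of $\boldsymbol D$ that are mapped to curves by $\pi_1$ (i.e. those of the form $\pi_1^{-1}$ of a curve along which all three coefficients of $\mathbf H$ vanish), and $\boldsymbol D_S:=\boldsymbol D-\boldsymbol D_1$. The restriction $\pi_1|_{\boldsymbol D_S}:\boldsymbol D_S\to S$ is a generically finite double covering. Branch divisor of $\boldsymbol D_S\to S$: the (closure of the) zero divisor on $S$ of the discriminant, with respect to $(\lambda,\mu)$, of the quadratic form obtained from $\mathbf H$ by dividing by a local equation of $\boldsymbol D_1$; concretely, near a generic point of a curve $\{y=0\}\subset S$, if $m\ge 0$ is the minimal vanishing order along the curve of the three coefficients of $\mathbf H$, it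 is the zero divisor of the discriminant of $\mathbf H/y^m$. *)

theory Defs
  imports
    Jordan_Normal_Form.Jordan_Normal_Form
    "HOL-Analysis.Analysis"
begin

no_notation Matrix.vec_index (infixl \<open>$\<close> 100)

section \<open>Projective varieties\<close>

text \<open>
  A point of the projective space with homogeneous coordinates indexed by \<open>'n\<close> is the set of
  its homogeneous coordinate vectors; so \<open>5 proj\<close> is $CP_4$.
\<close>

typedef ('n::finite) proj = "{l :: (complex^'n) set. \<exists>v. v \<noteq> 0 \<and> l = {c *s v | c. c \<noteq> 0}}"
  morphisms hcoords Abs_proj
proof -
  have "((\<chi> i. 1) :: complex^'n) \<noteq> 0"
    by (simp add: Finite_Cartesian_Product.vec_eq_iff)
  then show ?thesis by blast
qed

text \<open>Only meaningful for a non-zero argument.\<close>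

definition pt :: "complex^'n \<Rightarrow> 'n::finite proj" where
  "pt v = Abs_proj {c *s v | c. c \<noteq> 0}"

text \<open>The algebra of functions generated by \<open>X\<close>; polynomial functions are obtained
  by taking the coordinate functions for \<open>X\<close>.\<close>

inductive_set poly_funs :: "('a \<Rightarrow> complex) set \<Rightarrow> ('a \<Rightarrow> complex) set"
  for X :: "('a \<Rightarrow> complex) set" where
  gen: "f \<in> X \<Longrightarrow> f \<in> poly_funs X"
| const: "(\<lambda>_. c) \<in> poly_funs X"
| add: "f \<in> poly_funs X \<Longrightarrow> g \<in> poly_funs X \<Longrightarrow> (\<lambda>x. f x + g x) \<in> poly_funs X"
| mult: "f \<in> poly_funs X \<Longrightarrow> g \<in> poly_funs X \<Longrightarrow> (\<lambda>x. f x * g x) \<in> poly_funs X"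

definition form :: "nat \<Rightarrow> (complex^'n::finite \<Rightarrow> complex) \<Rightarrow> bool" where
  "form d f \<longleftrightarrow> f \<in> poly_funs (range (\<lambda>i v. v $ i)) \<and> (\<forall>c v. f (c *s v) = c ^ d * f v)"

definition zero_locus :: "(complex^'n \<Rightarrow> complex) set \<Rightarrow> 'n::finite proj set" where
  "zero_locus I = {p. \<forall>f\<in>I. \<forall>v\<in>hcoords p. f v = 0}"

definition zariski_closed :: "'n::finite proj set \<Rightarrow> bool" where
  "zariski_closed V \<longleftrightarrow> (\<exists>I. (\<forall>f\<in>I. \<exists>d. form d f) \<and> V = zero_locus I)"

definition irreducible_variety :: "'n::finite proj set \<Rightarrow> bool" where
  "irreducible_variety V \<longleftrightarrow> zariski_closed V \<and> V \<noteq> {} \<and>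
     (\<forall>V1 V2. zariski_closed V1 \<and> zariski_closed V2 \<and> V = V1 \<union> V2 \<longrightarrow> V = V1 \<or> V = V2)"

text \<open>Krull dimension.\<close>

definition variety_dim :: "'n::finite proj set \<Rightarrow> enat" where
  "variety_dim V = Sup {enat n | n. \<exists>Z. (\<forall>i\<le>n. irreducible_variety (Z i) \<and> Z i \<subseteq> V) \<and>
                                      (\<forall>i<n. Z i \<subset> Z (Suc i))}"

definition irreducible_curve :: "'n::finite proj set \<Rightarrow> bool" where
  "irreducible_curve C \<longleftrightarrow> irreducible_variety C \<and> variety_dim C = 1"

definition irreducible_surface :: "'n::finite proj set \<Rightarrow> bool" where
  "irreducible_surface S \<longleftrightarrow> irreducible_variety S \<and> variety_dim S = 2"

definition linear_subspace :: "(complex^'n) set \<Rightarrow> 'n::finite proj set" where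
  "linear_subspace W = {p. hcoords p \<subseteq> W}"

definition projective_line :: "'n::finite proj set \<Rightarrow> bool" where
  "projective_line L \<longleftrightarrow> (\<exists>W. vec.subspace W \<and> vec.dim W = 2 \<and> L = linear_subspace W)"

definition linear_zeros :: "complex^'n \<Rightarrow> 'n::finite proj set" where
  "linear_zeros u = {p. \<forall>v\<in>hcoords p. (\<Sum>i\<in>UNIV. u $ i * v $ i) = 0}"

definition nondegenerate :: "'n::finite proj set \<Rightarrow> bool" where
  "nondegenerate V \<longleftrightarrow> (\<forall>u. u \<noteq> 0 \<longrightarrow> \<not> V \<subseteq> linear_zeros u)"

text \<open>
  The degree of a \<open>d\<close>-dimensional variety is the number of its intersection points with a general
  linear subspace of codimension \<open>d\<close>. The subspace is given by \<open>d\<close> linear forms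
  \<open>u 0, \<dots>, u (d - 1)\<close>, and ``general'' means: off the zero set of some non-zero polynomial
  \<open>R\<close> in the coefficients of these forms.
\<close>

definition has_degree :: "'n::finite proj set \<Rightarrow> nat \<Rightarrow> bool" where
  "has_degree V k \<longleftrightarrow> (\<exists>d. variety_dim V = enat d \<and>
     (\<exists>R \<in> poly_funs {(\<lambda>u :: nat \<Rightarrow> complex^'n. u i $ j) | i j. i < d}.
        (\<exists>u. R u \<noteq> 0) \<and>
        (\<forall>u. R u \<noteq> 0 \<longrightarrow>
           finite (V \<inter> (\<Inter>i<d. linear_zeros (u i))) \<and>
           card (V \<inter> (\<Inter>i<d. linear_zeros (u i))) = k)))"

text \<open>
  \<open>p\<close> is smooth on \<open>V\<close> if the Zariski tangent space has the dimension of \<open>V\<close>. The space below is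
  the tangent space of the affine cone over \<open>V\<close> at a homogeneous coordinate vector of \<open>p\<close>, hence
  the \<open>d + 1\<close>.
\<close>

definition cone_tangent_space :: "'n::finite proj set \<Rightarrow> complex^'n \<Rightarrow> (complex^'n) set" where
  "cone_tangent_space V v =
     {w. \<forall>d f. form d f \<and> V \<subseteq> zero_locus {f} \<longrightarrow> deriv (\<lambda>t. f (v + t *s w)) 0 = 0}"

definition smooth_locus :: "'n::finite proj set \<Rightarrow> 'n proj set" where
  "smooth_locus V = {p\<in>V. \<exists>d. variety_dim V = enat d \<and>
                        (\<forall>v\<in>hcoords p. vec.dim (cone_tangent_space V v) = d + 1)}"

definition singular_locus :: "'n::finite proj set \<Rightarrow> 'n proj set" where
  "singular_locus V = V - smooth_locus V"


section \<open>Segre surfaces\<close>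

text \<open>The curve lies in $CP_3$, embedded as a hyperplane by \<open>M\<close>; the vertex is the point \<open>pt o'\<close>.\<close>

definition cone_over_quartic_curve :: "5 proj set \<Rightarrow> bool" where
  "cone_over_quartic_curve S \<longleftrightarrow>
     (\<exists>(C :: 4 proj set) (M :: complex^4^5) o'.
        irreducible_curve C \<and> has_degree C 4 \<and> inj (\<lambda>w. M *v w) \<and> o' \<notin> range (\<lambda>w. M *v w) \<and>
        S = {p. \<exists>a w. a *s o' + M *v w \<in> hcoords p \<and> (w = 0 \<or> pt w \<in> C)})"

text \<open>
  The quartic surface in $CP_5$ has to be non-degenerate, since otherwise every surface in $CP_4$
  would be such a projection. The centre of the projection, the kernel of \<open>M\<close>, is not on it.
\<close>

definition projection_of_quartic_surface :: "5 proj set \<Rightarrow> bool" where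
  "projection_of_quartic_surface S \<longleftrightarrow>
     (\<exists>(T :: 6 proj set) (M :: complex^6^5).
        irreducible_surface T \<and> nondegenerate T \<and> has_degree T 4 \<and>
        surj (\<lambda>v. M *v v) \<and> (\<forall>p\<in>T. \<forall>v\<in>hcoords p. M *v v \<noteq> 0) \<and>
        S = {pt (M *v v) | v. \<exists>p\<in>T. v \<in> hcoords p})"

definition segre_surface :: "5 proj set \<Rightarrow> bool" where
  "segre_surface S \<longleftrightarrow> irreducible_surface S \<and> nondegenerate S \<and> has_degree S 4 \<and>
     \<not> cone_over_quartic_curve S \<and> \<not> projection_of_quartic_surface S"

definition quadratic_form :: "complex^5^5 \<Rightarrow> complex^5 \<Rightarrow> complex" where
  "quadratic_form P v = (\<Sum>i\<in>UNIV. \<Sum>j\<in>UNIV. v $ i * P $ i $ j * v $ j)"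

definition to_mat :: "complex^5^5 \<Rightarrow> complex mat" where
  "to_mat A = Matrix.mat 5 5 (\<lambda>(i, j). A $ of_nat i $ of_nat j)"

text \<open>
  A Segre symbol is a multiset with one element for each eigenvalue, namely the multiset of the
  sizes of the Jordan blocks with this eigenvalue. For instance $[(11)12]$ is
  \<open>{#{#1, 1#}, {#1#}, {#2#}#}\<close>. The argument is a list of pairs (block size, eigenvalue).
\<close>

definition segre_symbol :: "(nat \<times> complex) list \<Rightarrow> nat multiset multiset" where
  "segre_symbol n_as =
     image_mset (\<lambda>e. image_mset fst (filter_mset (\<lambda>(n, a). a = e) (mset n_as)))
       (mset_set (snd ` set n_as))"

definition has_segre_symbol :: "5 proj set \<Rightarrow> nat multiset multiset \<Rightarrow> bool" where
  "has_segre_symbol S \<sigma> \<longleftrightarrow>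
     (\<exists>P Q n_as.
        Finite_Cartesian_Product.transpose P = P \<and> Finite_Cartesian_Product.transpose Q = Q \<and>
        invertible Q \<and> S = zero_locus {quadratic_form P, quadratic_form Q} \<and>
        jordan_nf (to_mat (matrix_inv Q ** P)) n_as \<and> \<sigma> = segre_symbol n_as)"

text \<open>The Segre symbol $[k_1 \ldots k_r]$ without parentheses.\<close>

definition ungrouped :: "nat list \<Rightarrow> nat multiset multiset" where
  "ungrouped ks = image_mset (\<lambda>k. {#k#}) (mset ks)"


section \<open>Local computations on the smooth locus\<close>

definition holomorphic2_on :: "(complex \<times> complex \<Rightarrow> complex) \<Rightarrow> (complex \<times> complex) set \<Rightarrow> bool" where
  "holomorphic2_on F U \<longleftrightarrow> open U \<and>
     (\<forall>q\<in>U. \<exists>\<alpha> \<beta>. (F has_derivative (\<lambda>(s, t). \<alpha> * s + \<beta> * t)) (at q))"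

definition dx :: "(complex \<times> complex \<Rightarrow> complex) \<Rightarrow> complex \<times> complex \<Rightarrow> complex" where
  "dx F = (\<lambda>(x, y). deriv (\<lambda>s. F (s, y)) x)"

definition dy :: "(complex \<times> complex \<Rightarrow> complex) \<Rightarrow> complex \<times> complex \<Rightarrow> complex" where
  "dy F = (\<lambda>(x, y). deriv (\<lambda>t. F (x, t)) y)"

text \<open>The point with affine coordinates \<open>(x, y, z, w)\<close>; the affine coordinate system on $CP_4$
  is determined by the invertible matrix \<open>A\<close>.\<close>

definition affine_pt :: "complex^5^5 \<Rightarrow> complex \<Rightarrow> complex \<Rightarrow> complex \<Rightarrow> complex \<Rightarrow> 5 proj" where
  "affine_pt A x y z w = pt (A *v vector [1, x, y, z, w])"

definition graph_pt :: "complex^5^5 \<Rightarrow> (complex \<times> complex \<Rightarrow> complex) \<Rightarrow>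
    (complex \<times> complex \<Rightarrow> complex) \<Rightarrow> complex \<times> complex \<Rightarrow> 5 proj" where
  "graph_pt A F G q = affine_pt A (fst q) (snd q) (F q) (G q)"

text \<open>In the affine coordinates given by \<open>A\<close>, the surface \<open>S\<close> coincides on the open set \<open>W\<close> with
  \<open>z = F (x, y)\<close>, \<open>w = G (x, y)\<close>, where \<open>(x, y) \<in> U\<close>.\<close>

definition graph_chart :: "5 proj set \<Rightarrow> complex^5^5 \<Rightarrow> (complex \<times> complex) set \<Rightarrow>
    (complex \<times> complex \<Rightarrow> complex) \<Rightarrow> (complex \<times> complex \<Rightarrow> complex) \<Rightarrow> bool" where
  "graph_chart S A U F G \<longleftrightarrow> invertible A \<and> holomorphic2_on F U \<and> holomorphic2_on G U \<and>
     (\<exists>W :: (complex \<times> complex \<times> complex \<times> complex) set. open W \<and>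
        {(x, y, z, w) \<in> W. affine_pt A x y z w \<in> S} =
        {(x, y, z, w). (x, y) \<in> U \<and> z = F (x, y) \<and> w = G (x, y)})"

text \<open>
  The coefficients of \<open>\<lambda>\<^sup>2\<close>, \<open>\<lambda>\<mu>\<close>, \<open>\<mu>\<^sup>2\<close> in the Hessian \<open>H\<close> of \<open>\<lambda> F + \<mu> G\<close>. As \<open>(\<lambda> : \<mu>)\<close> are
  homogeneous coordinates on the fibres of the incidence variety, \<open>H = 0\<close> is the local equation of
  the divisor \<open>D\<close>.
\<close>

definition H_coeffs :: "(complex \<times> complex \<Rightarrow> complex) \<Rightarrow> (complex \<times> complex \<Rightarrow> complex) \<Rightarrow>
    (complex \<times> complex \<Rightarrow> complex) \<times> (complex \<times> complex \<Rightarrow> complex) \<times> (complex \<times> complex \<Rightarrow> complex)" where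
  "H_coeffs F G =
    ((\<lambda>q. dx (dx F) q * dy (dy F) q - (dx (dy F) q)\<^sup>2),
     (\<lambda>q. dx (dx F) q * dy (dy G) q + dx (dx G) q * dy (dy F) q - 2 * dx (dy F) q * dx (dy G) q),
     (\<lambda>q. dx (dx G) q * dy (dy G) q - (dx (dy G) q)\<^sup>2))"

text \<open>
  \<open>h\<close> is a reduced equation, near \<open>q\<close>, of the curve \<open>C\<close> in the chart. As its differential at \<open>q\<close> is
  not zero, \<open>C\<close> is smooth at this point and \<open>h\<close> can be taken as one of two local coordinates on
  \<open>S\<close>, in which \<open>C\<close> is a coordinate line.
\<close>

definition curve_equation :: "5 proj set \<Rightarrow> complex^5^5 \<Rightarrow> (complex \<times> complex) set \<Rightarrow>
    (complex \<times> complex \<Rightarrow> complex) \<Rightarrow> (complex \<times> complex \<Rightarrow> complex) \<Rightarrow>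
    complex \<times> complex \<Rightarrow> (complex \<times> complex \<Rightarrow> complex) \<Rightarrow> bool" where
  "curve_equation C A U F G q h \<longleftrightarrow>
     (\<exists>N. q \<in> N \<and> N \<subseteq> U \<and> holomorphic2_on h N \<and>
        (\<forall>r\<in>N. graph_pt A F G r \<in> C \<longleftrightarrow> h r = 0)) \<and>
     h q = 0 \<and> (dx h q \<noteq> 0 \<or> dy h q \<noteq> 0)"

text \<open>The vanishing order, near \<open>q\<close>, of \<open>f\<close> along the curve \<open>h = 0\<close>.\<close>

definition order_along :: "complex \<times> complex \<Rightarrow> (complex \<times> complex \<Rightarrow> complex) \<Rightarrow>
    (complex \<times> complex \<Rightarrow> complex) \<Rightarrow> enat" where
  "order_along q h f =
     Sup {enat k | k. \<exists>N g. q \<in> N \<and> holomorphic2_on g N \<and> (\<forall>r\<in>N. f r = h r ^ k * g r)}"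

text \<open>The multiplicity in \<open>D\<^sub>1\<close> of the inverse image of the curve \<open>h = 0\<close> in the incidence
  variety. The argument is the triple of coefficients of \<open>H\<close>.\<close>

fun D1_multiplicity :: "complex \<times> complex \<Rightarrow> (complex \<times> complex \<Rightarrow> complex) \<Rightarrow>
    (complex \<times> complex \<Rightarrow> complex) \<times> (complex \<times> complex \<Rightarrow> complex) \<times> (complex \<times> complex \<Rightarrow> complex) \<Rightarrow>
    enat" where
  "D1_multiplicity q h (a, b, c) =
     min (order_along q h a) (min (order_along q h b) (order_along q h c))"

text \<open>The quadratic form with coefficients \<open>a'\<close>, \<open>b'\<close>, \<open>c'\<close> is obtained from the one with coefficients
  \<open>a\<close>, \<open>b\<close>, \<open>c\<close> by dividing by the local equation \<open>h ^ m\<close> of \<open>D\<^sub>1\<close>. Applied to \<open>H\<close>, the result is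
  a local equation of \<open>D\<^sub>S\<close>.\<close>

fun divided_by_D1 :: "complex \<times> complex \<Rightarrow> (complex \<times> complex \<Rightarrow> complex) \<Rightarrow>
    (complex \<times> complex \<Rightarrow> complex) \<times> (complex \<times> complex \<Rightarrow> complex) \<times> (complex \<times> complex \<Rightarrow> complex) \<Rightarrow>
    (complex \<times> complex \<Rightarrow> complex) \<times> (complex \<times> complex \<Rightarrow> complex) \<times> (complex \<times> complex \<Rightarrow> complex) \<Rightarrow>
    bool" where
  "divided_by_D1 q h (a, b, c) (a', b', c') \<longleftrightarrow>
     (\<exists>m N. enat m = D1_multiplicity q h (a, b, c) \<and> q \<in> N \<and>
        holomorphic2_on a' N \<and> holomorphic2_on b' N \<and> holomorphic2_on c' N \<and>
        (\<forall>r\<in>N. a r = h r ^ m * a' r \<and> b r = h r ^ m * b' r \<and> c r = h r ^ m * c' r))"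

fun discriminant :: "(complex \<times> complex \<Rightarrow> complex) \<times> (complex \<times> complex \<Rightarrow> complex) \<times>
    (complex \<times> complex \<Rightarrow> complex) \<Rightarrow> complex \<times> complex \<Rightarrow> complex" where
  "discriminant (a, b, c) = (\<lambda>q. (b q)\<^sup>2 - 4 * a q * c q)"


section \<open>The branch divisor\<close>

text \<open>The multiplicity, computed near the point \<open>p\<close>, of the curve \<open>C\<close> in the zero divisor of the
  discriminant of the local equation of \<open>D\<^sub>S\<close>.\<close>

definition has_branch_multiplicity_at :: "5 proj set \<Rightarrow> 5 proj set \<Rightarrow> 5 proj \<Rightarrow> nat \<Rightarrow> bool" where
  "has_branch_multiplicity_at S C p k \<longleftrightarrow>
     (\<exists>A U F G q h DS. graph_chart S A U F G \<and> q \<in> U \<and> p = graph_pt A F G q \<and>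
        curve_equation C A U F G q h \<and> divided_by_D1 q h (H_coeffs F G) DS \<and>
        order_along q h (discriminant DS) = enat k)"

text \<open>\<open>k\<close> is the multiplicity of the irreducible curve \<open>C\<close> in the branch divisor of \<open>D\<^sub>S \<rightarrow> S\<close>, to be
  computed at a generic point of the curve.\<close>

definition has_branch_multiplicity :: "5 proj set \<Rightarrow> 5 proj set \<Rightarrow> nat \<Rightarrow> bool" where
  "has_branch_multiplicity S C k \<longleftrightarrow>
     (\<exists>E. finite E \<and> (\<forall>p\<in>C - E. has_branch_multiplicity_at S C p k))"

definition branch_divisor_components :: "5 proj set \<Rightarrow> 5 proj set set" where
  "branch_divisor_components S =
     {C. irreducible_curve C \<and> C \<subseteq> S \<and> (\<exists>k>0. has_branch_multiplicity S C k)}"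

end

theory Submission
  imports Defs "HOL-Complex_Analysis.Complex_Analysis" "Jordan_Normal_Form.Jordan_Normal_Form_Uniqueness"
    "HOL-Computational_Algebra.Field_as_Ring"
begin

text \<open>
  The generators of the pencil are brought into the form \<open>Q(f, g) = l(f g)\<close>, \<open>P(f, g) = l(t f g)\<close> on
  polynomials modulo the characteristic polynomial \<open>\<Delta>\<close> of \<open>Q\<^sup>-\<^sup>1 P\<close>, where \<open>l\<close> is the coefficient of \<open>t\<^sup>4\<close>;
  this is possible since every eigenvalue has only one Jordan block. So \<open>S\<close> consists of the \<open>f\<close> for
  which \<open>f\<^sup>2 mod \<Delta>\<close> has degree at most two. In a chart, a Gram determinant computation shows that \<open>H\<close> is,
  up to a linear substitution and a unit, the quadratic polynomial \<open>f\<^sup>2 mod \<Delta>\<close> itself. Its discriminant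
  vanishes exactly on the lines of \<open>S\<close>, which can therefore be listed: square roots of squares of
  linear polynomials, and nilpotent elements. The multiplicity along a line is read off from the
  Taylor coefficients of \<open>f\<close> at the eigenvalues. It is positive except for the line
  which joins two singular points.
\<close>

no_notation Matrix.vec_index (infixl \<open>$\<close> 100)
no_notation fps_nth (infixl \<open>$\<close> 75)

section \<open>Projective geometry\<close>

text \<open>Why H turns into f^2 modulo \<open>\<Delta>\<close>: on the tangent plane the
  determinant of \<open>P - \<tau> Q\<close> is governed by Q(X, (A - \<tau>)^-1 X), where A = Q^-1
  P. The coefficient of t^4 modulo \<open>\<Delta>\<close> is a sum of residues, and as f^2 has a
  remainder of degree at most two, the residue theorem evaluates this number as the remainder at
  \<open>\<tau>\<close> over \<open>\<Delta>\<close> at \<open>\<tau>\<close>, up to sign.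

  Two features of the definitions shape the rest. Tangent spaces are cut out by all forms vanishing
  on S, while only two quadrics are at hand. So smoothness is derived from a chart, and singularity
  from enough curves on S. Moreover, a branch multiplicity may be read off in any chart with any
  equation of the curve. Excluding a positive one on the line joining two singular points therefore
  needs an argument for arbitrary data; here division by the equation of a curve enters, and with it
  Osgood's lemma.

  The symbols are grouped by their elements of square zero, which form at most single points, the
  line joining two singular points, or a line with one singular point. Along such lines all
  coefficients of H vanish.\<close>

lemmas cart_eq_iff = Finite_Cartesian_Product.vec_eq_iff

lemma exhaust_5: "x = 1 \<or> x = 2 \<or> x = 3 \<or> x = 4 \<or> x = 5" for x :: 5
proof (induct x)
 case (of_int z)
 then have "0 \<le> z" "z < 5" by simp_all
 then have "z = 0 \<or> z = 1 \<or> z = 2 \<or> z = 3 \<or> z = 4" by arith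
 then show ?case by auto
qed

lemma forall_5: "(\<forall>i::5. P i) \<longleftrightarrow> P 1 \<and> P 2 \<and> P 3 \<and> P 4 \<and> P 5"
 by (metis exhaust_5)

lemma UNIV_5: "UNIV = {1::5, 2, 3, 4, 5}"
 using exhaust_5 by auto

lemma sum_5: "sum f (UNIV::5 set) = f 1 + f 2 + f 3 + f 4 + f 5"
 unfolding UNIV_5 by (simp add: ac_simps)

lemma vector_5:
 "(vector [a, b, c, d, e] :: 'a::zero^5) $ 1 = a"
 "(vector [a, b, c, d, e] :: 'a::zero^5) $ 2 = b"
 "(vector [a, b, c, d, e] :: 'a::zero^5) $ 3 = c"
 "(vector [a, b, c, d, e] :: 'a::zero^5) $ 4 = d"
 "(vector [a, b, c, d, e] :: 'a::zero^5) $ 5 = e"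
 by (simp_all add: vector_def)

lemma vec5_eq_iff: "(v :: 'a^5) = w \<longleftrightarrow>
  v $ 1 = w $ 1 \<and> v $ 2 = w $ 2 \<and> v $ 3 = w $ 3 \<and> v $ 4 = w $ 4 \<and> v $ 5 = w $ 5"
 unfolding cart_eq_iff forall_5 ..

lemma hcoords_pt:
 assumes "v \<noteq> 0"
 shows "hcoords (pt v) = {c *s v | c. c \<noteq> 0}"
 unfolding pt_def by (rule Abs_proj_inverse) (use assms in blast)

lemma proj_cases [case_names pt]:
 obtains v where "v \<noteq> 0" "p = pt v"
proof -
 from hcoords[of p] obtain v where v: "v \<noteq> 0" "hcoords p = {c *s v | c. c \<noteq> 0}"
  by blast
 then have "p = pt v" unfolding pt_def by (metis hcoords_inverse)
 with v that show thesis by blast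
qed

lemma mem_hcoords_pt: "v \<noteq> 0 \<Longrightarrow> v \<in> hcoords (pt v)"
 unfolding hcoords_pt by (auto intro!: exI[of _ 1])

lemma hcoords_nonzero: "v \<in> hcoords p \<Longrightarrow> v \<noteq> 0"
 by (cases p rule: proj_cases) (auto simp: hcoords_pt)

lemma pt_hcoords:
 assumes "v \<in> hcoords p"
 shows "p = pt v"
proof (cases p rule: proj_cases)
 case (pt w)
 with assms obtain c where c: "c \<noteq> 0" "v = c *s w" by (auto simp: hcoords_pt)
 have "{d *s v | d. d \<noteq> 0} = {d *s w | d. d \<noteq> 0}"
 proof (intro equalityI subsetI)
  fix x assume "x \<in> {d *s v | d. d \<noteq> 0}"
  then obtain d where "d \<noteq> 0" "x = d *s v" by blast
  with c show "x \<in> {d *s w | d. d \<noteq> 0}" by (auto intro!: exI[of _ "d * c"])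
 next
  fix x assume "x \<in> {d *s w | d. d \<noteq> 0}"
  then obtain d where "d \<noteq> 0" "x = d *s w" by blast
  with c show "x \<in> {d *s v | d. d \<noteq> 0}" by (auto intro!: exI[of _ "d / c"])
 qed
 then show ?thesis unfolding pt pt_def by simp
qed

lemma pt_eqD: "pt v = pt w \<Longrightarrow> v \<noteq> 0 \<Longrightarrow> w \<noteq> 0 \<Longrightarrow> \<exists>c. c \<noteq> 0 \<and> w = c *s v"
 using mem_hcoords_pt[of w] hcoords_pt[of v] by auto

lemma pt_scale: "c \<noteq> 0 \<Longrightarrow> v \<noteq> 0 \<Longrightarrow> pt (c *s v) = pt v"
 using pt_hcoords[of "c *s v" "pt v"] by (auto simp: hcoords_pt)

section \<open>Forms and Zariski closed sets\<close>

lemma form_mult: "form d f \<Longrightarrow> form e g \<Longrightarrow> form (d + e) (\<lambda>v. f v * g v)"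
 unfolding form_def by (auto intro: poly_funs.mult simp: power_add)

lemma poly_funs_sum:
 assumes "finite A" "\<And>i. i \<in> A \<Longrightarrow> f i \<in> poly_funs X"
 shows "(\<lambda>v. \<Sum>i\<in>A. f i v) \<in> poly_funs X"
 using assms by (induction A rule: finite_induct) (auto intro: poly_funs.intros)

lemma form_linear: "form 1 (\<lambda>v. \<Sum>i\<in>UNIV. u $ i * v $ i)"
proof -
 have "(\<lambda>v. u $ i * v $ i) \<in> poly_funs (range (\<lambda>i v. v $ i))" for i
  by (intro poly_funs.mult poly_funs.gen poly_funs.const rangeI)
 then have "(\<lambda>v. \<Sum>i\<in>UNIV. u $ i * v $ i) \<in> poly_funs (range (\<lambda>i v. v $ i))"
  by (rule poly_funs_sum[rotated]) simp
 then show ?thesis unfolding form_def by (simp add: sum_distrib_left algebra_simps)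
qed

lemma form_quadratic: "form 2 (quadratic_form P)"
proof -
 have *: "(\<lambda>v. v $ i * P $ i $ j * v $ j) \<in> poly_funs (range (\<lambda>i v. v $ i))" for i j
  by (intro poly_funs.mult poly_funs.gen poly_funs.const rangeI)
 have "(\<lambda>v. \<Sum>i\<in>UNIV. \<Sum>j\<in>UNIV. v $ i * P $ i $ j * v $ j) \<in> poly_funs (range (\<lambda>i v. v $ i))"
  by (rule poly_funs_sum[OF finite_class.finite_UNIV poly_funs_sum[OF finite_class.finite_UNIV *]])
 moreover have "quadratic_form P (c *s v) = c\<^sup>2 * quadratic_form P v" for c v
  unfolding quadratic_form_def sum_distrib_left
  by (intro sum.cong refl) (simp add: power2_eq_square)
 ultimately show ?thesis unfolding form_def quadratic_form_def by blast
qed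

lemma mem_zero_locus:
 assumes "\<forall>f\<in>I. \<exists>d. form d f" "v \<noteq> 0"
 shows "pt v \<in> zero_locus I \<longleftrightarrow> (\<forall>f\<in>I. f v = 0)"
proof
 assume "pt v \<in> zero_locus I"
 then have *: "\<forall>g\<in>I. \<forall>w\<in>hcoords (pt v). g w = 0"
  unfolding zero_locus_def by (simp only: mem_Collect_eq)
 show "\<forall>f\<in>I. f v = 0"
 proof
  fix f assume "f \<in> I"
  show "f v = 0" by (rule bspec[OF bspec[OF * \<open>f \<in> I\<close>] mem_hcoords_pt[OF assms(2)]])
 qed
next
 assume *: "\<forall>f\<in>I. f v = 0"
 show "pt v \<in> zero_locus I" unfolding zero_locus_def hcoords_pt[OF assms(2)] mem_Collect_eq
 proof (intro ballI)
  fix f w assume f: "f \<in> I" and "w \<in> {c *s v |c. c \<noteq> 0}"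
  then obtain c where c: "w = c *s v" by auto
  obtain d where "form d f" using assms(1) f by blast
  then have "f (c *s v) = c ^ d * f v" by (simp add: form_def)
  moreover have "f v = 0" by (rule bspec[OF * f])
  ultimately show "f w = 0" unfolding c by (simp only: mult_zero_right)
 qed
qed

lemma zariski_closed_Int:
 assumes "zariski_closed V" "zariski_closed W"
 shows "zariski_closed (V \<inter> W)"
proof -
 from assms obtain I J where "\<forall>f\<in>I. \<exists>d. form d f" "V = zero_locus I"
  "\<forall>f\<in>J. \<exists>d. form d f" "W = zero_locus J" unfolding zariski_closed_def by blast
 moreover have "zero_locus I \<inter> zero_locus J = zero_locus (I \<union> J)"
  unfolding zero_locus_def by blast
 ultimately show ?thesis unfolding zariski_closed_def by (intro exI[of _ "I \<union> J"]) auto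
qed

lemma zariski_closed_Un:
 assumes "zariski_closed V" "zariski_closed W"
 shows "zariski_closed (V \<union> W)"
proof -
 from assms obtain I J where I: "\<forall>f\<in>I. \<exists>d. form d f" "V = zero_locus I"
  and J: "\<forall>f\<in>J. \<exists>d. form d f" "W = zero_locus J" unfolding zariski_closed_def by blast
 define K where "K = {\<lambda>v. f v * g v | f g. f \<in> I \<and> g \<in> J}"
 have K: "\<forall>f\<in>K. \<exists>d. form d f"
  unfolding K_def using I J form_mult by blast
 have "p \<in> zero_locus I \<union> zero_locus J \<longleftrightarrow> p \<in> zero_locus K" for p
 proof (cases p rule: proj_cases)
  case (pt v)
  have "p \<in> zero_locus K \<longleftrightarrow> (\<forall>f\<in>I. \<forall>g\<in>J. f v * g v = 0)"
  unfolding pt mem_zero_locus[OF K pt(1)] unfolding K_def by fast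
  moreover have "p \<in> zero_locus I \<longleftrightarrow> (\<forall>f\<in>I. f v = 0)"
  "p \<in> zero_locus J \<longleftrightarrow> (\<forall>f\<in>J. f v = 0)"
  using mem_zero_locus[OF I(1) pt(1)] mem_zero_locus[OF J(1) pt(1)] pt by auto
  ultimately show ?thesis by auto
 qed
 then have "V \<union> W = zero_locus K" using I J by blast
 with K show ?thesis unfolding zariski_closed_def by blast
qed

lemma zariski_closed_empty: "zariski_closed {}"
proof -
 have "zero_locus {\<lambda>_. 1} = ({} :: 'a proj set)"
 proof -
  have "p \<notin> zero_locus {\<lambda>_. 1}" for p :: "'a proj"
  by (cases p rule: proj_cases) (use mem_hcoords_pt in \<open>auto simp: zero_locus_def\<close>)
  then show ?thesis by blast
 qed
 moreover have "form 0 (\<lambda>_. 1)" by (auto simp: form_def intro: poly_funs.const)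
 ultimately show ?thesis unfolding zariski_closed_def by (intro exI[of _ "{\<lambda>_. 1}"]) auto
qed

lemma zariski_closed_Union:
 "finite \<F> \<Longrightarrow> (\<And>V. V \<in> \<F> \<Longrightarrow> zariski_closed V) \<Longrightarrow> zariski_closed (\<Union>\<F>)"
 by (induction \<F> rule: finite_induct) (auto intro: zariski_closed_empty zariski_closed_Un)

lemma irreducible_varietyD:
 "irreducible_variety V \<Longrightarrow> zariski_closed V1 \<Longrightarrow> zariski_closed V2 \<Longrightarrow> V = V1 \<union> V2 \<Longrightarrow> V = V1 \<or> V = V2"
 unfolding irreducible_variety_def by blast

lemma irreducible_subset_Union:
 assumes "irreducible_variety C" "finite \<F>" "\<And>V. V \<in> \<F> \<Longrightarrow> zariski_closed V" "C \<subseteq> \<Union>\<F>"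
 shows "\<exists>V\<in>\<F>. C \<subseteq> V"
 using assms(2-)
proof (induction \<F> rule: finite_induct)
 case empty
 then show ?case using assms(1) unfolding irreducible_variety_def by auto
next
 case (insert V \<F>)
 have C: "zariski_closed C" using assms(1) unfolding irreducible_variety_def by blast
 have "zariski_closed (C \<inter> V)" "zariski_closed (C \<inter> \<Union>\<F>)"
  using C insert.prems insert.hyps by (auto intro!: zariski_closed_Int zariski_closed_Union)
 moreover have "C = (C \<inter> V) \<union> (C \<inter> \<Union>\<F>)" using insert.prems by blast
 ultimately have "C = C \<inter> V \<or> C = C \<inter> \<Union>\<F>"
  using irreducible_varietyD[OF assms(1)] by blast
 then show ?case
 proof
  assume "C = C \<inter> \<Union>\<F>"
  then have "\<exists>V\<in>\<F>. C \<subseteq> V" using insert.IH insert.prems by blast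
  then show ?case by blast
 qed blast
qed

lemma mem_linear_subspace:
 assumes "vec.subspace W" "v \<noteq> 0"
 shows "pt v \<in> linear_subspace W \<longleftrightarrow> v \<in> W"
proof
 assume "pt v \<in> linear_subspace W"
 then show "v \<in> W" using mem_hcoords_pt[OF assms(2)] unfolding linear_subspace_def by auto
next
 assume "v \<in> W"
 then show "pt v \<in> linear_subspace W" unfolding linear_subspace_def mem_Collect_eq hcoords_pt[OF assms(2)]
  using vec.subspace_scale[OF assms(1)] by auto
qed

lemma linear_form_of_component:
 fixes g :: "complex^'n::finite \<Rightarrow> complex^'n"
 assumes "Vector_Spaces.linear (*s) (*s) g"
 shows "form 1 (\<lambda>v. g v $ j)"
proof -
 have "g v $ j = (\<Sum>i\<in>UNIV. (\<chi> i. Finite_Cartesian_Product.matrix g $ j $ i) $ i * v $ i)" for v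
  unfolding matrix_works[OF assms, of v, symmetric] by (simp add: matrix_vector_mult_def)
 then show ?thesis using form_linear[of "\<chi> i. Finite_Cartesian_Product.matrix g $ j $ i"] by simp
qed

text \<open>The components of all endomorphisms that vanish on a subspace cut it out: a vector
  outside is independent of a basis of the subspace, so some endomorphism kills the basis and fixes
  this vector.\<close>

lemma zariski_closed_linear_subspace:
 fixes W :: "(complex^'n::finite) set"
 assumes W: "vec.subspace W"
 shows "zariski_closed (linear_subspace W)"
proof -
 define I where "I = {(\<lambda>v. g v $ j) | g j. Vector_Spaces.linear (*s) (*s) g \<and> (\<forall>v\<in>W. g v = (0::complex^'n))}"
 have I: "\<forall>f\<in>I. \<exists>d. form d f"
 proof
  fix f assume "f \<in> I"
  then show "\<exists>d. form d f" unfolding I_def mem_Collect_eq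
  proof (elim exE conjE)
  fix g :: "complex^'n \<Rightarrow> complex^'n" and j assume "f = (\<lambda>v. g v $ j)" "Vector_Spaces.linear (*s) (*s) g"
  then show ?thesis using linear_form_of_component[of g j] by auto
  qed
 qed
 have "p \<in> linear_subspace W \<longleftrightarrow> p \<in> zero_locus I" for p
 proof (cases p rule: proj_cases)
  case (pt v)
  have "v \<in> W" if *: "\<forall>f\<in>I. f v = 0"
  proof (rule ccontr)
  assume "v \<notin> W"
  obtain B where B: "B \<subseteq> W" "vec.independent B" "W \<subseteq> vec.span B"
  by (rule vec.basis_exists[of W])
  then have "v \<notin> vec.span B" using \<open>v \<notin> W\<close> W vec.span_minimal[of B W] by blast
  then have ind: "vec.independent (insert v B)" using B by (simp add: vec.independent_insert)
  obtain g where g: "Vector_Spaces.linear (*s) (*s) g" "\<forall>x\<in>insert v B. g x = (if x = v then v else 0)"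
  using vec.linear_independent_extend[OF ind, of "\<lambda>x. if x = v then v else 0"] by blast
  have "g x = 0" if "x \<in> vec.span B" for x
  using vec.linear_eq_0_on_span[OF g(1) _ that] g(2) \<open>v \<notin> vec.span B\<close> vec.span_base by fastforce
  then have "(\<lambda>v. g v $ j) \<in> I" for j unfolding I_def using g(1) B(3) by auto
  then have "g v $ j = 0" for j by (rule bspec[OF *])
  then have "g v = 0" by (simp add: cart_eq_iff)
  with g(2) pt(1) show False by auto
  qed
  moreover have "\<forall>f\<in>I. f v = 0" if "v \<in> W" unfolding I_def using that by auto
  ultimately show ?thesis
  unfolding pt mem_linear_subspace[OF W pt(1)] mem_zero_locus[OF I pt(1)] by (rule iffI[rotated])
 qed
 then have "linear_subspace W = zero_locus I" by blast
 with I show ?thesis unfolding zariski_closed_def by blast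
qed

section \<open>Lines as joins of two points, and curves contained in lines\<close>

definition indep2 :: "complex^'n \<Rightarrow> complex^'n \<Rightarrow> bool" where
 "indep2 a b \<longleftrightarrow> (\<forall>\<alpha> \<beta>. \<alpha> *s a + \<beta> *s b = 0 \<longrightarrow> \<alpha> = 0 \<and> \<beta> = 0)"

definition join :: "complex^'n \<Rightarrow> complex^'n::finite \<Rightarrow> 'n proj set" where
 "join a b = linear_subspace (vec.span {a, b})"

lemma mem_span2: "v \<in> vec.span {a, b} \<longleftrightarrow> (\<exists>\<alpha> \<beta>. v = \<alpha> *s a + \<beta> *s b)"
proof -
 have "v \<in> vec.span {a, b} \<longleftrightarrow> (\<exists>\<alpha> \<beta>. v - \<alpha> *s a = \<beta> *s b)"
  by (auto simp: vec.span_insert vec.span_singleton)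
 also have "\<dots> \<longleftrightarrow> (\<exists>\<alpha> \<beta>. v = \<alpha> *s a + \<beta> *s b)"
  by (metis add.commute diff_add_cancel add_diff_cancel_left')
 finally show ?thesis .
qed

lemma mem_join: "v \<noteq> 0 \<Longrightarrow> pt v \<in> join a b \<longleftrightarrow> (\<exists>\<alpha> \<beta>. v = \<alpha> *s a + \<beta> *s b)"
 unfolding join_def by (simp add: mem_linear_subspace mem_span2)

lemma joinE:
 assumes "p \<in> join a b"
 obtains \<alpha> \<beta> where "\<alpha> *s a + \<beta> *s b \<noteq> 0" "p = pt (\<alpha> *s a + \<beta> *s b)"
 using assms by (cases p rule: proj_cases) (auto simp: mem_join)

lemma zariski_closed_join: "zariski_closed (join a b)"
 unfolding join_def by (rule zariski_closed_linear_subspace) simp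

lemma indep2_independent:
 assumes "indep2 a b"
 shows "vec.independent {a, b}" "a \<noteq> b"
proof -
 show "a \<noteq> b"
 proof
  assume "a = b"
  then have "1 *s a + (-1) *s b = 0" by simp
  with assms show False unfolding indep2_def by fastforce
 qed
 have "a \<notin> vec.span {b}"
 proof
  assume "a \<in> vec.span {b}"
  then obtain k where "a = k *s b" by (auto simp: vec.span_singleton)
  then have "1 *s a + (-k) *s b = 0" by simp
  with assms show False unfolding indep2_def by fastforce
 qed
 moreover have "b \<noteq> 0" using assms unfolding indep2_def
  by (metis add.right_neutral vector_smult_lzero vector_smult_rzero zero_neq_one)
 ultimately show "vec.independent {a, b}" by (simp add: vec.independent_insert)
qed

lemma projective_line_join: "indep2 a b \<Longrightarrow> projective_line (join a b)"
 unfolding projective_line_def join_def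
 by (intro exI[of _ "vec.span {a, b}"])
  (auto simp: vec.dim_eq_card_independent indep2_independent)

lemma projective_lineE:
 assumes "projective_line L"
 obtains a b where "indep2 a b" "L = join a b"
proof -
 obtain W where W: "vec.subspace W" "vec.dim W = 2" "L = linear_subspace W"
  using assms unfolding projective_line_def by blast
 obtain B where B: "B \<subseteq> W" "vec.independent B" "W \<subseteq> vec.span B" "card B = 2"
  using vec.basis_exists[of W] W by metis
 obtain a b where ab: "B = {a, b}" "a \<noteq> b" using B(4) card_2_iff by metis
 have "W = vec.span {a, b}" using B W vec.span_minimal ab by blast
 moreover have "indep2 a b" unfolding indep2_def
 proof (intro allI impI)
  fix \<alpha> \<beta> assume *: "\<alpha> *s a + \<beta> *s b = 0"
  have na: "a \<notin> vec.span {b}"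
  using B(2) ab by (auto simp: vec.independent_insert)
  have 1: "\<alpha> = 0"
  proof (rule ccontr)
  assume "\<alpha> \<noteq> 0"
  have "\<alpha> *s a = (-\<beta>) *s b" using * by (simp add: eq_neg_iff_add_eq_0)
  then have "a = (-\<beta> / \<alpha>) *s b" using \<open>\<alpha> \<noteq> 0\<close>
  by (metis (no_types, lifting) divide_inverse mult.commute vector_smult_assoc vector_smult_lid right_inverse)
  then have "a \<in> vec.span {b}" unfolding vec.span_singleton by blast
  then show False using na by blast
  qed
  with * have "\<beta> *s b = 0" by simp
  moreover have "b \<noteq> 0" using B(2) ab vec.dependent_zero[of B] by auto
  ultimately show "\<alpha> = 0 \<and> \<beta> = 0" using 1 by simp
 qed
 ultimately show thesis using that W(3) unfolding join_def by blast
qed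

lemma poly_funs_on_line:
 fixes f :: "complex^'n::finite \<Rightarrow> complex"
 assumes "f \<in> poly_funs (range (\<lambda>i v. v $ i))"
 shows "\<exists>p. \<forall>t. f (a + t *s b) = poly p t"
 using assms
proof induction
 case (gen f)
 then obtain i where "f = (\<lambda>v. v $ i)" by blast
 then show ?case by (intro exI[of _ "[:a $ i, b $ i:]"]) auto
next
 case (const c)
 show ?case by (intro exI[of _ "[:c:]"]) auto
next
 case (add f g)
 then obtain p q where "\<forall>t. f (a + t *s b) = poly p t" "\<forall>t. g (a + t *s b) = poly q t" by blast
 then show ?case by (intro exI[of _ "p + q"]) auto
next
 case (mult f g)
 then obtain p q where "\<forall>t. f (a + t *s b) = poly p t" "\<forall>t. g (a + t *s b) = poly q t" by blast
 then show ?case by (intro exI[of _ "p * q"]) auto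
qed

lemma indep2_swap: "indep2 a b \<Longrightarrow> indep2 b a"
 unfolding indep2_def by (metis add.commute)

lemma indep2_nonzero: "indep2 a b \<Longrightarrow> \<alpha> \<noteq> 0 \<or> \<beta> \<noteq> 0 \<Longrightarrow> \<alpha> *s a + \<beta> *s b \<noteq> 0"
 unfolding indep2_def by blast

lemma indep2_nonzero': "indep2 a b \<Longrightarrow> a \<noteq> 0" "indep2 a b \<Longrightarrow> b \<noteq> 0"
 using indep2_nonzero[of a b 1 0] indep2_nonzero[of a b 0 1] by auto

text \<open>On the affine line \<open>v1 + t v0\<close> the form is a polynomial \<open>p\<close> in
  \<open>t\<close>, and \<open>pt v0\<close> is the only further point. If \<open>p\<close> were
  zero, homogeneity would make the form vanish at \<open>v0 + t v1\<close> for all nonzero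
  \<open>t\<close>, hence also at \<open>v0\<close>.\<close>

lemma linear_comb_form_finite:
 fixes f :: "complex^'n::finite \<Rightarrow> complex"
 assumes f: "form d f" "f v0 \<noteq> 0" and i: "indep2 v0 v1"
 shows "finite (zero_locus {f} \<inter> join v0 v1)"
proof -
 obtain p where p: "\<And>t. f (v1 + t *s v0) = poly p t"
  using poly_funs_on_line[of f v1 v0] f unfolding form_def by blast
 obtain r where r: "\<And>t. f (v0 + t *s v1) = poly r t"
  using poly_funs_on_line[of f v0 v1] f unfolding form_def by blast
 have "p \<noteq> 0"
 proof
  assume "p = 0"
  have "poly r t = 0" if "t \<noteq> 0" for t
  proof -
  have "v0 + t *s v1 = t *s (v1 + (1 / t) *s v0)" using that by (simp add: vector_add_ldistrib)
  then have "poly r t = t ^ d * poly p (1 / t)"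
  using f(1) unfolding form_def by (metis p r)
  then show ?thesis using \<open>p = 0\<close> by simp
  qed
  then have "UNIV - {0} \<subseteq> {t. poly r t = 0}" by blast
  then have "r = 0" using poly_roots_finite[of r] infinite_UNIV_char_0
  by (metis finite.emptyI finite_Diff2 finite_insert finite_subset)
  then have "f (v0 + 0 *s v1) = 0" unfolding r by simp
  then show False using f(2) by simp
 qed
 have "zero_locus {f} \<inter> join v0 v1 \<subseteq> insert (pt v0) ((\<lambda>t. pt (v1 + t *s v0)) ` {t. poly p t = 0})"
 proof
  fix x assume x: "x \<in> zero_locus {f} \<inter> join v0 v1"
  then obtain \<alpha> \<beta> where ab: "\<alpha> *s v0 + \<beta> *s v1 \<noteq> 0" "x = pt (\<alpha> *s v0 + \<beta> *s v1)"
  by (auto elim: joinE)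
  show "x \<in> insert (pt v0) ((\<lambda>t. pt (v1 + t *s v0)) ` {t. poly p t = 0})"
  proof (cases "\<beta> = 0")
  case True
  with ab have "\<alpha> \<noteq> 0" "v0 \<noteq> 0" by auto
  with True ab show ?thesis by (simp add: pt_scale)
  next
  case False
  define w where "w = v1 + (\<alpha> / \<beta>) *s v0"
  have e: "\<alpha> *s v0 + \<beta> *s v1 = \<beta> *s w"
  unfolding w_def using False by (simp add: vector_add_ldistrib)
  with ab have w: "w \<noteq> 0" by auto
  have "x = pt w" using ab(2) e False w by (simp add: pt_scale)
  moreover have "f w = 0" using x f(1) w mem_zero_locus[of "{f}" w] \<open>x = pt w\<close> by auto
  ultimately show ?thesis unfolding w_def using p by auto
  qed
 qed
 then show ?thesis using \<open>p \<noteq> 0\<close> poly_roots_finite[of p] by (meson finite_imageI finite_insert finite_subset)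
qed

text \<open>Allows an argument about the first spanning vector of a line to be applied to an
  arbitrary point of it, while the second vector stays among the given two.\<close>

lemma join_other:
 assumes "indep2 a b" "v = \<alpha> *s a + \<beta> *s b" "v \<noteq> 0"
 obtains w where "indep2 v w" "join v w = join a b" "w = a \<or> w = b"
proof -
 have *: "\<exists>w. indep2 v w \<and> vec.span {v, w} = vec.span {a, b} \<and> (w = a \<or> w = b)"
 proof (cases "\<alpha> = 0")
  case False
  have i: "indep2 v b" unfolding indep2_def
  proof (intro allI impI)
  fix x y assume "x *s v + y *s b = 0"
  then have "(x * \<alpha>) *s a + (x * \<beta> + y) *s b = 0" using assms(2)
  by (simp add: vector_add_ldistrib vector_sadd_rdistrib add.assoc)
  then have "x * \<alpha> = 0" "x * \<beta> + y = 0" using assms(1) unfolding indep2_def by blast+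
  then show "x = 0 \<and> y = 0" using False by auto
  qed
  have "a = (1 / \<alpha>) *s v + (- \<beta> / \<alpha>) *s b"
  using assms(2) False by (simp add: vector_add_ldistrib)
  then have "a \<in> vec.span {v, b}" "v \<in> vec.span {a, b}" using assms(2) unfolding mem_span2 by blast+
  then have "vec.span {v, b} = vec.span {a, b}"
  by (intro vec.span_eq[THEN iffD2] conjI) (auto simp: vec.span_base)
  with i show ?thesis by blast
 next
  case True
  then have nb: "\<beta> \<noteq> 0" using assms by auto
  have i: "indep2 v a" unfolding indep2_def
  proof (intro allI impI)
  fix x y assume "x *s v + y *s a = 0"
  then have "y *s a + (x * \<beta>) *s b = 0" using assms(2) True by (simp add: add.commute)
  then show "x = 0 \<and> y = 0" using assms(1) nb unfolding indep2_def by fastforce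
  qed
  have "b = (1 / \<beta>) *s v + 0 *s a" using assms(2) nb True by simp
  moreover have "v = 0 *s a + \<beta> *s b" using assms(2) True by simp
  ultimately have "b \<in> vec.span {v, a}" "v \<in> vec.span {a, b}" unfolding mem_span2 by blast+
  then have "vec.span {v, a} = vec.span {a, b}"
  by (intro vec.span_eq[THEN iffD2] conjI) (auto simp: vec.span_base)
  with i show ?thesis by blast
 qed
 then show thesis using that unfolding join_def by metis
qed

text \<open>A defining form that is nonzero at one point of the line has finitely many zeros on it.
  Irreducibility and dimension one of lines rest on this.\<close>

lemma zariski_closed_in_line:
 fixes V :: "'n::finite proj set"
 assumes "zariski_closed V" "V \<subseteq> join a b" "indep2 a b"
 shows "finite V \<or> V = join a b"
proof (cases "join a b \<subseteq> V")
 case False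
 obtain I where I: "\<forall>f\<in>I. \<exists>d. form d f" "V = zero_locus I"
  using assms(1) unfolding zariski_closed_def by blast
 obtain \<alpha> \<beta> where ab: "\<alpha> *s a + \<beta> *s b \<noteq> 0" "pt (\<alpha> *s a + \<beta> *s b) \<notin> V"
  using False by (metis joinE subsetI)
 define v where "v = \<alpha> *s a + \<beta> *s b"
 have "\<not> (\<forall>f\<in>I. f v = 0)"
  using ab I(2) mem_zero_locus[OF I(1) ab(1)] unfolding v_def by simp
 then obtain f where f0: "f \<in> I" "f v \<noteq> 0" by auto
 obtain d where f: "f \<in> I" "form d f" "f v \<noteq> 0" using I(1) f0 by auto
 obtain w where w: "indep2 v w" "join v w = join a b"
  by (rule join_other[OF assms(3) v_def]) (use ab(1) v_def in auto)
 have "V \<subseteq> zero_locus {f} \<inter> join v w" using I f assms(2) w unfolding zero_locus_def by auto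
 then show ?thesis using linear_comb_form_finite[OF f(2,3) w(1)] finite_subset by blast
qed (use assms in auto)

lemma infinite_join:
 fixes a b :: "complex^'n::finite"
 assumes "indep2 a b"
 shows "infinite (join a b)"
proof -
 have "inj (\<lambda>t. pt (a + t *s b))"
 proof (rule injI)
  fix s t assume *: "pt (a + s *s b) = pt (a + t *s b)"
  have nz: "a + x *s b \<noteq> 0" for x using indep2_nonzero[OF assms, of 1 x] by simp
  obtain c where "a + t *s b = c *s (a + s *s b)" using pt_eqD[OF * nz nz] by blast
  then have "(1 - c) *s a + (t - c * s) *s b = 0"
  by (simp add: cart_eq_iff algebra_simps)
  then have "1 - c = 0" "t - c * s = 0" using assms unfolding indep2_def by blast+
  then show "s = t" by simp
 qed
 then have "infinite (range (\<lambda>t. pt (a + t *s b)))"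
  using infinite_UNIV_char_0 by (metis finite_imageD)
 moreover have "range (\<lambda>t. pt (a + t *s b)) \<subseteq> join a b"
 proof clarify
  fix t
  have "a + t *s b \<noteq> 0" using indep2_nonzero[OF assms, of 1 t] by simp
  moreover have "a + t *s b = 1 *s a + t *s b" by simp
  ultimately show "pt (a + t *s b) \<in> join a b" using mem_join by blast
 qed
 ultimately show ?thesis using finite_subset by blast
qed

lemma zariski_closed_point: "zariski_closed {p}"
proof (cases p rule: proj_cases)
 case (pt v)
 have "linear_subspace (vec.span {v}) = {p}"
 proof -
  have "q \<in> linear_subspace (vec.span {v}) \<longleftrightarrow> q = p" for q
  proof (cases q rule: proj_cases)
  case w: (pt w)
  have "w \<in> vec.span {v} \<longleftrightarrow> pt w = pt v"
  proof
  assume "w \<in> vec.span {v}"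
  then obtain c where "w = c *s v" by (auto simp: vec.span_singleton)
  with w pt show "pt w = pt v" by (cases "c = 0") (auto simp: pt_scale)
  next
  assume "pt w = pt v"
  then show "w \<in> vec.span {v}" using pt_eqD[of v w] w pt by (auto simp: vec.span_singleton)
  qed
  then show ?thesis unfolding w pt by (simp add: mem_linear_subspace w)
  qed
  then show ?thesis by blast
 qed
 then show ?thesis using zariski_closed_linear_subspace[of "vec.span {v}"] by simp
qed

lemma irreducible_point: "irreducible_variety {p}"
 unfolding irreducible_variety_def using zariski_closed_point by blast

lemma irreducible_finite:
 assumes "irreducible_variety V" "finite V"
 obtains p where "V = {p}"
proof -
 have "\<exists>W\<in>(\<lambda>p. {p}) ` V. V \<subseteq> W"
  by (rule irreducible_subset_Union) (use assms zariski_closed_point in auto)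
 then obtain p where "p \<in> V" "V \<subseteq> {p}" by blast
 then show thesis using that by blast
qed

lemma variety_dim_point: "variety_dim {p} = 0"
proof -
 have "n = 0" if "\<forall>i\<le>n. irreducible_variety (Z i) \<and> Z i \<subseteq> {p}" "\<forall>i<n. Z i \<subset> Z (Suc i)" for n and Z :: "nat \<Rightarrow> 'a proj set"
 proof (rule ccontr)
  assume "n \<noteq> 0"
  then have "Z 0 \<subset> Z 1" "Z 1 \<subseteq> {p}" "Z 0 \<noteq> {}" using that by (auto simp: irreducible_variety_def)
  then show False by blast
 qed
 then have "variety_dim {p} \<le> 0" unfolding variety_dim_def
  by (intro Sup_least) (auto simp: zero_enat_def)
 then show ?thesis by simp
qed

lemma irreducible_join: "indep2 a b \<Longrightarrow> irreducible_variety (join a b)"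
proof -
 assume i: "indep2 a b"
 show ?thesis unfolding irreducible_variety_def
 proof (intro conjI allI impI)
  show "join a b \<noteq> {}" using infinite_join[OF i] by auto
  fix V1 V2 assume *: "zariski_closed V1 \<and> zariski_closed V2 \<and> join a b = V1 \<union> V2"
  then have "finite V1 \<or> V1 = join a b" "finite V2 \<or> V2 = join a b"
  using zariski_closed_in_line[OF _ _ i] by blast+
  then show "join a b = V1 \<or> join a b = V2" using * infinite_join[OF i] by auto
 qed (rule zariski_closed_join)
qed

text \<open>In a chain with two proper inclusions the middle member would be a proper closed subset
  of the line, hence finite and, being irreducible, a single point; nothing nonempty lies properly
  below it.\<close>

lemma variety_dim_join:
 assumes i: "indep2 a b"
 shows "variety_dim (join a b) = 1"
proof (rule antisym)
 have "n \<le> 1" if "\<forall>i\<le>n. irreducible_variety (Z i) \<and> Z i \<subseteq> join a b" "\<forall>i<n. Z i \<subset> Z (Suc i)"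
  for n and Z :: "nat \<Rightarrow> 'a proj set"
 proof (rule ccontr)
  assume "\<not> n \<le> 1"
  then have Z: "Z 0 \<subset> Z 1" "Z 1 \<subset> Z 2" "Z 2 \<subseteq> join a b" "irreducible_variety (Z 1)" "Z 0 \<noteq> {}"
  proof -
  show "Z 0 \<subset> Z 1" "Z 1 \<subset> Z 2" using that(2) \<open>\<not> n \<le> 1\<close> by (auto simp: numeral_2_eq_2)
  show "Z 2 \<subseteq> join a b" "irreducible_variety (Z 1)" using that(1) \<open>\<not> n \<le> 1\<close> by simp_all
  have "irreducible_variety (Z 0)" using that(1) by simp
  then show "Z 0 \<noteq> {}" by (simp add: irreducible_variety_def)
  qed
  have "zariski_closed (Z 1)" using Z(4) unfolding irreducible_variety_def by simp
  then have "finite (Z 1)" using zariski_closed_in_line[of "Z 1", OF _ _ i] Z by auto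
  then obtain p where "Z 1 = {p}" using irreducible_finite[OF Z(4)] by auto
  then show False using Z(1,5) by auto
 qed
 then show "variety_dim (join a b) \<le> 1" unfolding variety_dim_def
  by (intro Sup_least) (auto simp: one_enat_def)
 obtain p where p: "p \<in> join a b" using infinite_join[OF i] by (metis finite.emptyI equals0I)
 define Z where "Z = (\<lambda>n::nat. if n = 0 then {p} else join a b)"
 have "{p} \<noteq> join a b" using infinite_join[OF i] by (metis finite.emptyI finite_insert)
 then have "(\<forall>i\<le>1. irreducible_variety (Z i) \<and> Z i \<subseteq> join a b) \<and> (\<forall>i<1. Z i \<subset> Z (Suc i))"
  unfolding Z_def using p irreducible_point irreducible_join[OF i] by auto
 then show "1 \<le> variety_dim (join a b)" unfolding variety_dim_def one_enat_def
  by (intro Sup_upper) blast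
qed

lemma irreducible_curve_join: "indep2 a b \<Longrightarrow> irreducible_curve (join a b)"
 unfolding irreducible_curve_def by (simp add: irreducible_join variety_dim_join)

text \<open>Irreducibility places the curve in one of the lines or in one of the exceptional points;
  being infinite and closed, it then fills the line. So information at all but finitely many points
  determines the curve.\<close>

lemma irreducible_curve_in_lines:
 assumes C: "irreducible_curve C" and "finite E" "C - E \<subseteq> \<Union>\<L>" "finite \<L>"
  and \<L>: "\<And>L. L \<in> \<L> \<Longrightarrow> projective_line L"
 shows "C \<in> \<L>"
proof -
 have irr: "irreducible_variety C" using C unfolding irreducible_curve_def by blast
 have closed: "zariski_closed L" if "L \<in> \<L>" for L
  using \<L>[OF that] projective_lineE zariski_closed_join by metis
 have "\<exists>V\<in>\<L> \<union> (\<lambda>p. {p}) ` E. C \<subseteq> V"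
  by (rule irreducible_subset_Union) (use irr assms closed zariski_closed_point in auto)
 moreover have np: "infinite C"
 proof
  assume "finite C"
  then obtain p where "C = {p}" using irr irreducible_finite by blast
  then show False using C variety_dim_point[of p] unfolding irreducible_curve_def by simp
 qed
 then have "\<not> C \<subseteq> {p}" for p using finite_subset by blast
 ultimately obtain L where L: "L \<in> \<L>" "C \<subseteq> L" by auto
 obtain a b where "indep2 a b" "L = join a b" using \<L>[OF L(1)] projective_lineE by metis
 then have "C = L" using zariski_closed_in_line[of C a b] L np irr
  unfolding irreducible_variety_def by blast
 then show ?thesis using L by simp
qed

lemma distinct_lines_Int:
 assumes "projective_line L" "projective_line M" "L \<noteq> M"
 shows "finite (L \<inter> M)"
proof -
 obtain a b c d where "indep2 a b" "L = join a b" "indep2 c d" "M = join c d"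
  using assms projective_lineE by metis
 then have "finite (L \<inter> M) \<or> L \<inter> M = L" "finite (L \<inter> M) \<or> L \<inter> M = M"
  using zariski_closed_in_line[of "L \<inter> M"] zariski_closed_Int zariski_closed_join by blast+
 then show ?thesis using assms(3) by auto
qed

section \<open>Linear functionals as forms of degree one\<close>

definition lin :: "(complex^'n \<Rightarrow> complex) \<Rightarrow> bool" where
 "lin \<psi> \<longleftrightarrow> (\<forall>v w. \<psi> (v + w) = \<psi> v + \<psi> w) \<and> (\<forall>c v. \<psi> (c *s v) = c * \<psi> v)"

lemma lin_sum: "lin \<psi> \<Longrightarrow> \<psi> (\<Sum>i\<in>A. f i) = (\<Sum>i\<in>A. \<psi> (f i))"
proof -
 assume l: "lin \<psi>"
 have "\<psi> 0 = 0" using l unfolding lin_def by (metis mult_zero_left vector_smult_lzero)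
 then show ?thesis using l by (induction A rule: infinite_finite_induct) (auto simp: lin_def)
qed

lemma lin_expand:
 fixes \<psi> :: "complex^'n::finite \<Rightarrow> complex"
 assumes "lin \<psi>"
 shows "\<psi> v = (\<Sum>i\<in>UNIV. \<psi> (axis i 1) * v $ i)"
proof -
 have "\<psi> v = \<psi> (\<Sum>i\<in>UNIV. v $ i *s axis i 1)" using basis_expansion[of v] by simp
 also have "\<dots> = (\<Sum>i\<in>UNIV. \<psi> (axis i 1) * v $ i)"
  using assms by (simp add: lin_sum) (simp add: lin_def mult.commute)
 finally show ?thesis .
qed

lemma form_lin: "lin \<psi> \<Longrightarrow> form 1 \<psi>"
 using form_linear[of "\<chi> i. \<psi> (axis i 1)"] lin_expand[of \<psi>] by (metis (no_types, lifting) ext sum.cong vec_lambda_beta)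

section \<open>Holomorphic functions of two variables\<close>

lemma has_derivative_dx_dy:
 assumes "(F has_derivative (\<lambda>(s, t). \<alpha> * s + \<beta> * t)) (at q)"
 shows "((\<lambda>s. F (s, snd q)) has_field_derivative \<alpha>) (at (fst q))"
  and "((\<lambda>t. F (fst q, t)) has_field_derivative \<beta>) (at (snd q))"
  and "dx F q = \<alpha>" and "dy F q = \<beta>"
proof -
 have q: "q = (fst q, snd q)" by simp
 have "((\<lambda>s. (s, snd q)) has_derivative (\<lambda>s. (s, 0))) (at (fst q))"
  by (auto intro!: derivative_eq_intros)
 from has_derivative_compose[OF this, of F "\<lambda>(s, t). \<alpha> * s + \<beta> * t"]
 show 1: "((\<lambda>s. F (s, snd q)) has_field_derivative \<alpha>) (at (fst q))"
  using assms by (simp add: has_field_derivative_def)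
 have "((\<lambda>t. (fst q, t)) has_derivative (\<lambda>t. (0, t))) (at (snd q))"
  by (auto intro!: derivative_eq_intros)
 from has_derivative_compose[OF this, of F "\<lambda>(s, t). \<alpha> * s + \<beta> * t"]
 show 2: "((\<lambda>t. F (fst q, t)) has_field_derivative \<beta>) (at (snd q))"
  using assms by (simp add: has_field_derivative_def)
 show "dx F q = \<alpha>" "dy F q = \<beta>" using DERIV_imp_deriv[OF 1] DERIV_imp_deriv[OF 2]
  unfolding dx_def dy_def by (simp_all add: case_prod_unfold)
qed

lemma holo2D:
 assumes "holomorphic2_on F U" "q \<in> U"
 shows "(F has_derivative (\<lambda>(s, t). dx F q * s + dy F q * t)) (at q)"
proof -
 from assms obtain \<alpha> \<beta> where *: "(F has_derivative (\<lambda>(s, t). \<alpha> * s + \<beta> * t)) (at q)"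
  unfolding holomorphic2_on_def by blast
 with has_derivative_dx_dy[OF *] show ?thesis by simp
qed

lemma holo2_open: "holomorphic2_on F U \<Longrightarrow> open U"
 unfolding holomorphic2_on_def by blast

lemma holo2_partial:
 assumes "holomorphic2_on F U" "(x, y) \<in> U"
 shows "((\<lambda>s. F (s, y)) has_field_derivative dx F (x, y)) (at x)"
  "((\<lambda>t. F (x, t)) has_field_derivative dy F (x, y)) (at y)"
 using has_derivative_dx_dy(1,2)[OF holo2D[OF assms]] by simp_all

text \<open>A real derivative is additive anyway, so complex homogeneity makes it complex linear. In
  this form the usual differentiation rules may produce \<open>D\<close>.\<close>

lemma holo2I:
 assumes "open U"
  "\<And>q. q \<in> U \<Longrightarrow> \<exists>D. (F has_derivative D) (at q) \<and> (\<forall>c v. D (c * fst v, c * snd v) = c * D v)"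
 shows "holomorphic2_on F U"
 unfolding holomorphic2_on_def
proof (intro conjI ballI)
 fix q assume "q \<in> U"
 with assms(2) obtain D where D: "(F has_derivative D) (at q)"
  "\<And>c v. D (c * fst v, c * snd v) = c * D v" by blast
 interpret D: bounded_linear D using D(1) by (rule has_derivative_bounded_linear)
 have Deq: "D v = D (1, 0) * fst v + D (0, 1) * snd v" for v
 proof -
  have "D v = D ((fst v, 0) + (0, snd v))" by simp
  also have "\<dots> = D (fst v, 0) + D (0, snd v)" by (rule D.add)
  also have "\<dots> = D (1, 0) * fst v + D (0, 1) * snd v"
  using D(2)[of "fst v" "(1, 0)"] D(2)[of "snd v" "(0, 1)"] by simp
  finally show ?thesis .
 qed
 have "D = (\<lambda>(s, t). D (1, 0) * s + D (0, 1) * t)"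
 proof (rule ext)
  fix v
  show "D v = (case v of (s, t) \<Rightarrow> D (1, 0) * s + D (0, 1) * t)"
  using Deq[of v] by (cases v) simp
 qed
 with D(1) show "\<exists>\<alpha> \<beta>. (F has_derivative (\<lambda>(s, t). \<alpha> * s + \<beta> * t)) (at q)" by metis
qed fact

lemma holo2_subset: "holomorphic2_on F U \<Longrightarrow> open V \<Longrightarrow> V \<subseteq> U \<Longrightarrow> holomorphic2_on F V"
 unfolding holomorphic2_on_def by blast

lemma holo2_continuous: "holomorphic2_on F U \<Longrightarrow> continuous_on U F"
 by (meson continuous_at_imp_continuous_on has_derivative_continuous holo2D)

lemma holo2_const: "open U \<Longrightarrow> holomorphic2_on (\<lambda>_. c) U"
 by (rule holo2I) (auto intro!: exI[of _ "\<lambda>_. 0"])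

lemma holo2_fst: "open U \<Longrightarrow> holomorphic2_on fst U"
 by (rule holo2I) (auto intro!: exI[of _ fst] derivative_eq_intros)

lemma holo2_snd: "open U \<Longrightarrow> holomorphic2_on snd U"
 by (rule holo2I) (auto intro!: exI[of _ snd] derivative_eq_intros)

lemma holo2_add:
 assumes "holomorphic2_on F U" "holomorphic2_on G U"
 shows "holomorphic2_on (\<lambda>q. F q + G q) U"
 by (rule holo2I[OF holo2_open[OF assms(1)]])
  (rule exI conjI has_derivative_add holo2D assms | assumption | simp add: case_prod_unfold algebra_simps)+

lemma holo2_diff:
 assumes "holomorphic2_on F U" "holomorphic2_on G U"
 shows "holomorphic2_on (\<lambda>q. F q - G q) U"
 by (rule holo2I[OF holo2_open[OF assms(1)]])
  (rule exI conjI has_derivative_diff holo2D assms | assumption | simp add: case_prod_unfold algebra_simps)+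

lemma holo2_mult:
 assumes "holomorphic2_on F U" "holomorphic2_on G U"
 shows "holomorphic2_on (\<lambda>q. F q * G q) U"
 by (rule holo2I[OF holo2_open[OF assms(1)]])
  (rule exI conjI has_derivative_mult holo2D assms | assumption | simp add: case_prod_unfold algebra_simps)+

lemma holo2_inverse:
 assumes "holomorphic2_on F U" "\<And>q. q \<in> U \<Longrightarrow> F q \<noteq> 0"
 shows "holomorphic2_on (\<lambda>q. inverse (F q)) U"
proof (rule holo2I[OF holo2_open[OF assms(1)]])
 fix q assume q: "q \<in> U"
 show "\<exists>D. ((\<lambda>q. inverse (F q)) has_derivative D) (at q) \<and> (\<forall>c v. D (c * fst v, c * snd v) = c * D v)"
  by (rule exI, rule conjI, rule Deriv.has_derivative_inverse[OF assms(2)[OF q] holo2D[OF assms(1) q]])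
  (simp add: case_prod_unfold algebra_simps)
qed

lemma holo2_divide:
 assumes "holomorphic2_on F U" "holomorphic2_on G U" "\<And>q. q \<in> U \<Longrightarrow> G q \<noteq> 0"
 shows "holomorphic2_on (\<lambda>q. F q / G q) U"
 unfolding divide_inverse by (intro holo2_mult holo2_inverse assms)

lemma holo2_minus: "holomorphic2_on F U \<Longrightarrow> holomorphic2_on (\<lambda>q. - F q) U"
 using holo2_diff[OF holo2_const[of U 0]] holo2_open by fastforce

lemma holo2_power: "holomorphic2_on F U \<Longrightarrow> holomorphic2_on (\<lambda>q. F q ^ n) U"
 by (induction n) (auto intro: holo2_mult holo2_const dest: holo2_open)

lemma holo2_sum:
 assumes "open U" "\<And>i. i \<in> I \<Longrightarrow> holomorphic2_on (F i) U"
 shows "holomorphic2_on (\<lambda>q. \<Sum>i\<in>I. F i q) U"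
 using assms(2)
 by (induction I rule: infinite_finite_induct)
  (auto intro: holo2_add holo2_const assms(1))

lemmas holomorphic2_intros = holo2_const holo2_fst holo2_snd
 holo2_add holo2_diff holo2_mult holo2_divide
 holo2_minus holo2_power holo2_sum

lemma holo2_cong:
 assumes "holomorphic2_on F U" "\<And>q. q \<in> U \<Longrightarrow> F q = G q"
 shows "holomorphic2_on G U"
 unfolding holomorphic2_on_def
proof (intro conjI ballI)
 show "open U" using assms(1) by (rule holo2_open)
 fix q assume q: "q \<in> U"
 have "(G has_derivative (\<lambda>(s, t). dx F q * s + dy F q * t)) (at q)"
  by (rule has_derivative_transform_within_open[OF holo2D[OF assms(1) q] \<open>open U\<close> q]) (rule assms(2))
 then show "\<exists>\<alpha> \<beta>. (G has_derivative (\<lambda>(s, t). \<alpha> * s + \<beta> * t)) (at q)" by blast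
qed

lemma dx_dy_cong:
 assumes "holomorphic2_on F U" "\<And>r. r \<in> U \<Longrightarrow> F r = G r" "q \<in> U"
 shows "dx F q = dx G q" "dy F q = dy G q"
proof -
 have "(G has_derivative (\<lambda>(s, t). dx F q * s + dy F q * t)) (at q)"
  by (rule has_derivative_transform_within_open[OF holo2D[OF assms(1,3)] holo2_open[OF assms(1)] assms(3)])
  (rule assms(2))
 from has_derivative_dx_dy(3,4)[OF this] show "dx F q = dx G q" "dy F q = dy G q" by simp_all
qed

lemma dx_dy_const: "dx (\<lambda>_. c) q = 0" "dy (\<lambda>_. c) q = 0"
 using has_derivative_dx_dy(3,4)[of "\<lambda>_. c" 0 0 q] by (simp_all add: case_prod_unfold)

lemma dx_dy_add:
 assumes "holomorphic2_on F U" "holomorphic2_on G U" "q \<in> U"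
 shows "dx (\<lambda>q. F q + G q) q = dx F q + dx G q" "dy (\<lambda>q. F q + G q) q = dy F q + dy G q"
proof -
 have "((\<lambda>q. F q + G q) has_derivative (\<lambda>(s, t). (dx F q + dx G q) * s + (dy F q + dy G q) * t)) (at q)"
  by (rule has_derivative_eq_rhs[OF has_derivative_add[OF holo2D[OF assms(1,3)] holo2D[OF assms(2,3)]]])
  (simp add: fun_eq_iff algebra_simps)
 from has_derivative_dx_dy(3,4)[OF this] show "dx (\<lambda>q. F q + G q) q = dx F q + dx G q"
  "dy (\<lambda>q. F q + G q) q = dy F q + dy G q" by simp_all
qed

lemma dx_dy_mult:
 assumes "holomorphic2_on F U" "holomorphic2_on G U" "q \<in> U"
 shows "dx (\<lambda>q. F q * G q) q = dx F q * G q + F q * dx G q"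
  "dy (\<lambda>q. F q * G q) q = dy F q * G q + F q * dy G q"
proof -
 have "((\<lambda>q. F q * G q) has_derivative (\<lambda>(s, t). (dx F q * G q + F q * dx G q) * s + (dy F q * G q + F q * dy G q) * t)) (at q)"
  by (rule has_derivative_eq_rhs[OF has_derivative_mult[OF holo2D[OF assms(1,3)] holo2D[OF assms(2,3)]]])
  (simp add: fun_eq_iff algebra_simps)
 from has_derivative_dx_dy(3,4)[OF this] show "dx (\<lambda>q. F q * G q) q = dx F q * G q + F q * dx G q"
  "dy (\<lambda>q. F q * G q) q = dy F q * G q + F q * dy G q" by simp_all
qed

lemma dx_dy_sum:
 assumes "open U" "\<And>i. i \<in> I \<Longrightarrow> holomorphic2_on (F i) U" "q \<in> U"
 shows "dx (\<lambda>q. \<Sum>i\<in>I. F i q) q = (\<Sum>i\<in>I. dx (F i) q)"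
  "dy (\<lambda>q. \<Sum>i\<in>I. F i q) q = (\<Sum>i\<in>I. dy (F i) q)"
proof -
 have "dx (\<lambda>q. \<Sum>i\<in>I. F i q) q = (\<Sum>i\<in>I. dx (F i) q) \<and> dy (\<lambda>q. \<Sum>i\<in>I. F i q) q = (\<Sum>i\<in>I. dy (F i) q)"
  using assms(2)
 proof (induction I rule: infinite_finite_induct)
  case (insert i I)
  then have "holomorphic2_on (F i) U" "holomorphic2_on (\<lambda>q. \<Sum>i\<in>I. F i q) U"
  using assms(1) by (auto intro: holo2_sum)
  with insert show ?case using dx_dy_add[OF _ _ assms(3)] by simp
 qed (auto simp: dx_dy_const)
 then show "dx (\<lambda>q. \<Sum>i\<in>I. F i q) q = (\<Sum>i\<in>I. dx (F i) q)"
  "dy (\<lambda>q. \<Sum>i\<in>I. F i q) q = (\<Sum>i\<in>I. dy (F i) q)" by blast+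
qed

text \<open>A function that is continuous and holomorphic in each variable is holomorphic (Osgood's lemma);
 the partial derivatives are continuous by Cauchy's inequality.\<close>

lemma rectangle_in_open:
 assumes "open (U :: (complex \<times> complex) set)" "(x, y) \<in> U"
 obtains r where "r > 0" "cball x r \<times> cball y r \<subseteq> U"
proof -
 obtain A B where AB: "open A" "open B" "x \<in> A" "y \<in> B" "A \<times> B \<subseteq> U"
  using assms by (auto elim!: open_prod_elim)
 obtain a b where "a > 0" "cball x a \<subseteq> A" "b > 0" "cball y b \<subseteq> B"
  using AB open_contains_cball by meson
 then have "min a b > 0" "cball x (min a b) \<times> cball y (min a b) \<subseteq> U"
  using AB(5) by (auto simp: subset_iff)
 then show thesis by (rule that)
qed

lemma continuous_on_dy_separate:
 assumes U: "open U" and cont: "continuous_on U f"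
  and holo: "\<And>x y. (x, y) \<in> U \<Longrightarrow> (\<lambda>t. f (x, t)) field_differentiable (at y)"
 shows "continuous_on U (dy f)"
proof (rule continuous_at_imp_continuous_on, rule ballI)
 fix q assume "q \<in> U"
 obtain x1 y1 where q: "q = (x1, y1)" by (cases q)
 obtain r where r: "r > 0" "cball x1 r \<times> cball y1 r \<subseteq> U"
  using rectangle_in_open[OF U] \<open>q \<in> U\<close> q by blast
 define K where "K = cball x1 r \<times> cball y1 r"
 have K: "compact K" unfolding K_def by (intro compact_Times compact_cball)
 have uc: "uniformly_continuous_on K f"
  using compact_uniformly_continuous[OF continuous_on_subset[OF cont] K] r K_def by blast
 have hol: "(\<lambda>t. f (x, t)) holomorphic_on ball y1 r" if "x \<in> cball x1 r" for x
  unfolding holomorphic_on_def using holo r that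
  by (meson ball_subset_cball field_differentiable_at_within mem_Sigma_iff subset_iff)
 have cont_x: "continuous_on (cball y1 r) (\<lambda>t. f (x, t))" if "x \<in> cball x1 r" for x
  by (rule continuous_on_compose2[OF cont]) (use r that in \<open>auto intro!: continuous_intros\<close>)
 show "isCont (dy f) q"
  unfolding continuous_at_eps_delta
 proof (intro allI impI)
  fix e :: real assume e: "e > 0"
  have "isCont (deriv (\<lambda>t. f (x1, t))) y1"
  using holomorphic_deriv[OF hol[of x1] open_ball] r
  by (meson centre_in_ball centre_in_cball continuous_on_eq_continuous_at holomorphic_on_imp_continuous_on less_imp_le open_ball)
  then obtain d1 where d1: "d1 > 0" "\<And>y. norm (y - y1) < d1 \<Longrightarrow>
  norm (deriv (\<lambda>t. f (x1, t)) y - deriv (\<lambda>t. f (x1, t)) y1) < e / 2"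
  unfolding continuous_at_eps_delta using e by (metis dist_norm half_gt_zero)
  \<comment> \<open>Cauchy's inequality on a circle of radius \<open>r / 2\<close> turns this bound
    for the difference of two slices into \<open>e / 4\<close> for its derivative.\<close>
  have "e * r / 8 > 0" using e r by simp
  then obtain d2 where d2: "d2 > 0" "\<And>u v. u \<in> K \<Longrightarrow> v \<in> K \<Longrightarrow> dist v u < d2 \<Longrightarrow> dist (f v) (f u) < e * r / 8"
  using uc unfolding uniformly_continuous_on_def by metis
  define d where "d = Min {d1, d2, r / 2}"
  have d: "d > 0" "d \<le> d1" "d \<le> d2" "d \<le> r / 2" unfolding d_def using d1 d2 r by auto
  have "dist (dy f p) (dy f q) < e" if "dist p q < d" for p
  proof -
  obtain x y where p: "p = (x, y)" by (cases p)
  have xy: "dist x x1 < d" "dist y y1 < d"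
  using that dist_fst_le[of p q] dist_snd_le[of p q] unfolding p q by auto
  have x: "x \<in> cball x1 r" and x1: "x1 \<in> cball x1 r" using xy d r by (auto simp: dist_commute)
  have yr: "cball y (r / 2) \<subseteq> ball y1 r"
  proof
  fix t assume "t \<in> cball y (r / 2)"
  then have "dist y1 t < r" using xy d dist_triangle[of y1 t y] by (auto simp: dist_commute)
  then show "t \<in> ball y1 r" by simp
  qed
  define g where "g = (\<lambda>t. f (x, t) - f (x1, t))"
  have "norm ((deriv ^^ 1) g y) \<le> fact 1 * (e * r / 8) / (r / 2) ^ 1"
  proof (rule Cauchy_inequality)
  have "g holomorphic_on ball y1 r" unfolding g_def using hol[OF x] hol[OF x1]
  by (intro holomorphic_intros)
  then show "g holomorphic_on ball y (r / 2)"
  by (rule holomorphic_on_subset) (use yr in auto)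
  have "continuous_on (cball y1 r) g" unfolding g_def using cont_x[OF x] cont_x[OF x1]
  by (intro continuous_intros)
  then show "continuous_on (cball y (r / 2)) g"
  by (rule continuous_on_subset) (use yr in auto)
  show "0 < r / 2" using r by simp
  fix t assume "norm (y - t) = r / 2"
  then have t: "t \<in> cball y1 r" using yr by (auto simp: dist_norm)
  have "dist (x, t) (x1, t) < d2" using xy d by (simp add: dist_Pair_Pair)
  then have "dist (f (x, t)) (f (x1, t)) < e * r / 8"
  using d2(2)[of "(x1, t)" "(x, t)"] x x1 t unfolding K_def by auto
  then show "norm (g t) \<le> e * r / 8" unfolding g_def dist_norm by simp
  qed
  then have g1: "norm (deriv g y) \<le> e / 4" using r by simp
  have "y \<in> cball y (r / 2)" using r by simp
  then have y: "y \<in> ball y1 r" using yr by blast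
  have "deriv g y = deriv (\<lambda>t. f (x, t)) y - deriv (\<lambda>t. f (x1, t)) y"
  unfolding g_def using hol[OF x] hol[OF x1] y
  by (intro deriv_diff) (auto intro: holomorphic_on_imp_differentiable_at)
  then have "dist (dy f p) (dy f q) = norm (deriv g y + (deriv (\<lambda>t. f (x1, t)) y - deriv (\<lambda>t. f (x1, t)) y1))"
  unfolding dy_def p q dist_norm by simp
  also have "\<dots> \<le> norm (deriv g y) + norm (deriv (\<lambda>t. f (x1, t)) y - deriv (\<lambda>t. f (x1, t)) y1)"
  by (rule norm_triangle_ineq)
  also have "\<dots> < e / 4 + e / 2"
  using g1 d1(2)[of y] xy d by (simp add: dist_norm)
  finally show ?thesis using e by simp
  qed
  then show "\<exists>d>0. \<forall>p. dist p q < d \<longrightarrow> dist (dy f p) (dy f q) < e" using d(1) by blast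
 qed
qed

lemma holo2I_separate:
 assumes U: "open U" and cont: "continuous_on U f"
  and hx: "\<And>x y. (x, y) \<in> U \<Longrightarrow> (\<lambda>s. f (s, y)) field_differentiable (at x)"
  and hy: "\<And>x y. (x, y) \<in> U \<Longrightarrow> (\<lambda>t. f (x, t)) field_differentiable (at y)"
 shows "holomorphic2_on f U"
 unfolding holomorphic2_on_def
proof (intro conjI ballI)
 show "open U" by fact
 fix q assume "q \<in> U"
 obtain x y where q: "q = (x, y)" by (cases q)
 obtain r where r: "r > 0" "cball x r \<times> cball y r \<subseteq> U"
  using rectangle_in_open[OF U] \<open>q \<in> U\<close> q by blast
 define X Y where "X = ball x r" and "Y = ball y r"
 have XY: "X \<times> Y \<subseteq> U" "open X" "open Y" "convex Y" "x \<in> X" "y \<in> Y" unfolding X_def Y_def using r by auto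
 define fy where "fy = (\<lambda>a b. Blinfun ((*) (dy f (a, b))))"
 have fy_app: "blinfun_apply (fy a b) = (*) (dy f (a, b))" for a b
  unfolding fy_def by (rule bounded_linear_Blinfun_apply) (rule bounded_linear_mult_right)
 have cd: "continuous_on U (dy f)" using continuous_on_dy_separate[OF U cont hy] .
 \<comment> \<open>Total differentiability needs the continuity of one partial derivative only; here
   it is \<open>dy f\<close>.\<close>
 have "((\<lambda>(a, b). f (a, b)) has_derivative (\<lambda>(tx, ty). (*) (dx f (x, y)) tx + blinfun_apply (fy x y) ty)) (at (x, y) within X \<times> Y)"
 proof (rule has_derivative_partialsI)
  show "((\<lambda>a. f (a, y)) has_derivative (*) (dx f (x, y))) (at x within X)"
  using hx[of x y] \<open>q \<in> U\<close> q
  by (simp add: dx_def field_differentiable_derivI has_field_derivative_def[symmetric] has_field_derivative_at_within)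
  fix a b assume "a \<in> X" "b \<in> Y"
  then have "(a, b) \<in> U" using XY by blast
  then show "((\<lambda>b. f (a, b)) has_derivative blinfun_apply (fy a b)) (at b within Y)"
  unfolding fy_app using hy[of a b]
  by (simp add: dy_def field_differentiable_derivI has_field_derivative_def[symmetric] has_field_derivative_at_within)
 next
  have bl: "bounded_linear (\<lambda>c::complex. Blinfun ((*) c))"
  proof -
  have "Blinfun ((*) c) = blinfun_mult_left c" for c :: complex
  by (rule blinfun_eqI) (simp add: bounded_linear_Blinfun_apply bounded_linear_mult_right)
  then show ?thesis by (metis (no_types, lifting) ext bounded_linear_blinfun_mult_left)
  qed
  have "continuous (at (x, y)) (dy f)" using cd U \<open>q \<in> U\<close> q continuous_on_eq_continuous_at by blast
  then have "continuous (at (x, y)) (\<lambda>p. Blinfun ((*) (dy f p)))"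
  by (rule bounded_linear.continuous[OF bl])
  then show "continuous (at (x, y) within X \<times> Y) (\<lambda>(x, y). fy x y)"
  unfolding fy_def by (simp add: case_prod_unfold continuous_at_imp_continuous_at_within)
 qed (use XY in auto)
 then have "(f has_derivative (\<lambda>(s, t). dx f (x, y) * s + dy f (x, y) * t)) (at q)"
  unfolding fy_app q using at_within_open[of "(x, y)" "X \<times> Y"] XY by (simp add: open_Times)
 then show "\<exists>\<alpha> \<beta>. (f has_derivative (\<lambda>(s, t). \<alpha> * s + \<beta> * t)) (at q)" by blast
qed

lemma continuous_on_dy:
 assumes "holomorphic2_on f U"
 shows "continuous_on U (dy f)"
 using continuous_on_dy_separate[OF holo2_open[OF assms] holo2_continuous[OF assms]]
  holo2_partial(2)[OF assms] field_differentiable_def by blast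

lemma holo2_compose_linear:
 fixes a b c d :: complex
 assumes f: "holomorphic2_on f U" and T_def: "T = (\<lambda>q. (a * fst q + b * snd q, c * fst q + d * snd q))"
 shows "holomorphic2_on (\<lambda>q. f (T q)) (T -` U)"
  and "T q \<in> U \<Longrightarrow> dx (\<lambda>q. f (T q)) q = dx f (T q) * a + dy f (T q) * c"
  and "T q \<in> U \<Longrightarrow> dy (\<lambda>q. f (T q)) q = dx f (T q) * b + dy f (T q) * d"
proof -
 have T: "(T has_derivative T) (at q)" for q unfolding T_def by (auto intro!: derivative_eq_intros)
 have *: "((\<lambda>q. f (T q)) has_derivative (\<lambda>(s, t). (dx f (T q) * a + dy f (T q) * c) * s + (dx f (T q) * b + dy f (T q) * d) * t)) (at q)"
  if "T q \<in> U" for q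
  using has_derivative_compose[OF T holo2D[OF f that]]
  by (rule has_derivative_eq_rhs) (simp add: T_def fun_eq_iff algebra_simps)
 have "continuous_on UNIV T" unfolding T_def by (intro continuous_intros)
 then have "open (T -` U)" using holo2_open[OF f] open_vimage by blast
 with * show "holomorphic2_on (\<lambda>q. f (T q)) (T -` U)" unfolding holomorphic2_on_def by blast
 show "T q \<in> U \<Longrightarrow> dx (\<lambda>q. f (T q)) q = dx f (T q) * a + dy f (T q) * c"
  "T q \<in> U \<Longrightarrow> dy (\<lambda>q. f (T q)) q = dx f (T q) * b + dy f (T q) * d"
  using has_derivative_dx_dy(3,4)[OF *] by blast+
qed

lemma continuous_on_dx:
 assumes "holomorphic2_on f U"
 shows "continuous_on U (dx f)"
proof -
 \<comment> \<open>Exchanging the two variables reduces the claim to \<open>dy\<close>.\<close>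
 define T where "T = (\<lambda>q :: complex \<times> complex. (0 * fst q + 1 * snd q, 1 * fst q + 0 * snd q))"
 have TT: "T (T q) = q" for q unfolding T_def by simp
 have h: "holomorphic2_on (\<lambda>q. f (T q)) (T -` U)"
  by (rule holo2_compose_linear(1)[OF assms T_def])
 have "continuous_on U (\<lambda>q. dy (\<lambda>q. f (T q)) (T q))"
  by (rule continuous_on_compose2[OF continuous_on_dy[OF h]])
  (auto simp: T_def intro!: continuous_intros)
 moreover have "dy (\<lambda>q. f (T q)) (T q) = dx f q" if "q \<in> U" for q
  using holo2_compose_linear(3)[OF assms T_def, of "T q"] that by (simp add: TT)
 ultimately show ?thesis by (metis (no_types, lifting) continuous_on_cong)
qed

section \<open>Removable singularities and division by the equation of a smooth curve\<close>

lemma isolated_zero: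
 assumes "(h has_field_derivative D) (at x)" "D \<noteq> 0" "h x = (0::complex)"
 shows "eventually (\<lambda>t. h t \<noteq> 0) (at x)"
proof -
 have "((\<lambda>t. (h t - h x) / (t - x)) \<longlongrightarrow> D) (at x)"
  using assms(1) by (simp add: has_field_derivative_iff)
 from tendsto_imp_eventually_ne[OF this assms(2)] show ?thesis
  by eventually_elim (use assms(3) in auto)
qed

lemma quotient_tendsto:
 assumes "(g has_field_derivative C) (at x)" "(h has_field_derivative D) (at x)"
  "D \<noteq> 0" "h x = 0" "g x = (0::complex)"
 shows "((\<lambda>t. g t / h t) \<longlongrightarrow> C / D) (at x)"
proof -
 have "((\<lambda>t. (g t - g x) / (t - x)) \<longlongrightarrow> C) (at x)" "((\<lambda>t. (h t - h x) / (t - x)) \<longlongrightarrow> D) (at x)"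
  using assms by (simp_all add: has_field_derivative_iff)
 from tendsto_divide[OF this assms(3)] have "((\<lambda>t. ((g t - g x) / (t - x)) / ((h t - h x) / (t - x))) \<longlongrightarrow> C / D) (at x)" .
 moreover have "eventually (\<lambda>t. ((g t - g x) / (t - x)) / ((h t - h x) / (t - x)) = g t / h t) (at x)"
  unfolding eventually_at_filter using assms(4,5) by (intro always_eventually) auto
 ultimately show ?thesis by (rule Lim_transform_eventually)
qed

lemma removable_differentiable:
 assumes "continuous (at x) v" "eventually (\<lambda>t. v field_differentiable (at t)) (at (x::complex))"
 shows "v field_differentiable (at x)"
proof -
 obtain d where d: "d > 0" "\<And>t. t \<noteq> x \<Longrightarrow> dist t x < d \<Longrightarrow> v field_differentiable (at t)"
  using assms(2) unfolding eventually_at by auto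
 have cont: "isCont v t" if "t \<in> ball x d" for t
  using that d(2)[of t] assms(1) field_differentiable_imp_continuous_at by (cases "t = x") (auto simp: dist_commute)
 have "v holomorphic_on ball x d"
 proof (rule no_isolated_singularity)
  show "continuous_on (ball x d) v" using cont by (simp add: continuous_at_imp_continuous_on)
  show "v holomorphic_on ball x d - {x}" unfolding holomorphic_on_def
  using d(2) by (auto simp: dist_commute intro: field_differentiable_at_within)
 qed auto
 then show ?thesis using d(1) holomorphic_on_imp_differentiable_at by fastforce
qed

lemma open_nonzero:
 fixes f :: "'a::topological_space \<Rightarrow> complex"
 assumes "open U" "continuous_on U f"
 shows "open {r \<in> U. f r \<noteq> 0}"
proof -
 have "open (U \<inter> f -` (- {0}))" using assms by (intro continuous_open_preimage) auto
 moreover have "U \<inter> f -` (- {0}) = {r \<in> U. f r \<noteq> 0}" by auto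
 ultimately show ?thesis by simp
qed

text \<open>If both partial derivatives of \<open>h\<close> are non-zero, the quotient \<open>g / h\<close> has only removable
 singularities on each horizontal and each vertical disc; it is jointly continuous by the maximum
 principle, applied on a circle that avoids the zeros of \<open>h\<close>.\<close>

lemma holomorphic2_division_aux:
 assumes g: "holomorphic2_on g N" and h: "holomorphic2_on h N" and q: "q \<in> N" "h q = 0"
  and nz: "dx h q \<noteq> 0" "dy h q \<noteq> 0" and zeros: "\<And>r. r \<in> N \<Longrightarrow> h r = 0 \<Longrightarrow> g r = 0"
 shows "\<exists>N' v. q \<in> N' \<and> N' \<subseteq> N \<and> holomorphic2_on v N' \<and> (\<forall>r\<in>N'. g r = h r * v r)"
proof -
 obtain x0 y0 where q0: "q = (x0, y0)" by (cases q)
 define M where "M = {r \<in> N. dx h r * dy h r \<noteq> 0}"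
 have "open N" using holo2_open[OF g] .
 have "open M" unfolding M_def
  using continuous_on_dx[OF h] continuous_on_dy[OF h] \<open>open N\<close>
  by (intro open_nonzero continuous_intros)
 have "(x0, y0) \<in> M" unfolding M_def using q nz q0 by auto
 then obtain e where e: "e > 0" "cball x0 e \<times> cball y0 e \<subseteq> M"
  using rectangle_in_open[OF \<open>open M\<close>] by blast
 have MN: "M \<subseteq> N" and Mnz: "\<And>r. r \<in> M \<Longrightarrow> dx h r \<noteq> 0" "\<And>r. r \<in> M \<Longrightarrow> dy h r \<noteq> 0"
  unfolding M_def by auto
 \<comment> \<open>On the curve the value of the quotient is prescribed by l'Hospital's rule in the
   first variable.\<close>
 define v where "v = (\<lambda>r. if h r \<noteq> 0 then g r / h r else dx g r / dx h r)"
 have gv: "g r = h r * v r" if "r \<in> N" for r using zeros[OF that] unfolding v_def by auto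
 define N0 where "N0 = {r \<in> N. h r \<noteq> 0}"
 have N0: "open N0" "N0 \<subseteq> N" "\<And>r. r \<in> N0 \<Longrightarrow> h r \<noteq> 0" unfolding N0_def
  using open_nonzero[OF \<open>open N\<close> holo2_continuous[OF h]] by auto
 have vN0: "holomorphic2_on v N0"
  by (rule holo2_cong[OF holo2_divide[of g N0 h]])
  (use N0 g h in \<open>auto simp: v_def intro: holo2_subset\<close>)
 have vdiff0: "(\<lambda>s. v (s, y)) field_differentiable (at x)" "(\<lambda>t. v (x, t)) field_differentiable (at y)"
  if "(x, y) \<in> N0" for x y
  using holo2_partial[OF vN0 that] unfolding field_differentiable_def by blast+
 have ev_x: "eventually (\<lambda>s. (s, y) \<in> N) (at x)" if "(x, y) \<in> N" for x y
 proof -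
  have "open ((\<lambda>s. (s, y)) -` N)" by (rule open_vimage[OF \<open>open N\<close>]) (intro continuous_intros)
  then show ?thesis using that eventually_at_topological by blast
 qed
 have ev_y: "eventually (\<lambda>t. (x, t) \<in> N) (at y)" if "(x, y) \<in> N" for x y
 proof -
  have "open ((\<lambda>t. (x, t)) -` N)" by (rule open_vimage[OF \<open>open N\<close>]) (intro continuous_intros)
  then show ?thesis using that eventually_at_topological by blast
 qed
 have hx: "(\<lambda>s. v (s, y)) field_differentiable (at x)" if M: "(x, y) \<in> M" for x y
 proof (cases "h (x, y) = 0")
  case False
  then show ?thesis using vdiff0(1) M MN unfolding N0_def by blast
 next
  case True
  have xyN: "(x, y) \<in> N" using M MN by blast
  have iz: "eventually (\<lambda>s. h (s, y) \<noteq> 0) (at x)"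
  by (rule isolated_zero[OF holo2_partial(1)[OF h xyN] Mnz(1)[OF M] True])
  show ?thesis
  proof (rule removable_differentiable)
  show "eventually (\<lambda>s. (\<lambda>s. v (s, y)) field_differentiable (at s)) (at x)"
  using iz ev_x[OF xyN] by eventually_elim (rule vdiff0, simp add: N0_def)
  have "((\<lambda>s. g (s, y) / h (s, y)) \<longlongrightarrow> dx g (x, y) / dx h (x, y)) (at x)"
  by (rule quotient_tendsto[OF holo2_partial(1)[OF g xyN] holo2_partial(1)[OF h xyN] Mnz(1)[OF M] True zeros[OF xyN True]])
  then have "((\<lambda>s. v (s, y)) \<longlongrightarrow> dx g (x, y) / dx h (x, y)) (at x)"
  by (rule Lim_transform_eventually) (use iz in eventually_elim, simp add: v_def)
  then show "isCont (\<lambda>s. v (s, y)) x" unfolding isCont_def using True by (simp add: v_def)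
  qed
 qed
 have "eventually (\<lambda>s. h (s, y0) \<noteq> 0) (at x0)"
  using isolated_zero[OF holo2_partial(1)[OF h]] q nz q0 by blast
 then obtain d where d: "d > 0" "\<And>s. s \<noteq> x0 \<Longrightarrow> dist s x0 < d \<Longrightarrow> h (s, y0) \<noteq> 0"
  unfolding eventually_at by auto
 define \<rho> where "\<rho> = min (d / 2) (e / 2)"
 have \<rho>: "\<rho> > 0" "\<rho> < d" "\<rho> < e" unfolding \<rho>_def using d e by auto
 \<comment> \<open>The variables are exchanged because the tube lemma expects the compact factor,
   here the circle, in second place.\<close>
 define W where "W = (\<lambda>p. (snd p, fst p)) -` N0"
 have "open W" unfolding W_def by (rule open_vimage[OF N0(1)]) (intro continuous_intros)
 have "{y0} \<times> sphere x0 \<rho> \<subseteq> W"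
 proof
  fix p assume "p \<in> {y0} \<times> sphere x0 \<rho>"
  then obtain s where s: "p = (y0, s)" "dist x0 s = \<rho>" by auto
  have "s \<in> cball x0 e" "y0 \<in> cball y0 e" using e s \<rho> by auto
  then have "(s, y0) \<in> M" using e(2) by blast
  moreover have "h (s, y0) \<noteq> 0" using d(2)[of s] s \<rho> by (auto simp: dist_commute)
  ultimately show "p \<in> W" unfolding W_def N0_def using s MN by auto
 qed
 \<comment> \<open>By compactness the same circle avoids the zeros of \<open>h\<close> on all slices
   near \<open>y0\<close>.\<close>
 from Elementary_Topology.tube_lemma[OF compact_sphere \<open>open W\<close> this] obtain X0 where
  X0: "y0 \<in> X0" "open X0" "X0 \<times> sphere x0 \<rho> \<subseteq> W" by blast
 define E where "E = X0 \<inter> ball y0 e"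
 have E: "open E" "y0 \<in> E" "E \<subseteq> ball y0 e" unfolding E_def using X0 e by auto
 have circ: "(s, y) \<in> N0" if "s \<in> sphere x0 \<rho>" "y \<in> E" for s y
 proof -
  have "(y, s) \<in> W" using X0(3) that unfolding E_def by blast
  then show ?thesis unfolding W_def by simp
 qed
 define N' where "N' = ball x0 \<rho> \<times> E"
 have inM: "(s, y) \<in> M" if "s \<in> ball x0 e" "y \<in> E" for s y
  using e(2) that E(3) ball_subset_cball by blast
 have N'M: "N' \<subseteq> M" unfolding N'_def using inM \<rho> by auto
 have "open N'" unfolding N'_def using E by (intro open_Times) auto
 have contv: "isCont v (x1, y1)" if "(x1, y1) \<in> N'" for x1 y1
  unfolding continuous_at_eps_delta
 proof (intro allI impI)
  fix \<epsilon> :: real assume \<epsilon>: "\<epsilon> > 0"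
  have x1: "x1 \<in> ball x0 \<rho>" and y1: "y1 \<in> E" using that unfolding N'_def by auto
  have "isCont (\<lambda>s. v (s, y1)) x1"
  using hx[of x1 y1] N'M that field_differentiable_imp_continuous_at by blast
  then obtain d1 where d1: "d1 > 0" "\<And>s. dist s x1 < d1 \<Longrightarrow> dist (v (s, y1)) (v (x1, y1)) < \<epsilon> / 2"
  unfolding continuous_at_eps_delta using \<epsilon> half_gt_zero by blast
  obtain r where r: "r > 0" "cball y1 r \<subseteq> E" using E(1) y1 open_contains_cball by blast
  define K where "K = sphere x0 \<rho> \<times> cball y1 r"
  have "K \<subseteq> N0" unfolding K_def using circ r by blast
  then have "uniformly_continuous_on K v"
  using compact_uniformly_continuous[OF continuous_on_subset[OF holo2_continuous[OF vN0]], of K]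
  unfolding K_def by (simp add: compact_Times)
  then obtain d2 where d2: "d2 > 0" "\<And>u w. u \<in> K \<Longrightarrow> w \<in> K \<Longrightarrow> dist w u < d2 \<Longrightarrow> dist (v w) (v u) < \<epsilon> / 2"
  unfolding uniformly_continuous_on_def using \<epsilon> half_gt_zero by metis
  obtain d3 where d3: "d3 > 0" "ball x1 d3 \<subseteq> ball x0 \<rho>" using x1 open_ball open_contains_ball by blast
  define d' where "d' = Min {d1, d2, d3, r}"
  have d': "d' > 0" "d' \<le> d1" "d' \<le> d2" "d' \<le> d3" "d' \<le> r" unfolding d'_def using d1 d2 d3 r by auto
  have "dist (v p) (v (x1, y1)) < \<epsilon>" if "dist p (x1, y1) < d'" for p
  proof -
  obtain x y where p: "p = (x, y)" by (cases p)
  have xy: "dist x x1 < d'" "dist y y1 < d'"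
  using that dist_fst_le[of p "(x1, y1)"] dist_snd_le[of p "(x1, y1)"] unfolding p by auto
  have y: "y \<in> E" "y \<in> cball y1 r" using xy d' r by (auto simp: dist_commute)
  have "x \<in> ball x1 d3" using xy d' by (auto simp: dist_commute)
  then have x: "x \<in> ball x0 \<rho>" using d3 by blast
  define f where "f = (\<lambda>s. v (s, y) - v (s, y1))"
  have "(\<lambda>s. v (s, y')) holomorphic_on ball x0 e" if "y' \<in> E" for y'
  unfolding holomorphic_on_def using hx inM that by (blast intro: field_differentiable_at_within)
  then have fh: "f holomorphic_on ball x0 e" unfolding f_def using y(1) y1
  by (intro holomorphic_intros) auto
  have "norm (f x) \<le> \<epsilon> / 2"
  proof (rule maximum_modulus_frontier[of f "ball x0 \<rho>" "\<epsilon> / 2" x])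
  show "f holomorphic_on interior (ball x0 \<rho>)"
  by (rule holomorphic_on_subset[OF fh]) (use \<rho> in auto)
  show "continuous_on (closure (ball x0 \<rho>)) f"
  by (rule continuous_on_subset[OF holomorphic_on_imp_continuous_on[OF fh]]) (use \<rho> in auto)
  fix s assume "s \<in> frontier (ball x0 \<rho>)"
  then have s: "s \<in> sphere x0 \<rho>" using \<rho> by simp
  have "dist (s, y) (s, y1) < d2" using xy d' by (simp add: dist_Pair_Pair)
  then have "dist (v (s, y)) (v (s, y1)) < \<epsilon> / 2"
  using d2(2)[of "(s, y1)" "(s, y)"] s y r unfolding K_def by auto
  then show "norm (f s) \<le> \<epsilon> / 2" unfolding f_def dist_norm by simp
  qed (use x in auto)
  then have "dist (v (x, y)) (v (x, y1)) \<le> \<epsilon> / 2" unfolding f_def dist_norm .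
  moreover have "dist (v (x, y1)) (v (x1, y1)) < \<epsilon> / 2" using d1(2) xy d' by auto
  ultimately show ?thesis unfolding p using dist_triangle[of "v (x, y)" "v (x1, y1)" "v (x, y1)"] by linarith
  qed
  then show "\<exists>d>0. \<forall>p. dist p (x1, y1) < d \<longrightarrow> dist (v p) (v (x1, y1)) < \<epsilon>" using d'(1) by blast
 qed
 have hy: "(\<lambda>t. v (x, t)) field_differentiable (at y)" if xyN': "(x, y) \<in> N'" for x y
 proof (cases "h (x, y) = 0")
  case False
  then show ?thesis using vdiff0(2) xyN' N'M MN unfolding N0_def by blast
 next
  case True
  have M: "(x, y) \<in> M" and xyN: "(x, y) \<in> N" using xyN' N'M MN by blast+
  have iz: "eventually (\<lambda>t. h (x, t) \<noteq> 0) (at y)"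
  by (rule isolated_zero[OF holo2_partial(2)[OF h xyN] Mnz(2)[OF M] True])
  show ?thesis
  proof (rule removable_differentiable)
  show "eventually (\<lambda>t. (\<lambda>t. v (x, t)) field_differentiable (at t)) (at y)"
  using iz ev_y[OF xyN] by eventually_elim (rule vdiff0, simp add: N0_def)
  show "isCont (\<lambda>t. v (x, t)) y"
  by (rule isCont_o2[where f = "\<lambda>t. (x, t)" and g = v]) (use contv[OF xyN'] in \<open>auto intro!: continuous_intros\<close>)
  qed
 qed
 have "holomorphic2_on v N'"
  by (rule holo2I_separate)
  (use \<open>open N'\<close> contv hx hy N'M in \<open>auto intro!: continuous_at_imp_continuous_on\<close>)
 moreover have "q \<in> N'" "N' \<subseteq> N" using N'M MN E \<rho> unfolding N'_def q0 by auto
 ultimately show ?thesis using gv by blast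
qed

text \<open>A shear makes both partial derivatives of \<open>h\<close> nonzero, which reduces the
  claim to the case treated before.\<close>

lemma holomorphic2_division:
 assumes g: "holomorphic2_on g N" and h: "holomorphic2_on h N" and q: "q \<in> N" "h q = 0"
  and nz: "dx h q \<noteq> 0 \<or> dy h q \<noteq> 0" and zeros: "\<And>r. r \<in> N \<Longrightarrow> h r = 0 \<Longrightarrow> g r = 0"
 obtains N' v where "q \<in> N'" "N' \<subseteq> N" "holomorphic2_on v N'" "\<And>r. r \<in> N' \<Longrightarrow> g r = h r * v r"
proof -
 \<comment> \<open>With \<open>b * c = 0\<close> the linear map has determinant one, and its inverse
   arises by changing the signs of \<open>b\<close> and \<open>c\<close>.\<close>
 obtain b c :: complex where bc: "b * c = 0" "dx h q + dy h q * c \<noteq> 0" "dx h q * b + dy h q \<noteq> 0"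
 proof (cases "dx h q = 0 \<or> dy h q = 0")
  case False
  then show thesis using that[of 0 0] by auto
 next
  case True
  then show thesis using that[of 0 1] that[of 1 0] nz by auto
 qed
 define T where "T = (\<lambda>q::complex \<times> complex. (1 * fst q + b * snd q, c * fst q + 1 * snd q))"
 define T' where "T' = (\<lambda>q::complex \<times> complex. (1 * fst q + (-b) * snd q, (-c) * fst q + 1 * snd q))"
 have TT: "T (T' r) = r" "T' (T r) = r" for r using bc(1) unfolding T_def T'_def
  by (auto simp: prod_eq_iff algebra_simps)
 note comp = holo2_compose_linear[OF _ T_def]
 have d: "dx (\<lambda>r. h (T r)) (T' q) \<noteq> 0" "dy (\<lambda>r. h (T r)) (T' q) \<noteq> 0"
  using comp(2,3)[OF h, of "T' q"] bc q unfolding TT by (simp_all add: TT)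
 have "\<exists>N' v. T' q \<in> N' \<and> N' \<subseteq> T -` N \<and> holomorphic2_on v N' \<and> (\<forall>r\<in>N'. g (T r) = h (T r) * v r)"
  by (rule holomorphic2_division_aux[OF comp(1)[OF g] comp(1)[OF h] _ _ d]) (use q TT zeros in auto)
 then obtain N' v where N': "T' q \<in> N'" "N' \<subseteq> T -` N" "holomorphic2_on v N'"
  "\<And>r. r \<in> N' \<Longrightarrow> g (T r) = h (T r) * v r" by blast
 have "holomorphic2_on (\<lambda>r. v (T' r)) (T' -` N')"
  by (rule holo2_compose_linear(1)[OF N'(3) T'_def])
 moreover have "T' -` N' \<subseteq> N"
 proof
  fix r assume "r \<in> T' -` N'"
  then have "T (T' r) \<in> N" using N'(2) by auto
  then show "r \<in> N" by (simp add: TT)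
 qed
 moreover have "g r = h r * v (T' r)" if "r \<in> T' -` N'" for r using N'(4)[of "T' r"] that by (simp add: TT)
 ultimately show thesis using that[of "T' -` N'"] N'(1) by auto
qed

section \<open>Vanishing orders along a curve\<close>

lemma order_along_ge:
 assumes "q \<in> N" "holomorphic2_on g N" "\<And>r. r \<in> N \<Longrightarrow> f r = h r ^ k * g r"
 shows "enat k \<le> order_along q h f"
 unfolding order_along_def by (rule Sup_upper) (use assms in blast)

lemma curve_complement_dense:
 assumes h: "holomorphic2_on h M" "q \<in> M" and nz: "dx h q \<noteq> 0 \<or> dy h q \<noteq> 0"
  and "open N" "q \<in> N"
 obtains r where "r \<in> N" "h r \<noteq> 0"
proof (rule ccontr)
 assume "\<not> thesis"
 then have 0: "h r = 0" if "r \<in> N" for r using that \<open>\<And>r. r \<in> N \<Longrightarrow> h r \<noteq> 0 \<Longrightarrow> thesis\<close> by blast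
 have "holomorphic2_on (\<lambda>_. 0) N" using \<open>open N\<close> by (rule holo2_const)
 from dx_dy_cong[OF this _ \<open>q \<in> N\<close>, of h] 0 nz show False by (simp add: dx_dy_const)
qed

text \<open>The complement of a smooth curve is dense near each of its points. So identities
  obtained by cancelling powers of \<open>h\<close> off the curve persist on it.\<close>

lemma vanishes_by_density:
 fixes f :: "complex \<times> complex \<Rightarrow> complex"
 assumes h: "holomorphic2_on h M" "q \<in> M" and nz: "dx h q \<noteq> 0 \<or> dy h q \<noteq> 0"
  and N: "open N" "q \<in> N" "continuous_on N f" and 0: "\<And>r. r \<in> N \<Longrightarrow> h r \<noteq> 0 \<Longrightarrow> f r = 0"
 shows "f q = 0"
proof (rule ccontr)
 assume "f q \<noteq> 0"
 then have "open {r \<in> N. f r \<noteq> 0}" "q \<in> {r \<in> N. f r \<noteq> 0}" using open_nonzero[OF N(1,3)] N by auto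
 from curve_complement_dense[OF h nz this] 0 show False by blast
qed

text \<open>A higher exponent would, after cancelling \<open>h ^ k\<close> off the curve and passing
  to the limit, force \<open>g q = 0\<close>.\<close>

lemma order_along_eq:
 assumes h: "holomorphic2_on h M" "q \<in> M" "h q = 0" and nz: "dx h q \<noteq> 0 \<or> dy h q \<noteq> 0"
  and g: "q \<in> N" "holomorphic2_on g N" "\<And>r. r \<in> N \<Longrightarrow> f r = h r ^ k * g r" "g q \<noteq> 0"
 shows "order_along q h f = enat k"
proof (rule antisym[OF _ order_along_ge[OF g(1-3)]])
 show "order_along q h f \<le> enat k" unfolding order_along_def
 proof (intro Sup_least; clarsimp)
  fix j N' g' assume N': "q \<in> N'" "holomorphic2_on g' N'" "\<forall>r\<in>N'. f r = h r ^ j * g' r"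
  show "j \<le> k"
  proof (rule ccontr)
  assume j: "\<not> j \<le> k"
  define O' where "O' = M \<inter> N \<inter> N'"
  have O': "open O'" "q \<in> O'" "O' \<subseteq> M" "O' \<subseteq> N" "O' \<subseteq> N'" unfolding O'_def
  using h(2) g(1) N'(1) by (auto intro!: open_Int
  holo2_open[OF h(1)] holo2_open[OF g(2)] holo2_open[OF N'(2)])
  have "holomorphic2_on (\<lambda>r. g r - h r ^ (j - k) * g' r) O'"
  by (intro holo2_diff holo2_mult holo2_power)
  (use O' h g N' in \<open>auto intro: holo2_subset\<close>)
  from holo2_continuous[OF this]
  have "g q - h q ^ (j - k) * g' q = 0"
  proof (rule vanishes_by_density[OF h(1,2) nz O'(1,2)])
  fix r assume r: "r \<in> O'" "h r \<noteq> 0"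
  then have "r \<in> N" "r \<in> N'" using O' by auto
  then have "h r ^ k * g r = h r ^ j * g' r" using g(3)[of r] N'(3) by simp
  moreover have "h r ^ j = h r ^ k * h r ^ (j - k)" using j by (simp flip: power_add)
  ultimately show "g r - h r ^ (j - k) * g' r = 0" using r by auto
  qed
  then show False using h(3) g(4) j by auto
  qed
 qed
qed

section \<open>Normal form of the pencil\<close>

definition bil :: "complex^5^5 \<Rightarrow> complex^5 \<Rightarrow> complex^5 \<Rightarrow> complex" where
 "bil M v w = (\<Sum>i\<in>UNIV. \<Sum>j\<in>UNIV. v $ i * M $ i $ j * w $ j)"

lemma quadratic_form_bil: "quadratic_form M v = bil M v v"
 unfolding quadratic_form_def bil_def ..

lemma bil_add_left: "bil M (v + v') w = bil M v w + bil M v' w"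
 unfolding bil_def by (simp add: sum.distrib algebra_simps)

lemma bil_add_right: "bil M v (w + w') = bil M v w + bil M v w'"
 unfolding bil_def by (simp add: sum.distrib algebra_simps)

lemma bil_scale_left: "bil M (c *s v) w = c * bil M v w"
 unfolding bil_def by (simp add: sum_distrib_left algebra_simps)

lemma bil_scale_right: "bil M v (c *s w) = c * bil M v w"
 unfolding bil_def by (simp add: sum_distrib_left algebra_simps)

lemma bil_zero: "bil M 0 w = 0" "bil M v 0 = 0"
 unfolding bil_def by simp_all

lemma bil_diff_left: "bil M (v - v') w = bil M v w - bil M v' w"
 unfolding bil_def by (simp add: sum_subtractf algebra_simps)

lemma bil_diff_right: "bil M v (w - w') = bil M v w - bil M v w'"
 unfolding bil_def by (simp add: sum_subtractf algebra_simps)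

lemmas bil_simps = bil_add_left bil_add_right bil_scale_left bil_scale_right bil_zero
 bil_diff_left bil_diff_right

lemma bil_commute: "Finite_Cartesian_Product.transpose M = M \<Longrightarrow> bil M v w = bil M w v"
proof -
 assume "Finite_Cartesian_Product.transpose M = M"
 from arg_cong[OF this, of "\<lambda>A. A $ i $ j" for i j] have "M $ i $ j = M $ j $ i" for i j
  by (simp add: Finite_Cartesian_Product.transpose_def)
 then show ?thesis unfolding bil_def
  by (subst sum.swap) (intro sum.cong refl, simp add: ac_simps)
qed

lemma bil_matrix_vector: "bil M v w = (\<Sum>i\<in>UNIV. v $ i * (M *v w) $ i)"
 unfolding bil_def matrix_vector_mult_def by (simp add: sum_distrib_left algebra_simps)

lemma bil_nondegenerate:
 assumes "invertible M" "\<And>v. bil M v w = 0"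
 shows "w = 0"
proof -
 have "(M *v w) $ i = 0" for i
  using assms(2)[of "axis i 1"] unfolding bil_matrix_vector
  by (simp add: axis_def if_distrib[of "\<lambda>x. x * _"] cong: if_cong)
 then have "M *v w = 0" by (simp add: cart_eq_iff)
 then show "w = 0" using assms(1) by (metis invertible_def matrix_left_invertible_ker)
qed

text \<open>For monic \<open>\<Delta>\<close> of degree five this is the sum of the residues of
  \<open>f / \<Delta>\<close> at the roots of \<open>\<Delta>\<close>: the residue functional, whose
  pairing identifies the quotient ring with its dual.\<close>

definition l0 :: "complex poly \<Rightarrow> complex poly \<Rightarrow> complex" where
 "l0 \<Delta> f = coeff (f mod \<Delta>) 4"

lemma l0_add: "l0 \<Delta> (f + g) = l0 \<Delta> f + l0 \<Delta> g"
 unfolding l0_def by (simp add: poly_mod_add_left)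

lemma l0_smult: "l0 \<Delta> (Polynomial.smult c f) = c * l0 \<Delta> f"
 unfolding l0_def by (simp add: mod_smult_left)

lemma l0_diff: "l0 \<Delta> (f - g) = l0 \<Delta> f - l0 \<Delta> g"
 unfolding l0_def by (simp add: poly_mod_diff_left)

lemma l0_zero: "l0 \<Delta> 0 = 0"
 unfolding l0_def by simp

lemma l0_cong: "\<Delta> dvd f - g \<Longrightarrow> l0 \<Delta> f = l0 \<Delta> g"
 unfolding l0_def by (metis mod_eq_dvd_iff)

lemma l0_dvd: "\<Delta> dvd f \<Longrightarrow> l0 \<Delta> f = 0"
 unfolding l0_def by simp

lemma l0_degree_le: "degree f < degree \<Delta> \<Longrightarrow> l0 \<Delta> f = coeff f 4"
 unfolding l0_def by (simp add: mod_poly_less)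

text \<open>In this normal form the module over the polynomial ring given by \<open>Q\<^sup>-\<^sup>1 P\<close> is identified with the
 quotient by \<open>\<Delta>\<close>, the form \<open>Q\<close> being the coefficient of the top degree term of the product.\<close>

locale pencil =
 fixes P Q :: "complex^5^5" and \<Delta> :: "complex poly" and \<phi> :: "complex poly \<Rightarrow> complex^5" and c0 :: complex
 assumes symP: "Finite_Cartesian_Product.transpose P = P"
  and symQ: "Finite_Cartesian_Product.transpose Q = Q"
  and deg\<Delta>: "degree \<Delta> = 5" and monic: "lead_coeff \<Delta> = 1"
  and \<phi>_add: "\<phi> (f + g) = \<phi> f + \<phi> g"
  and \<phi>_smult: "\<phi> (Polynomial.smult c f) = c *s \<phi> f"
  and \<phi>_eq_0: "\<phi> f = 0 \<longleftrightarrow> \<Delta> dvd f"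
  and \<phi>_surj: "\<exists>f. \<phi> f = v"
  and bilQ: "bil Q (\<phi> f) (\<phi> g) = l0 \<Delta> (f * g)"
  and bilP: "bil P (\<phi> f) (\<phi> g) = l0 \<Delta> ([:0, 1:] * (f * g))"
  and c0: "c0 \<noteq> 0"
  and det_pencil: "Determinant.det (to_mat (\<chi> i j. P $ i $ j - \<tau> * Q $ i $ j)) = c0 * poly \<Delta> \<tau>"

subsection \<open>Polynomials in an operator\<close>

text \<open>The module structure over the polynomial ring defined by the operator, evaluated by
  Horner's scheme.\<close>

definition pact :: "(complex^5 \<Rightarrow> complex^5) \<Rightarrow> complex poly \<Rightarrow> complex^5 \<Rightarrow> complex^5" where
 "pact T f v = fold_coeffs (\<lambda>a r. a *s v + T r) f 0"

locale operator =
 fixes T :: "complex^5 \<Rightarrow> complex^5"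
 assumes T_add: "T (v + w) = T v + T w" and T_scale: "T (c *s v) = c *s T v"
begin

lemma T_zero: "T 0 = 0"
 using T_scale[of 0 0] by simp

lemma pact_0: "pact T 0 v = 0"
 unfolding pact_def by simp

lemma pact_pCons: "pact T (pCons a f) v = a *s v + T (pact T f v)"
 unfolding pact_def by (cases "f = 0 \<and> a = 0") (auto simp: T_zero)

lemma pact_add: "pact T (f + g) v = pact T f v + pact T g v"
proof (induction f g rule: poly_induct2)
 case (pCons a f b g)
 then show ?case by (simp add: pact_pCons T_add vector_sadd_rdistrib)
qed (simp add: pact_0)

lemma pact_smult: "pact T (Polynomial.smult c f) v = c *s pact T f v"
 by (induction f) (simp_all add: pact_0 pact_pCons T_scale vector_add_ldistrib)

lemma pact_T: "pact T f (T v) = T (pact T f v)"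
 by (induction f) (simp_all add: pact_0 pact_pCons T_zero T_add T_scale)

lemma pact_mult: "pact T (f * g) v = pact T f (pact T g v)"
 by (induction f) (simp_all add: pact_0 pact_pCons pact_add pact_smult)

lemma pact_add_right: "pact T f (v + w) = pact T f v + pact T f w"
 by (induction f) (simp_all add: pact_0 pact_pCons T_add vector_add_ldistrib)

lemma pact_scale_right: "pact T f (c *s v) = c *s pact T f v"
 by (induction f) (simp_all add: pact_0 pact_pCons T_scale vector_add_ldistrib mult.commute)

lemma pact_zero_right: "pact T f 0 = 0"
 using pact_scale_right[of f 0 0] by simp

lemma pact_sum_right: "pact T f (\<Sum>i\<in>I. g i) = (\<Sum>i\<in>I. pact T f (g i))"
 by (induction I rule: infinite_finite_induct) (auto simp: pact_zero_right pact_add_right)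

lemma pact_dvd: "f dvd g \<Longrightarrow> pact T f v = 0 \<Longrightarrow> pact T g v = 0"
 by (metis dvd_def mult.commute pact_mult pact_zero_right)

lemma pact_eigen: "T v = e *s v \<Longrightarrow> pact T f v = poly f e *s v"
 by (induction f) (simp_all add: pact_0 pact_pCons T_scale vector_sadd_rdistrib mult.commute)

lemma pact_1: "pact T 1 v = v"
 unfolding one_pCons by (simp add: pact_pCons pact_0 T_zero)

text \<open>The sum of vectors \<open>v e\<close> of maximal order in the generalized eigenspaces is a cyclic vector.\<close>

lemma cyclic_vector:
 assumes E: "finite E" "\<And>e. e \<in> E \<Longrightarrow> \<mu> e > 0"
  and v: "\<And>e. e \<in> E \<Longrightarrow> pact T ([:-e, 1:] ^ \<mu> e) (v e) = 0"
  "\<And>e. e \<in> E \<Longrightarrow> pact T ([:-e, 1:] ^ (\<mu> e - 1)) (v e) \<noteq> 0"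
 defines "\<Delta> \<equiv> \<Prod>e\<in>E. [:-e, 1:] ^ \<mu> e"
 shows "pact T f (\<Sum>e\<in>E. v e) = 0 \<longleftrightarrow> \<Delta> dvd f"
proof
 have \<Delta>_split: "\<Delta> = [:-e, 1:] ^ \<mu> e * (\<Prod>e\<in>E - {e}. [:-e, 1:] ^ \<mu> e)" if "e \<in> E" for e
  unfolding \<Delta>_def using E that by (simp add: prod.remove)
 have kill: "pact T f (v e) = 0" if "e \<in> E" "[:-e, 1:] ^ \<mu> e dvd f" for e f
  using pact_dvd[OF that(2) v(1)[OF that(1)]] .
 have \<Delta>0: "\<Delta> \<noteq> 0" unfolding \<Delta>_def using E by auto
 {
  assume d: "\<Delta> dvd f"
  have "pact T \<Delta> (v e) = 0" if "e \<in> E" for e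
  using kill[OF that, of \<Delta>] \<Delta>_split[OF that] by simp
  then have "pact T \<Delta> (\<Sum>e\<in>E. v e) = 0" by (simp add: pact_sum_right)
  then show "pact T f (\<Sum>e\<in>E. v e) = 0" using d pact_dvd by blast
 }
 assume 0: "pact T f (\<Sum>e\<in>E. v e) = 0"
 have \<Delta>w: "pact T \<Delta> (\<Sum>e\<in>E. v e) = 0"
  using kill \<Delta>_split by (simp add: pact_sum_right)
 \<comment> \<open>By Bezout the gcd also annihilates the sum. If it is a proper divisor of
   \<open>\<Delta>\<close>, a linear factor at some \<open>e\<close> is missing, and
   \<open>\<Delta>\<close> divided by this factor is still a multiple of \<open>d\<close>.\<close>
 define d where "d = gcd f \<Delta>"
 obtain a b where ab: "a * f + b * \<Delta> = d" unfolding d_def using bezout_coefficients_fst_snd[of f \<Delta>] by blast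
 have dw: "pact T d (\<Sum>e\<in>E. v e) = 0"
  unfolding ab[symmetric] by (simp add: pact_add pact_mult 0 \<Delta>w pact_zero_right)
 show "\<Delta> dvd f"
 proof (rule ccontr)
  assume n: "\<not> \<Delta> dvd f"
  have "d dvd \<Delta>" unfolding d_def by simp
  then obtain k where k: "\<Delta> = d * k" by (elim dvdE)
  have "degree k \<noteq> 0"
  proof
  assume "degree k = 0"
  then have "is_unit k" using k \<Delta>0 by (auto simp: is_unit_iff_degree)
  then have "\<Delta> dvd d" using k by (simp add: mult_unit_dvd_iff)
  then show False using n unfolding d_def by simp
  qed
  then obtain e where e: "poly k e = 0" using Fundamental_Theorem_Algebra.fundamental_theorem_of_algebra[of k] by (auto simp: constant_degree)
  then obtain k' where k': "k = [:-e, 1:] * k'" by (auto simp: poly_eq_0_iff_dvd elim!: dvdE)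
  have "poly \<Delta> e = 0" using k e by simp
  then have eE: "e \<in> E" unfolding \<Delta>_def by (auto simp: poly_prod E(1))
  define R where "R = (\<Prod>e\<in>E - {e}. [:-e, 1:] ^ \<mu> e)"
  have "[:-e, 1:] * (d * k') = [:-e, 1:] * ([:-e, 1:] ^ (\<mu> e - 1) * R)"
  using \<Delta>_split[OF eE] k k' E(2)[OF eE] unfolding R_def
  by (metis (no_types, lifting) mult.assoc mult.left_commute power_minus_mult mult.commute)
  from mult_left_cancel[THEN iffD1, OF _ this]
  have dk: "d * k' = R * [:-e, 1:] ^ (\<mu> e - 1)" by (simp add: mult.commute)
  have "pact T (d * k') (\<Sum>e\<in>E. v e) = 0" using pact_dvd[of d "d * k'"] dw by simp
  then have "(\<Sum>e'\<in>E. pact T (d * k') (v e')) = 0" by (simp add: pact_sum_right)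
  moreover have "pact T (d * k') (v e') = 0" if "e' \<in> E - {e}" for e'
  by (rule kill) (use that E in \<open>auto simp: dk R_def intro!: dvd_mult2 dvd_prodI\<close>)
  ultimately have "pact T (d * k') (v e) = 0"
  using sum.remove[OF E(1) eE, of "\<lambda>e'. pact T (d * k') (v e')"] by simp
  \<comment> \<open>On the eigenvector \<open>x\<close> the remaining factor \<open>R\<close> acts
    as the nonzero scalar \<open>poly R e\<close>.\<close>
  moreover define x where "x = pact T ([:-e, 1:] ^ (\<mu> e - 1)) (v e)"
  have "pact T [:-e, 1:] x = 0"
  using v(1)[OF eE] E(2)[OF eE] unfolding x_def
  by (metis One_nat_def Suc_pred pact_mult power_Suc)
  then have "T x = e *s x" by (simp add: pact_pCons pact_0 T_zero)
  then have "pact T (d * k') (v e) = poly R e *s x"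
  unfolding dk pact_mult x_def[symmetric] by (rule pact_eigen)
  moreover have "poly R e \<noteq> 0" unfolding R_def using E by (auto simp: poly_prod)
  moreover have "x \<noteq> 0" unfolding x_def using v(2)[OF eE] .
  ultimately show False by simp
 qed
qed

end

subsection \<open>Square roots modulo a polynomial\<close>

lemma complex_quadratic_root: "(A::complex) \<noteq> 0 \<Longrightarrow> \<exists>x. A * x\<^sup>2 + B * x + C = 0"
proof -
 assume A: "A \<noteq> 0"
 define x where "x = (- B + csqrt (B\<^sup>2 - 4 * A * C)) / (2 * A)"
 have "2 * A * x + B = csqrt (B\<^sup>2 - 4 * A * C)" unfolding x_def using A by simp
 then have "(2 * A * x + B)\<^sup>2 = B\<^sup>2 - 4 * A * C" by simp
 moreover have "4 * A * (A * x\<^sup>2 + B * x + C) = (2 * A * x + B)\<^sup>2 - (B\<^sup>2 - 4 * A * C)"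
  by (simp add: power2_eq_square algebra_simps)
 ultimately have "4 * A * (A * x\<^sup>2 + B * x + C) = 0" by simp
 then have "A * x\<^sup>2 + B * x + C = 0" using A by (simp only: mult_eq_0_iff) simp
 then show ?thesis ..
qed

text \<open>Induction on the degree, splitting off one root \<open>a\<close> as in Hensel's lemma. A
  solution \<open>s\<close> modulo the cofactor \<open>p'\<close> is corrected to
  \<open>s + k p'\<close>, and \<open>k\<close> is chosen such that the quotient vanishes at
  \<open>a\<close>. The condition on \<open>k\<close> is linear if \<open>a\<close> is still a root
  of \<open>p'\<close>, and quadratic otherwise.\<close>

lemma inverse_square_root_mod:
 fixes p u :: "complex poly"
 assumes "p \<noteq> 0" "\<And>x. poly p x = 0 \<Longrightarrow> poly u x \<noteq> 0"
 shows "\<exists>s. p dvd s\<^sup>2 * u - 1"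
 using assms
proof (induction "degree p" arbitrary: p rule: less_induct)
 case less
 show ?case
 proof (cases "degree p = 0")
  case True
  then have "is_unit p" using less.prems by (auto simp: is_unit_iff_degree)
  then show ?thesis by (meson unit_imp_dvd)
 next
  case False
  then obtain a where a: "poly p a = 0" using Fundamental_Theorem_Algebra.fundamental_theorem_of_algebra[of p] by (auto simp: constant_degree)
  then obtain p' where p: "p = [:-a, 1:] * p'" by (auto simp: poly_eq_0_iff_dvd elim!: dvdE)
  have p'0: "p' \<noteq> 0" using less.prems p by auto
  then have "degree p' < degree p" unfolding p by (subst degree_mult_eq) auto
  moreover have "poly u x \<noteq> 0" if "poly p' x = 0" for x using less.prems(2)[of x] that unfolding p by simp
  ultimately obtain s where "p' dvd s\<^sup>2 * u - 1" using less.hyps p'0 by blast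
  then obtain r where r: "s\<^sup>2 * u - 1 = p' * r" by (elim dvdE)
  have ua: "poly u a \<noteq> 0" using less.prems(2) a .
  have "\<exists>k. poly r a + 2 * k * poly s a * poly u a + k\<^sup>2 * poly p' a * poly u a = 0"
  proof (cases "poly p' a = 0")
  case True
  have "poly s a ^ 2 * poly u a - 1 = 0" using arg_cong[OF r, of "\<lambda>f. poly f a"] True by simp
  then have "poly s a * poly u a \<noteq> 0" using ua by auto
  then show ?thesis using True by (intro exI[of _ "- poly r a / (2 * (poly s a * poly u a))"]) (simp add: field_simps)
  next
  case False
  then have "poly p' a * poly u a \<noteq> 0" using ua by simp
  from complex_quadratic_root[OF this, of "2 * poly s a * poly u a" "poly r a"] show ?thesis
  by (auto simp: algebra_simps)
  qed
  then obtain k where k: "poly r a + 2 * k * poly s a * poly u a + k\<^sup>2 * poly p' a * poly u a = 0" by blast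
  define c where "c = [:k:]"
  define z where "z = r + 2 * c * s * u + c\<^sup>2 * p' * u"
  have "poly z a = 0" unfolding z_def c_def using k by (simp add: algebra_simps)
  then obtain y where y: "z = [:-a, 1:] * y" by (auto simp: poly_eq_0_iff_dvd elim!: dvdE)
  have "(s + c * p')\<^sup>2 * u - 1 = (s\<^sup>2 * u - 1) + p' * (2 * c * s * u + c\<^sup>2 * p' * u)"
  by (simp add: power2_eq_square algebra_simps)
  also have "\<dots> = p' * z" unfolding r z_def by (simp add: algebra_simps)
  also have "\<dots> = p * y" unfolding y p by (simp only: ac_simps)
  finally show ?thesis by (intro exI[of _ "s + c * p'"]) simp
 qed
qed

subsection \<open>Coordinates for polynomials of degree at most four\<close>

definition pol :: "complex^5 \<Rightarrow> complex poly" where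
 "pol x = [:x $ 1, x $ 2, x $ 3, x $ 4, x $ 5:]"

lemma pol_add: "pol (x + y) = pol x + pol y"
 unfolding pol_def by simp

lemma pol_scale: "pol (c *s x) = Polynomial.smult c (pol x)"
 unfolding pol_def by simp

lemma degree_pol: "degree (pol x) < 5"
 unfolding pol_def by (auto simp: less_Suc_eq_le numeral_eq_Suc intro!: order_trans[OF degree_pCons_le])

lemma pol_eq_0: "pol x = 0 \<longleftrightarrow> x = 0"
 unfolding pol_def by (auto simp: vec5_eq_iff)

lemma pol_surj: "degree f < 5 \<Longrightarrow> \<exists>x. f = pol x"
proof -
 assume f: "degree f < 5"
 define x :: "complex^5" where "x = vector [coeff f 0, coeff f 1, coeff f 2, coeff f 3, coeff f 4]"
 have "coeff f n = coeff (pol x) n" for n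
 proof (cases "n < 5")
  case True
  then have "n = 0 \<or> n = 1 \<or> n = 2 \<or> n = 3 \<or> n = 4" by auto
  then show ?thesis
  unfolding pol_def x_def vector_5 by (elim disjE) (simp_all add: coeff_pCons eval_nat_numeral)
 next
  case False
  then show ?thesis using f degree_pol[of x] by (simp add: coeff_eq_0)
 qed
 then show ?thesis by (intro exI poly_eqI)
qed

lemma linear_injective_surj5:
 fixes f :: "complex^5 \<Rightarrow> complex^5"
 assumes "\<And>x y. f (x + y) = f x + f y" "\<And>c x. f (c *s x) = c *s f x" "\<And>x. f x = 0 \<Longrightarrow> x = 0"
 shows "\<exists>x. f x = y"
proof -
 have l: "Vector_Spaces.linear (*s) (*s) f"
  unfolding Vector_Spaces.linear_iff using assms(1,2) vec.vector_space_axioms by auto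
 have "inj f" using assms(3) vec.linear_inj_iff_eq_0[OF l] by blast
 then have "surj f" using vec.linear_inj_imp_surj[OF l] by blast
 then show ?thesis by (metis surjD)
qed

subsection \<open>Passing to the matrices of the library of Jordan normal forms\<close>

text \<open>In the type \<open>5\<close> the numbers 0 and 5 coincide, so the list of components
  begins with the fifth one. As \<open>to_mat\<close> uses the same order, products of matrices and
  vectors correspond.\<close>

definition cvec :: "complex^5 \<Rightarrow> complex Matrix.vec" where
 "cvec v = Matrix.vec 5 (\<lambda>i. v $ of_nat i)"

lemma of_nat_image_5: "of_nat ` {..<5::nat} = (UNIV :: 5 set)"
proof -
 have "{..<5::nat} = {0, 1, 2, 3, 4}" by auto
 then have "of_nat ` {..<5::nat} = {0::5, 1, 2, 3, 4}" by simp
 moreover have "x \<in> {0::5, 1, 2, 3, 4}" for x using exhaust_5[of x] by auto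
 ultimately show ?thesis by blast
qed

lemma inj_of_nat_5: "inj_on (of_nat :: nat \<Rightarrow> 5) {..<5}"
 by (rule eq_card_imp_inj_on) (simp_all add: of_nat_image_5)

lemma sum_UNIV_5: "(\<Sum>i\<in>(UNIV::5 set). f i) = (\<Sum>i = 0..<5. f (of_nat i))"
 unfolding of_nat_image_5[symmetric] sum.reindex[OF inj_of_nat_5] by (simp add: atLeast0LessThan)

lemma ex_of_nat_5: "\<exists>k<5. i = (of_nat k :: 5)"
 using of_nat_image_5 by (metis UNIV_I imageE lessThan_iff)

lemma cvec_carrier [simp]: "cvec v \<in> carrier_vec 5"
 unfolding cvec_def by simp

lemma cvec_inj: "cvec v = cvec w \<longleftrightarrow> v = w"
proof
 assume eq: "cvec v = cvec w"
 have "v $ i = w $ i" for i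
 proof -
  obtain k where "k < 5" "i = of_nat k" using ex_of_nat_5 by blast
  then show ?thesis using arg_cong[OF eq, of "\<lambda>x. vec_index x k"] unfolding cvec_def by simp
 qed
 then show "v = w" by (simp add: cart_eq_iff)
qed simp

lemma cvec_surj:
 assumes "x \<in> carrier_vec 5"
 obtains v where "x = cvec v"
proof -
 define v where "v = (\<chi> i. vec_index x (inv_into {..<5} of_nat (i::5)))"
 have "x = cvec v"
  by (rule eq_vecI) (use assms in \<open>auto simp: cvec_def v_def inv_into_f_f[OF inj_of_nat_5]\<close>)
 then show thesis by (rule that)
qed

lemma to_mat_carrier [simp]: "to_mat A \<in> carrier_mat 5 5"
 unfolding to_mat_def by simp

lemma to_mat_cvec: "to_mat A *\<^sub>v cvec v = cvec (A *v v)"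
 by (rule eq_vecI)
  (auto simp: to_mat_def cvec_def matrix_vector_mult_def sum_UNIV_5 scalar_prod_def)

lemma to_mat_mult: "to_mat (A ** B) = to_mat A * to_mat B"
 by (rule eq_matI) (auto simp: to_mat_def matrix_matrix_mult_def sum_UNIV_5 scalar_prod_def)

lemma of_nat_5_eq_iff: "i < 5 \<Longrightarrow> j < 5 \<Longrightarrow> (of_nat i :: 5) = of_nat j \<longleftrightarrow> i = j"
 using inj_of_nat_5 by (auto simp: inj_on_def)

lemma to_mat_one: "to_mat (Finite_Cartesian_Product.mat 1) = 1\<^sub>m 5"
 by (rule eq_matI) (auto simp: to_mat_def Finite_Cartesian_Product.mat_def of_nat_5_eq_iff)

lemma det_to_mat_invertible: "invertible Q \<Longrightarrow> Determinant.det (to_mat Q) \<noteq> 0"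
proof -
 assume "invertible Q"
 then obtain R where "Q ** R = Finite_Cartesian_Product.mat 1" unfolding invertible_def by blast
 then have "to_mat Q * to_mat R = 1\<^sub>m 5" by (metis to_mat_mult to_mat_one)
 then have "Determinant.det (to_mat Q) * Determinant.det (to_mat R) = 1"
  using det_mult[OF to_mat_carrier to_mat_carrier, of Q R] by simp
 then show ?thesis by auto
qed

lemma char_matrix_pow_cvec:
 fixes A :: "complex^5^5"
 shows "(char_matrix (to_mat A) e ^\<^sub>m k) *\<^sub>v cvec v = cvec (pact ((*v) A) ([:-e, 1:] ^ k) v)"
proof -
 interpret operator "(*v) A"
  by unfold_locales (simp_all add: matrix_vector_right_distrib vector_scalar_commute)
 have 1: "char_matrix (to_mat A) e *\<^sub>v cvec v = cvec (pact ((*v) A) [:-e, 1:] v)" for v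
 proof -
  have "char_matrix (to_mat A) e = to_mat (\<chi> i j. A $ i $ j - (if i = j then e else 0))"
  unfolding char_matrix_def by (rule eq_matI) (auto simp: to_mat_def of_nat_5_eq_iff)
  moreover have "(\<chi> i j. A $ i $ j - (if i = j then e else 0)) *v v = pact ((*v) A) [:-e, 1:] v"
  by (simp add: pact_pCons pact_0 T_zero cart_eq_iff matrix_vector_mult_def
  left_diff_distrib sum_subtractf if_distrib[of "\<lambda>x. x * _"] cong: if_cong)
  ultimately show ?thesis by (simp add: to_mat_cvec)
 qed
 show ?thesis
 proof (induction k arbitrary: v)
  case (Suc k)
  have C: "char_matrix (to_mat A) e \<in> carrier_mat 5 5" by simp
  have "(char_matrix (to_mat A) e ^\<^sub>m Suc k) *\<^sub>v cvec v =
  (char_matrix (to_mat A) e ^\<^sub>m k) *\<^sub>v (char_matrix (to_mat A) e *\<^sub>v cvec v)"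
  using C by (simp add: assoc_mult_mat_vec[OF pow_carrier_mat[OF C] C])
  then show ?case by (simp add: 1 Suc mult.commute flip: pact_mult)
 qed (simp add: pact_1 char_matrix_def to_mat_def cvec_def)
qed

text \<open>With a single block of size \<open>m\<close> for \<open>e\<close>, the kernel of the
  k-th power of \<open>A - e\<close> has dimension \<open>min k m\<close>. So the kernels of the
  powers \<open>m - 1\<close> and \<open>m\<close> differ, and any vector in the difference will
  do.\<close>

lemma generalized_eigenvector:
 fixes A :: "complex^5^5"
 assumes jnf: "jordan_nf (to_mat A) n_as" and f: "filter (\<lambda>(n, a). a = e) n_as = [(m, e)]" and m: "m > 0"
 shows "\<exists>v. pact ((*v) A) ([:-e, 1:] ^ m) v = 0 \<and> pact ((*v) A) ([:-e, 1:] ^ (m - 1)) v \<noteq> 0"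
proof (rule ccontr)
 assume n: "\<not> ?thesis"
 let ?C = "char_matrix (to_mat A) e"
 interpret operator "(*v) A"
  by unfold_locales (simp_all add: matrix_vector_right_distrib vector_scalar_commute)
 have C: "?C \<in> carrier_mat 5 5" by simp
 have dim: "kernel_dim (?C ^\<^sub>m k) = min k m" for k
  using dim_gen_eigenspace[OF jnf, of e k] f unfolding dim_gen_eigenspace_def by (simp add: case_prod_unfold)
 have ker: "cvec v \<in> mat_kernel (?C ^\<^sub>m k) \<longleftrightarrow> pact ((*v) A) ([:-e, 1:] ^ k) v = 0" for v k
 proof -
  have "0\<^sub>v 5 = cvec 0" by (rule eq_vecI) (auto simp: cvec_def)
  then show ?thesis
  unfolding mat_kernel[OF pow_carrier_mat[OF C]] by (simp add: char_matrix_pow_cvec cvec_inj)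
 qed
 have "mat_kernel (?C ^\<^sub>m m) = mat_kernel (?C ^\<^sub>m (m - 1))"
 proof (intro equalityI subsetI)
  fix x assume x: "x \<in> mat_kernel (?C ^\<^sub>m m)"
  then obtain v where "x = cvec v" using mat_kernelD(1)[OF pow_carrier_mat[OF C]] cvec_surj by blast
  then show "x \<in> mat_kernel (?C ^\<^sub>m (m - 1))" using x n ker by blast
 next
  fix x assume x: "x \<in> mat_kernel (?C ^\<^sub>m (m - 1))"
  then obtain v where v: "x = cvec v" using mat_kernelD(1)[OF pow_carrier_mat[OF C]] cvec_surj by blast
  then have "pact ((*v) A) ([:-e, 1:] ^ m) v = 0"
  using x ker pact_dvd[of "[:-e, 1:] ^ (m - 1)" "[:-e, 1:] ^ m" v] by (simp add: le_imp_power_dvd)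
  then show "x \<in> mat_kernel (?C ^\<^sub>m m)" using v ker by blast
 qed
 moreover have "kernel 5 5 (?C ^\<^sub>m k)" for k by unfold_locales (rule pow_carrier_mat[OF C])
 ultimately have "kernel_dim (?C ^\<^sub>m m) = kernel_dim (?C ^\<^sub>m (m - 1))"
  unfolding kernel_dim_def by (simp add: carrier_matD[OF C] carrier_matD[OF pow_carrier_mat[OF C]])
 then show False unfolding dim using m by simp
qed

text \<open>A symbol without parentheses consists of singletons, which forces exactly one block per
  eigenvalue; hence the block size becomes a function of the eigenvalue.\<close>

lemma segre_symbol_ungrouped:
 assumes "segre_symbol n_as = ungrouped ks" and pos: "0 \<notin> fst ` set n_as"
 obtains \<mu> where "\<And>e. e \<in> snd ` set n_as \<Longrightarrow> filter (\<lambda>(n, a). a = e) n_as = [(\<mu> e, e)]"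
  "\<And>e. e \<in> snd ` set n_as \<Longrightarrow> \<mu> e > 0"
  "mset n_as = image_mset (\<lambda>e. (\<mu> e, e)) (mset_set (snd ` set n_as))"
  "image_mset \<mu> (mset_set (snd ` set n_as)) = mset ks"
proof -
 define E where "E = snd ` set n_as"
 have E: "finite E" unfolding E_def by simp
 have sym: "image_mset (\<lambda>e. image_mset fst (filter_mset (\<lambda>(n, a). a = e) (mset n_as))) (mset_set E)
  = image_mset (\<lambda>k. {#k#}) (mset ks)"
  using assms(1) unfolding segre_symbol_def ungrouped_def E_def .
 have "\<exists>k. image_mset fst (filter_mset (\<lambda>(n, a). a = e) (mset n_as)) = {#k#}" if "e \<in> E" for e
 proof -
  have "image_mset fst (filter_mset (\<lambda>(n, a). a = e) (mset n_as)) \<in>#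
  image_mset (\<lambda>e. image_mset fst (filter_mset (\<lambda>(n, a). a = e) (mset n_as))) (mset_set E)"
  using that E by simp
  then show ?thesis unfolding sym by auto
 qed
 then obtain \<mu> where \<mu>: "\<And>e. e \<in> E \<Longrightarrow> image_mset fst (filter_mset (\<lambda>(n, a). a = e) (mset n_as)) = {#\<mu> e#}"
  by metis
 have fl: "filter (\<lambda>(n, a). a = e) n_as = [(\<mu> e, e)]" if "e \<in> E" for e
 proof -
  have "mset (map fst (filter (\<lambda>(n, a). a = e) n_as)) = mset [\<mu> e]" using \<mu>[OF that] by simp
  then have "map fst (filter (\<lambda>(n, a). a = e) n_as) = [\<mu> e]" by (simp only: mset_single_iff mset.simps)
  then obtain x where x: "filter (\<lambda>(n, a). a = e) n_as = [x]" "fst x = \<mu> e" by auto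
  then have "x \<in> set (filter (\<lambda>(n, a). a = e) n_as)" by simp
  then have "snd x = e" by auto
  then show ?thesis using x by (cases x) auto
 qed
 have pos': "\<mu> e > 0" if "e \<in> E" for e
 proof -
  have "(\<mu> e, e) \<in> set (filter (\<lambda>(n, a). a = e) n_as)" using fl[OF that] by simp
  then have "\<mu> e \<in> fst ` set n_as" by force
  then show ?thesis using pos by (metis gr0I)
 qed
 have "count (mset n_as) (n, a) = count (image_mset (\<lambda>e. (\<mu> e, e)) (mset_set E)) (n, a)" for n a
 proof (cases "a \<in> E")
  case True
  have "count (mset n_as) (n, a) = count (filter_mset (\<lambda>(n, a'). a' = a) (mset n_as)) (n, a)" by simp
  also have "\<dots> = count (mset (filter (\<lambda>(n, a'). a' = a) n_as)) (n, a)" by simp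
  also have "\<dots> = (if n = \<mu> a then 1 else 0)" unfolding fl[OF True] by simp
  also have "\<dots> = count (image_mset (\<lambda>e. (\<mu> e, e)) (mset_set E)) (n, a)"
  proof (cases "n = \<mu> a")
  case True
  have "inj_on (\<lambda>e. (\<mu> e, e)) E" by (auto simp: inj_on_def)
  then have "image_mset (\<lambda>e. (\<mu> e, e)) (mset_set E) = mset_set ((\<lambda>e. (\<mu> e, e)) ` E)"
  by (rule image_mset_mset_set)
  then show ?thesis using True \<open>a \<in> E\<close> E by simp
  next
  case False
  then have "(n, a) \<notin># image_mset (\<lambda>e. (\<mu> e, e)) (mset_set E)" by auto
  then have "count (image_mset (\<lambda>e. (\<mu> e, e)) (mset_set E)) (n, a) = 0"
  by (rule not_in_iff[THEN iffD1])
  then show ?thesis using False by simp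
  qed
  finally show ?thesis .
 next
  case False
  then have "(n, a) \<notin> set n_as" "(n, a) \<notin># image_mset (\<lambda>e. (\<mu> e, e)) (mset_set E)"
  unfolding E_def by force+
  then show ?thesis by (metis count_eq_zero_iff set_mset_mset)
 qed
 then have ms: "mset n_as = image_mset (\<lambda>e. (\<mu> e, e)) (mset_set E)" by (intro multiset_eqI) (metis surj_pair)
 have "image_mset (\<lambda>e. {#\<mu> e#}) (mset_set E) = image_mset (\<lambda>k. {#k#}) (mset ks)"
  unfolding sym[symmetric] using \<mu> E by (intro image_mset_cong) auto
 \<comment> \<open>\<open>sum_mset\<close> unwraps the singletons, so that the multisets of block
   sizes themselves are compared.\<close>
 then have "image_mset sum_mset (image_mset (\<lambda>e. {#\<mu> e#}) (mset_set E)) = image_mset sum_mset (image_mset (\<lambda>k. {#k#}) (mset ks))"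
  by simp
 then have "image_mset \<mu> (mset_set E) = mset ks" by (simp add: image_mset.compositionality o_def)
 with fl pos' ms show thesis unfolding E_def by (intro that) auto
qed

text \<open>The pairing given by \<open>l0\<close> is nondegenerate: a nonzero polynomial of degree
  \<open>d\<close> at most four, multiplied by t^(4 - d), yields its leading coefficient. So the
  five values at monomials depend injectively, hence surjectively, on the five coefficients of the
  representing polynomial.\<close>

lemma l0_represents:
 fixes \<Delta> :: "complex poly" and L0 :: "complex poly \<Rightarrow> complex"
 assumes deg: "degree \<Delta> = 5"
  and add: "\<And>f g. L0 (f + g) = L0 f + L0 g" and scale: "\<And>c f. L0 (Polynomial.smult c f) = c * L0 f"
  and dvd: "\<And>f. \<Delta> dvd f \<Longrightarrow> L0 f = 0"
 obtains u where "\<And>f. L0 f = l0 \<Delta> (u * f)"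
proof -
 define mon where "mon = (\<lambda>n. monom (1::complex) n)"
 define \<Psi> where "\<Psi> = (\<lambda>x. vector [l0 \<Delta> (pol x * mon 0), l0 \<Delta> (pol x * mon 1), l0 \<Delta> (pol x * mon 2),
  l0 \<Delta> (pol x * mon 3), l0 \<Delta> (pol x * mon 4)] :: complex^5)"
 have "\<exists>x. \<Psi> x = vector [L0 (mon 0), L0 (mon 1), L0 (mon 2), L0 (mon 3), L0 (mon 4)]"
 proof (rule linear_injective_surj5)
  show "\<Psi> (x + y) = \<Psi> x + \<Psi> y" for x y unfolding \<Psi>_def
  by (simp add: vec5_eq_iff vector_5 pol_add l0_add distrib_right)
  show "\<Psi> (c *s x) = c *s \<Psi> x" for c x unfolding \<Psi>_def
  by (simp add: vec5_eq_iff vector_5 pol_scale l0_smult)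
  fix x assume "\<Psi> x = 0"
  then have 0: "l0 \<Delta> (pol x * mon n) = 0" if "n < 5" for n
  using that unfolding \<Psi>_def by (auto simp: vec5_eq_iff vector_5 less_Suc_eq numeral_eq_Suc)
  show "x = 0"
  proof (rule ccontr)
  assume "x \<noteq> 0"
  then have nz: "pol x \<noteq> 0" by (simp add: pol_eq_0)
  define d where "d = degree (pol x)"
  have d: "d \<le> 4" unfolding d_def using degree_pol[of x] by simp
  have "degree (pol x * mon (4 - d)) = 4" using nz d
  by (simp add: mon_def degree_mult_eq degree_monom_eq d_def monom_eq_0_iff)
  then have "l0 \<Delta> (pol x * mon (4 - d)) = lead_coeff (pol x * mon (4 - d))"
  using deg by (simp add: l0_degree_le)
  also have "\<dots> \<noteq> 0" using nz by (simp add: mon_def monom_eq_0_iff)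
  finally show False using 0[of "4 - d"] by simp
  qed
 qed
 then obtain x where "\<Psi> x = vector [L0 (mon 0), L0 (mon 1), L0 (mon 2), L0 (mon 3), L0 (mon 4)]" by blast
 then have x: "l0 \<Delta> (pol x * mon n) = L0 (mon n)" if "n < 5" for n
  using that unfolding \<Psi>_def by (auto simp: vec5_eq_iff vector_5 less_Suc_eq numeral_eq_Suc)
 have small: "L0 f = l0 \<Delta> (pol x * f)" if d: "degree f < 5" for f
 proof -
  obtain y where "f = pol y" using pol_surj[OF d] by blast
  moreover have "pol y = Polynomial.smult (y $ 1) (mon 0) + Polynomial.smult (y $ 2) (mon 1) + Polynomial.smult (y $ 3) (mon 2)
  + Polynomial.smult (y $ 4) (mon 3) + Polynomial.smult (y $ 5) (mon 4)"
  unfolding pol_def mon_def by (rule poly_eqI) (auto simp: coeff_pCons numeral_eq_Suc split: nat.split)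
  ultimately show ?thesis using x[of 0] x[of 1] x[of 2] x[of 3] x[of 4]
  by (simp add: add scale l0_add l0_smult distrib_left)
 qed
 have "L0 f = l0 \<Delta> (pol x * f)" for f
 proof -
  have "f = f mod \<Delta> + f div \<Delta> * \<Delta>" by simp
  then have "L0 f = L0 (f mod \<Delta>) + L0 (f div \<Delta> * \<Delta>)" using add by metis
  also have "\<dots> = L0 (f mod \<Delta>)" using dvd[of "f div \<Delta> * \<Delta>"] by simp
  also have "\<dots> = l0 \<Delta> (pol x * (f mod \<Delta>))"
  by (rule small) (use degree_mod_less'[of \<Delta> f] deg in \<open>cases "f mod \<Delta> = 0"; force\<close>)
  also have "\<dots> = l0 \<Delta> (pol x * f)"
  by (rule l0_cong) (simp add: mod_eq_dvd_iff[symmetric] mod_mult_right_eq)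
  finally show ?thesis .
 qed
 then show thesis by (rule that)
qed

text \<open>A cyclic vector \<open>w\<close> of \<open>A = Q^-1 P\<close> identifies the space with
  the quotient ring by \<open>\<Delta>\<close>. Since \<open>A\<close> is self-adjoint for
  \<open>Q\<close>, the form \<open>Q\<close> depends only on the product of two polynomials,
  through a functional \<open>L0 = l0 (u f)\<close>. Nondegeneracy of \<open>Q\<close> makes
  \<open>u\<close> a unit, and replacing \<open>w\<close> by \<open>s w\<close> with
  \<open>s^2 u = 1\<close> removes it.\<close>

lemma pencil_normal_form:
 assumes S: "has_segre_symbol S (ungrouped ks)" and ks: "sum_list ks = 5"
 obtains P Q \<Delta> \<phi> c0 E \<mu> where "pencil P Q \<Delta> \<phi> c0" "S = zero_locus {quadratic_form P, quadratic_form Q}"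
  "finite E" "\<And>e. e \<in> E \<Longrightarrow> \<mu> e > 0" "\<Delta> = (\<Prod>e\<in>E. [:-e, 1:] ^ \<mu> e)"
  "image_mset \<mu> (mset_set E) = mset ks"
proof -
 obtain P Q n_as where symP: "Finite_Cartesian_Product.transpose P = P"
  and symQ: "Finite_Cartesian_Product.transpose Q = Q" and Q: "invertible Q"
  and S_eq: "S = zero_locus {quadratic_form P, quadratic_form Q}"
  and jnf: "jordan_nf (to_mat (matrix_inv Q ** P)) n_as" and sym: "ungrouped ks = segre_symbol n_as"
  using S unfolding has_segre_symbol_def by blast
 define E where "E = snd ` set n_as"
 have E: "finite E" unfolding E_def by simp
 have pos: "0 \<notin> fst ` set n_as" using jnf unfolding jordan_nf_def by blast
 obtain \<mu> where \<mu>: "\<And>e. e \<in> E \<Longrightarrow> filter (\<lambda>(n, a). a = e) n_as = [(\<mu> e, e)]"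
  "\<And>e. e \<in> E \<Longrightarrow> \<mu> e > 0" "mset n_as = image_mset (\<lambda>e. (\<mu> e, e)) (mset_set E)"
  "image_mset \<mu> (mset_set E) = mset ks"
  using segre_symbol_ungrouped[OF sym[symmetric] pos] unfolding E_def by blast
 define A where "A = matrix_inv Q ** P"
 define T where "T = (*v) A"
 have QA: "Q ** A = P"
 proof -
  have "Q ** matrix_inv Q = Finite_Cartesian_Product.mat 1"
  using someI_ex[of "\<lambda>R. Q ** R = Finite_Cartesian_Product.mat 1 \<and> R ** Q = Finite_Cartesian_Product.mat 1"] Q
  unfolding matrix_inv_def invertible_def by blast
  then show ?thesis unfolding A_def by (simp add: matrix_mul_assoc)
 qed
 interpret operator T
  unfolding T_def by unfold_locales (simp_all add: matrix_vector_right_distrib vector_scalar_commute)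
 define \<Delta> where "\<Delta> = (\<Prod>e\<in>E. [:-e, 1:] ^ \<mu> e)"
 have sum\<mu>: "(\<Sum>e\<in>E. \<mu> e) = 5"
  using arg_cong[OF \<mu>(4), of sum_mset] ks by (simp add: sum_unfold_sum_mset sum_mset_sum_list)
 have deg: "degree \<Delta> = 5" unfolding \<Delta>_def
  by (subst degree_prod_eq_sum_degree) (auto simp: degree_power_eq sum\<mu>)
 have lc: "lead_coeff \<Delta> = 1" unfolding \<Delta>_def by (simp add: lead_coeff_prod lead_coeff_power)
 have \<Delta>0: "\<Delta> \<noteq> 0" using deg by auto
 have "\<forall>e\<in>E. \<exists>v. pact T ([:-e, 1:] ^ \<mu> e) v = 0 \<and> pact T ([:-e, 1:] ^ (\<mu> e - 1)) v \<noteq> 0"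
  unfolding T_def using generalized_eigenvector[OF jnf[folded A_def] \<mu>(1) \<mu>(2)] by blast
 then obtain v where v: "\<And>e. e \<in> E \<Longrightarrow> pact T ([:-e, 1:] ^ \<mu> e) (v e) = 0"
  "\<And>e. e \<in> E \<Longrightarrow> pact T ([:-e, 1:] ^ (\<mu> e - 1)) (v e) \<noteq> 0" by metis
 define w where "w = (\<Sum>e\<in>E. v e)"
 have cyc: "pact T f w = 0 \<longleftrightarrow> \<Delta> dvd f" for f
  unfolding w_def \<Delta>_def by (rule cyclic_vector[OF E \<mu>(2) v])
 have surj: "\<exists>f. pact T f w = y" for y
 proof -
  have "\<exists>x. pact T (pol x) w = y"
  proof (rule linear_injective_surj5)
  fix x assume "pact T (pol x) w = 0"
  then have "\<Delta> dvd pol x" by (simp add: cyc)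
  then have "pol x = 0" using degree_pol[of x] deg dvd_imp_degree_le[of \<Delta> "pol x"] by linarith
  then show "x = 0" by (simp add: pol_eq_0)
  qed (simp_all add: pol_add pol_scale pact_add pact_smult)
  then show ?thesis by blast
 qed
 have QT: "bil Q (T x) y = bil P x y" for x y
 proof -
  have "bil Q y (T x) = bil P y x"
  unfolding bil_matrix_vector T_def by (simp add: matrix_vector_mul_assoc QA)
  then show ?thesis using bil_commute[OF symP] bil_commute[OF symQ] by metis
 qed
 have QT': "bil Q (T x) y = bil Q x (T y)" for x y
  using QT bil_commute[OF symP] bil_commute[OF symQ] by metis
 have Qpact: "bil Q (pact T f x) y = bil Q x (pact T f y)" for f x y
 proof (induction f arbitrary: y)
  case (pCons a f)
  then show ?case by (simp add: pact_pCons bil_simps QT' pact_T)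
 qed (simp add: pact_0 bil_zero)
 define L0 where "L0 = (\<lambda>f. bil Q w (pact T f w))"
 have L0: "bil Q (pact T f w) (pact T g w) = L0 (f * g)" for f g
  unfolding L0_def by (simp add: Qpact pact_mult)
 obtain u where u: "\<And>f. L0 f = l0 \<Delta> (u * f)"
 proof (rule l0_represents[OF deg, of L0])
  show "L0 f = 0" if "\<Delta> dvd f" for f using that unfolding L0_def by (simp add: cyc[THEN iffD2] bil_zero)
 qed (simp_all add: L0_def pact_add pact_smult bil_simps)
 \<comment> \<open>If \<open>u\<close> vanished at \<open>e\<close>, the vector belonging to
   \<open>\<Delta> / (t - e)\<close> would be orthogonal to everything with respect to
   \<open>Q\<close>.\<close>
 have unit: "poly u e \<noteq> 0" if e: "poly \<Delta> e = 0" for e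
 proof
  assume "poly u e = 0"
  then obtain u' where u': "u = [:-e, 1:] * u'" by (auto simp: poly_eq_0_iff_dvd elim!: dvdE)
  obtain \<Delta>' where \<Delta>': "\<Delta> = [:-e, 1:] * \<Delta>'" using e by (auto simp: poly_eq_0_iff_dvd elim!: dvdE)
  have "bil Q y (pact T \<Delta>' w) = 0" for y
  proof -
  obtain g where "y = pact T g w" using surj by metis
  then have "bil Q y (pact T \<Delta>' w) = l0 \<Delta> (u * (g * \<Delta>'))" by (simp add: L0 u)
  also have "\<dots> = 0"
  proof (rule l0_dvd, rule dvdI)
  show "u * (g * \<Delta>') = \<Delta> * (u' * g)" unfolding u' \<Delta>' by (simp only: ac_simps)
  qed
  finally show ?thesis .
  qed
  then have "pact T \<Delta>' w = 0" by (rule bil_nondegenerate[OF Q])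
  then have "\<Delta> dvd \<Delta>'" by (simp add: cyc)
  moreover have "\<Delta>' \<noteq> 0" using \<Delta>' \<Delta>0 by auto
  ultimately have "degree \<Delta> \<le> degree \<Delta>'" using dvd_imp_degree_le by blast
  moreover have "degree \<Delta> = 1 + degree \<Delta>'" unfolding \<Delta>' using \<open>\<Delta>' \<noteq> 0\<close> by (subst degree_mult_eq) auto
  ultimately show False by simp
 qed
 obtain s where s: "\<Delta> dvd s\<^sup>2 * u - 1" using inverse_square_root_mod[OF \<Delta>0 unit] by blast
 define \<phi> where "\<phi> = (\<lambda>f. pact T (s * f) w)"
 have "pencil P Q \<Delta> \<phi> (- Determinant.det (to_mat Q))"
 proof
  show "\<phi> f = 0 \<longleftrightarrow> \<Delta> dvd f" for f
  proof -
  have "\<Delta> dvd f" if "\<Delta> dvd s * f"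
  proof -
  have "\<Delta> dvd (s * u) * (s * f) - (s\<^sup>2 * u - 1) * f" using that s by (intro dvd_diff) auto
  then show ?thesis by (simp add: power2_eq_square algebra_simps)
  qed
  then show ?thesis unfolding \<phi>_def cyc by auto
  qed
  show "\<exists>f. \<phi> f = y" for y
  proof -
  obtain g where g: "pact T g w = y" using surj by blast
  have "\<Delta> dvd s * (s * u * g) - g" using dvd_mult2[OF s, of g] by (simp add: power2_eq_square algebra_simps)
  then have "pact T (s * (s * u * g) - g) w = 0" by (simp add: cyc)
  moreover have "pact T (s * (s * u * g)) w = pact T (s * (s * u * g) - g) w + pact T g w"
  by (simp flip: pact_add)
  ultimately show ?thesis unfolding \<phi>_def g by auto
  qed
  have key: "L0 ((s * f) * (s * g)) = l0 \<Delta> (f * g)" for f g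
  unfolding u by (rule l0_cong) (use dvd_mult2[OF s, of "f * g"] in \<open>simp add: power2_eq_square algebra_simps\<close>)
  show "bil Q (\<phi> f) (\<phi> g) = l0 \<Delta> (f * g)" for f g
  unfolding \<phi>_def L0 key ..
  have T\<phi>: "T (\<phi> f) = \<phi> ([:0, 1:] * f)" for f
  unfolding \<phi>_def by (simp add: pact_pCons)
  show "bil P (\<phi> f) (\<phi> g) = l0 \<Delta> ([:0, 1:] * (f * g))" for f g
  unfolding QT[symmetric] T\<phi> unfolding \<phi>_def L0 key by (simp add: mult.assoc)
  show "- Determinant.det (to_mat Q) \<noteq> 0" using det_to_mat_invertible[OF Q] by simp
  fix \<tau>
  define B :: "complex^5^5" where "B = (\<chi> i j. A $ i $ j - (if i = j then \<tau> else 0))"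
  have "(\<chi> i j. P $ i $ j - \<tau> * Q $ i $ j) = Q ** B"
  unfolding B_def QA[symmetric]
  by (simp add: cart_eq_iff matrix_matrix_mult_def right_diff_distrib sum_subtractf
  if_distrib[of "\<lambda>x. _ * x"] mult.commute cong: if_cong)
  then have "Determinant.det (to_mat (\<chi> i j. P $ i $ j - \<tau> * Q $ i $ j)) = Determinant.det (to_mat Q) * Determinant.det (to_mat B)"
  by (simp add: to_mat_mult det_mult[OF to_mat_carrier to_mat_carrier])
  \<comment> \<open>The sign comes from the odd size: the characteristic polynomial is the
    determinant of \<open>\<tau> - A\<close>, whereas \<open>B\<close> is
    \<open>A - \<tau>\<close>.\<close>
  also have "Determinant.det (to_mat B) = - poly (char_poly (to_mat A)) \<tau>"
  proof -
  have "char_matrix (to_mat A) \<tau> = to_mat B"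
  unfolding char_matrix_def B_def by (rule eq_matI) (auto simp: to_mat_def of_nat_5_eq_iff)
  moreover have "- to_mat B = (-1) \<cdot>\<^sub>m to_mat B" by (rule eq_matI) (auto simp: to_mat_def)
  ultimately have "poly (char_poly (to_mat A)) \<tau> = Determinant.det ((-1) \<cdot>\<^sub>m to_mat B)"
  using char_poly_matrix[OF to_mat_carrier, of A \<tau>] by simp
  also have "\<dots> = - Determinant.det (to_mat B)" by (simp add: det_smult to_mat_def)
  finally show ?thesis by simp
  qed
  also have "char_poly (to_mat A) = \<Delta>"
  proof -
  have "char_poly (to_mat A) = prod_mset (image_mset (\<lambda>(n, a). [:- a, 1:] ^ n) (mset n_as))"
  unfolding A_def jordan_nf_char_poly[OF jnf] by (simp flip: prod_mset_prod_list)
  also have "\<dots> = \<Delta>" unfolding \<mu>(3) \<Delta>_def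
  by (simp add: image_mset.compositionality o_def prod_unfold_prod_mset)
  finally show ?thesis .
  qed
  finally show "Determinant.det (to_mat (\<chi> i j. P $ i $ j - \<tau> * Q $ i $ j)) = - Determinant.det (to_mat Q) * poly \<Delta> \<tau>"
  by simp
 qed (use symP symQ deg lc in \<open>auto simp: \<phi>_def distrib_left pact_add pact_smult\<close>)
 then show thesis using that[of P Q \<Delta> \<phi> _ E \<mu>] S_eq E \<mu> \<Delta>_def by blast
qed

section \<open>The surface as a set of square roots\<close>

lemma degree_le_2E:
 assumes "degree (h :: complex poly) \<le> 2"
 obtains a b c where "h = [:c, b, a:]"
proof -
 have "h = [:coeff h 0, coeff h 1, coeff h 2:]"
 proof (rule poly_eqI)
  fix n
  show "coeff h n = coeff [:coeff h 0, coeff h 1, coeff h 2:] n"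
  using assms by (cases "n \<le> 2") (auto simp: coeff_pCons coeff_eq_0 numeral_eq_Suc le_Suc_eq split: nat.split)
 qed
 then show thesis by (rule that)
qed

definition disc :: "complex poly \<Rightarrow> complex" where
 "disc h = (coeff h 1)\<^sup>2 - 4 * coeff h 2 * coeff h 0"

lemma disc_pCons: "disc [:c, b, a:] = b\<^sup>2 - 4 * a * c"
 unfolding disc_def by (simp add: numeral_2_eq_2)

lemma disc_0_square:
 assumes "degree h \<le> 2" "disc h = 0"
 obtains \<alpha> \<beta> where "h = [:\<beta>, \<alpha>:]\<^sup>2"
proof -
 obtain a b c where h: "h = [:c, b, a:]" using degree_le_2E[OF assms(1)] .
 have d: "b\<^sup>2 = 4 * a * c" using assms(2) unfolding h disc_pCons by simp
 show thesis
 \<comment> \<open>With \<open>a = 0\<close> also \<open>b = 0\<close>, and the square root is a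
   constant; linear polynomials are allowed to degenerate.\<close>
 proof (cases "a = 0")
  case True
  then have "b = 0" using d by simp
  have "csqrt c * csqrt c = c" by (simp flip: power2_eq_square)
  then have "h = [:csqrt c, 0:]\<^sup>2" using True \<open>b = 0\<close> h by (simp add: power2_eq_square)
  then show thesis by (rule that)
 next
  case False
  define s where "s = csqrt a"
  have s: "s * s = a" "s \<noteq> 0" using False unfolding s_def by (auto simp flip: power2_eq_square)
  have "(b / (2 * s))\<^sup>2 = c" using d s False by (simp add: power_divide power2_eq_square field_simps)
  moreover have "2 * (b / (2 * s)) * s = b" using s by simp
  ultimately have "h = [:b / (2 * s), s:]\<^sup>2" unfolding h using s
  by (simp add: power2_eq_square)
  then show thesis by (rule that)
 qed
qed

lemma poly_inverse_mod:
 fixes p r :: "complex poly"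
 assumes "p \<noteq> 0" "\<And>x. poly p x = 0 \<Longrightarrow> poly r x \<noteq> 0"
 obtains s where "p dvd r * s - 1"
proof -
 have "\<exists>s. p dvd s\<^sup>2 * r - 1" using inverse_square_root_mod[OF assms] .
 then obtain s where "p dvd s\<^sup>2 * r - 1" by blast
 then have "p dvd r * s\<^sup>2 - 1" by (simp add: mult.commute)
 then show thesis by (rule that)
qed

lemma dvd_cancel_unit:
 fixes p r f :: "complex poly"
 assumes "p \<noteq> 0" "\<And>x. poly p x = 0 \<Longrightarrow> poly r x \<noteq> 0" "p dvd r * f"
 shows "p dvd f"
proof -
 obtain s where s: "p dvd r * s - 1" using poly_inverse_mod[OF assms(1,2)] .
 have "p dvd s * (r * f) - (r * s - 1) * f" by (rule dvd_diff[OF dvd_mult[OF assms(3)] dvd_mult2[OF s]])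
 then show ?thesis by (simp add: algebra_simps)
qed

lemma coprime_mult_dvd:
 fixes p q f :: "complex poly"
 assumes "p \<noteq> 0" "q \<noteq> 0" "\<And>x. poly p x = 0 \<Longrightarrow> poly q x \<noteq> 0" "p dvd f" "q dvd f"
 shows "p * q dvd f"
proof -
 obtain g where g: "f = q * g" using assms(5) by (elim dvdE)
 have "p dvd g" by (rule dvd_cancel_unit[OF assms(1,3)]) (use assms(4) g in auto)
 then show ?thesis unfolding g by (simp add: mult.commute mult_dvd_mono)
qed

lemma root_factorE:
 assumes "poly p a = (0::complex)"
 obtains y where "p = [:-a, 1:] * y"
 using assms that unfolding poly_eq_0_iff_dvd by (elim dvdE)

text \<open>Reduced representatives of the square roots of 1 modulo \<open>m\<close>. Such a root
  amounts to a choice of sign at each distinct root of \<open>m\<close>.\<close>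

definition sqrt1 :: "complex poly \<Rightarrow> complex poly set" where
 "sqrt1 m = {j. degree j < degree m \<and> m dvd j\<^sup>2 - 1}"

lemma sqrt1_eval: "j \<in> sqrt1 m \<Longrightarrow> poly m e = 0 \<Longrightarrow> (poly j e)\<^sup>2 = 1"
proof -
 assume "j \<in> sqrt1 m" "poly m e = 0"
 then obtain k where k: "j\<^sup>2 - 1 = m * k" unfolding sqrt1_def by (auto elim!: dvdE)
 from arg_cong[OF this, of "\<lambda>p. poly p e"] show ?thesis using \<open>poly m e = 0\<close> by simp
qed

text \<open>If two square roots of 1 have the same signs at the roots of \<open>m\<close>, their sum
  is a unit modulo \<open>m\<close>; as it annihilates their difference, they are equal. So
  evaluation at the roots is injective.\<close>

lemma finite_sqrt1:
 shows "finite (sqrt1 m)"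
proof (cases "degree m = 0")
 case False
 then have m: "m \<noteq> 0" by auto
 define Z where "Z = {x. poly m x = 0}"
 have Z: "finite Z" unfolding Z_def using m by (rule poly_roots_finite)
 define ev where "ev = (\<lambda>j :: complex poly. restrict (poly j) Z)"
 have "ev ` sqrt1 m \<subseteq> Z \<rightarrow>\<^sub>E {1, -1}"
 proof clarify
  fix j assume "j \<in> sqrt1 m"
  then obtain k where k: "j\<^sup>2 - 1 = m * k" unfolding sqrt1_def by (auto elim!: dvdE)
  have "(poly j x)\<^sup>2 = 1" if "x \<in> Z" for x
  using arg_cong[OF k, of "\<lambda>f. poly f x"] that unfolding Z_def by simp
  then show "ev j \<in> Z \<rightarrow>\<^sub>E {1, -1}" unfolding ev_def by (auto simp: power2_eq_1_iff)
 qed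
 moreover have "finite (Z \<rightarrow>\<^sub>E {1, - 1 :: complex})" using Z by (intro finite_PiE) auto
 moreover have "inj_on ev (sqrt1 m)"
 proof (rule inj_onI)
  fix j j' assume j: "j \<in> sqrt1 m" "j' \<in> sqrt1 m" and eq: "ev j = ev j'"
  have e: "poly j x = poly j' x" if "poly m x = 0" for x
  using fun_cong[OF eq, of x] that unfolding ev_def Z_def by simp
  have "m dvd (j\<^sup>2 - 1) - (j'\<^sup>2 - 1)" using j unfolding sqrt1_def by (intro dvd_diff[of m "j\<^sup>2 - 1"]) auto
  then have "m dvd (j + j') * (j - j')" by (simp add: power2_eq_square algebra_simps)
  moreover have "poly (j + j') x \<noteq> 0" if x: "poly m x = 0" for x
  proof
  assume "poly (j + j') x = 0"
  then have "poly j x = 0" using e[OF x] by simp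
  then show False using sqrt1_eval[OF j(1) x] by simp
  qed
  ultimately have "m dvd j - j'" using dvd_cancel_unit[OF m] by blast
  moreover have "degree (j - j') < degree m" using j unfolding sqrt1_def by (intro degree_diff_less) auto
  ultimately show "j = j'" using dvd_imp_degree_le[of m "j - j'"] by fastforce
 qed
 ultimately show ?thesis using finite_imageD finite_subset by blast
qed (auto simp: sqrt1_def)

lemma mod_sqrt1:
 fixes m j :: "complex poly"
 assumes "degree m \<noteq> 0" "m dvd j\<^sup>2 - 1"
 shows "j mod m \<in> sqrt1 m"
proof -
 have "m dvd (j mod m)\<^sup>2 - j\<^sup>2"
  by (simp add: mod_eq_dvd_iff[symmetric] power_mod)
 from dvd_add[OF this assms(2)] have "m dvd (j mod m)\<^sup>2 - 1" by simp
 moreover have "degree (j mod m) < degree m" using assms(1)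
  by (cases "j mod m = 0") (auto intro: degree_mod_less')
 ultimately show ?thesis unfolding sqrt1_def by simp
qed

section \<open>The quotient ring as a model of the space, and singular points\<close>

locale pencil_roots = pencil +
 fixes E :: "complex set" and \<mu> :: "complex \<Rightarrow> nat"
 assumes finE: "finite E" and \<mu>_pos: "e \<in> E \<Longrightarrow> \<mu> e > 0"
  and \<Delta>_prod: "\<Delta> = (\<Prod>e\<in>E. [:-e, 1:] ^ \<mu> e)"
begin

lemma \<Delta>_nz: "\<Delta> \<noteq> 0"
 using deg\<Delta> by auto

lemma root_iff: "poly \<Delta> e = 0 \<longleftrightarrow> e \<in> E"
 unfolding \<Delta>_prod using finE \<mu>_pos by (auto simp: poly_prod)

lemma \<Delta>_split:
 assumes "a \<in> E"
 obtains \<Delta>1 where "\<Delta> = [:-a, 1:] ^ \<mu> a * \<Delta>1" "poly \<Delta>1 a \<noteq> 0" "\<Delta>1 \<noteq> 0"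
  "\<And>x. poly \<Delta>1 x = 0 \<Longrightarrow> x \<in> E - {a}"
proof -
 define \<Delta>1 where "\<Delta>1 = (\<Prod>e\<in>E - {a}. [:-e, 1:] ^ \<mu> e)"
 have "\<Delta> = [:-a, 1:] ^ \<mu> a * \<Delta>1" unfolding \<Delta>_prod \<Delta>1_def using finE assms by (simp add: prod.remove)
 moreover have "poly \<Delta>1 a \<noteq> 0" "\<And>x. poly \<Delta>1 x = 0 \<Longrightarrow> x \<in> E - {a}"
  unfolding \<Delta>1_def using finE by (auto simp: poly_prod)
 ultimately show thesis by (intro that[of \<Delta>1]) auto
qed

lemma \<Delta>_dvdI:
 assumes "\<And>e. e \<in> E \<Longrightarrow> [:-e, 1:] ^ \<mu> e dvd f"
 shows "\<Delta> dvd f"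
proof -
 have "(\<Prod>e\<in>F. [:-e, 1:] ^ \<mu> e) dvd f" if "F \<subseteq> E" for F
  using finite_subset[OF that finE] that
 proof (induction F rule: finite_induct)
  case (insert e F)
  have "[:-e, 1:] ^ \<mu> e * (\<Prod>e\<in>F. [:-e, 1:] ^ \<mu> e) dvd f"
  by (rule coprime_mult_dvd) (use insert assms in \<open>auto simp: poly_prod\<close>)
  then show ?case using insert by simp
 qed simp
 from this[of E] show ?thesis unfolding \<Delta>_prod by simp
qed

lemma \<phi>_diff: "\<phi> (f - g) = \<phi> f - \<phi> g"
proof -
 have "\<phi> (f - g) + \<phi> g = \<phi> f" by (simp flip: \<phi>_add)
 then show ?thesis by (simp add: eq_diff_eq)
qed

lemma \<phi>_eq_iff: "\<phi> f = \<phi> g \<longleftrightarrow> \<Delta> dvd f - g"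
 using \<phi>_eq_0[of "f - g"] by (simp add: \<phi>_diff)

lemma l0_nondegenerate: "(\<And>g. l0 \<Delta> (f * g) = 0) \<Longrightarrow> \<Delta> dvd f"
proof (rule ccontr)
 assume 0: "\<And>g. l0 \<Delta> (f * g) = 0" and n: "\<not> \<Delta> dvd f"
 define r where "r = f mod \<Delta>"
 have r: "r \<noteq> 0" "degree r < 5" unfolding r_def using n degree_mod_less'[of \<Delta> f] deg\<Delta> \<Delta>_nz
  by (auto simp: mod_eq_0_iff_dvd)
 define g where "g = monom (1::complex) (4 - degree r)"
 have "degree (r * g) = 4" using r by (simp add: g_def degree_mult_eq degree_monom_eq monom_eq_0_iff)
 then have "l0 \<Delta> (r * g) = lead_coeff (r * g)" using deg\<Delta> by (simp add: l0_degree_le)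
 moreover have "l0 \<Delta> (r * g) = l0 \<Delta> (f * g)" unfolding r_def
  by (rule l0_cong) (simp add: mod_eq_dvd_iff[symmetric] mod_mult_left_eq)
 moreover have "lead_coeff (r * g) \<noteq> 0" using r by (simp add: g_def monom_eq_0_iff)
 ultimately show False using 0[of g] by simp
qed

text \<open>The inverse of \<open>\<phi>\<close> with values in degree below five. Reduction modulo
  \<open>\<Delta>\<close> makes the result independent of the choice, hence linear.\<close>

definition rep :: "complex^5 \<Rightarrow> complex poly" where
 "rep X = (SOME f. \<phi> f = X) mod \<Delta>"

lemma rep_\<phi>: "rep (\<phi> f) = f mod \<Delta>"
proof -
 have "\<phi> (SOME g. \<phi> g = \<phi> f) = \<phi> f" by (rule someI) simp
 then show ?thesis unfolding rep_def \<phi>_eq_iff by (simp add: mod_eq_dvd_iff)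
qed

lemma \<phi>_rep: "\<phi> (rep X) = X"
proof -
 obtain f where f: "\<phi> f = X" using \<phi>_surj by blast
 have "\<Delta> dvd f mod \<Delta> - f" by (simp add: mod_eq_dvd_iff[symmetric])
 then have "\<phi> (f mod \<Delta>) = \<phi> f" by (simp add: \<phi>_eq_iff)
 then show ?thesis using f rep_\<phi> by metis
qed

lemma rep_add: "rep (X + Y) = rep X + rep Y"
proof -
 obtain f g where "\<phi> f = X" "\<phi> g = Y" using \<phi>_surj by blast
 then have "rep (X + Y) = (f + g) mod \<Delta>" "rep X = f mod \<Delta>" "rep Y = g mod \<Delta>"
  by (auto simp: rep_\<phi> simp flip: \<phi>_add)
 then show ?thesis by (simp add: poly_mod_add_left)
qed

lemma rep_scale: "rep (c *s X) = Polynomial.smult c (rep X)"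
proof -
 obtain f where "\<phi> f = X" using \<phi>_surj by blast
 then have "rep (c *s X) = (Polynomial.smult c f) mod \<Delta>" "rep X = f mod \<Delta>"
  by (auto simp: rep_\<phi> simp flip: \<phi>_smult)
 then show ?thesis by (simp add: mod_smult_left)
qed

lemma rep_eq_0: "rep X = 0 \<longleftrightarrow> X = 0"
 by (metis \<phi>_rep \<phi>_eq_0 dvd_0_right rep_\<phi> mod_0)

definition onS :: "complex^5 \<Rightarrow> bool" where
 "onS X \<longleftrightarrow> bil Q X X = 0 \<and> bil P X X = 0"

definition sq :: "complex^5 \<Rightarrow> complex poly" where
 "sq X = (rep X)\<^sup>2 mod \<Delta>"

lemma sq_\<phi>: "sq (\<phi> f) = f\<^sup>2 mod \<Delta>"
 unfolding sq_def rep_\<phi> by (simp add: power_mod)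

lemma degree_sq: "degree (sq X) < 5"
 unfolding sq_def using degree_mod_less'[of \<Delta>] deg\<Delta> \<Delta>_nz by (metis degree_0 zero_less_numeral)

text \<open>For \<open>h = f^2 mod \<Delta>\<close> the value of \<open>Q\<close> is the coefficient
  of t^4. Once this vanishes, multiplication by t needs no further reduction, and the value of
  \<open>P\<close> is the coefficient of t^3.\<close>

lemma onS_iff: "onS X \<longleftrightarrow> degree (sq X) \<le> 2"
proof -
 obtain f where X: "X = \<phi> f" using \<phi>_surj by metis
 define h where "h = sq X"
 have h: "degree h < 5" unfolding h_def by (rule degree_sq)
 have d: "\<Delta> dvd f\<^sup>2 - h" unfolding h_def X sq_\<phi> by (simp add: mod_eq_dvd_iff[symmetric])
 have Q: "bil Q X X = coeff h 4" unfolding X bilQ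
  using l0_cong[OF d] l0_degree_le[of h] h deg\<Delta> by (simp add: power2_eq_square)
 have P: "bil P X X = coeff h 3" if "coeff h 4 = 0"
 proof -
  have h3: "degree h \<le> 3"
  proof (rule degree_le, intro allI impI)
  fix i :: nat assume "3 < i"
  then show "coeff h i = 0" using that h by (cases "i = 4") (auto simp: coeff_eq_0)
  qed
  have "\<Delta> dvd [:0, 1:] * f\<^sup>2 - [:0, 1:] * h" using dvd_mult[OF d, of "[:0, 1:]"] by (simp add: algebra_simps)
  from l0_cong[OF this] have "bil P X X = l0 \<Delta> ([:0, 1:] * h)" unfolding X bilP by (simp add: power2_eq_square)
  also have "\<dots> = coeff ([:0, 1:] * h) 4"
  by (rule l0_degree_le) (use h3 deg\<Delta> degree_mult_le[of "[:0, 1:]" h] in simp)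
  also have "\<dots> = coeff h 3" by (simp add: coeff_pCons eval_nat_numeral)
  finally show ?thesis .
 qed
 show ?thesis
 proof
  assume "onS X"
  then have c: "coeff h 4 = 0" "coeff h 3 = 0" using Q P unfolding onS_def by auto
  show "degree (sq X) \<le> 2" unfolding h_def[symmetric]
  proof (rule degree_le, intro allI impI)
  fix i :: nat assume "2 < i"
  then have "i = 3 \<or> i = 4 \<or> i > 4" by linarith
  then show "coeff h i = 0" using c h by (auto simp: coeff_eq_0)
  qed
 next
  assume "degree (sq X) \<le> 2"
  then show "onS X" unfolding onS_def using Q P unfolding h_def by (simp add: coeff_eq_0)
 qed
qed

lemma onS_\<phi>I:
 assumes "\<Delta> dvd f\<^sup>2 - h" "degree h \<le> 2"
 shows "onS (\<phi> f)" "sq (\<phi> f) = h"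
proof -
 have "f\<^sup>2 mod \<Delta> = h mod \<Delta>" using assms(1) by (simp add: mod_eq_dvd_iff)
 then show "sq (\<phi> f) = h" unfolding sq_\<phi> using assms(2) deg\<Delta> by (simp add: mod_poly_less)
 then show "onS (\<phi> f)" using assms(2) by (simp add: onS_iff)
qed

lemma sq_dvd: "\<Delta> dvd f\<^sup>2 - sq (\<phi> f)"
 unfolding sq_\<phi> by (simp add: mod_eq_dvd_iff[symmetric])

lemma root_eval: "\<Delta> dvd f - g \<Longrightarrow> e \<in> E \<Longrightarrow> poly f e = poly g e"
proof -
 assume "\<Delta> dvd f - g" "e \<in> E"
 then obtain k where "f - g = \<Delta> * k" by (elim dvdE)
 from arg_cong[OF this, of "\<lambda>p. poly p e"] show ?thesis using \<open>e \<in> E\<close> root_iff[of e] by simp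
qed

text \<open>Independence of the differentials of the two quadrics at \<open>X\<close>: the Jacobian
  criterion, formulated for these equations rather than for the whole ideal of the surface.\<close>

definition nonsing :: "complex^5 \<Rightarrow> bool" where
 "nonsing X \<longleftrightarrow> (\<forall>\<alpha> \<beta>. (\<forall>w. \<alpha> * bil Q X w + \<beta> * bil P X w = 0) \<longrightarrow> \<alpha> = 0 \<and> \<beta> = 0)"

lemma nonsing_\<phi>: "nonsing (\<phi> f) \<longleftrightarrow> (\<forall>\<alpha> \<beta>. \<Delta> dvd [:\<alpha>, \<beta>:] * f \<longrightarrow> \<alpha> = 0 \<and> \<beta> = 0)"
proof -
 have "(\<forall>w. \<alpha> * bil Q (\<phi> f) w + \<beta> * bil P (\<phi> f) w = 0) \<longleftrightarrow> \<Delta> dvd [:\<alpha>, \<beta>:] * f" for \<alpha> \<beta>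
 proof -
  have "\<alpha> * bil Q (\<phi> f) (\<phi> g) + \<beta> * bil P (\<phi> f) (\<phi> g) = l0 \<Delta> (([:\<alpha>, \<beta>:] * f) * g)" for g
  proof -
  have "([:\<alpha>, \<beta>:] * f) * g = Polynomial.smult \<alpha> (f * g) + Polynomial.smult \<beta> ([:0, 1:] * (f * g))"
  by (simp add: mult.assoc distrib_right flip: smult_add_right)
  then show ?thesis unfolding bilQ bilP l0_smult[symmetric] l0_add[symmetric] by simp
  qed
  then have "(\<forall>w. \<alpha> * bil Q (\<phi> f) w + \<beta> * bil P (\<phi> f) w = 0) \<longleftrightarrow> (\<forall>g. l0 \<Delta> (([:\<alpha>, \<beta>:] * f) * g) = 0)"
  by (metis \<phi>_surj)
  then show ?thesis using l0_nondegenerate[of "[:\<alpha>, \<beta>:] * f"] l0_dvd[of \<Delta>] dvd_mult2 by blast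
 qed
 then show ?thesis unfolding nonsing_def by blast
qed

text \<open>Its class is an eigenvector of \<open>Q^-1 P\<close> for the eigenvalue
  \<open>a\<close>. The points given by these classes are the candidates for singular
  points.\<close>

definition nn :: "complex \<Rightarrow> complex poly" where
 "nn a = \<Delta> div [:-a, 1:]"

lemma nn: "a \<in> E \<Longrightarrow> [:-a, 1:] * nn a = \<Delta>"
 unfolding nn_def using root_iff[of a] dvd_mult_div_cancel[of "[:-a, 1:]" \<Delta>] poly_eq_0_iff_dvd[of \<Delta> a] by metis

lemma nn_mult: "a \<in> E \<Longrightarrow> \<Delta> dvd nn a * z - Polynomial.smult (poly z a) (nn a)"
proof -
 assume a: "a \<in> E"
 have "poly (z - [:poly z a:]) a = 0" by simp
 then obtain y where "z - [:poly z a:] = [:-a, 1:] * y" by (elim root_factorE)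
 then have "nn a * (z - [:poly z a:]) = ([:-a, 1:] * nn a) * y" by (simp only: ac_simps)
 then have "nn a * (z - [:poly z a:]) = \<Delta> * y" unfolding nn[OF a] .
 moreover have "nn a * (z - [:poly z a:]) = nn a * z - Polynomial.smult (poly z a) (nn a)"
  by (simp add: algebra_simps)
 ultimately show ?thesis by (metis dvd_triv_left)
qed

lemma degree_nn: "a \<in> E \<Longrightarrow> degree (nn a) = 4"
proof -
 assume a: "a \<in> E"
 have "nn a \<noteq> 0" using nn[OF a] \<Delta>_nz by auto
 then have "degree \<Delta> = 1 + degree (nn a)" by (subst nn[OF a, symmetric], subst degree_mult_eq) auto
 then show ?thesis using deg\<Delta> by simp
qed

lemma nn_not_dvd: "a \<in> E \<Longrightarrow> \<not> \<Delta> dvd nn a"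
 using degree_nn dvd_imp_degree_le[of \<Delta> "nn a"] deg\<Delta> by fastforce

text \<open>A dependence of the differentials says that a linear polynomial annihilates the class of
  \<open>f\<close>. As \<open>f\<close> is not zero, this polynomial is not a unit, so it is a
  multiple of \<open>t - a\<close> for a root \<open>a\<close>, and the annihilator of
  \<open>t - a\<close> is spanned by \<open>nn a\<close>.\<close>

lemma sing_imp_nn:
 assumes "\<not> nonsing X" "X \<noteq> 0"
 obtains a c where "a \<in> E" "X = c *s \<phi> (nn a)"
proof -
 obtain f where X: "X = \<phi> f" using \<phi>_surj by metis
 have nd: "\<not> \<Delta> dvd f" using assms(2) unfolding X by (simp add: \<phi>_eq_0)
 obtain \<alpha> \<beta> where ab: "\<Delta> dvd [:\<alpha>, \<beta>:] * f" "\<alpha> \<noteq> 0 \<or> \<beta> \<noteq> 0" using assms(1) unfolding X nonsing_\<phi> by auto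
 obtain a where a: "poly \<Delta> a = 0" "poly [:\<alpha>, \<beta>:] a = 0" using dvd_cancel_unit[OF \<Delta>_nz _ ab(1)] nd by blast
 then have b: "\<beta> \<noteq> 0" "\<alpha> = - (a * \<beta>)" using ab(2) by (auto simp: eq_neg_iff_add_eq_0)
 have aE: "a \<in> E" using a root_iff by blast
 have "[:\<alpha>, \<beta>:] = [:\<beta>:] * [:-a, 1:]" using b by (simp add: mult.commute)
 then have "\<Delta> dvd [:\<beta>:] * ([:-a, 1:] * f)" using ab(1) by (simp only: mult.assoc)
 then have "\<Delta> dvd [:-a, 1:] * f" by (rule dvd_cancel_unit[OF \<Delta>_nz, rotated]) (use b(1) in simp)
 then have "[:-a, 1:] * nn a dvd [:-a, 1:] * f" using nn[OF aE] by simp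
 then have "nn a dvd f" by (subst (asm) dvd_times_left_cancel_iff) auto
 then obtain z where "f = nn a * z" by (elim dvdE)
 then have "\<phi> f = poly z a *s \<phi> (nn a)" using nn_mult[OF aE, of z] by (simp add: \<phi>_eq_iff flip: \<phi>_smult)
 then show thesis using that[OF aE] unfolding X by blast
qed

subsection \<open>The lines on the surface\<close>

text \<open>For a multiple root \<open>a\<close> its class spans, together with that of
  \<open>nn a\<close>, the kernel of \<open>(t - a)^2\<close>. It is also the modulus left after
  cancelling \<open>(t - a)^2\<close> in an equation of squares.\<close>

definition N2 :: "complex \<Rightarrow> complex poly" where
 "N2 a = \<Delta> div [:-a, 1:]\<^sup>2"

lemma N2: "a \<in> E \<Longrightarrow> \<mu> a \<ge> 2 \<Longrightarrow> [:-a, 1:]\<^sup>2 * N2 a = \<Delta>"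
proof -
 assume a: "a \<in> E" "\<mu> a \<ge> 2"
 obtain \<Delta>1 where \<Delta>1: "\<Delta> = [:-a, 1:] ^ \<mu> a * \<Delta>1" using \<Delta>_split[OF a(1)] by blast
 have "[:-a, 1:]\<^sup>2 dvd \<Delta>" by (subst \<Delta>1) (rule dvd_mult2[OF le_imp_power_dvd[OF a(2)]])
 then show ?thesis unfolding N2_def by (rule dvd_mult_div_cancel)
qed

lemma N2_nn: "a \<in> E \<Longrightarrow> \<mu> a \<ge> 2 \<Longrightarrow> nn a = [:-a, 1:] * N2 a"
proof -
 assume a: "a \<in> E" "\<mu> a \<ge> 2"
 have "[:-a, 1:] * nn a = \<Delta>" by (rule nn[OF a(1)])
 also have "\<Delta> = [:-a, 1:] * ([:-a, 1:] * N2 a)"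
  using N2[OF a] by (simp only: power2_eq_square mult.assoc)
 finally show ?thesis by (subst (asm) mult_left_cancel) auto
qed

lemma degree_N2: "a \<in> E \<Longrightarrow> \<mu> a \<ge> 2 \<Longrightarrow> degree (N2 a) = 3"
proof -
 assume a: "a \<in> E" "\<mu> a \<ge> 2"
 have "N2 a \<noteq> 0" using N2[OF a] \<Delta>_nz by auto
 then have "degree (nn a) = 1 + degree (N2 a)" unfolding N2_nn[OF a] by (subst degree_mult_eq) auto
 then show ?thesis using degree_nn[OF a(1)] by simp
qed

text \<open>The products \<open>r j\<close> with \<open>r\<close> of degree at most one; for a
  square root \<open>j\<close> of 1 they satisfy \<open>(r j)^2 = r^2\<close>, which is of degree at
  most two.\<close>

definition line0 :: "complex poly \<Rightarrow> 5 proj set" where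
 "line0 j = join (\<phi> j) (\<phi> ([:0, 1:] * j))"

text \<open>The multiples \<open>(t - a) (\<alpha> j + \<beta> N2 a)\<close>. If \<open>j\<close> is
  a square root of 1 modulo \<open>N2 a\<close>, their squares are
  \<open>\<alpha>^2 (t - a)^2\<close>. All these lines pass through the point of
  \<open>nn a\<close>.\<close>

definition line2 :: "complex \<Rightarrow> complex poly \<Rightarrow> 5 proj set" where
 "line2 a j = join (\<phi> ([:-a, 1:] * j)) (\<phi> (nn a))"

lemma indep2_\<phi>:
 assumes "\<And>\<alpha> \<beta>. \<Delta> dvd Polynomial.smult \<alpha> f + Polynomial.smult \<beta> g \<Longrightarrow> \<alpha> = 0 \<and> \<beta> = 0"
 shows "indep2 (\<phi> f) (\<phi> g)"
 unfolding indep2_def using assms by (simp flip: \<phi>_smult \<phi>_add add: \<phi>_eq_0)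

lemma comb_\<phi>: "\<alpha> *s \<phi> f + \<beta> *s \<phi> g = \<phi> (Polynomial.smult \<alpha> f + Polynomial.smult \<beta> g)"
 by (simp add: \<phi>_add \<phi>_smult)

lemma line0_indep: "j \<in> sqrt1 \<Delta> \<Longrightarrow> indep2 (\<phi> j) (\<phi> ([:0, 1:] * j))"
proof (rule indep2_\<phi>)
 fix \<alpha> \<beta> assume j: "j \<in> sqrt1 \<Delta>" and "\<Delta> dvd Polynomial.smult \<alpha> j + Polynomial.smult \<beta> ([:0, 1:] * j)"
 moreover have "Polynomial.smult \<alpha> j + Polynomial.smult \<beta> ([:0, 1:] * j) = j * [:\<alpha>, \<beta>:]" by simp
 ultimately have "\<Delta> dvd j * [:\<alpha>, \<beta>:]" by simp
 moreover have "poly j x \<noteq> 0" if "poly \<Delta> x = 0" for x using sqrt1_eval[OF j that] by auto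
 ultimately have d: "\<Delta> dvd [:\<alpha>, \<beta>:]" using dvd_cancel_unit[OF \<Delta>_nz, of j] by blast
 have "degree [:\<alpha>, \<beta>:] < degree \<Delta>" using deg\<Delta> by simp
 then have "[:\<alpha>, \<beta>:] = 0" using dvd_imp_degree_le[OF d] by linarith
 then show "\<alpha> = 0 \<and> \<beta> = 0" by simp
qed

lemma line2_sq:
 assumes a: "a \<in> E" "\<mu> a \<ge> 2" and j: "j \<in> sqrt1 (N2 a)"
 shows "onS (\<alpha> *s \<phi> ([:-a, 1:] * j) + \<beta> *s \<phi> (nn a))"
  "sq (\<alpha> *s \<phi> ([:-a, 1:] * j) + \<beta> *s \<phi> (nn a)) = Polynomial.smult (\<alpha>\<^sup>2) ([:-a, 1:]\<^sup>2)"
proof -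
 obtain k where k: "j\<^sup>2 - 1 = N2 a * k" using j unfolding sqrt1_def by (auto elim!: dvdE)
 define s where "s = [:-a, 1:]"
 define A where "A = [:\<alpha>:]" define B where "B = [:\<beta>:]"
 have "(A * (s * j) + B * nn a)\<^sup>2 - A\<^sup>2 * s\<^sup>2 = A\<^sup>2 * s\<^sup>2 * (j\<^sup>2 - 1) + 2 * A * B * j * (s * nn a) + B\<^sup>2 * nn a * nn a"
  by (simp add: power2_eq_square algebra_simps)
 also have "\<dots> = \<Delta> * (A\<^sup>2 * k + 2 * A * B * j + B\<^sup>2 * N2 a)"
 proof -
  have N: "s\<^sup>2 * N2 a = \<Delta>" using N2[OF a] unfolding s_def .
  have "s\<^sup>2 * (j\<^sup>2 - 1) = (s\<^sup>2 * N2 a) * k" unfolding k by (simp only: ac_simps)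
  then have 1: "s\<^sup>2 * (j\<^sup>2 - 1) = \<Delta> * k" unfolding N .
  have 2: "s * nn a = \<Delta>" using nn[OF a(1)] unfolding s_def .
  have "nn a * nn a = (s\<^sup>2 * N2 a) * N2 a"
  unfolding N2_nn[OF a] s_def by (simp only: power2_eq_square ac_simps)
  then have 3: "nn a * nn a = \<Delta> * N2 a" unfolding N .
  have "A\<^sup>2 * s\<^sup>2 * (j\<^sup>2 - 1) + 2 * A * B * j * (s * nn a) + B\<^sup>2 * nn a * nn a =
  A\<^sup>2 * (s\<^sup>2 * (j\<^sup>2 - 1)) + 2 * A * B * j * (s * nn a) + B\<^sup>2 * (nn a * nn a)" by (simp only: mult.assoc)
  also have "\<dots> = \<Delta> * (A\<^sup>2 * k + 2 * A * B * j + B\<^sup>2 * N2 a)"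
  unfolding 1 2 3 by (simp add: distrib_left mult.assoc mult.left_commute)
  finally show ?thesis .
 qed
 finally have "(A * (s * j) + B * nn a)\<^sup>2 - A\<^sup>2 * s\<^sup>2 = \<Delta> * (A\<^sup>2 * k + 2 * A * B * j + B\<^sup>2 * N2 a)" .
 then have d: "\<Delta> dvd (Polynomial.smult \<alpha> ([:-a, 1:] * j) + Polynomial.smult \<beta> (nn a))\<^sup>2 - Polynomial.smult (\<alpha>\<^sup>2) ([:-a, 1:]\<^sup>2)"
 proof -
  have "Polynomial.smult \<alpha> ([:-a, 1:] * j) = A * (s * j)" "Polynomial.smult \<beta> (nn a) = B * nn a"
  "Polynomial.smult (\<alpha>\<^sup>2) ([:-a, 1:]\<^sup>2) = A\<^sup>2 * s\<^sup>2"
  unfolding A_def B_def s_def by (simp_all add: power2_eq_square mult.assoc)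
  with \<open>(A * (s * j) + B * nn a)\<^sup>2 - A\<^sup>2 * s\<^sup>2 = \<Delta> * (A\<^sup>2 * k + 2 * A * B * j + B\<^sup>2 * N2 a)\<close>
  show ?thesis by (simp only: dvd_triv_left)
 qed
 have "degree (Polynomial.smult (\<alpha>\<^sup>2) ([:-a, 1:]\<^sup>2)) \<le> 2"
  by (rule order_trans[OF degree_smult_le]) (simp add: power2_eq_square)
 from onS_\<phi>I[OF d this] show "onS (\<alpha> *s \<phi> ([:-a, 1:] * j) + \<beta> *s \<phi> (nn a))"
  "sq (\<alpha> *s \<phi> ([:-a, 1:] * j) + \<beta> *s \<phi> (nn a)) = Polynomial.smult (\<alpha>\<^sup>2) ([:-a, 1:]\<^sup>2)" unfolding comb_\<phi> by auto
qed

lemma line2_indep: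
 assumes a: "a \<in> E" "\<mu> a \<ge> 2" and j: "j \<in> sqrt1 (N2 a)"
 shows "indep2 (\<phi> ([:-a, 1:] * j)) (\<phi> (nn a))"
 unfolding indep2_def
proof (intro allI impI)
 fix \<alpha> \<beta> assume 0: "\<alpha> *s \<phi> ([:-a, 1:] * j) + \<beta> *s \<phi> (nn a) = 0"
 have "sq 0 = 0" unfolding sq_def using rep_eq_0[of 0] by simp
 then have "Polynomial.smult (\<alpha>\<^sup>2) ([:-a, 1:]\<^sup>2) = 0" using line2_sq(2)[OF a j, of \<alpha> \<beta>] 0 by simp
 then have \<alpha>: "\<alpha> = 0" by simp
 moreover have "\<phi> (nn a) \<noteq> 0" using nn_not_dvd[OF a(1)] by (simp add: \<phi>_eq_0)
 ultimately show "\<alpha> = 0 \<and> \<beta> = 0" using 0 by simp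
qed

definition nilp :: "(complex^5) set" where
 "nilp = {X. sq X = 0}"

text \<open>A quadratic remainder with zero discriminant is a square \<open>r^2\<close>. If
  \<open>r\<close> is a unit, \<open>f / r\<close> is a square root of 1. Otherwise
  \<open>r = \<alpha> (t - a)\<close> and \<open>t - a\<close> divides \<open>f\<close>; the
  cofactor squares to \<open>\<alpha>^2\<close> only modulo what remains of \<open>\<Delta>\<close>
  after cancelling. At a simple root this can be repaired, at a multiple root the remaining freedom
  is the parameter of \<open>line2\<close>.\<close>

lemma disc_zero_cases:
 assumes X: "onS X" "disc (sq X) = 0" "X \<noteq> 0"
 obtains (nil) "X \<in> nilp"
 | (line0) j where "j \<in> sqrt1 \<Delta>" "pt X \<in> line0 j"
 | (line2) a j where "a \<in> E" "\<mu> a \<ge> 2" "j \<in> sqrt1 (N2 a)" "pt X \<in> line2 a j"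
proof (cases "sq X = 0")
 case True
 then show thesis using nil unfolding nilp_def by simp
next
 case nz: False
 obtain f where Xf: "X = \<phi> f" using \<phi>_surj by metis
 obtain \<alpha> \<beta> where r: "sq X = [:\<beta>, \<alpha>:]\<^sup>2"
  using disc_0_square[of "sq X"] X unfolding onS_iff by blast
 define r where "r = [:\<beta>, \<alpha>:]"
 have f2: "\<Delta> dvd f\<^sup>2 - r\<^sup>2" using sq_dvd[of f] unfolding Xf[symmetric] r r_def .
 have on0: thesis if j: "\<Delta> dvd j\<^sup>2 - 1" "\<Delta> dvd f - r * j" for j
 proof -
  define j' where "j' = j mod \<Delta>"
  have j': "j' \<in> sqrt1 \<Delta>" unfolding j'_def using mod_sqrt1 deg\<Delta> j(1) by simp
  have "\<Delta> dvd j - j'" unfolding j'_def by (simp add: mod_eq_dvd_iff[symmetric])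
  then have "\<Delta> dvd (f - r * j) + r * (j - j')" using j(2) by (intro dvd_add dvd_mult)
  then have "\<Delta> dvd f - r * j'" by (simp add: algebra_simps)
  then have "\<Delta> dvd f - (Polynomial.smult \<beta> j' + Polynomial.smult \<alpha> ([:0, 1:] * j'))" unfolding r_def by simp
  then have "X = \<beta> *s \<phi> j' + \<alpha> *s \<phi> ([:0, 1:] * j')" unfolding comb_\<phi> Xf \<phi>_eq_iff .
  then have "pt X \<in> line0 j'" unfolding line0_def using mem_join[OF X(3)] by blast
  then show thesis using line0 j' by blast
 qed
 show thesis
 proof (cases "\<exists>a\<in>E. poly r a = 0")
  case False
  then have unit: "poly r e \<noteq> 0" if "poly \<Delta> e = 0" for e using that root_iff by blast
  obtain s where s: "\<Delta> dvd r * s - 1" using poly_inverse_mod[OF \<Delta>_nz unit] .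
  show thesis
  proof (rule on0[of "f * s"])
  have "\<Delta> dvd (f\<^sup>2 - r\<^sup>2) * s\<^sup>2 + (r * s - 1) * (r * s + 1)"
  by (rule dvd_add[OF dvd_mult2[OF f2] dvd_mult2[OF s]])
  then show "\<Delta> dvd (f * s)\<^sup>2 - 1" by (simp add: power2_eq_square algebra_simps)
  have "\<Delta> dvd (- f) * (r * s - 1)" using s by (rule dvd_mult)
  then show "\<Delta> dvd f - r * (f * s)" by (simp add: algebra_simps)
  qed
 next
  case True
  then obtain a where a: "a \<in> E" "\<beta> = - (a * \<alpha>)" unfolding r_def by (auto simp: eq_neg_iff_add_eq_0)
  have \<alpha>: "\<alpha> \<noteq> 0" using nz unfolding r a(2) by auto
  define s where "s = [:-a, 1:]"
  define A where "A = [:\<alpha>:]"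
  define B where "B = [:1 / \<alpha>:]"
  have AB: "A * B = 1" unfolding A_def B_def using \<alpha> by (simp add: one_pCons)
  have rs: "r = A * s" unfolding r_def a(2) s_def A_def by simp
  have sa: "poly s a = 0" "\<And>x. x \<noteq> a \<Longrightarrow> poly s x \<noteq> 0" "s \<noteq> 0" unfolding s_def by auto
  have "poly (f\<^sup>2) a = poly (r\<^sup>2) a" by (rule root_eval[OF f2 a(1)])
  then have "poly f a = 0" using sa(1) unfolding rs by simp
  then obtain f' where f': "f = s * f'" unfolding s_def by (elim root_factorE)
  have d2: "\<Delta> dvd s\<^sup>2 * (f'\<^sup>2 - A\<^sup>2)" using f2 unfolding rs f' by (simp add: power_mult_distrib algebra_simps)
  have scale: "m dvd (B * g)\<^sup>2 - 1" if "m dvd g\<^sup>2 - A\<^sup>2" for m g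
  proof -
  have "m dvd B\<^sup>2 * (g\<^sup>2 - A\<^sup>2)" using that by (rule dvd_mult)
  also have "B\<^sup>2 * (g\<^sup>2 - A\<^sup>2) = (B * g)\<^sup>2 - (A * B)\<^sup>2"
  by (simp add: power_mult_distrib algebra_simps)
  finally show ?thesis unfolding AB by simp
  qed
  have unscale: "A * (B * g) = g" for g using AB by (simp add: mult.assoc[symmetric])
  obtain \<Delta>1 where \<Delta>1: "\<Delta> = s ^ \<mu> a * \<Delta>1" "poly \<Delta>1 a \<noteq> 0" "\<Delta>1 \<noteq> 0"
  by (rule \<Delta>_split[OF a(1)]) (simp add: s_def)
  show thesis
  proof (cases "\<mu> a \<ge> 2")
  case False
  then have "\<mu> a = 1" using \<mu>_pos[OF a(1)] by linarith
  then have m1: "\<Delta> = s * \<Delta>1" using \<Delta>1(1) by simp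
  have "\<Delta>1 dvd s\<^sup>2 * (f'\<^sup>2 - A\<^sup>2)" using d2 unfolding m1 by (rule dvd_mult_right)
  then have d1: "\<Delta>1 dvd f'\<^sup>2 - A\<^sup>2"
  proof (rule dvd_cancel_unit[OF \<Delta>1(3), rotated])
  show "poly (s\<^sup>2) x \<noteq> 0" if "poly \<Delta>1 x = 0" for x
  using sa(2)[of x] that \<Delta>1(2) by (cases "x = a") auto
  qed
  \<comment> \<open>A multiple of \<open>\<Delta>1\<close> does not change the class of
    \<open>s * f'\<close>, so it can be used to give the cofactor the value \<open>\<alpha>\<close>
    at \<open>a\<close>.\<close>
  define k where "k = [:(\<alpha> - poly f' a) / poly \<Delta>1 a:]"
  define g where "g = f' + k * \<Delta>1"
  have ga: "poly g a = \<alpha>" unfolding g_def k_def using \<Delta>1(2) by simp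
  have "\<Delta>1 dvd (f'\<^sup>2 - A\<^sup>2) + \<Delta>1 * (2 * f' * k + k\<^sup>2 * \<Delta>1)" by (rule dvd_add[OF d1]) simp
  also have "(f'\<^sup>2 - A\<^sup>2) + \<Delta>1 * (2 * f' * k + k\<^sup>2 * \<Delta>1) = g\<^sup>2 - A\<^sup>2"
  unfolding g_def by (simp add: power2_eq_square algebra_simps)
  finally have "\<Delta>1 dvd g\<^sup>2 - A\<^sup>2" .
  moreover have "poly (g\<^sup>2 - A\<^sup>2) a = 0" using ga unfolding A_def by simp
  then have "s dvd g\<^sup>2 - A\<^sup>2" unfolding s_def poly_eq_0_iff_dvd .
  moreover have "poly \<Delta>1 x \<noteq> 0" if "poly s x = 0" for x
  using sa(2)[of x] that \<Delta>1(2) by (cases "x = a") auto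
  ultimately have dg: "\<Delta> dvd g\<^sup>2 - A\<^sup>2" unfolding m1
  by (intro coprime_mult_dvd sa(3) \<Delta>1(3))
  show thesis
  proof (rule on0[of "B * g"])
  show "\<Delta> dvd (B * g)\<^sup>2 - 1" using dg by (rule scale)
  have "f - r * (B * g) = s * f' - s * (A * (B * g))" unfolding rs f' by (simp only: ac_simps)
  also have "\<dots> = \<Delta> * (- k)" unfolding unscale g_def m1 by (simp add: algebra_simps)
  finally show "\<Delta> dvd f - r * (B * g)" by simp
  qed
  next
  case m2: True
  have N: "s\<^sup>2 * N2 a = \<Delta>" using N2[OF a(1) m2] unfolding s_def .
  have "s\<^sup>2 * N2 a dvd s\<^sup>2 * (f'\<^sup>2 - A\<^sup>2)" using d2 unfolding N .
  then have d: "N2 a dvd f'\<^sup>2 - A\<^sup>2" by (subst (asm) dvd_times_left_cancel_iff) (auto simp: sa)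
  define j where "j = (B * f') mod N2 a"
  have j: "j \<in> sqrt1 (N2 a)" unfolding j_def
  by (rule mod_sqrt1[OF _ scale[OF d]]) (use degree_N2[OF a(1) m2] in simp)
  have "N2 a dvd B * f' - j" unfolding j_def by (simp add: mod_eq_dvd_iff[symmetric])
  then obtain z where z: "B * f' - j = N2 a * z" by (elim dvdE)
  have "f' = A * (B * f')" by (simp only: unscale)
  also have "B * f' = j + N2 a * z" using z by (simp add: eq_diff_eq diff_eq_eq add.commute)
  finally have "f = s * (A * (j + N2 a * z))" unfolding f' by simp
  also have "\<dots> = A * (s * j) + nn a * (A * z)" unfolding N2_nn[OF a(1) m2] s_def[symmetric]
  by (simp only: distrib_left ac_simps)
  finally have "f - (Polynomial.smult \<alpha> (s * j) + Polynomial.smult (poly (A * z) a) (nn a))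
  = nn a * (A * z) - Polynomial.smult (poly (A * z) a) (nn a)" unfolding A_def by simp
  then have "\<Delta> dvd f - (Polynomial.smult \<alpha> (s * j) + Polynomial.smult (poly (A * z) a) (nn a))"
  using nn_mult[OF a(1), of "A * z"] by (simp only:)
  then have "X = \<alpha> *s \<phi> (s * j) + poly (A * z) a *s \<phi> (nn a)" unfolding comb_\<phi> Xf \<phi>_eq_iff .
  then have "pt X \<in> line2 a j" unfolding line2_def s_def using mem_join[OF X(3)] by blast
  then show thesis using line2 a(1) m2 j by blast
  qed
 qed
qed

end

section \<open>The discriminant vanishes along lines of the surface\<close>

lemma quadratic_proportional:
 fixes h g k :: "complex poly"
 assumes h: "degree h \<le> 2" "disc h \<noteq> 0" and g: "degree g \<le> 2" and k: "degree k \<le> 2" and eq: "g\<^sup>2 = h * k"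
 obtains \<kappa> where "g = [:\<kappa>:] * h"
proof -
 obtain a b c where habc: "h = [:c, b, a:]" using degree_le_2E[OF h(1)] .
 obtain p q r where gpqr: "g = [:r, q, p:]" using degree_le_2E[OF g] .
 have D: "b\<^sup>2 - 4 * a * c \<noteq> 0" using h(2) unfolding habc disc_pCons .
 have root: "poly g x = 0" if "poly h x = 0" for x
  using arg_cong[OF eq, of "\<lambda>f. poly f x"] that by simp
 show thesis
 \<comment> \<open>A nonzero discriminant means two distinct roots on the projective line, both
   shared by \<open>g\<close>. For \<open>a = 0\<close> one of them is infinity, where sharing it
   means that \<open>g\<close> has no quadratic term.\<close>
 proof (cases "a = 0")
  case False
  define d where "d = csqrt (b\<^sup>2 - 4 * a * c)"
  have d: "d\<^sup>2 = b\<^sup>2 - 4 * a * c" "d \<noteq> 0" unfolding d_def using D by auto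
  have hr: "poly h x = 0" if x: "2 * a * x + b = e" "e\<^sup>2 = d\<^sup>2" for x e
  proof -
  have "4 * a * (a * x\<^sup>2 + b * x + c) = (2 * a * x + b)\<^sup>2 - (b\<^sup>2 - 4 * a * c)"
  by (simp add: power2_eq_square algebra_simps)
  also have "\<dots> = 0" using x d by simp
  finally have "a * x\<^sup>2 + b * x + c = 0" using False by simp
  then show ?thesis unfolding habc by (simp add: power2_eq_square algebra_simps)
  qed
  define x y where "x = (d - b) / (2 * a)" and "y = (- d - b) / (2 * a)"
  have "poly h x = 0" "poly h y = 0"
  by (rule hr[of _ d]; use False in \<open>simp add: x_def\<close>) (rule hr[of _ "- d"]; use False in \<open>simp add: y_def\<close>)
  then have gr: "poly g x = 0" "poly g y = 0" using root by auto
  have xy: "x \<noteq> y" unfolding x_def y_def using d False by (auto simp: field_simps)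
  define \<kappa> where "\<kappa> = p / a"
  define u v where "u = r - \<kappa> * c" and "v = q - \<kappa> * b"
  have "g - [:\<kappa>:] * h = [:u, v:]" unfolding gpqr habc u_def v_def \<kappa>_def using False by simp
  then have uv: "poly [:u, v:] x = 0" "poly [:u, v:] y = 0"
  using gr \<open>poly h x = 0\<close> \<open>poly h y = 0\<close> by (metis (no_types, lifting) diff_zero mult_zero_right poly_diff poly_mult)+
  have "v * (x - y) = poly [:u, v:] x - poly [:u, v:] y" by (simp add: algebra_simps)
  then have "v * (x - y) = 0" unfolding uv by simp
  then have "v = 0" "u = 0" using xy uv by auto
  then have "g = [:\<kappa>:] * h" using \<open>g - [:\<kappa>:] * h = [:u, v:]\<close> by simp
  then show thesis by (rule that)
 next
  case True
  then have b: "b \<noteq> 0" using D by auto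
  obtain a' b' c' where k': "k = [:c', b', a':]" using degree_le_2E[OF k] .
  have "p\<^sup>2 = 0" using arg_cong[OF eq, of "\<lambda>f. coeff f 4"] True
  unfolding gpqr habc k' by (simp add: power2_eq_square coeff_pCons eval_nat_numeral)
  then have p: "p = 0" by simp
  have "poly h (- c / b) = 0" unfolding habc using True b by simp
  then have "poly g (- c / b) = 0" by (rule root)
  then have "r = q * c / b" unfolding gpqr using p by (simp add: algebra_simps)
  then have "g = [:q / b:] * h" unfolding gpqr habc using True p b by simp
  then show thesis by (rule that)
 qed
qed

context pencil_roots
begin

lemma sq_add:
 obtains h where "\<Delta> dvd rep X * rep Y - h" "degree h < 5"
  "\<And>\<alpha> \<beta>. sq (\<alpha> *s X + \<beta> *s Y) = Polynomial.smult (\<alpha>\<^sup>2) (sq X) + Polynomial.smult (2 * \<alpha> * \<beta>) h + Polynomial.smult (\<beta>\<^sup>2) (sq Y)"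
proof (rule that[of "rep X * rep Y mod \<Delta>"])
 show "\<Delta> dvd rep X * rep Y - rep X * rep Y mod \<Delta>" by simp
 show "degree (rep X * rep Y mod \<Delta>) < 5" using degree_mod_less'[of \<Delta>] deg\<Delta> \<Delta>_nz by (metis degree_0 zero_less_numeral)
 fix \<alpha> \<beta>
 have "(rep (\<alpha> *s X + \<beta> *s Y))\<^sup>2 = Polynomial.smult (\<alpha>\<^sup>2) ((rep X)\<^sup>2) + Polynomial.smult (2 * \<alpha> * \<beta>) (rep X * rep Y) + Polynomial.smult (\<beta>\<^sup>2) ((rep Y)\<^sup>2)"
 proof -
  define A B where "A = [:\<alpha>:]" and "B = [:\<beta>:]"
  have "Polynomial.smult \<alpha> p = A * p" "Polynomial.smult \<beta> p = B * p" "Polynomial.smult (\<alpha>\<^sup>2) p = A\<^sup>2 * p"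
  "Polynomial.smult (\<beta>\<^sup>2) p = B\<^sup>2 * p" "Polynomial.smult (2 * \<alpha> * \<beta>) p = 2 * A * B * p" for p
  unfolding A_def B_def by (simp_all add: power2_eq_square numeral_poly mult.commute)
  then show ?thesis unfolding rep_add rep_scale by (simp only: power2_eq_square) (simp add: algebra_simps)
 qed
 then show "sq (\<alpha> *s X + \<beta> *s Y) = Polynomial.smult (\<alpha>\<^sup>2) (sq X) + Polynomial.smult (2 * \<alpha> * \<beta>) (rep X * rep Y mod \<Delta>) + Polynomial.smult (\<beta>\<^sup>2) (sq Y)"
  unfolding sq_def by (simp add: poly_mod_add_left mod_smult_left)
qed

text \<open>Suppose that \<open>h = f1^2\<close> had distinct roots. The products
  \<open>f1 f2\<close> and \<open>f2^2\<close> are of degree at most two as well, and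
  \<open>g^2 = h k\<close> forces them to be proportional to \<open>h\<close>. Then some nonzero
  combination \<open>f3\<close> of \<open>f1\<close>, \<open>f2\<close> has square zero and is
  annihilated by \<open>f1\<close>. At a root where \<open>f3\<close> is not zero, \<open>f1\<close>
  vanishes: a simple root contradicts \<open>f3^2 = 0\<close>, and a multiple one makes
  \<open>h\<close> a multiple of \<open>(t - e)^2\<close>.\<close>

lemma line_disc_aux:
 assumes on: "\<And>\<alpha> \<beta>. onS (\<alpha> *s X + \<beta> *s Y)" and i: "indep2 X Y"
 shows "disc (sq X) = 0"
proof (rule ccontr)
 assume D: "disc (sq X) \<noteq> 0"
 obtain g where g: "\<Delta> dvd rep X * rep Y - g" "degree g < 5"
  "\<And>\<alpha> \<beta>. sq (\<alpha> *s X + \<beta> *s Y) = Polynomial.smult (\<alpha>\<^sup>2) (sq X) + Polynomial.smult (2 * \<alpha> * \<beta>) g + Polynomial.smult (\<beta>\<^sup>2) (sq Y)"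
  using sq_add[of X Y] by blast
 define h k where "h = sq X" and "k = sq Y"
 have h: "degree h \<le> 2" and k: "degree k \<le> 2"
  using on[of 1 0] on[of 0 1] unfolding onS_iff h_def k_def by auto
 have "sq (1 *s X + 1 *s Y) - h - k = Polynomial.smult 2 g" unfolding g(3) h_def k_def by simp
 moreover have "degree (sq (1 *s X + 1 *s Y) - h - k) \<le> 2"
  using on[of 1 1] h k unfolding onS_iff by (intro degree_diff_le) auto
 ultimately have gd: "degree g \<le> 2" by simp
 define f1 f2 where "f1 = rep X" and "f2 = rep Y"
 have d: "\<Delta> dvd f1\<^sup>2 - h" "\<Delta> dvd f2\<^sup>2 - k" "\<Delta> dvd f1 * f2 - g"
  using sq_dvd[of f1] sq_dvd[of f2] g(1) unfolding f1_def f2_def h_def k_def \<phi>_rep by auto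
 have "\<Delta> dvd (f1\<^sup>2 - h) * f2\<^sup>2 + h * (f2\<^sup>2 - k) - (f1 * f2 - g) * (f1 * f2 + g)"
  by (intro dvd_diff[OF dvd_add[OF dvd_mult2 dvd_mult] dvd_mult2] d)
 then have dd: "\<Delta> dvd g\<^sup>2 - h * k" by (simp add: power2_eq_square algebra_simps)
 have "degree (g\<^sup>2 - h * k) \<le> 4"
 proof (rule degree_diff_le)
  show "degree (g\<^sup>2) \<le> 4" using gd by (simp add: power2_eq_square order_trans[OF degree_mult_le])
  show "degree (h * k) \<le> 4" using h k by (simp add: order_trans[OF degree_mult_le])
 qed
 \<comment> \<open>Both sides have degree at most four, so the congruence modulo
   \<open>\<Delta>\<close> is an equality.\<close>
 then have "g\<^sup>2 = h * k" using dvd_imp_degree_le[OF dd] deg\<Delta> by fastforce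
 then obtain \<kappa> where \<kappa>: "g = [:\<kappa>:] * h"
  using quadratic_proportional[OF h D[folded h_def] gd k] by blast
 define K where "K = [:\<kappa>:]"
 have h0: "h \<noteq> 0" using D unfolding h_def[symmetric] disc_def by auto
 have "h * k = (K * h)\<^sup>2" using \<open>g\<^sup>2 = h * k\<close> unfolding \<kappa> K_def[symmetric] by (rule sym)
 also have "\<dots> = h * (K\<^sup>2 * h)" by (simp add: power2_eq_square algebra_simps)
 finally have "h * k = h * (K\<^sup>2 * h)" .
 from mult_left_cancel[THEN iffD1, OF h0 this] have k2: "k = K\<^sup>2 * h" .
 define f3 where "f3 = f2 - K * f1"
 have gK: "g = K * h" using \<kappa> unfolding K_def .
 have d13: "\<Delta> dvd f1 * f3"
 proof -
  have "\<Delta> dvd (f1 * f2 - g) - K * (f1\<^sup>2 - h)" by (intro dvd_diff[OF _ dvd_mult] d)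
  then show ?thesis unfolding f3_def gK by (simp add: power2_eq_square algebra_simps)
 qed
 have d33: "\<Delta> dvd f3\<^sup>2"
 proof -
  have "\<Delta> dvd (f2\<^sup>2 - k) + (K\<^sup>2 * (f1\<^sup>2 - h) - 2 * K * (f1 * f2 - g))"
  by (intro dvd_add[OF _ dvd_diff[OF dvd_mult dvd_mult]] d)
  then show ?thesis unfolding f3_def gK k2 by (simp add: power2_eq_square algebra_simps)
 qed
 have "\<not> \<Delta> dvd f3"
 proof
  assume "\<Delta> dvd f3"
  then have "\<phi> (f2 - K * f1) = 0" unfolding f3_def by (simp add: \<phi>_eq_0)
  then have "Y - \<kappa> *s X = 0" unfolding \<phi>_diff f1_def f2_def K_def by (simp add: \<phi>_smult \<phi>_rep)
  then have "(-\<kappa>) *s X + 1 *s Y = 0" by simp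
  with i show False unfolding indep2_def by fastforce
 qed
 then obtain e where e: "e \<in> E" "\<not> [:-e, 1:] ^ \<mu> e dvd f3" using \<Delta>_dvdI by blast
 define s where "s = [:-e, 1:]"
 have s: "s ^ \<mu> e dvd \<Delta>" using \<Delta>_split[OF e(1)] unfolding s_def by (metis dvd_triv_left)
 have sroot: "x = e" if "poly (s ^ n) x = 0" for x n using that unfolding s_def by (auto simp: poly_power)
 have snz: "s ^ n \<noteq> 0" for n unfolding s_def by simp
 have f1e: "poly f1 e = 0"
 proof (rule ccontr)
  assume "poly f1 e \<noteq> 0"
  then have "s ^ \<mu> e dvd f3" using dvd_cancel_unit[OF snz _ dvd_trans[OF s d13]] sroot by blast
  then show False using e(2) unfolding s_def by simp
 qed
 show False
 proof (cases "\<mu> e \<ge> 2")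
  case True
  then have s2: "s\<^sup>2 dvd \<Delta>" using dvd_trans[OF le_imp_power_dvd s] by blast
  obtain y where y: "f1 = s * y" using f1e unfolding s_def by (elim root_factorE)
  have "s\<^sup>2 dvd f1\<^sup>2" unfolding y by (simp add: power_mult_distrib)
  from dvd_diff[OF this dvd_trans[OF s2 d(1)]] have "s\<^sup>2 dvd h" by simp
  then obtain z where z: "h = s\<^sup>2 * z" by (elim dvdE)
  then have "z \<noteq> 0" using h0 by auto
  then have "degree h = 2 + degree z" unfolding z s_def by (subst degree_mult_eq) (auto simp: degree_power_eq)
  then have "degree z = 0" using h by simp
  then obtain w where "z = [:w:]" by (rule degree_eq_zeroE)
  then have "h = [:w * e\<^sup>2, - 2 * w * e, w:]" unfolding z s_def by (simp add: power2_eq_square algebra_simps)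
  then have "disc h = 0" by (simp add: disc_pCons power2_eq_square algebra_simps)
  then show False using D unfolding h_def by simp
 next
  case False
  then have "\<mu> e = 1" using \<mu>_pos[OF e(1)] by linarith
  then have "s dvd f3\<^sup>2" using dvd_trans[OF s d33] by simp
  then have "poly (f3\<^sup>2) e = 0" unfolding s_def poly_eq_0_iff_dvd .
  then have "s dvd f3" unfolding s_def poly_eq_0_iff_dvd[symmetric] by simp
  then show False using e(2) \<open>\<mu> e = 1\<close> unfolding s_def by simp
 qed
qed

lemma sq_0: "sq 0 = 0"
 unfolding sq_def using rep_eq_0[of 0] by simp

lemma line_disc:
 assumes on: "\<And>\<alpha> \<beta>. onS (\<alpha> *s X + \<beta> *s Y)" and i: "indep2 X Y"
 shows "disc (sq (\<alpha> *s X + \<beta> *s Y)) = 0"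
proof (cases "\<alpha> *s X + \<beta> *s Y = 0")
 case True
 then show ?thesis by (simp add: sq_0 disc_def)
next
 case False
 define Z where "Z = \<alpha> *s X + \<beta> *s Y"
 obtain W where W: "indep2 Z W" "W = X \<or> W = Y" using join_other[OF i Z_def] False unfolding Z_def by metis
 have "disc (sq Z) = 0"
 proof (rule line_disc_aux[OF _ W(1)])
  fix x y
  have "x *s Z + y *s W = (x * \<alpha> + y) *s X + (x * \<beta>) *s Y \<or> x *s Z + y *s W = (x * \<alpha>) *s X + (x * \<beta> + y) *s Y"
  using W(2) unfolding Z_def by (auto simp: vector_add_ldistrib vector_sadd_rdistrib)
  then show "onS (x *s Z + y *s W)" using on by metis
 qed
 then show ?thesis unfolding Z_def .
qed

subsection \<open>Elements of square zero\<close>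

text \<open>The kinds sort the symbols by their elements of square zero: [11111], [1112], [113] for
  \<open>kind1\<close>, [122], [23] for \<open>kind2\<close>, and [14], [5] for
  \<open>kind3\<close>. These elements give at most a point in the first case and a line in the
  other two.\<close>

definition kind1 :: bool where
 "kind1 \<longleftrightarrow> (\<forall>e\<in>E. \<mu> e \<le> 3) \<and> (\<forall>a\<in>E. \<forall>b\<in>E. \<mu> a \<ge> 2 \<and> \<mu> b \<ge> 2 \<longrightarrow> a = b)"

definition kind2 :: "complex \<Rightarrow> complex \<Rightarrow> bool" where
 "kind2 a b \<longleftrightarrow> a \<in> E \<and> b \<in> E \<and> a \<noteq> b \<and> (\<mu> a = 2 \<or> \<mu> a = 3) \<and> (\<mu> b = 2 \<or> \<mu> b = 3) \<and> (\<forall>e\<in>E - {a, b}. \<mu> e = 1)"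

definition kind3 :: "complex \<Rightarrow> bool" where
 "kind3 a \<longleftrightarrow> a \<in> E \<and> (\<mu> a = 4 \<or> \<mu> a = 5) \<and> (\<forall>e\<in>E - {a}. \<mu> e = 1)"

abbreviation known_kind :: bool where
 "known_kind \<equiv> kind1 \<or> (\<exists>a b. kind2 a b) \<or> (\<exists>a. kind3 a)"

lemma nilp_\<phi>: "\<phi> f \<in> nilp \<longleftrightarrow> \<Delta> dvd f\<^sup>2"
 unfolding nilp_def by (simp add: sq_\<phi> mod_eq_0_iff_dvd)

text \<open>The order of \<open>f\<close> at \<open>e\<close> is at least half of
  \<open>\<mu> e\<close>; the added 1 in the hypothesis rounds this half up.\<close>

lemma nil_dvd:
 assumes "\<Delta> dvd f\<^sup>2" "e \<in> E" "2 * n \<le> \<mu> e + 1"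
 shows "[:-e, 1:] ^ n dvd f"
proof (cases "f = 0")
 case False
 have "[:-e, 1:] ^ \<mu> e dvd f\<^sup>2" using \<Delta>_split[OF assms(2)] assms(1) by (metis dvd_mult_left)
 then have "\<mu> e \<le> Polynomial.order e (f\<^sup>2)" using False by (simp add: order_divides)
 also have "\<dots> = 2 * Polynomial.order e f" using False by (simp add: power2_eq_square order_mult)
 finally have "n \<le> Polynomial.order e f" using assms(3) by linarith
 then show ?thesis by (simp add: order_divides)
qed simp

lemma nn_multiple:
 assumes "a \<in> E" "\<Delta> dvd [:-a, 1:] * f"
 obtains c where "\<phi> f = c *s \<phi> (nn a)"
proof -
 have "[:-a, 1:] * nn a dvd [:-a, 1:] * f" using nn[OF assms(1)] assms(2) by simp
 then have "nn a dvd f" by (subst (asm) dvd_times_left_cancel_iff) auto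
 then obtain z where "f = nn a * z" by (elim dvdE)
 then have "\<phi> f = poly z a *s \<phi> (nn a)" using nn_mult[OF assms(1), of z] by (simp add: \<phi>_eq_iff flip: \<phi>_smult)
 then show thesis by (rule that)
qed

text \<open>Half of 2 or 3, rounded up, is \<open>\<mu> a - 1\<close>. So \<open>t - a\<close>
  annihilates the element, which is then a multiple of \<open>nn a\<close>.\<close>

lemma nilp_kind1:
 assumes k: "kind1" and X: "X \<in> nilp" "X \<noteq> 0"
 obtains a c where "a \<in> E" "\<mu> a \<ge> 2" "X = c *s \<phi> (nn a)"
proof -
 obtain f where f: "X = \<phi> f" using \<phi>_surj by metis
 have d: "\<Delta> dvd f\<^sup>2" using X(1) unfolding f nilp_\<phi> .
 have simple: "[:-e, 1:] ^ \<mu> e dvd f" if "e \<in> E" "\<mu> e = 1" for e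
  using nil_dvd[OF d that(1), of 1] that(2) by simp
 have "\<not> \<Delta> dvd f" using X(2) unfolding f by (simp add: \<phi>_eq_0)
 then obtain a where a: "a \<in> E" "\<not> [:-a, 1:] ^ \<mu> a dvd f" using \<Delta>_dvdI by blast
 then have m: "\<mu> a \<ge> 2" "\<mu> a \<le> 3" using simple[OF a(1)] \<mu>_pos[OF a(1)] k unfolding kind1_def by (cases "\<mu> a = 1"; force)+
 have "\<Delta> dvd [:-a, 1:] * f"
 proof (rule \<Delta>_dvdI)
  fix e assume e: "e \<in> E"
  show "[:-e, 1:] ^ \<mu> e dvd [:-a, 1:] * f"
  proof (cases "e = a")
  case True
  have "[:-a, 1:] ^ (\<mu> a - 1) dvd f" by (rule nil_dvd[OF d a(1)]) (use m in linarith)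
  then have "[:-a, 1:] * [:-a, 1:] ^ (\<mu> a - 1) dvd [:-a, 1:] * f" by (rule mult_dvd_mono[OF dvd_refl])
  then show ?thesis using True m by (metis One_nat_def Suc_pred \<mu>_pos e power_Suc)
  next
  case False
  then have "\<not> \<mu> e \<ge> 2" using k m(1) a(1) e unfolding kind1_def by blast
  then have "\<mu> e = 1" using \<mu>_pos[OF e] by linarith
  then show ?thesis using simple[OF e] dvd_mult by blast
  qed
 qed
 then obtain c where "\<phi> f = c *s \<phi> (nn a)" using nn_multiple[OF a(1)] by blast
 then show thesis using that a(1) m(1) f by blast
qed

lemma two_factor:
 assumes "kind2 a b"
 obtains M where "nn a = [:-b, 1:] * M" "nn b = [:-a, 1:] * M" "[:-a, 1:] * [:-b, 1:] * M = \<Delta>"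
proof -
 have ab: "a \<in> E" "b \<in> E" "a \<noteq> b" using assms unfolding kind2_def by auto
 have "poly ([:-a, 1:] * nn a) b = 0" using nn[OF ab(1)] root_iff[of b] ab(2) by simp
 then have "poly (nn a) b = 0" using ab(3) by simp
 then obtain M where M: "nn a = [:-b, 1:] * M" by (elim root_factorE)
 have D: "[:-a, 1:] * [:-b, 1:] * M = \<Delta>" using nn[OF ab(1)] unfolding M by (simp only: mult.assoc)
 have "[:-b, 1:] * nn b = [:-b, 1:] * ([:-a, 1:] * M)" using nn[OF ab(2)] D by (simp only: ac_simps)
 then have "nn b = [:-a, 1:] * M" by (subst (asm) mult_left_cancel) auto
 with M D show thesis using that by blast
qed

lemma nilp_kind2:
 assumes k: "kind2 a b" and X: "X \<in> nilp"
 obtains \<alpha> \<beta> where "X = \<alpha> *s \<phi> (nn a) + \<beta> *s \<phi> (nn b)"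
proof -
 obtain f where f: "X = \<phi> f" using \<phi>_surj by metis
 have d: "\<Delta> dvd f\<^sup>2" using X(1) unfolding f nilp_\<phi> .
 have ab: "a \<in> E" "b \<in> E" "a \<noteq> b" "\<mu> a = 2 \<or> \<mu> a = 3" "\<mu> b = 2 \<or> \<mu> b = 3" using k unfolding kind2_def by auto
 define s r where "s = [:-a, 1:]" and "r = [:-b, 1:]"
 obtain M where M: "nn a = r * M" "nn b = s * M" "s * r * M = \<Delta>" using two_factor[OF k] unfolding s_def r_def .
 have half: "s ^ (\<mu> a - 1) dvd f" "r ^ (\<mu> b - 1) dvd f"
  unfolding s_def r_def by (rule nil_dvd[OF d]; use ab in auto)+
 have "\<Delta> dvd (s * r) * f"
 proof (rule \<Delta>_dvdI)
  fix e assume e: "e \<in> E"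
  consider "e = a" | "e = b" | "e \<noteq> a" "e \<noteq> b" by blast
  then show "[:-e, 1:] ^ \<mu> e dvd (s * r) * f"
  proof cases
  case 1
  have "s * s ^ (\<mu> a - 1) dvd (s * r) * f" using mult_dvd_mono[OF dvd_triv_left half(1)] .
  moreover have "s * s ^ (\<mu> a - 1) = s ^ \<mu> a" using ab(4) by (metis One_nat_def Suc_pred \<mu>_pos ab(1) power_Suc)
  ultimately show ?thesis using 1 unfolding s_def by simp
  next
  case 2
  have "r * r ^ (\<mu> b - 1) dvd (s * r) * f" using mult_dvd_mono[OF dvd_triv_right half(2)] .
  moreover have "r * r ^ (\<mu> b - 1) = r ^ \<mu> b" using ab(5) by (metis One_nat_def Suc_pred \<mu>_pos ab(2) power_Suc)
  ultimately show ?thesis using 2 unfolding r_def by simp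
  next
  case 3
  then have "\<mu> e = 1" using k e unfolding kind2_def by blast
  then show ?thesis using nil_dvd[OF d e, of 1] by (simp add: dvd_mult)
  qed
 qed
 then have "(s * r) * M dvd (s * r) * f" unfolding M(3) .
 then have "M dvd f" by (subst (asm) dvd_times_left_cancel_iff) (auto simp: s_def r_def)
 then obtain z where z: "f = M * z" by (elim dvdE)
 \<comment> \<open>Lagrange interpolation at \<open>a\<close> and \<open>b\<close>: with
   \<open>nn a = (t - b) M\<close> and \<open>nn b = (t - a) M\<close>, the cofactor
   \<open>z\<close> only matters through its two values.\<close>
 define \<alpha> \<beta> where "\<alpha> = poly z a / (a - b)" and "\<beta> = poly z b / (b - a)"
 define y where "y = z - (Polynomial.smult \<alpha> r + Polynomial.smult \<beta> s)"
 have "\<alpha> * (a - b) = poly z a" "\<beta> * (b - a) = poly z b" unfolding \<alpha>_def \<beta>_def using ab(3) by auto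
 moreover have "poly y a = poly z a - \<alpha> * (a - b)" "poly y b = poly z b - \<beta> * (b - a)"
  unfolding y_def s_def r_def by (simp_all add: algebra_simps)
 ultimately have "poly y a = 0" "poly y b = 0" by simp_all
 then have "s dvd y" "r dvd y" unfolding s_def r_def poly_eq_0_iff_dvd by auto
 then have "s * r dvd y" by (intro coprime_mult_dvd) (use ab(3) in \<open>auto simp: s_def r_def\<close>)
 then obtain w where w: "y = s * r * w" by (elim dvdE)
 have "f - (Polynomial.smult \<alpha> (nn a) + Polynomial.smult \<beta> (nn b)) = M * y"
  unfolding z M(1,2) y_def by (simp add: algebra_simps)
 also have "\<dots> = (s * r * M) * w" unfolding w by (simp only: ac_simps)
 finally have "\<Delta> dvd f - (Polynomial.smult \<alpha> (nn a) + Polynomial.smult \<beta> (nn b))" unfolding M(3) by simp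
 then have "X = \<alpha> *s \<phi> (nn a) + \<beta> *s \<phi> (nn b)" unfolding f comb_\<phi> \<phi>_eq_iff .
 then show thesis by (rule that)
qed

text \<open>Half of 4 or 5, rounded up, is \<open>\<mu> a - 2\<close>. So the element is annihilated
  by \<open>(t - a)^2\<close>, whose kernel is spanned by \<open>N2 a\<close> and
  \<open>nn a\<close>.\<close>

lemma nilp_kind3:
 assumes k: "kind3 a" and X: "X \<in> nilp"
 obtains \<alpha> \<beta> where "X = \<alpha> *s \<phi> (N2 a) + \<beta> *s \<phi> (nn a)"
proof -
 obtain f where f: "X = \<phi> f" using \<phi>_surj by metis
 have d: "\<Delta> dvd f\<^sup>2" using X(1) unfolding f nilp_\<phi> .
 have a: "a \<in> E" "\<mu> a = 4 \<or> \<mu> a = 5" "\<mu> a \<ge> 2" using k unfolding kind3_def by auto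
 define s where "s = [:-a, 1:]"
 have "\<Delta> dvd s\<^sup>2 * f"
 proof (rule \<Delta>_dvdI)
  fix e assume e: "e \<in> E"
  show "[:-e, 1:] ^ \<mu> e dvd s\<^sup>2 * f"
  proof (cases "e = a")
  case True
  have "s ^ (\<mu> a - 2) dvd f" unfolding s_def by (rule nil_dvd[OF d a(1)]) (use a in auto)
  then have "s\<^sup>2 * s ^ (\<mu> a - 2) dvd s\<^sup>2 * f" by (rule mult_dvd_mono[OF dvd_refl])
  moreover have "s\<^sup>2 * s ^ (\<mu> a - 2) = s ^ \<mu> a" using a(3) by (simp only: power_add[symmetric] le_add_diff_inverse)
  ultimately show ?thesis using True unfolding s_def by simp
  next
  case False
  then have "\<mu> e = 1" using k e unfolding kind3_def by blast
  then show ?thesis using nil_dvd[OF d e, of 1] by (simp add: dvd_mult)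
  qed
 qed
 then have "s\<^sup>2 * N2 a dvd s\<^sup>2 * f" using N2[OF a(1,3)] unfolding s_def by simp
 then have "N2 a dvd f" by (subst (asm) dvd_times_left_cancel_iff) (auto simp: s_def)
 then obtain z where z: "f = N2 a * z" by (elim dvdE)
 have "poly (z - [:poly z a:]) a = 0" by simp
 then obtain y where y: "z - [:poly z a:] = s * y" unfolding s_def by (elim root_factorE)
 have "f = N2 a * [:poly z a:] + N2 a * (z - [:poly z a:])" unfolding z by (simp only: distrib_left[symmetric]) simp
 also have "N2 a * (z - [:poly z a:]) = nn a * y" unfolding y N2_nn[OF a(1,3)] s_def by (simp only: ac_simps)
 finally have "f - (Polynomial.smult (poly z a) (N2 a) + Polynomial.smult (poly y a) (nn a)) = nn a * y - Polynomial.smult (poly y a) (nn a)"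
  by simp
 then have "\<Delta> dvd f - (Polynomial.smult (poly z a) (N2 a) + Polynomial.smult (poly y a) (nn a))"
  using nn_mult[OF a(1), of y] by (simp only:)
 then have "X = poly z a *s \<phi> (N2 a) + poly y a *s \<phi> (nn a)" unfolding f comb_\<phi> \<phi>_eq_iff .
 then show thesis by (rule that)
qed

text \<open>The parametrisation repeats lines, since \<open>j\<close> and \<open>- j\<close> give
  the same one. For the symbol [11111] the 32 sign choices yield the classical 16 lines of a quartic
  del Pezzo surface.\<close>

definition lines :: "5 proj set set" where
 "lines = line0 ` sqrt1 \<Delta> \<union> (\<Union>a\<in>{a \<in> E. \<mu> a \<ge> 2}. line2 a ` sqrt1 (N2 a)) \<union>
  (\<lambda>(a, b). join (\<phi> (nn a)) (\<phi> (nn b))) ` {(a, b) \<in> E \<times> E. kind2 a b} \<union>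
  (\<lambda>a. join (\<phi> (N2 a)) (\<phi> (nn a))) ` {a \<in> E. kind3 a}"

lemma finite_lines: "finite lines"
proof -
 have "finite {(a, b) \<in> E \<times> E. kind2 a b}" by (rule finite_subset[of _ "E \<times> E"]) (use finE in auto)
 then show ?thesis unfolding lines_def using finE by (auto intro!: finite_imageI finite_sqrt1)
qed

lemma indep2_nn:
 assumes "kind2 a b"
 shows "indep2 (\<phi> (nn a)) (\<phi> (nn b))"
proof (rule indep2_\<phi>)
 have ab: "a \<in> E" "b \<in> E" "a \<noteq> b" using assms unfolding kind2_def by auto
 obtain M where M: "nn a = [:-b, 1:] * M" "nn b = [:-a, 1:] * M" "[:-a, 1:] * [:-b, 1:] * M = \<Delta>" using two_factor[OF assms] .
 fix \<alpha> \<beta> assume d: "\<Delta> dvd Polynomial.smult \<alpha> (nn a) + Polynomial.smult \<beta> (nn b)"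
 have M0: "M \<noteq> 0" using M(3) \<Delta>_nz by auto
 have "[:-a, 1:] * [:-b, 1:] * M dvd (Polynomial.smult \<alpha> [:-b, 1:] + Polynomial.smult \<beta> [:-a, 1:]) * M"
  using d unfolding M(1,2) M(3) by (simp only: distrib_right mult_smult_left)
 then have dd: "[:-a, 1:] * [:-b, 1:] dvd Polynomial.smult \<alpha> [:-b, 1:] + Polynomial.smult \<beta> [:-a, 1:]"
  by (subst (asm) dvd_times_right_cancel_iff) (use M0 in auto)
 then obtain w where w: "Polynomial.smult \<alpha> [:-b, 1:] + Polynomial.smult \<beta> [:-a, 1:] = [:-a, 1:] * [:-b, 1:] * w" by (elim dvdE)
 have "poly (Polynomial.smult \<alpha> [:-b, 1:] + Polynomial.smult \<beta> [:-a, 1:]) a = 0"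
  "poly (Polynomial.smult \<alpha> [:-b, 1:] + Polynomial.smult \<beta> [:-a, 1:]) b = 0"
  unfolding w poly_mult by simp_all
 then have "\<alpha> * (a - b) = 0" "\<beta> * (b - a) = 0" by (simp_all add: algebra_simps)
 then show "\<alpha> = 0 \<and> \<beta> = 0" using ab(3) by simp
qed

lemma indep2_N2:
 assumes "a \<in> E" "\<mu> a \<ge> 2"
 shows "indep2 (\<phi> (N2 a)) (\<phi> (nn a))"
proof (rule indep2_\<phi>)
 fix \<alpha> \<beta> assume d: "\<Delta> dvd Polynomial.smult \<alpha> (N2 a) + Polynomial.smult \<beta> (nn a)"
 have "degree (Polynomial.smult \<alpha> (N2 a) + Polynomial.smult \<beta> (nn a)) \<le> 4"
  by (intro degree_add_le order_trans[OF degree_smult_le]) (use degree_N2[OF assms] degree_nn[OF assms(1)] in auto)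
 then have 0: "Polynomial.smult \<alpha> (N2 a) + Polynomial.smult \<beta> (nn a) = 0" using dvd_imp_degree_le[OF d] deg\<Delta> by linarith
 have "coeff (N2 a) 4 = 0" using degree_N2[OF assms] by (simp add: coeff_eq_0)
 moreover have "coeff (nn a) 4 \<noteq> 0" using degree_nn[OF assms(1)] by (metis degree_0 leading_coeff_0_iff zero_neq_numeral)
 ultimately have b: "\<beta> = 0" using arg_cong[OF 0, of "\<lambda>p. coeff p 4"] by simp
 then show "\<alpha> = 0 \<and> \<beta> = 0" using 0 degree_N2[OF assms] by auto
qed

lemma lines_projective: "L \<in> lines \<Longrightarrow> projective_line L"
 unfolding lines_def line0_def line2_def kind3_def
 by (auto simp del: mult_pCons_left mult_pCons_right
  intro!: projective_line_join line0_indep line2_indep indep2_nn indep2_N2)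

lemma one_sqrt1: "degree m \<noteq> 0 \<Longrightarrow> 1 \<in> sqrt1 m"
 unfolding sqrt1_def by auto

lemma disc_lines:
 assumes kinds: known_kind
  and X: "onS X" "disc (sq X) = 0" "X \<noteq> 0"
 shows "\<exists>L\<in>lines. pt X \<in> L"
 using X
proof (cases rule: disc_zero_cases)
 case nil
 consider kind1 | a b where "kind2 a b" | a where "kind3 a" using kinds by blast
 then show ?thesis
 proof cases
  case 1
  obtain a c where ac: "a \<in> E" "\<mu> a \<ge> 2" "X = c *s \<phi> (nn a)" using nilp_kind1[OF 1 nil X(3)] .
  \<comment> \<open>The point of \<open>nn a\<close> lies on every \<open>line2 a j\<close>, and
    \<open>j = 1\<close> is always available.\<close>
  then have "X = 0 *s \<phi> ([:-a, 1:] * 1) + c *s \<phi> (nn a)" by simp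
  then have "pt X \<in> line2 a 1" unfolding line2_def using mem_join[OF X(3)] by blast
  moreover have "1 \<in> sqrt1 (N2 a)" using one_sqrt1 degree_N2[OF ac(1,2)] by simp
  ultimately show ?thesis unfolding lines_def using ac by blast
 next
  case 2
  obtain \<alpha> \<beta> where "X = \<alpha> *s \<phi> (nn a) + \<beta> *s \<phi> (nn b)" using nilp_kind2[OF 2 nil] .
  then have "pt X \<in> join (\<phi> (nn a)) (\<phi> (nn b))" using mem_join[OF X(3)] by blast
  moreover
  have "join (\<phi> (nn a)) (\<phi> (nn b)) \<in> (\<lambda>(a, b). join (\<phi> (nn a)) (\<phi> (nn b))) ` {(a, b) \<in> E \<times> E. kind2 a b}"
  using 2 unfolding kind2_def by (intro rev_image_eqI[of "(a, b)"]) auto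
  then have "join (\<phi> (nn a)) (\<phi> (nn b)) \<in> lines" unfolding lines_def by (intro UnI1 UnI2)
  ultimately show ?thesis by blast
 next
  case 3
  obtain \<alpha> \<beta> where "X = \<alpha> *s \<phi> (N2 a) + \<beta> *s \<phi> (nn a)" using nilp_kind3[OF 3 nil] .
  then have "pt X \<in> join (\<phi> (N2 a)) (\<phi> (nn a))" using mem_join[OF X(3)] by blast
  moreover have "a \<in> E" using 3 unfolding kind3_def by blast
  ultimately show ?thesis unfolding lines_def using 3 by blast
 qed
next
 case (line0 j)
 then show ?thesis unfolding lines_def by blast
next
 case (line2 a j)
 then show ?thesis unfolding lines_def by blast
qed

end

section \<open>The Hessian in a chart\<close>

subsection \<open>Determinants\<close>

lemma det_2_2:
 fixes A :: "complex Matrix.mat"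
 assumes A: "A \<in> carrier_mat 2 2"
 shows "Determinant.det A = A $$ (0, 0) * A $$ (1, 1) - A $$ (0, 1) * A $$ (1, 0)"
proof -
 have c: "cofactor A i 0 = (-1) ^ i * A $$ (1 - i, 1)" if "i < 2" for i
 proof -
  have "mat_delete A i 0 \<in> carrier_mat 1 1" using A by (auto simp: mat_delete_def)
  then have "Determinant.det (mat_delete A i 0) = mat_delete A i 0 $$ (0, 0)" by (rule det_single)
  also have "\<dots> = A $$ (1 - i, 1)" using A that by (cases i) (auto simp: mat_delete_def)
  finally show ?thesis unfolding cofactor_def by simp
 qed
 have "Determinant.det A = (\<Sum>i<2. A $$ (i, 0) * cofactor A i 0)"
  by (rule laplace_expansion_column[OF A]) simp
 also have "\<dots> = A $$ (0, 0) * A $$ (1, 1) - A $$ (0, 1) * A $$ (1, 0)"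
  using c[of 0] c[of 1] by (simp add: lessThan_nat_numeral lessThan_Suc numeral_2_eq_2 mult.commute)
 finally show ?thesis .
qed

lemma det_block_5:
 fixes G :: "complex Matrix.mat"
 assumes G: "G \<in> carrier_mat 5 5"
  and 0: "\<And>i j. i < 2 \<Longrightarrow> 2 \<le> j \<Longrightarrow> j < 5 \<Longrightarrow> G $$ (i, j) = 0" "G $$ (2, 4) = 0" "G $$ (3, 4) = 0"
 shows "Determinant.det G = (G $$ (0, 0) * G $$ (1, 1) - G $$ (0, 1) * G $$ (1, 0)) *
  (G $$ (2, 2) * G $$ (3, 3) - G $$ (2, 3) * G $$ (3, 2)) * G $$ (4, 4)"
proof -
 define A where "A = Matrix.mat 2 2 (\<lambda>(i, j). G $$ (i, j))"
 define C where "C = Matrix.mat 3 2 (\<lambda>(i, j). G $$ (i + 2, j))"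
 define D where "D = Matrix.mat 3 3 (\<lambda>(i, j). G $$ (i + 2, j + 2))"
 define D1 where "D1 = Matrix.mat 2 2 (\<lambda>(i, j). G $$ (i + 2, j + 2))"
 define D3 where "D3 = Matrix.mat 1 2 (\<lambda>(i, j). G $$ (4, j + 2))"
 define D4 where "D4 = Matrix.mat 1 1 (\<lambda>(i, j). G $$ (4, 4))"
 have GE: "G = four_block_mat A (0\<^sub>m 2 3) C D"
 proof -
  have "Suc (Suc (i - 2)) = i" if "\<not> i < 2" for i using that by linarith
  then show ?thesis
  by (intro eq_matI) (use G 0(1) in \<open>auto simp: A_def C_def D_def four_block_mat_def Let_def\<close>)
 qed
 have "D = four_block_mat D1 (0\<^sub>m 2 1) D3 D4"
 proof (rule eq_matI)
  fix i j assume "i < dim_row (four_block_mat D1 (0\<^sub>m 2 1) D3 D4)" "j < dim_col (four_block_mat D1 (0\<^sub>m 2 1) D3 D4)"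
  then have "i = 0 \<or> i = 1 \<or> i = 2" "j = 0 \<or> j = 1 \<or> j = 2" by (auto simp: D1_def D4_def)
  then show "D $$ (i, j) = four_block_mat D1 (0\<^sub>m 2 1) D3 D4 $$ (i, j)"
  using 0(2,3) by (elim disjE) (simp_all add: D_def D1_def D3_def D4_def four_block_mat_def Let_def eval_nat_numeral)
 qed (auto simp: D_def D1_def D4_def)
 then have "Determinant.det D = Determinant.det D1 * Determinant.det D4"
  using det_four_block_mat_upper_right_zero[of D1 2 "0\<^sub>m 2 1" 1 D3 D4] by (simp add: D1_def D3_def D4_def)
 moreover have "Determinant.det D4 = G $$ (4, 4)" by (subst det_single) (auto simp: D4_def)
 moreover have "Determinant.det G = Determinant.det A * Determinant.det D"
  unfolding GE using det_four_block_mat_upper_right_zero[of A 2 "0\<^sub>m 2 3" 3 C D] by (simp add: A_def C_def D_def)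
 moreover have "Determinant.det A = G $$ (0, 0) * G $$ (1, 1) - G $$ (0, 1) * G $$ (1, 0)"
  by (subst det_2_2) (auto simp: A_def)
 moreover have "Determinant.det D1 = G $$ (2, 2) * G $$ (3, 3) - G $$ (2, 3) * G $$ (3, 2)"
  by (subst det_2_2) (auto simp: D1_def eval_nat_numeral)
 ultimately show ?thesis by simp
qed

definition cmat :: "(complex^5) list \<Rightarrow> complex Matrix.mat" where
 "cmat l = Matrix.mat 5 5 (\<lambda>(i, j). (l ! j) $ of_nat i)"

lemma cmat_carrier [simp]: "cmat l \<in> carrier_mat 5 5"
 unfolding cmat_def by simp

lemma less_5_cases: "(i::nat) < 5 \<longleftrightarrow> i = 0 \<or> i = 1 \<or> i = 2 \<or> i = 3 \<or> i = 4"
 by auto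

lemma sum_0_5: "(\<Sum>i = 0..<5. f i) = f 0 + f 1 + f 2 + f 3 + f (4::nat)"
 by (simp add: numeral_eq_Suc)

lemma gram_cmat:
 "transpose_mat (cmat l) * to_mat M * cmat l' = Matrix.mat 5 5 (\<lambda>(i, j). bil M (l ! i) (l' ! j))"
proof (rule eq_matI)
 fix i j assume ij: "i < dim_row (Matrix.mat 5 5 (\<lambda>(i, j). bil M (l ! i) (l' ! j)))"
  "j < dim_col (Matrix.mat 5 5 (\<lambda>(i, j). bil M (l ! i) (l' ! j)))"
 have "bil M (l ! i) (l' ! j) = (\<Sum>b = 0..<5. \<Sum>a = 0..<5. (l ! i) $ of_nat a * M $ of_nat a $ of_nat b * (l' ! j) $ of_nat b)"
  unfolding bil_def sum_UNIV_5 by (rule sum.swap)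
 then show "(transpose_mat (cmat l) * to_mat M * cmat l') $$ (i, j) = Matrix.mat 5 5 (\<lambda>(i, j). bil M (l ! i) (l' ! j)) $$ (i, j)"
  using ij by (simp add: cmat_def to_mat_def scalar_prod_def sum_distrib_right)
qed (auto simp: cmat_def)

lemma det_gram_cmat:
 "Determinant.det (cmat l) * Determinant.det (to_mat M) * Determinant.det (cmat l') =
  Determinant.det (Matrix.mat 5 5 (\<lambda>(i, j). bil M (l ! i) (l' ! j)))"
proof -
 have "Determinant.det (transpose_mat (cmat l) * to_mat M * cmat l') =
  Determinant.det (transpose_mat (cmat l)) * Determinant.det (to_mat M) * Determinant.det (cmat l')"
  using det_mult[OF mult_carrier_mat[of "transpose_mat (cmat l)" 5 5 "to_mat M" 5] cmat_carrier, of l']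
  det_mult[of "transpose_mat (cmat l)" 5 "to_mat M"] by simp
 then show ?thesis unfolding gram_cmat by (simp add: Determinant.det_transpose[OF cmat_carrier])
qed

lemma cmat_mult:
 assumes C: "C \<in> carrier_mat 5 5" and l': "\<And>j. j < 5 \<Longrightarrow> l' ! j = (\<Sum>k = 0..<5. C $$ (k, j) *s l ! k)"
 shows "Determinant.det (cmat l') = Determinant.det (cmat l) * Determinant.det C"
proof -
 have "cmat l' = cmat l * C"
  by (rule eq_matI) (use C in \<open>auto simp: cmat_def scalar_prod_def l' sum_component mult.commute\<close>)
 then show ?thesis using det_mult[OF cmat_carrier C] by simp
qed

lemma five_eq_0: "(5::5) = 0"
 by simp

lemma cmat_basis:
 assumes "Determinant.det (cmat [b0, b1, b2, b3, b4]) \<noteq> 0"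
 shows "\<exists>x0 x1 x2 x3 x4. v = x0 *s b0 + x1 *s b1 + x2 *s b2 + x3 *s b3 + x4 *s b4"
proof -
 define f where "f = (\<lambda>x :: complex^5. x $ 0 *s b0 + x $ 1 *s b1 + x $ 2 *s b2 + x $ 3 *s b3 + x $ 4 *s b4)"
 have "\<exists>x. f x = v"
 proof (rule linear_injective_surj5)
  fix x assume "f x = 0"
  have "cmat [b0, b1, b2, b3, b4] *\<^sub>v cvec x = cvec (f x)"
  by (rule eq_vecI) (auto simp: cmat_def cvec_def scalar_prod_def sum_0_5 f_def mult.commute)
  also have "\<dots> = 0\<^sub>v 5" unfolding \<open>f x = 0\<close> by (rule eq_vecI) (auto simp: cvec_def)
  finally have "cvec x = 0\<^sub>v 5"
  using assms det_0_iff_vec_prod_zero[OF cmat_carrier] cvec_carrier by blast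
  also have "\<dots> = cvec 0" by (rule eq_vecI) (auto simp: cvec_def)
  finally show "x = 0" by (simp add: cvec_inj)
 qed (auto simp: f_def cart_eq_iff algebra_simps)
 then show ?thesis unfolding f_def by metis
qed

lemma det_cmat_nonzeroI:
 assumes "\<And>x0 x1 x2 x3 x4. x0 *s b0 + x1 *s b1 + x2 *s b2 + x3 *s b3 + x4 *s b4 = 0 \<Longrightarrow>
  x0 = 0 \<and> x1 = 0 \<and> x2 = 0 \<and> x3 = 0 \<and> x4 = 0"
 shows "Determinant.det (cmat [b0, b1, b2, b3, b4]) \<noteq> 0"
proof
 assume "Determinant.det (cmat [b0, b1, b2, b3, b4]) = 0"
 then obtain y where y: "y \<in> carrier_vec 5" "y \<noteq> 0\<^sub>v 5" "cmat [b0, b1, b2, b3, b4] *\<^sub>v y = 0\<^sub>v 5"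
  using det_0_iff_vec_prod_zero[OF cmat_carrier] by blast
 obtain x where x: "y = cvec x" using cvec_surj[OF y(1)] .
 have z: "0\<^sub>v 5 = cvec 0" by (rule eq_vecI) (auto simp: cvec_def)
 have "cvec (x $ 0 *s b0 + x $ 1 *s b1 + x $ 2 *s b2 + x $ 3 *s b3 + x $ 4 *s b4) = cmat [b0, b1, b2, b3, b4] *\<^sub>v cvec x"
  by (rule eq_vecI) (auto simp: cmat_def cvec_def scalar_prod_def sum_0_5 mult.commute)
 then have "x $ 0 *s b0 + x $ 1 *s b1 + x $ 2 *s b2 + x $ 3 *s b3 + x $ 4 *s b4 = 0"
  using y(3) unfolding x z cvec_inj[symmetric] by simp
 from assms[OF this] have "x = 0" unfolding vec5_eq_iff five_eq_0 by simp
 then show False using y(2) unfolding x z by simp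
qed

subsection \<open>The second fundamental form of the pencil\<close>

context pencil_roots
begin

text \<open>The residue theorem for \<open>h / ((t - \<tau>) \<Delta>)\<close>: the degree is so
  negative that all finite residues add up to zero. Those at the roots of \<open>\<Delta>\<close>
  give \<open>l0 \<Delta> g\<close>, and the one at \<open>\<tau>\<close> is the quotient of the
  values of \<open>h\<close> and \<open>\<Delta>\<close>.\<close>

lemma l0_division:
 assumes h: "degree h \<le> 2" and s': "\<Delta> dvd [:-\<tau>, 1:] * s' - 1" and fy: "\<Delta> dvd g - h * s'"
 shows "l0 \<Delta> g * poly \<Delta> \<tau> = - poly h \<tau>"
proof -
 have "poly (\<Delta> - [:poly \<Delta> \<tau>:]) \<tau> = 0" by simp
 \<comment> \<open>Modulo \<open>\<Delta>\<close> the difference quotient is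
   \<open>- poly \<Delta> \<tau>\<close> times the inverse \<open>s'\<close> of
   \<open>t - \<tau>\<close>. Being monic of degree four, it makes \<open>l0\<close> of
   \<open>s'\<close> computable.\<close>
 then obtain \<Omega> where \<Omega>: "\<Delta> - [:poly \<Delta> \<tau>:] = [:-\<tau>, 1:] * \<Omega>" by (elim root_factorE)
 have "degree (\<Delta> - [:poly \<Delta> \<tau>:]) = 5"
 proof -
  have "degree (\<Delta> + [:- poly \<Delta> \<tau>:]) = degree \<Delta>" by (rule degree_add_eq_left) (use deg\<Delta> in simp)
  moreover have "\<Delta> + [:- poly \<Delta> \<tau>:] = \<Delta> - [:poly \<Delta> \<tau>:]"
  by (rule poly_eqI) (simp add: coeff_pCons split: nat.split)
  ultimately show ?thesis using deg\<Delta> by simp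
 qed
 moreover have "\<Omega> \<noteq> 0" using \<Omega> calculation by auto
 ultimately have d\<Omega>: "degree \<Omega> = 4" unfolding \<Omega> by (subst (asm) degree_mult_eq) auto
 have "coeff ([:-\<tau>, 1:] * \<Omega>) 5 = 1" unfolding \<Omega>[symmetric] using monic deg\<Delta> by (simp add: coeff_pCons eval_nat_numeral)
 then have c\<Omega>: "coeff \<Omega> 4 = 1" using d\<Omega> by (simp add: coeff_pCons coeff_eq_0 eval_nat_numeral)
 have l\<Omega>: "l0 \<Delta> \<Omega> = 1" using d\<Omega> deg\<Delta> c\<Omega> by (simp add: l0_degree_le)
 have e: "[:-\<tau>, 1:] * \<Omega> + [:poly \<Delta> \<tau>:] = \<Delta>" using \<Omega> by (metis diff_add_cancel)
 have "\<Delta> dvd ([:-\<tau>, 1:] * \<Omega> + [:poly \<Delta> \<tau>:]) * s'" unfolding e by simp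
 from dvd_diff[OF this dvd_mult[OF s', of \<Omega>]]
 have "\<Delta> dvd ([:-\<tau>, 1:] * \<Omega> + [:poly \<Delta> \<tau>:]) * s' - \<Omega> * ([:-\<tau>, 1:] * s' - 1)" .
 moreover have "([:-\<tau>, 1:] * \<Omega> + [:poly \<Delta> \<tau>:]) * s' - \<Omega> * ([:-\<tau>, 1:] * s' - 1) = \<Omega> - Polynomial.smult (- poly \<Delta> \<tau>) s'"
 proof -
  have ring: "(k * \<Omega> + c) * s' - \<Omega> * (k * s' - 1) = \<Omega> + c * s'" for k c by (simp add: algebra_simps)
  show ?thesis unfolding ring by simp
 qed
 ultimately have "l0 \<Delta> \<Omega> = l0 \<Delta> (Polynomial.smult (- poly \<Delta> \<tau>) s')" using l0_cong by metis
 then have ls: "poly \<Delta> \<tau> * l0 \<Delta> s' = - 1" unfolding l\<Omega> l0_smult by (simp add: eq_neg_iff_add_eq_0 add.commute)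
 have "poly (h - [:poly h \<tau>:]) \<tau> = 0" by simp
 then obtain k where k: "h - [:poly h \<tau>:] = [:-\<tau>, 1:] * k" by (elim root_factorE)
 have lk: "l0 \<Delta> k = 0"
 proof (cases "k = 0")
  case False
  have "degree (h - [:poly h \<tau>:]) \<le> 2" using h by (intro degree_diff_le) auto
  then have "degree k \<le> 2" unfolding k using False by (subst (asm) degree_mult_eq) auto
  then show ?thesis using deg\<Delta> by (simp add: l0_degree_le coeff_eq_0)
 qed (simp add: l0_zero)
 have "\<Delta> dvd (g - h * s') + k * ([:-\<tau>, 1:] * s' - 1)" using fy s' by (intro dvd_add dvd_mult)
 moreover have "(g - h * s') + k * ([:-\<tau>, 1:] * s' - 1) = g - (Polynomial.smult (poly h \<tau>) s' + k)"
 proof -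
  have "h = [:-\<tau>, 1:] * k + [:poly h \<tau>:]" using k by (simp add: diff_eq_eq)
  moreover have "(g - (m * k + c) * s') + k * (m * s' - 1) = g - (c * s' + k)" for m c by (simp add: algebra_simps)
  ultimately show ?thesis by (metis (no_types, lifting) mult_smult_left pCons_0_0 mult_pCons_left add.right_neutral mult_zero_left)
 qed
 ultimately have "l0 \<Delta> g = poly h \<tau> * l0 \<Delta> s'" using l0_cong[of \<Delta> g] lk by (metis l0_add l0_smult add.right_neutral)
 then have "l0 \<Delta> g * poly \<Delta> \<tau> = poly h \<tau> * (poly \<Delta> \<tau> * l0 \<Delta> s')" by (simp only: mult.assoc mult.left_commute mult.commute)
 then show ?thesis unfolding ls by simp
qed

definition PQ :: "complex \<Rightarrow> complex^5^5" where
 "PQ \<tau> = (\<chi> i j. P $ i $ j - \<tau> * Q $ i $ j)"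

lemma bil_PQ: "bil (PQ \<tau>) v w = bil P v w - \<tau> * bil Q v w"
 unfolding PQ_def bil_def by (simp add: sum_subtractf sum_distrib_left algebra_simps)

lemma bil_PQ_commute: "bil (PQ \<tau>) v w = bil (PQ \<tau>) w v"
 unfolding bil_PQ using bil_commute[OF symP] bil_commute[OF symQ] by metis

lemma bil_PQ_\<phi>: "bil (PQ \<tau>) (\<phi> f) (\<phi> g) = l0 \<Delta> ([:-\<tau>, 1:] * (f * g))"
proof -
 have "[:-\<tau>, 1:] * (f * g) = [:0, 1:] * (f * g) - Polynomial.smult \<tau> (f * g)" by simp
 then show ?thesis unfolding bil_PQ bilP bilQ by (simp only: l0_diff l0_smult)
qed

text \<open>Both sides are computed as Gram determinants of \<open>PQ \<tau>\<close>, using in addition to the basis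
 \<open>Z1, Z2, Y1, Y2, X\<close> the vector \<open>U\<close> with \<open>PQ \<tau> U = Q X\<close> and an auxiliary vector \<open>V\<close>.\<close>

lemma hessian_identity_at:
 assumes X: "bil Q X X = 0" "bil P X X = 0"
  and Y: "bil Q X Y1 = 0" "bil P X Y1 = 0" "bil Q X Y2 = 0" "bil P X Y2 = 0"
  and D: "Determinant.det (cmat [Z1, Z2, Y1, Y2, X]) \<noteq> 0"
  and \<tau>: "poly \<Delta> \<tau> \<noteq> 0"
 defines "M \<equiv> bil (PQ \<tau>)"
 shows "(bil Q X Z1 * bil P X Z2 - bil Q X Z2 * bil P X Z1)\<^sup>2 * (M Y1 Y1 * M Y2 Y2 - (M Y1 Y2)\<^sup>2) =
  c0 * (Determinant.det (cmat [Z1, Z2, Y1, Y2, X]))\<^sup>2 * poly (sq X) \<tau>"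
proof -
 define r s p q where "r = bil Q X Z1" and "s = bil Q X Z2" and "p = bil P X Z1" and "q = bil P X Z2"
 define DD where "DD = Determinant.det (cmat [Z1, Z2, Y1, Y2, X])"
 define f where "f = rep X"
 have Xf: "X = \<phi> f" unfolding f_def by (simp add: \<phi>_rep)
 have nz: "\<not> \<Delta> dvd f"
 proof
  assume "\<Delta> dvd f"
  then have X0: "X = 0" unfolding Xf by (simp add: \<phi>_eq_0)
  have "col (cmat [Z1, Z2, Y1, Y2, X]) 4 = 0\<^sub>v 5" unfolding X0 by (rule eq_vecI) (auto simp: cmat_def)
  moreover have "cmat [Z1, Z2, Y1, Y2, X] *\<^sub>v unit_vec 5 4 = col (cmat [Z1, Z2, Y1, Y2, X]) 4"
  by (rule eq_vecI) (auto simp: cmat_def scalar_prod_def sum_0_5 unit_vec_def less_5_cases)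
  moreover have "unit_vec 5 4 \<noteq> (0\<^sub>v 5 :: complex Matrix.vec)"
  proof
  assume "unit_vec 5 4 = (0\<^sub>v 5 :: complex Matrix.vec)"
  then have "vec_index (unit_vec 5 4) 4 = vec_index (0\<^sub>v 5 :: complex Matrix.vec) 4" by (simp only:)
  then show False by simp
  qed
  ultimately show False using D det_0_iff_vec_prod_zero[OF cmat_carrier, of "[Z1, Z2, Y1, Y2, X]"] unit_vec_carrier by metis
 qed
 have unit: "poly [:-\<tau>, 1:] x \<noteq> 0" if "poly \<Delta> x = 0" for x using that \<tau> by auto
 obtain s' where s': "\<Delta> dvd [:-\<tau>, 1:] * s' - 1" using poly_inverse_mod[OF \<Delta>_nz unit] .
 define U where "U = \<phi> (f * s')"
 have MU: "M U w = bil Q X w" for w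
 proof -
  obtain g where g: "w = \<phi> g" using \<phi>_surj by metis
  have "\<Delta> dvd ([:-\<tau>, 1:] * s' - 1) * (f * g)" using s' by (rule dvd_mult2)
  moreover have "(k * s' - 1) * (f * g) = k * (f * s' * g) - f * g" for k by (simp add: algebra_simps)
  ultimately show ?thesis unfolding M_def U_def g Xf bil_PQ_\<phi> bilQ using l0_cong by metis
 qed
 have sX: "degree (sq X) \<le> 2" using X onS_iff unfolding onS_def by blast
 have "\<Delta> dvd (f\<^sup>2 - sq X) * s'" using sq_dvd[of f] unfolding Xf by (rule dvd_mult2)
 then have "\<Delta> dvd f * (f * s') - sq X * s'" by (simp add: power2_eq_square algebra_simps)
 from l0_division[OF sX s' this] have W: "bil Q X U * poly \<Delta> \<tau> = - poly (sq X) \<tau>"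
  unfolding U_def by (simp add: Xf bilQ)
 have "\<not> \<Delta> dvd [:-\<tau>, 1:] * f" using dvd_cancel_unit[OF \<Delta>_nz unit] nz by blast
 then obtain g where "l0 \<Delta> (([:-\<tau>, 1:] * f) * g) \<noteq> 0" using l0_nondegenerate by blast
 then have "M X (\<phi> g) \<noteq> 0" unfolding M_def Xf bil_PQ_\<phi> by (simp only: mult.assoc) simp
 \<comment> \<open>\<open>M X\<close> vanishes on \<open>X\<close>, \<open>Y1\<close> and
   \<open>Y2\<close>, so a partner for \<open>X\<close> has to come from outside the tangent
   space.\<close>
 then obtain V where V: "M X V \<noteq> 0" by blast
 obtain u0 u1 u2 u3 u4 where U: "U = u0 *s Z1 + u1 *s Z2 + u2 *s Y1 + u3 *s Y2 + u4 *s X"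
  using cmat_basis[OF D] by blast
 obtain v0 v1 v2 v3 v4 where VE: "V = v0 *s Z1 + v1 *s Z2 + v2 *s Y1 + v3 *s Y2 + v4 *s X"
  using cmat_basis[OF D] by blast
 define c where "c = u0 * v1 - v0 * u1"
 have detN': "Determinant.det (cmat [U, V, Y1, Y2, X]) = DD * c"
 proof -
  define C where "C = Matrix.mat 5 5 (\<lambda>(i, j). [[u0, v0, 0, 0, 0], [u1, v1, 0, 0, 0], [u2, v2, 1, 0, 0], [u3, v3, 0, 1, 0], [u4, v4, 0, 0, 1]] ! i ! j)"
  have C: "C \<in> carrier_mat 5 5" unfolding C_def by simp
  have "Determinant.det (cmat [U, V, Y1, Y2, X]) = DD * Determinant.det C" unfolding DD_def
  proof (rule cmat_mult[OF C])
  fix j :: nat assume "j < 5"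
  then show "[U, V, Y1, Y2, X] ! j = (\<Sum>k = 0..<5. C $$ (k, j) *s [Z1, Z2, Y1, Y2, X] ! k)"
  unfolding less_5_cases by (elim disjE) (simp_all add: C_def sum_0_5 U VE numeral_eq_Suc)
  qed
  also have "Determinant.det C = c"
  proof (subst det_block_5[OF C])
  fix i j :: nat assume "i < 2" "2 \<le> j" "j < 5"
  then have "i = 0 \<or> i = 1" "j = 2 \<or> j = 3 \<or> j = 4" by auto
  then show "C $$ (i, j) = 0" by (elim disjE) (simp_all add: C_def numeral_eq_Suc)
  qed (simp_all add: C_def c_def numeral_eq_Suc)
  finally show ?thesis .
 qed
 have W1: "bil Q X U = u0 * r + u1 * s" and "bil P X U = u0 * p + u1 * q"
  and "bil Q X V = v0 * r + v1 * s" "bil P X V = v0 * p + v1 * q"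
  unfolding U VE r_def s_def p_def q_def by (simp_all add: bil_simps X Y)
 \<comment> \<open>The left side is \<open>M X U\<close>, which equals \<open>Q X X\<close> by the
   choice of \<open>U\<close>.\<close>
 moreover have "bil P X U - \<tau> * bil Q X U = 0" using MU[of X] X bil_PQ_commute unfolding M_def bil_PQ by metis
 moreover have "bil P X V - \<tau> * bil Q X V = M X V" unfolding M_def bil_PQ ..
 ultimately have e: "\<tau> * (u0 * r + u1 * s) = u0 * p + u1 * q" "M X V = (v0 * p + v1 * q) - \<tau> * (v0 * r + v1 * s)" by auto
 have "(u0 * r + u1 * s) * M X V = (u0 * r + u1 * s) * (v0 * p + v1 * q) - (v0 * r + v1 * s) * (\<tau> * (u0 * r + u1 * s))"
  unfolding e(2) by (simp add: algebra_simps)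
 also have "\<dots> = (r * q - s * p) * c" unfolding e(1) c_def by (simp add: algebra_simps)
 finally have Wm: "(u0 * r + u1 * s) * M X V = (r * q - s * p) * c" .
 define G where "G = Matrix.mat 5 5 (\<lambda>(i, j). bil (PQ \<tau>) ([U, V, Y1, Y2, X] ! i) ([Z1, Z2, Y1, Y2, X] ! j))"
 have G: "G \<in> carrier_mat 5 5" unfolding G_def by simp
 have "Determinant.det (cmat [U, V, Y1, Y2, X]) * Determinant.det (to_mat (PQ \<tau>)) * DD = Determinant.det G"
  unfolding G_def DD_def by (rule det_gram_cmat)
 moreover have "Determinant.det (to_mat (PQ \<tau>)) = c0 * poly \<Delta> \<tau>" unfolding PQ_def by (rule det_pencil)
 \<comment> \<open>With the rows of \<open>V\<close> and \<open>X\<close> exchanged, the matrix is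
   block triangular with blocks of sizes 2, 2, 1: both \<open>M U = Q X\<close> and
   \<open>M X\<close> vanish on \<open>Y1\<close>, \<open>Y2\<close>, \<open>X\<close>.\<close>
 moreover have "Determinant.det G = - Determinant.det (swaprows 1 4 G)" using det_swaprows[of 1 5 4 G] G by simp
 moreover have "Determinant.det (swaprows 1 4 G) = (r * (q - \<tau> * s) - s * (p - \<tau> * r)) * (M Y1 Y1 * M Y2 Y2 - M Y1 Y2 * M Y1 Y2) * M X V"
 proof -
  define G' where "G' = swaprows 1 4 G"
  have G': "G' \<in> carrier_mat 5 5" unfolding G'_def using G by simp
  have MX: "M X w = bil P X w - \<tau> * bil Q X w" for w unfolding M_def bil_PQ ..
  have MXY: "M X Y1 = 0" "M X Y2 = 0" "M X X = 0" unfolding MX using X Y by simp_all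
  moreover have "M Y1 X = M X Y1" "M Y2 X = M X Y2" unfolding M_def by (rule bil_PQ_commute)+
  ultimately have MXY': "M Y1 X = 0" "M Y2 X = 0" by simp_all
  have row: "G' $$ (i, j) = M ([U, X, Y1, Y2, V] ! i) ([Z1, Z2, Y1, Y2, X] ! j)" if "i < 5" "j < 5" for i j
  using that G unfolding G'_def G_def less_5_cases M_def by (elim disjE) (simp_all add: numeral_eq_Suc)
  have "Determinant.det G' = (G' $$ (0, 0) * G' $$ (1, 1) - G' $$ (0, 1) * G' $$ (1, 0)) *
  (G' $$ (2, 2) * G' $$ (3, 3) - G' $$ (2, 3) * G' $$ (3, 2)) * G' $$ (4, 4)"
  proof (rule det_block_5[OF G'])
  fix i j :: nat assume "i < 2" "2 \<le> j" "j < 5"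
  then have "i = 0 \<or> i = 1" "j = 2 \<or> j = 3 \<or> j = 4" by auto
  then show "G' $$ (i, j) = 0" by (elim disjE) (simp_all add: row MXY MXY' MU X Y numeral_eq_Suc)
  qed (simp_all add: row MXY MXY' numeral_eq_Suc)
  also have "\<dots> = (r * (q - \<tau> * s) - s * (p - \<tau> * r)) * (M Y1 Y1 * M Y2 Y2 - M Y1 Y2 * M Y1 Y2) * M X V"
  proof -
  have "M Y2 Y1 = M Y1 Y2" "M V X = M X V" unfolding M_def by (rule bil_PQ_commute)+
  then show ?thesis by (simp add: row MU MX[of Z1] MX[of Z2] numeral_eq_Suc r_def s_def p_def q_def)
  qed
  finally show ?thesis unfolding G'_def .
 qed
 ultimately have E: "DD * c * (c0 * poly \<Delta> \<tau>) * DD = - ((r * q - s * p) * (M Y1 Y1 * M Y2 Y2 - (M Y1 Y2)\<^sup>2) * M X V)"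
  unfolding detN' by (simp add: power2_eq_square algebra_simps)
 define d D2 mv W0 pd where "d = r * q - s * p" and "D2 = M Y1 Y1 * M Y2 Y2 - (M Y1 Y2)\<^sup>2" and "mv = M X V"
  and "W0 = u0 * r + u1 * s" and "pd = poly \<Delta> \<tau>"
 note fold = d_def[symmetric] D2_def[symmetric] mv_def[symmetric] W0_def[symmetric] pd_def[symmetric]
 have E': "DD * c * (c0 * pd) * DD = - (d * D2 * mv)" using E unfolding fold .
 have Wm': "W0 * mv = d * c" using Wm unfolding fold .
 \<comment> \<open>\<open>c\<close> may be zero. The combination eliminates it without a division,
   and only \<open>mv\<close> is cancelled in the end.\<close>
 have "mv * (W0 * (c0 * pd * DD\<^sup>2) + d\<^sup>2 * D2) = (W0 * mv) * (c0 * pd * DD\<^sup>2) + d * (d * D2 * mv)"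
  by (simp add: power2_eq_square algebra_simps)
 also have "\<dots> = d * (DD * c * (c0 * pd) * DD) + d * (d * D2 * mv)" unfolding Wm' by (simp add: power2_eq_square algebra_simps)
 also have "\<dots> = 0" unfolding E' by simp
 finally have "W0 * (c0 * pd * DD\<^sup>2) + d\<^sup>2 * D2 = 0" using V unfolding mv_def by (simp only: mult_eq_0_iff) simp
 moreover have "W0 * pd = - poly (sq X) \<tau>" using W unfolding W1 fold .
 moreover have "W0 * (c0 * pd * DD\<^sup>2) = c0 * DD\<^sup>2 * (W0 * pd)" by simp
 ultimately have "d\<^sup>2 * D2 = c0 * DD\<^sup>2 * poly (sq X) \<tau>" by (simp add: add_eq_0_iff)
 then have "(r * q - s * p)\<^sup>2 * (M Y1 Y1 * M Y2 Y2 - (M Y1 Y2)\<^sup>2) = c0 * DD\<^sup>2 * poly (sq X) \<tau>"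
  unfolding d_def D2_def .
 then show ?thesis unfolding r_def s_def p_def q_def DD_def .
qed

text \<open>Both sides of the pointwise identity are polynomials in \<open>\<tau>\<close>. They
  agree off the finitely many roots of \<open>\<Delta>\<close>, so their coefficients agree.\<close>

lemma hessian_identity:
 assumes X: "bil Q X X = 0" "bil P X X = 0"
  and Y: "bil Q X Y1 = 0" "bil P X Y1 = 0" "bil Q X Y2 = 0" "bil P X Y2 = 0"
  and D: "Determinant.det (cmat [Z1, Z2, Y1, Y2, X]) \<noteq> 0"
 defines "d \<equiv> bil Q X Z1 * bil P X Z2 - bil Q X Z2 * bil P X Z1"
  and "K \<equiv> c0 * (Determinant.det (cmat [Z1, Z2, Y1, Y2, X]))\<^sup>2"
 shows "d\<^sup>2 * (bil Q Y1 Y1 * bil Q Y2 Y2 - (bil Q Y1 Y2)\<^sup>2) = K * coeff (sq X) 2"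
  and "d\<^sup>2 * (bil P Y1 Y1 * bil Q Y2 Y2 + bil Q Y1 Y1 * bil P Y2 Y2 - 2 * bil P Y1 Y2 * bil Q Y1 Y2) = - (K * coeff (sq X) 1)"
  and "d\<^sup>2 * (bil P Y1 Y1 * bil P Y2 Y2 - (bil P Y1 Y2)\<^sup>2) = K * coeff (sq X) 0"
proof -
 define p1 p2 p3 where "p1 = [:bil P Y1 Y1, - bil Q Y1 Y1:]" and "p2 = [:bil P Y2 Y2, - bil Q Y2 Y2:]" and "p3 = [:bil P Y1 Y2, - bil Q Y1 Y2:]"
 define L where "L = Polynomial.smult (d\<^sup>2) (p1 * p2 - p3 * p3) - Polynomial.smult K (sq X)"
 have "poly L \<tau> = 0" if "poly \<Delta> \<tau> \<noteq> 0" for \<tau>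
  using hessian_identity_at[OF X Y D that] unfolding L_def p1_def p2_def p3_def d_def K_def bil_PQ
  by (simp add: power2_eq_square algebra_simps)
 then have "UNIV - {\<tau>. poly \<Delta> \<tau> = 0} \<subseteq> {\<tau>. poly L \<tau> = 0}" by blast
 moreover have "infinite (UNIV - {\<tau>. poly \<Delta> \<tau> = 0})"
  using poly_roots_finite[OF \<Delta>_nz] infinite_UNIV_char_0 by (metis finite_Diff2)
 ultimately have "L = 0" using poly_roots_finite[of L] finite_subset by blast
 then have eq: "Polynomial.smult (d\<^sup>2) (p1 * p2 - p3 * p3) = Polynomial.smult K (sq X)" unfolding L_def by simp
 show "d\<^sup>2 * (bil Q Y1 Y1 * bil Q Y2 Y2 - (bil Q Y1 Y2)\<^sup>2) = K * coeff (sq X) 2"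
  "d\<^sup>2 * (bil P Y1 Y1 * bil Q Y2 Y2 + bil Q Y1 Y1 * bil P Y2 Y2 - 2 * bil P Y1 Y2 * bil Q Y1 Y2) = - (K * coeff (sq X) 1)"
  "d\<^sup>2 * (bil P Y1 Y1 * bil P Y2 Y2 - (bil P Y1 Y2)\<^sup>2) = K * coeff (sq X) 0"
  using arg_cong[OF eq, of "\<lambda>p. coeff p 2"] arg_cong[OF eq, of "\<lambda>p. coeff p 1"] arg_cong[OF eq, of "\<lambda>p. coeff p 0"]
  unfolding p1_def p2_def p3_def by (simp_all add: power2_eq_square numeral_2_eq_2 algebra_simps)
qed

end

section \<open>Derivatives of vector-valued functions in a chart\<close>

lemma affine_comb_deriv:
 assumes "holomorphic2_on F U" "holomorphic2_on G U"
 shows "holomorphic2_on (\<lambda>q. a + fst q * b + snd q * c + F q * d + G q * e) U"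
  and "q \<in> U \<Longrightarrow> dx (\<lambda>q. a + fst q * b + snd q * c + F q * d + G q * e) q = b + dx F q * d + dx G q * e"
  and "q \<in> U \<Longrightarrow> dy (\<lambda>q. a + fst q * b + snd q * c + F q * d + G q * e) q = c + dy F q * d + dy G q * e"
proof -
 have o: "open U" using assms(1) by (rule holo2_open)
 show "holomorphic2_on (\<lambda>q. a + fst q * b + snd q * c + F q * d + G q * e) U"
  by (intro holo2_add holo2_mult holo2_const holo2_fst holo2_snd assms o)
 have *: "((\<lambda>q. a + fst q * b + snd q * c + F q * d + G q * e) has_derivative
  (\<lambda>(s, t). (b + dx F q * d + dx G q * e) * s + (c + dy F q * d + dy G q * e) * t)) (at q)" if q: "q \<in> U"
  by (rule has_derivative_eq_rhs, (rule derivative_intros holo2D[OF assms(1) q] holo2D[OF assms(2) q])+)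
  (simp add: fun_eq_iff algebra_simps)
 show "q \<in> U \<Longrightarrow> dx (\<lambda>q. a + fst q * b + snd q * c + F q * d + G q * e) q = b + dx F q * d + dx G q * e"
  "q \<in> U \<Longrightarrow> dy (\<lambda>q. a + fst q * b + snd q * c + F q * d + G q * e) q = c + dy F q * d + dy G q * e"
  using has_derivative_dx_dy(3,4)[OF *] by blast+
qed

definition vholo :: "(complex \<times> complex \<Rightarrow> complex^5) \<Rightarrow> (complex \<times> complex) set \<Rightarrow> bool" where
 "vholo Y U \<longleftrightarrow> open U \<and> (\<forall>i. holomorphic2_on (\<lambda>q. Y q $ i) U)"

definition vdx :: "(complex \<times> complex \<Rightarrow> complex^5) \<Rightarrow> complex \<times> complex \<Rightarrow> complex^5" where
 "vdx Y q = (\<chi> i. dx (\<lambda>q. Y q $ i) q)"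

definition vdy :: "(complex \<times> complex \<Rightarrow> complex^5) \<Rightarrow> complex \<times> complex \<Rightarrow> complex^5" where
 "vdy Y q = (\<chi> i. dy (\<lambda>q. Y q $ i) q)"

lemma vholo_const: "open U \<Longrightarrow> vholo (\<lambda>_. v) U"
 unfolding vholo_def by (simp add: holo2_const)

lemma bil_holo:
 assumes "vholo Y U" "vholo Z U"
 shows "holomorphic2_on (\<lambda>q. bil M (Y q) (Z q)) U"
 using assms unfolding vholo_def bil_def
 by (intro holo2_sum holo2_mult holo2_const) auto

lemma bil_deriv:
 assumes Y: "vholo Y U" and Z: "vholo Z U" and q: "q \<in> U"
 shows "dx (\<lambda>q. bil M (Y q) (Z q)) q = bil M (vdx Y q) (Z q) + bil M (Y q) (vdx Z q)"
  and "dy (\<lambda>q. bil M (Y q) (Z q)) q = bil M (vdy Y q) (Z q) + bil M (Y q) (vdy Z q)"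
proof -
 have o: "open U" and hY: "holomorphic2_on (\<lambda>q. Y q $ i) U" and hZ: "holomorphic2_on (\<lambda>q. Z q $ i) U" for i
  using Y Z unfolding vholo_def by auto
 have hYM: "holomorphic2_on (\<lambda>q. Y q $ i * M $ i $ j) U" for i j
  by (intro holo2_mult hY holo2_const o)
 have t: "holomorphic2_on (\<lambda>q. Y q $ i * M $ i $ j * Z q $ j) U" for i j
  by (intro holo2_mult hYM hZ)
 have s: "holomorphic2_on (\<lambda>q. \<Sum>j\<in>UNIV. Y q $ i * M $ i $ j * Z q $ j) U" for i
  by (intro holo2_sum o t)
 have cd: "holomorphic2_on (\<lambda>q. c) U" for c by (rule holo2_const[OF o])
 have m: "dx (\<lambda>q. Y q $ i * M $ i $ j * Z q $ j) q = dx (\<lambda>q. Y q $ i) q * M $ i $ j * Z q $ j + Y q $ i * M $ i $ j * dx (\<lambda>q. Z q $ j) q"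
  "dy (\<lambda>q. Y q $ i * M $ i $ j * Z q $ j) q = dy (\<lambda>q. Y q $ i) q * M $ i $ j * Z q $ j + Y q $ i * M $ i $ j * dy (\<lambda>q. Z q $ j) q" for i j
  by (simp_all add: dx_dy_mult[OF hYM hZ q] dx_dy_mult[OF hY cd q] dx_dy_const)
 show "dx (\<lambda>q. bil M (Y q) (Z q)) q = bil M (vdx Y q) (Z q) + bil M (Y q) (vdx Z q)"
  unfolding bil_def dx_dy_sum(1)[OF o s q] dx_dy_sum(1)[OF o t q] m vdx_def vec_lambda_beta by (simp add: sum.distrib)
 show "dy (\<lambda>q. bil M (Y q) (Z q)) q = bil M (vdy Y q) (Z q) + bil M (Y q) (vdy Z q)"
  unfolding bil_def dx_dy_sum(2)[OF o s q] dx_dy_sum(2)[OF o t q] m vdy_def vec_lambda_beta by (simp add: sum.distrib)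
qed

lemma bil_deriv_zero:
 assumes "vholo Y U" "vholo Z U" "q \<in> U" "\<And>r. r \<in> U \<Longrightarrow> bil M (Y r) (Z r) = 0"
 shows "bil M (vdx Y q) (Z q) + bil M (Y q) (vdx Z q) = 0"
  and "bil M (vdy Y q) (Z q) + bil M (Y q) (vdy Z q) = 0"
proof -
 have "open U" using assms(1) unfolding vholo_def by blast
 then have h: "holomorphic2_on (\<lambda>_. 0) U" by (rule holo2_const)
 from dx_dy_cong[OF h, of "\<lambda>q. bil M (Y q) (Z q)" q] assms
 show "bil M (vdx Y q) (Z q) + bil M (Y q) (vdx Z q) = 0" "bil M (vdy Y q) (Z q) + bil M (Y q) (vdy Z q) = 0"
  by (simp_all add: dx_dy_const bil_deriv[OF assms(1-3)])
qed

lemma affine_comb_vholo: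
 fixes wa wb wc wd we :: "complex^5"
 assumes "holomorphic2_on F U" "holomorphic2_on G U"
 defines "Y \<equiv> (\<lambda>q. wa + fst q *s wb + snd q *s wc + F q *s wd + G q *s we)"
 shows "vholo Y U" and "q \<in> U \<Longrightarrow> vdx Y q = wb + dx F q *s wd + dx G q *s we"
  and "q \<in> U \<Longrightarrow> vdy Y q = wc + dy F q *s wd + dy G q *s we"
 unfolding vholo_def vdx_def vdy_def Y_def
 using affine_comb_deriv[OF assms(1,2)] holo2_open[OF assms(1)]
 by (auto simp: cart_eq_iff)

section \<open>The frame of a chart and its second fundamental form\<close>

locale pencil_chart = pencil_roots +
 fixes S :: "5 proj set" and A :: "complex^5^5" and U :: "(complex \<times> complex) set"
  and F G :: "complex \<times> complex \<Rightarrow> complex"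
 assumes S_eq: "S = zero_locus {quadratic_form P, quadratic_form Q}"
  and chart: "graph_chart S A U F G"
begin

definition cl :: "5 \<Rightarrow> complex^5" where
 "cl i = A *v axis i 1"

definition X :: "complex \<times> complex \<Rightarrow> complex^5" where
 "X q = A *v vector [1, fst q, snd q, F q, G q]"

definition Xx :: "complex \<times> complex \<Rightarrow> complex^5" where
 "Xx q = cl 2 + dx F q *s cl 4 + dx G q *s cl 5"

definition Xy :: "complex \<times> complex \<Rightarrow> complex^5" where
 "Xy q = cl 3 + dy F q *s cl 4 + dy G q *s cl 5"

lemma hF: "holomorphic2_on F U" and hG: "holomorphic2_on G U" and invA: "invertible A"
 using chart unfolding graph_chart_def by auto

lemma openU: "open U"
 using hF by (rule holo2_open)

lemma A_comb: "A *v x = x $ 1 *s cl 1 + x $ 2 *s cl 2 + x $ 3 *s cl 3 + x $ 4 *s cl 4 + x $ 5 *s cl 5"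
proof -
 have "x = x $ 1 *s axis 1 1 + x $ 2 *s axis 2 1 + x $ 3 *s axis 3 1 + x $ 4 *s axis 4 1 + x $ 5 *s axis 5 1"
  unfolding vec5_eq_iff by (simp add: axis_def)
 then have "A *v x = A *v (x $ 1 *s axis 1 1 + x $ 2 *s axis 2 1 + x $ 3 *s axis 3 1 + x $ 4 *s axis 4 1 + x $ 5 *s axis 5 1)"
  by (rule arg_cong)
 then show ?thesis unfolding cl_def by (simp only: matrix_vector_right_distrib vector_scalar_commute)
qed

lemma X_comb: "X q = cl 1 + fst q *s cl 2 + snd q *s cl 3 + F q *s cl 4 + G q *s cl 5"
 unfolding X_def A_comb vector_5 by simp

lemma A_inj: "A *v x = 0 \<Longrightarrow> x = 0"
 using invA by (metis invertible_def matrix_left_invertible_ker)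

lemma X_nonzero: "X q \<noteq> 0"
proof
 assume "X q = 0"
 then have "vector [1, fst q, snd q, F q, G q] = (0 :: complex^5)" unfolding X_def by (rule A_inj)
 then have "(vector [1, fst q, snd q, F q, G q] :: complex^5) $ 1 = 0" by simp
 then show False unfolding vector_5 by simp
qed

lemma graph_pt_X: "graph_pt A F G q = pt (X q)"
 unfolding graph_pt_def affine_pt_def X_def ..

lemma mem_S: "v \<noteq> 0 \<Longrightarrow> pt v \<in> S \<longleftrightarrow> onS v"
proof -
 assume "v \<noteq> 0"
 have "\<forall>f\<in>{quadratic_form P, quadratic_form Q}. \<exists>d. form d f" using form_quadratic by blast
 from mem_zero_locus[OF this \<open>v \<noteq> 0\<close>] show ?thesis unfolding S_eq onS_def by (auto simp: quadratic_form_bil)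
qed

lemma onS_X: "q \<in> U \<Longrightarrow> onS (X q)"
proof -
 assume q: "q \<in> U"
 obtain W where W: "{(x, y, z, w) \<in> W. affine_pt A x y z w \<in> S} = {(x, y, z, w). (x, y) \<in> U \<and> z = F (x, y) \<and> w = G (x, y)}"
  using chart unfolding graph_chart_def by blast
 have "(fst q, snd q, F q, G q) \<in> {(x, y, z, w). (x, y) \<in> U \<and> z = F (x, y) \<and> w = G (x, y)}" using q by simp
 then have "(fst q, snd q, F q, G q) \<in> {(x, y, z, w) \<in> W. affine_pt A x y z w \<in> S}" unfolding W .
 then have "pt (X q) \<in> S" unfolding X_def affine_pt_def by simp
 then show ?thesis using mem_S[OF X_nonzero] by blast
qed

lemma vholo_X: "vholo X U"
 and vdx_X: "q \<in> U \<Longrightarrow> vdx X q = Xx q" and vdy_X: "q \<in> U \<Longrightarrow> vdy X q = Xy q"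
proof -
 have X: "X = (\<lambda>q. cl 1 + fst q *s cl 2 + snd q *s cl 3 + F q *s cl 4 + G q *s cl 5)"
  by (rule ext) (rule X_comb)
 show "vholo X U" "q \<in> U \<Longrightarrow> vdx X q = Xx q" "q \<in> U \<Longrightarrow> vdy X q = Xy q"
  unfolding X Xx_def Xy_def using affine_comb_vholo[OF hF hG] by blast+
qed

lemma tangent:
 assumes "q \<in> U"
 shows "bil Q (X q) (X q) = 0" "bil P (X q) (X q) = 0" "bil Q (X q) (Xx q) = 0" "bil P (X q) (Xx q) = 0"
  "bil Q (X q) (Xy q) = 0" "bil P (X q) (Xy q) = 0"
proof -
 have z: "bil Q (X r) (X r) = 0" "bil P (X r) (X r) = 0" if "r \<in> U" for r
  using onS_X[OF that] unfolding onS_def by auto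
 show "bil Q (X q) (X q) = 0" "bil P (X q) (X q) = 0" using z assms by auto
 show "bil Q (X q) (Xx q) = 0" "bil P (X q) (Xx q) = 0" "bil Q (X q) (Xy q) = 0" "bil P (X q) (Xy q) = 0"
  using bil_deriv_zero[OF vholo_X vholo_X assms, of Q] bil_deriv_zero[OF vholo_X vholo_X assms, of P] z
  bil_commute[OF symQ] bil_commute[OF symP]
  by (simp_all add: vdx_X[OF assms] vdy_X[OF assms] bil_commute[OF symQ, of _ "X q"] bil_commute[OF symP, of _ "X q"])
qed

definition D0 :: complex where
 "D0 = Determinant.det (cmat [cl 4, cl 5, cl 2, cl 3, cl 1])"

lemma D0_nz: "D0 \<noteq> 0"
 unfolding D0_def
proof (rule det_cmat_nonzeroI)
 fix x0 x1 x2 x3 x4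
 assume *: "x0 *s cl 4 + x1 *s cl 5 + x2 *s cl 2 + x3 *s cl 3 + x4 *s cl 1 = 0"
 have "A *v vector [x4, x2, x3, x0, x1] = x0 *s cl 4 + x1 *s cl 5 + x2 *s cl 2 + x3 *s cl 3 + x4 *s cl 1"
  unfolding A_comb vector_5 by (simp add: ac_simps)
 then have "vector [x4, x2, x3, x0, x1] = (0 :: complex^5)" using A_inj * by simp
 then show "x0 = 0 \<and> x1 = 0 \<and> x2 = 0 \<and> x3 = 0 \<and> x4 = 0"
  unfolding vec5_eq_iff vector_5 by simp
qed

text \<open>The frame arises from the coordinate basis by a unipotent triangular matrix, so its
  determinant is the same at all points of the chart.\<close>

lemma det_frame: "Determinant.det (cmat [cl 4, cl 5, Xx q, Xy q, X q]) = D0"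
proof -
 define C where "C = Matrix.mat 5 5 (\<lambda>(i, j). [[1, 0, dx F q, dy F q, F q], [0, 1, dx G q, dy G q, G q],
  [0, 0, 1, 0, fst q], [0, 0, 0, 1, snd q], [0, 0, 0, 0, 1]] ! i ! j)"
 have C: "C \<in> carrier_mat 5 5" unfolding C_def by simp
 have "Determinant.det (cmat [cl 4, cl 5, Xx q, Xy q, X q]) = D0 * Determinant.det C" unfolding D0_def
 proof (rule cmat_mult[OF C])
  fix j :: nat assume "j < 5"
  then show "[cl 4, cl 5, Xx q, Xy q, X q] ! j = (\<Sum>k = 0..<5. C $$ (k, j) *s [cl 4, cl 5, cl 2, cl 3, cl 1] ! k)"
  unfolding less_5_cases by (elim disjE) (simp_all add: C_def sum_0_5 Xx_def Xy_def X_comb numeral_eq_Suc ac_simps)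
 qed
 also have "Determinant.det C = prod_list (diag_mat C)"
 proof (rule det_upper_triangular[OF _ C])
  have "C $$ (i, j) = 0" if "j < i" "i < 5" for i j
  proof -
  have "i = 0 \<or> i = 1 \<or> i = 2 \<or> i = 3 \<or> i = 4" "j = 0 \<or> j = 1 \<or> j = 2 \<or> j = 3 \<or> j = 4" using that by auto
  then show ?thesis using that by (elim disjE) (simp_all add: C_def numeral_eq_Suc)
  qed
  then show "upper_triangular C" unfolding upper_triangular_def using C by auto
 qed
 also have "diag_mat C = [1, 1, 1, 1, 1]"
  unfolding diag_mat_def using C by (simp add: C_def upt_rec numeral_eq_Suc)
 finally show ?thesis by simp
qed

lemma frame_basis:
 obtains x0 x1 x2 x3 x4 where "v = x0 *s cl 4 + x1 *s cl 5 + x2 *s Xx q + x3 *s Xy q + x4 *s X q"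
 using cmat_basis[of "cl 4" "cl 5" "Xx q" "Xy q" "X q" v] D0_nz det_frame by auto

text \<open>Up to a factor two, \<open>rr\<close>, \<open>ss\<close>, \<open>pp\<close>,
  \<open>qq\<close> are the derivatives of the two quadrics with respect to the last two affine
  coordinates, and \<open>dd\<close> is the Jacobian determinant of the equations with respect to
  them.\<close>

definition rr where "rr q = bil Q (X q) (cl 4)"
definition ss where "ss q = bil Q (X q) (cl 5)"
definition pp where "pp q = bil P (X q) (cl 4)"
definition qq where "qq q = bil P (X q) (cl 5)"
definition dd where "dd q = rr q * qq q - ss q * pp q"

lemma holo_J: "holomorphic2_on rr U" "holomorphic2_on ss U" "holomorphic2_on pp U" "holomorphic2_on qq U" "holomorphic2_on dd U"
proof -
 have "holomorphic2_on (\<lambda>q. bil M (X q) v) U" for M v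
  by (rule bil_holo[OF vholo_X vholo_const[OF openU]])
 then show "holomorphic2_on rr U" "holomorphic2_on ss U" "holomorphic2_on pp U" "holomorphic2_on qq U"
  unfolding rr_def[abs_def] ss_def[abs_def] pp_def[abs_def] qq_def[abs_def] by auto
 then show "holomorphic2_on dd U" unfolding dd_def[abs_def] by (intro holo2_diff holo2_mult)
qed

text \<open>The differentials of both quadrics vanish on \<open>X\<close>, \<open>Xx\<close> and
  \<open>Xy\<close>, so their independence can be tested on the two remaining frame vectors
  \<open>cl 4\<close> and \<open>cl 5\<close>.\<close>

lemma nonsing_dd:
 assumes "q \<in> U"
 shows "nonsing (X q) \<longleftrightarrow> dd q \<noteq> 0"
proof
 assume n: "nonsing (X q)"
 show "dd q \<noteq> 0"
 proof
  assume d: "dd q = 0"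
  have "\<exists>\<alpha> \<beta>. (\<alpha> \<noteq> 0 \<or> \<beta> \<noteq> 0) \<and> \<alpha> * rr q + \<beta> * pp q = 0 \<and> \<alpha> * ss q + \<beta> * qq q = 0"
  proof (cases "pp q = 0 \<and> rr q = 0")
  case True
  show ?thesis
  proof (cases "qq q = 0 \<and> ss q = 0")
  case True
  with \<open>pp q = 0 \<and> rr q = 0\<close> show ?thesis by (intro exI[of _ 1] exI[of _ 0]) auto
  next
  case False
  with True show ?thesis by (intro exI[of _ "qq q"] exI[of _ "- ss q"]) (auto simp: mult.commute)
  qed
  next
  case False
  then show ?thesis using d unfolding dd_def by (intro exI[of _ "pp q"] exI[of _ "- rr q"]) (auto simp: algebra_simps)
  qed
  then obtain \<alpha> \<beta> where ab: "\<alpha> \<noteq> 0 \<or> \<beta> \<noteq> 0" "\<alpha> * rr q + \<beta> * pp q = 0" "\<alpha> * ss q + \<beta> * qq q = 0" by blast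
  have "\<alpha> * bil Q (X q) w + \<beta> * bil P (X q) w = 0" for w
  proof -
  obtain x0 x1 x2 x3 x4 where w: "w = x0 *s cl 4 + x1 *s cl 5 + x2 *s Xx q + x3 *s Xy q + x4 *s X q"
  using frame_basis by blast
  have "\<alpha> * bil Q (X q) w + \<beta> * bil P (X q) w = x0 * (\<alpha> * rr q + \<beta> * pp q) + x1 * (\<alpha> * ss q + \<beta> * qq q)"
  unfolding w by (simp add: bil_simps tangent[OF assms] rr_def ss_def pp_def qq_def algebra_simps)
  then show ?thesis using ab by simp
  qed
  with n ab(1) show False unfolding nonsing_def by blast
 qed
next
 assume d: "dd q \<noteq> 0"
 show "nonsing (X q)" unfolding nonsing_def
 proof (intro allI impI)
  fix \<alpha> \<beta> assume *: "\<forall>w. \<alpha> * bil Q (X q) w + \<beta> * bil P (X q) w = 0"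
  have e: "\<alpha> * rr q + \<beta> * pp q = 0" "\<alpha> * ss q + \<beta> * qq q = 0"
  using *[rule_format, of "cl 4"] *[rule_format, of "cl 5"] unfolding rr_def ss_def pp_def qq_def by auto
  have "\<alpha> * dd q = qq q * (\<alpha> * rr q + \<beta> * pp q) - pp q * (\<alpha> * ss q + \<beta> * qq q)"
  "\<beta> * dd q = rr q * (\<alpha> * ss q + \<beta> * qq q) - ss q * (\<alpha> * rr q + \<beta> * pp q)"
  unfolding dd_def by (simp_all add: algebra_simps)
  then have "\<alpha> * dd q = 0" "\<beta> * dd q = 0" unfolding e by simp_all
  then show "\<alpha> = 0 \<and> \<beta> = 0" using d by simp
 qed
qed

lemma tangent_space:
 assumes q: "q \<in> U" "dd q \<noteq> 0" and w: "bil Q (X q) w = 0" "bil P (X q) w = 0"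
 obtains \<alpha> \<beta> \<gamma> where "w = \<alpha> *s X q + \<beta> *s Xx q + \<gamma> *s Xy q"
proof -
 obtain x0 x1 x2 x3 x4 where we: "w = x0 *s cl 4 + x1 *s cl 5 + x2 *s Xx q + x3 *s Xy q + x4 *s X q"
  using frame_basis by blast
 have e: "x0 * rr q + x1 * ss q = 0" "x0 * pp q + x1 * qq q = 0"
  using w unfolding we by (simp_all add: bil_simps tangent[OF q(1)] rr_def ss_def pp_def qq_def)
 have "x0 * dd q = qq q * (x0 * rr q + x1 * ss q) - ss q * (x0 * pp q + x1 * qq q)"
  "x1 * dd q = rr q * (x0 * pp q + x1 * qq q) - pp q * (x0 * rr q + x1 * ss q)"
  unfolding dd_def by (simp_all add: algebra_simps)
 then have "x0 * dd q = 0" "x1 * dd q = 0" unfolding e by simp_all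
 then have "x0 = 0" "x1 = 0" using q(2) by simp_all
 then show thesis using that[of x4 x2 x3] we by (simp add: ac_simps)
qed

definition V where "V = {q \<in> U. dd q \<noteq> 0}"

lemma openV: "open V" and V_U: "V \<subseteq> U"
 unfolding V_def using open_nonzero[OF openU holo2_continuous[OF holo_J(5)]] by auto

text \<open>Cramer's rule, applied to the tangency equations, expresses the first derivatives of
  \<open>F\<close> and \<open>G\<close> by holomorphic functions divided by \<open>dd\<close>. This
  is how second derivatives become available.\<close>

lemma holo_first:
 "holomorphic2_on (dx F) V" "holomorphic2_on (dx G) V" "holomorphic2_on (dy F) V" "holomorphic2_on (dy G) V"
proof -
 have h: "holomorphic2_on (\<lambda>q. bil M (X q) v) V" for M v
  by (rule holo2_subset[OF bil_holo[OF vholo_X vholo_const[OF openU]] openV V_U])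
 have J: "holomorphic2_on rr V" "holomorphic2_on ss V" "holomorphic2_on pp V" "holomorphic2_on qq V" "holomorphic2_on dd V"
  using holo_J holo2_subset[OF _ openV V_U] by auto
 have solve: "holomorphic2_on f V \<and> holomorphic2_on g V"
  if e: "\<And>q. q \<in> V \<Longrightarrow> bil Q (X q) v + f q * rr q + g q * ss q = 0" "\<And>q. q \<in> V \<Longrightarrow> bil P (X q) v + f q * pp q + g q * qq q = 0" for f g v
 proof
  have nz: "\<And>q. q \<in> V \<Longrightarrow> dd q \<noteq> 0" unfolding V_def by blast
  have fe: "(ss q * bil P (X q) v - qq q * bil Q (X q) v) / dd q = f q"
  and ge: "(pp q * bil Q (X q) v - rr q * bil P (X q) v) / dd q = g q" if "q \<in> V" for q
  proof -
  have "f q * dd q = qq q * (bil Q (X q) v + f q * rr q + g q * ss q) - ss q * (bil P (X q) v + f q * pp q + g q * qq q)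
  + (ss q * bil P (X q) v - qq q * bil Q (X q) v)"
  "g q * dd q = rr q * (bil P (X q) v + f q * pp q + g q * qq q) - pp q * (bil Q (X q) v + f q * rr q + g q * ss q)
  + (pp q * bil Q (X q) v - rr q * bil P (X q) v)"
  unfolding dd_def by (simp_all add: algebra_simps)
  then show "(ss q * bil P (X q) v - qq q * bil Q (X q) v) / dd q = f q"
  "(pp q * bil Q (X q) v - rr q * bil P (X q) v) / dd q = g q"
  unfolding e[OF that] using nz[OF that] by (simp_all add: divide_eq_eq)
  qed
  show "holomorphic2_on f V"
  by (rule holo2_cong[OF _ fe]) (intro holo2_divide holo2_diff holo2_mult J h nz)
  show "holomorphic2_on g V"
  by (rule holo2_cong[OF _ ge]) (intro holo2_divide holo2_diff holo2_mult J h nz)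
 qed
 have "bil Q (X q) (cl 2) + dx F q * rr q + dx G q * ss q = 0" "bil P (X q) (cl 2) + dx F q * pp q + dx G q * qq q = 0"
  "bil Q (X q) (cl 3) + dy F q * rr q + dy G q * ss q = 0" "bil P (X q) (cl 3) + dy F q * pp q + dy G q * qq q = 0" if "q \<in> V" for q
  using tangent(3-6)[of q] V_U that unfolding Xx_def Xy_def rr_def ss_def pp_def qq_def
  by (auto simp: bil_simps)
 then show "holomorphic2_on (dx F) V" "holomorphic2_on (dx G) V" "holomorphic2_on (dy F) V" "holomorphic2_on (dy G) V"
  using solve[of "cl 2" "dx F" "dx G"] solve[of "cl 3" "dy F" "dy G"] by blast+
qed

lemma vholo_first: "vholo Xx V" "vholo Xy V"
 and second: "q \<in> V \<Longrightarrow> vdx Xx q = dx (dx F) q *s cl 4 + dx (dx G) q *s cl 5"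
  "q \<in> V \<Longrightarrow> vdx Xy q = dx (dy F) q *s cl 4 + dx (dy G) q *s cl 5"
  "q \<in> V \<Longrightarrow> vdy Xy q = dy (dy F) q *s cl 4 + dy (dy G) q *s cl 5"
proof -
 have Xx': "Xx = (\<lambda>q. cl 2 + fst q *s 0 + snd q *s 0 + dx F q *s cl 4 + dx G q *s cl 5)"
  and Xy': "Xy = (\<lambda>q. cl 3 + fst q *s 0 + snd q *s 0 + dy F q *s cl 4 + dy G q *s cl 5)"
  unfolding Xx_def[abs_def] Xy_def[abs_def] by simp_all
 show "vholo Xx V" "vholo Xy V"
  "q \<in> V \<Longrightarrow> vdx Xx q = dx (dx F) q *s cl 4 + dx (dx G) q *s cl 5"
  "q \<in> V \<Longrightarrow> vdx Xy q = dx (dy F) q *s cl 4 + dx (dy G) q *s cl 5"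
  "q \<in> V \<Longrightarrow> vdy Xy q = dy (dy F) q *s cl 4 + dy (dy G) q *s cl 5"
  unfolding Xx' Xy' using affine_comb_vholo[OF holo_first(1,2), where wa = "cl 2" and wb = 0 and wc = 0 and wd = "cl 4" and we = "cl 5"]
  affine_comb_vholo[OF holo_first(3,4), where wa = "cl 3" and wb = 0 and wc = 0 and wd = "cl 4" and we = "cl 5"] by simp_all
qed

text \<open>Differentiating the tangency relations trades the values of the quadratic forms on
  tangent vectors for second derivatives of \<open>X\<close>, which lie in the span of
  \<open>cl 4\<close> and \<open>cl 5\<close>.\<close>

lemma second_fundamental:
 assumes q: "q \<in> V"
 shows "bil Q (Xx q) (Xx q) = - (rr q * dx (dx F) q + ss q * dx (dx G) q)"
  "bil Q (Xx q) (Xy q) = - (rr q * dx (dy F) q + ss q * dx (dy G) q)"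
  "bil Q (Xy q) (Xy q) = - (rr q * dy (dy F) q + ss q * dy (dy G) q)"
  "bil P (Xx q) (Xx q) = - (pp q * dx (dx F) q + qq q * dx (dx G) q)"
  "bil P (Xx q) (Xy q) = - (pp q * dx (dy F) q + qq q * dx (dy G) q)"
  "bil P (Xy q) (Xy q) = - (pp q * dy (dy F) q + qq q * dy (dy G) q)"
proof -
 have XV: "vholo X V" using vholo_X openV V_U holo2_subset unfolding vholo_def by blast
 have qU: "q \<in> U" using q V_U by blast
 have t: "\<And>r. r \<in> V \<Longrightarrow> r \<in> U" using V_U by blast
 note b = bil_deriv_zero[OF XV vholo_first(1) q] bil_deriv_zero[OF XV vholo_first(2) q]
 have "bil M (Xx q) (Xx q) + bil M (X q) (vdx Xx q) = 0" "bil M (Xx q) (Xy q) + bil M (X q) (vdx Xy q) = 0"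
  "bil M (Xy q) (Xy q) + bil M (X q) (vdy Xy q) = 0" if "M = Q \<or> M = P" for M
  using b[of M] tangent(3-6)[OF t] that unfolding vdx_X[OF qU] vdy_X[OF qU] by auto
 from this[of Q] this[of P] show
  "bil Q (Xx q) (Xx q) = - (rr q * dx (dx F) q + ss q * dx (dx G) q)"
  "bil Q (Xx q) (Xy q) = - (rr q * dx (dy F) q + ss q * dx (dy G) q)"
  "bil Q (Xy q) (Xy q) = - (rr q * dy (dy F) q + ss q * dy (dy G) q)"
  "bil P (Xx q) (Xx q) = - (pp q * dx (dx F) q + qq q * dx (dx G) q)"
  "bil P (Xx q) (Xy q) = - (pp q * dx (dy F) q + qq q * dx (dy G) q)"
  "bil P (Xy q) (Xy q) = - (pp q * dy (dy F) q + qq q * dy (dy G) q)"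
  unfolding second[OF q] rr_def ss_def pp_def qq_def eq_neg_iff_add_eq_0 by (simp_all add: bil_simps mult.commute)
qed

definition KK where "KK = c0 * D0\<^sup>2"

lemma KK_nz: "KK \<noteq> 0"
 unfolding KK_def using c0 D0_nz by simp

text \<open>The second fundamental forms of the two quadrics arise from the Hessian matrices of
  \<open>F\<close> and \<open>G\<close> by the matrix of \<open>rr\<close>, \<open>ss\<close>,
  \<open>pp\<close>, \<open>qq\<close>. One factor \<open>dd^2\<close> on the left comes from the
  Gram identity, the other from inverting this substitution in a quadratic expression.\<close>

lemma H_formula:
 assumes q: "q \<in> V" and H: "H_coeffs F G = (Ha, Hb, Hc)"
 defines "a \<equiv> coeff (sq (X q)) 2" and "b \<equiv> coeff (sq (X q)) 1" and "c \<equiv> coeff (sq (X q)) 0"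
 shows "dd q ^ 4 * Ha q = KK * (a * (qq q)\<^sup>2 + b * qq q * ss q + c * (ss q)\<^sup>2)"
  "dd q ^ 4 * Hb q = - KK * (2 * a * pp q * qq q + b * (pp q * ss q + qq q * rr q) + 2 * c * rr q * ss q)"
  "dd q ^ 4 * Hc q = KK * (a * (pp q)\<^sup>2 + b * pp q * rr q + c * (rr q)\<^sup>2)"
proof -
 define f1 f2 f3 g1 g2 g3 where "f1 = dx (dx F) q" and "f2 = dx (dy F) q" and "f3 = dy (dy F) q"
  and "g1 = dx (dx G) q" and "g2 = dx (dy G) q" and "g3 = dy (dy G) q"
 have qU: "q \<in> U" using q V_U by blast
 have Hq: "Ha q = f1 * f3 - f2\<^sup>2" "Hb q = f1 * g3 + g1 * f3 - 2 * f2 * g2" "Hc q = g1 * g3 - g2\<^sup>2"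
  using H unfolding H_coeffs_def f1_def f2_def f3_def g1_def g2_def g3_def by auto
 define r s p t d where "r = rr q" and "s = ss q" and "p = pp q" and "t = qq q" and "d = dd q"
 have d: "d = r * t - s * p" unfolding d_def dd_def r_def s_def p_def t_def ..
 have D: "Determinant.det (cmat [cl 4, cl 5, Xx q, Xy q, X q]) \<noteq> 0" using D0_nz det_frame by simp
 have dd: "bil Q (X q) (cl 4) * bil P (X q) (cl 5) - bil Q (X q) (cl 5) * bil P (X q) (cl 4) = d"
  unfolding d_def dd_def rr_def ss_def pp_def qq_def ..
 have e1: "d\<^sup>2 * ((r * f1 + s * g1) * (r * f3 + s * g3) - (r * f2 + s * g2)\<^sup>2) = KK * a"
  and e2: "d\<^sup>2 * ((p * f1 + t * g1) * (r * f3 + s * g3) + (r * f1 + s * g1) * (p * f3 + t * g3) - 2 * (p * f2 + t * g2) * (r * f2 + s * g2)) = - (KK * b)"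
  and e3: "d\<^sup>2 * ((p * f1 + t * g1) * (p * f3 + t * g3) - (p * f2 + t * g2)\<^sup>2) = KK * c"
  using hessian_identity[OF tangent[OF qU] D]
  unfolding dd det_frame second_fundamental[OF q] KK_def a_def b_def c_def
  unfolding f1_def f2_def f3_def g1_def g2_def g3_def r_def s_def p_def t_def
  by (simp_all only: mult_minus_left mult_minus_right minus_minus power2_minus)
 define E1 E2 E3 where "E1 = (r * f1 + s * g1) * (r * f3 + s * g3) - (r * f2 + s * g2)\<^sup>2"
  and "E2 = (p * f1 + t * g1) * (r * f3 + s * g3) + (r * f1 + s * g1) * (p * f3 + t * g3) - 2 * (p * f2 + t * g2) * (r * f2 + s * g2)"
  and "E3 = (p * f1 + t * g1) * (p * f3 + t * g3) - (p * f2 + t * g2)\<^sup>2"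
 have E: "KK * a = d\<^sup>2 * E1" "KK * b = - (d\<^sup>2 * E2)" "KK * c = d\<^sup>2 * E3"
  using e1 e2 e3 unfolding E1_def E2_def E3_def by simp_all
 have d4: "d ^ 4 * x = d\<^sup>2 * (d\<^sup>2 * x)" for x by (simp add: power2_eq_square power4_eq_xxxx)
 have i0: "d\<^sup>2 * (f1 * f3 - f2\<^sup>2) = E1 * t\<^sup>2 - E2 * t * s + E3 * s\<^sup>2"
  unfolding E1_def E2_def E3_def d by (simp add: power2_eq_square algebra_simps)
 have "d ^ 4 * (f1 * f3 - f2\<^sup>2) = (d\<^sup>2 * E1) * t\<^sup>2 + - (d\<^sup>2 * E2) * t * s + (d\<^sup>2 * E3) * s\<^sup>2"
  unfolding d4 i0 by (simp add: algebra_simps)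
 then show "dd q ^ 4 * Ha q = KK * (a * (qq q)\<^sup>2 + b * qq q * ss q + c * (ss q)\<^sup>2)"
  unfolding E[symmetric] unfolding Hq d_def t_def s_def by (simp add: algebra_simps)
 have i1: "d\<^sup>2 * (f1 * g3 + g1 * f3 - 2 * f2 * g2) = - (2 * E1 * p * t - E2 * (p * s + t * r) + 2 * E3 * r * s)"
  unfolding E1_def E2_def E3_def d by (simp add: power2_eq_square algebra_simps)
 have "d ^ 4 * (f1 * g3 + g1 * f3 - 2 * f2 * g2) = - (2 * (d\<^sup>2 * E1) * p * t + - (d\<^sup>2 * E2) * (p * s + t * r) + 2 * (d\<^sup>2 * E3) * r * s)"
  unfolding d4 i1 by (simp add: algebra_simps)
 then show "dd q ^ 4 * Hb q = - KK * (2 * a * pp q * qq q + b * (pp q * ss q + qq q * rr q) + 2 * c * rr q * ss q)"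
  unfolding E[symmetric] unfolding Hq d_def t_def s_def p_def r_def by (simp add: algebra_simps)
 have i2: "d\<^sup>2 * (g1 * g3 - g2\<^sup>2) = E1 * p\<^sup>2 - E2 * p * r + E3 * r\<^sup>2"
  unfolding E1_def E2_def E3_def d by (simp add: power2_eq_square algebra_simps)
 have "d ^ 4 * (g1 * g3 - g2\<^sup>2) = (d\<^sup>2 * E1) * p\<^sup>2 + - (d\<^sup>2 * E2) * p * r + (d\<^sup>2 * E3) * r\<^sup>2"
  unfolding d4 i2 by (simp add: algebra_simps)
 then show "dd q ^ 4 * Hc q = KK * (a * (pp q)\<^sup>2 + b * pp q * rr q + c * (rr q)\<^sup>2)"
  unfolding E[symmetric] unfolding Hq d_def p_def r_def by (simp add: algebra_simps)
qed

end

section \<open>Existence of charts and the singular locus\<close>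

lemma scaleR_cvec: "r *\<^sub>R (v :: complex^'n) = complex_of_real r *s v"
 by (simp add: cart_eq_iff scaleR_conv_of_real[where 'a = complex])

lemma coeff_2_mult: "coeff (2 * p) n = 2 * coeff (p :: complex poly) n"
 by (metis coeff_add mult_2)

lemma smult_square:
 fixes x y :: "complex poly"
 shows "(x + Polynomial.smult t y)\<^sup>2 = x * x + Polynomial.smult (2 * t) (x * y) + Polynomial.smult (t\<^sup>2) (y * y)"
proof -
 have "(x + c * y)\<^sup>2 = x * x + (c + c) * (x * y) + (c * c) * (y * y)" for c
  by (simp add: power2_eq_square algebra_simps)
 from this[of "[:t:]"] show ?thesis by (simp add: power2_eq_square)
qed

lemma bounded_bilinear_bil: "bounded_bilinear (bil M)"
 unfolding bilinear_conv_bounded_bilinear[symmetric] bilinear_def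
 by (auto intro!: linearI simp: bil_simps scaleR_cvec scaleR_conv_of_real[where 'a = complex])

lemma independent_family:
 fixes v :: "nat \<Rightarrow> complex^'n::finite"
 assumes "\<And>c. (\<Sum>i<n. c i *s v i) = 0 \<Longrightarrow> \<forall>i<n. c i = 0"
 shows "vec.independent (v ` {..<n})" "card (v ` {..<n}) = n"
proof -
 have inj: "inj_on v {..<n}"
 proof (rule inj_onI, rule ccontr)
  fix i j assume ij: "i \<in> {..<n}" "j \<in> {..<n}" "v i = v j" "i \<noteq> j"
  define c where "c = (\<lambda>k. if k = i then 1 else if k = j then -1 else (0::complex))"
  have "(\<Sum>k<n. c k *s v k) = (\<Sum>k\<in>{i, j}. c k *s v k)"
  by (rule sum.mono_neutral_right) (use ij in \<open>auto simp: c_def\<close>)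
  also have "\<dots> = 0" using ij by (simp add: c_def)
  finally show False using assms[of c] ij by (auto simp: c_def)
 qed
 then show "card (v ` {..<n}) = n" by (simp add: card_image)
 show "vec.independent (v ` {..<n})"
 proof
  assume "vec.dependent (v ` {..<n})"
  then obtain u where u: "\<exists>w\<in>v ` {..<n}. u w \<noteq> 0" "(\<Sum>w\<in>v ` {..<n}. u w *s w) = 0"
  using vec.dependent_finite[of "v ` {..<n}"] by auto
  have "(\<Sum>i<n. u (v i) *s v i) = 0" using u(2) unfolding sum.reindex[OF inj] by (simp add: o_def)
  from assms[of "\<lambda>i. u (v i)", OF this] u(1) show False by auto
 qed
qed

lemma exists_not_in_span:
 fixes B :: "(complex^'n::finite) set"
 assumes "finite B" "card B < CARD('n)"
 obtains y where "y \<notin> vec.span B"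
proof -
 have le: "vec.dim (vec.span B) \<le> card B" unfolding vec.dim_span using assms(1) by (rule vec.dim_le_card')
 have "vec.span B \<noteq> UNIV"
 proof
  assume "vec.span B = UNIV"
  then have "vec.dim (UNIV :: (complex^'n) set) \<le> card B" using le by metis
  then show False using assms(2) unfolding vec_dim_card by simp
 qed
 then show thesis using that by blast
qed

lemma not_in_span_coeff:
 fixes B :: "(complex^'n::finite) set"
 assumes "y \<notin> vec.span B" "c *s y + s = 0" "s \<in> vec.span B"
 shows "c = 0"
proof (rule ccontr)
 assume "c \<noteq> 0"
 have "c *s y = - s" using assms(2) by (simp add: eq_neg_iff_add_eq_0)
 then have "inverse c *s (c *s y) = inverse c *s (- s)" by (rule arg_cong)
 then have "y = inverse c *s (- s)" using \<open>c \<noteq> 0\<close> by simp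
 moreover have "inverse c *s (- s) \<in> vec.span B" using assms(3) by (intro vec.span_scale vec.span_neg)
 ultimately show False using assms(1) by metis
qed

context pencil_roots
begin

lemma pt_zero_locus: "v \<noteq> 0 \<Longrightarrow> pt v \<in> zero_locus {quadratic_form P, quadratic_form Q} \<longleftrightarrow> onS v"
proof -
 assume "v \<noteq> 0"
 have "\<forall>f\<in>{quadratic_form P, quadratic_form Q}. \<exists>d. form d f" using form_quadratic by blast
 from mem_zero_locus[OF this \<open>v \<noteq> 0\<close>] show ?thesis unfolding onS_def by (auto simp: quadratic_form_bil)
qed

text \<open>Independence of the differentials yields \<open>Z1\<close> and then \<open>Z2\<close>
  with nonzero Jacobian determinant. These are independent of \<open>X0\<close>, on which both
  differentials vanish, and \<open>Y1\<close>, \<open>Y2\<close> complete a basis.\<close>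

lemma transversal_frame:
 assumes X0: "onS X0" "nonsing X0"
 obtains Z1 Z2 Y1 Y2 where "bil Q X0 Z1 * bil P X0 Z2 - bil Q X0 Z2 * bil P X0 Z1 \<noteq> 0"
  "\<And>x y z u w. x *s X0 + y *s Y1 + z *s Y2 + u *s Z1 + w *s Z2 = 0 \<Longrightarrow> x = 0 \<and> y = 0 \<and> z = 0 \<and> u = 0 \<and> w = 0"
proof -
 obtain Z1 where z1: "bil Q X0 Z1 \<noteq> 0"
  using X0(2)[unfolded nonsing_def, rule_format, of 1 0] by auto
 obtain Z2 where z2: "- bil P X0 Z1 * bil Q X0 Z2 + bil Q X0 Z1 * bil P X0 Z2 \<noteq> 0"
  using X0(2)[unfolded nonsing_def, rule_format, of "- bil P X0 Z1" "bil Q X0 Z1"] z1 by blast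
 define d where "d = bil Q X0 Z1 * bil P X0 Z2 - bil Q X0 Z2 * bil P X0 Z1"
 have d: "d \<noteq> 0" using z2 unfolding d_def by (simp add: algebra_simps)
 have X0z: "X0 \<noteq> 0" using z1 by (auto simp: bil_simps)
 have i3: "x = 0 \<and> u = 0 \<and> w = 0" if "x *s X0 + u *s Z1 + w *s Z2 = 0" for x u w
 proof -
  have "bil M X0 (x *s X0 + u *s Z1 + w *s Z2) = 0" for M unfolding that by (simp add: bil_simps)
  from this[of Q] this[of P] have e: "u * bil Q X0 Z1 + w * bil Q X0 Z2 = 0" "u * bil P X0 Z1 + w * bil P X0 Z2 = 0"
  using X0(1) unfolding onS_def by (auto simp: bil_simps)
  have "u * d = bil P X0 Z2 * (u * bil Q X0 Z1 + w * bil Q X0 Z2) - bil Q X0 Z2 * (u * bil P X0 Z1 + w * bil P X0 Z2)"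
  "w * d = bil Q X0 Z1 * (u * bil P X0 Z1 + w * bil P X0 Z2) - bil P X0 Z1 * (u * bil Q X0 Z1 + w * bil Q X0 Z2)"
  unfolding d_def by (simp_all add: algebra_simps)
  then have "u * d = 0" "w * d = 0" unfolding e by simp_all
  then have "u = 0" "w = 0" using d by simp_all
  then show ?thesis using that X0z by (auto simp: cart_eq_iff)
 qed
 obtain Y1 where Y1: "Y1 \<notin> vec.span {X0, Z1, Z2}"
  by (rule exists_not_in_span[of "{X0, Z1, Z2}"]) (auto simp: card_insert_if)
 obtain Y2 where Y2: "Y2 \<notin> vec.span {Y1, X0, Z1, Z2}"
  by (rule exists_not_in_span[of "{Y1, X0, Z1, Z2}"]) (auto simp: card_insert_if)
 show thesis
 proof (rule that)
  show "bil Q X0 Z1 * bil P X0 Z2 - bil Q X0 Z2 * bil P X0 Z1 \<noteq> 0" using d unfolding d_def .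
  fix x y z u w assume 0: "x *s X0 + y *s Y1 + z *s Y2 + u *s Z1 + w *s Z2 = 0"
  have "z = 0"
  proof (rule not_in_span_coeff[OF Y2])
  show "z *s Y2 + (x *s X0 + y *s Y1 + u *s Z1 + w *s Z2) = 0" using 0 by (simp add: ac_simps)
  show "x *s X0 + y *s Y1 + u *s Z1 + w *s Z2 \<in> vec.span {Y1, X0, Z1, Z2}"
  by (intro vec.span_add vec.span_scale vec.span_base) auto
  qed
  have "y = 0"
  proof (rule not_in_span_coeff[OF Y1])
  show "y *s Y1 + (x *s X0 + u *s Z1 + w *s Z2) = 0" using 0 \<open>z = 0\<close> by (simp add: ac_simps)
  show "x *s X0 + u *s Z1 + w *s Z2 \<in> vec.span {X0, Z1, Z2}"
  by (intro vec.span_add vec.span_scale vec.span_base) auto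
  qed
  show "x = 0 \<and> y = 0 \<and> z = 0 \<and> u = 0 \<and> w = 0" using i3[of x u w] 0 \<open>y = 0\<close> \<open>z = 0\<close> by simp
 qed
qed

text \<open>The inverse function theorem is applied to the map whose last two components are the
  quadrics, the first two coordinates being kept. On the slice where the quadrics vanish, the last
  two components of the inverse are \<open>F\<close> and \<open>G\<close>.\<close>

lemma chart_exists:
 assumes X0: "onS X0" "nonsing X0" and S: "S = zero_locus {quadratic_form P, quadratic_form Q}"
 obtains A U F G where "graph_chart S A U F G" "(0, 0) \<in> U" "A *v vector [1, 0, 0, F (0, 0), G (0, 0)] = X0"
proof -
 obtain Z1 Z2 Y1 Y2 where d: "bil Q X0 Z1 * bil P X0 Z2 - bil Q X0 Z2 * bil P X0 Z1 \<noteq> 0"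
  and ind: "\<And>x y z u w. x *s X0 + y *s Y1 + z *s Y2 + u *s Z1 + w *s Z2 = 0 \<Longrightarrow> x = 0 \<and> y = 0 \<and> z = 0 \<and> u = 0 \<and> w = 0"
  using transversal_frame[OF X0] by blast
 define A :: "complex^5^5" where
  "A = (\<chi> i j. (if j = 1 then X0 else if j = 2 then Y1 else if j = 3 then Y2 else if j = 4 then Z1 else Z2) $ i)"
 have A: "A *v x = x$1 *s X0 + x$2 *s Y1 + x$3 *s Y2 + x$4 *s Z1 + x$5 *s Z2" for x
  by (simp add: A_def matrix_vector_mult_def cart_eq_iff sum_5 mult.commute)
 have A0: "x = 0" if "A *v x = 0" for x
  using ind[of "x$1" "x$2" "x$3" "x$4" "x$5"] that unfolding A vec5_eq_iff[of x] by simp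
 have invA: "invertible A" unfolding invertible_left_inverse matrix_left_invertible_ker using A0 by blast
 define LL where "LL h = fst h *s Y1 + fst (snd h) *s Y2 + fst (snd (snd h)) *s Z1 + snd (snd (snd h)) *s Z2"
  for h :: "complex \<times> complex \<times> complex \<times> complex"
 define XX where "XX v = X0 + LL v" for v
 define \<Psi> where "\<Psi> v = (fst v, fst (snd v), bil Q (XX v) (XX v), bil P (XX v) (XX v))" for v
 define D where "D v h = (fst h, fst (snd h), 2 * bil Q (XX v) (LL h), 2 * bil P (XX v) (LL h))" for v h
 have XX_A: "A *v vector [1, x, y, z, w] = XX (x, y, z, w)" for x y z w
  unfolding A vector_5 XX_def LL_def by (simp add: ac_simps)
 have XX_nz: "XX v \<noteq> 0" for v
 proof
  assume "XX v = 0"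
  then have "A *v vector [1, fst v, fst (snd v), fst (snd (snd v)), snd (snd (snd v))] = 0" unfolding XX_A by simp
  from A0[OF this] show False unfolding vec5_eq_iff vector_5 by simp
 qed
 have "linear LL"
  by (rule linearI) (simp_all add: LL_def cart_eq_iff algebra_simps scaleR_conv_of_real[where 'a = complex])
 then have bLL: "bounded_linear LL" by (rule linear_conv_bounded_linear[THEN iffD1])
 have XXd: "(XX has_derivative LL) (at v)" for v
  unfolding XX_def[abs_def] using has_derivative_add[OF has_derivative_const bounded_linear_imp_has_derivative[OF bLL]] by simp
 have bd: "((\<lambda>v. bil M (XX v) (XX v)) has_derivative (\<lambda>h. bil M (XX v) (LL h) + bil M (LL h) (XX v))) (at v)" for M v
  by (rule bounded_bilinear.FDERIV[OF bounded_bilinear_bil XXd XXd])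
 have \<Psi>d: "(\<Psi> has_derivative D v) (at v)" for v
  unfolding \<Psi>_def[abs_def]
 proof (rule has_derivative_eq_rhs)
  show "((\<lambda>v. (fst v, fst (snd v), bil Q (XX v) (XX v), bil P (XX v) (XX v))) has_derivative
  (\<lambda>h. (fst h, fst (snd h), bil Q (XX v) (LL h) + bil Q (LL h) (XX v), bil P (XX v) (LL h) + bil P (LL h) (XX v)))) (at v)"
  by (intro has_derivative_Pair has_derivative_fst has_derivative_snd has_derivative_ident bd)
  show "(\<lambda>h. (fst h, fst (snd h), bil Q (XX v) (LL h) + bil Q (LL h) (XX v), bil P (XX v) (LL h) + bil P (LL h) (XX v))) = D v"
  unfolding D_def[abs_def] by (simp add: fun_eq_iff bil_commute[OF symQ, of _ "XX v"] bil_commute[OF symP, of _ "XX v"])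
 qed
 have bD: "bounded_linear (D v)" for v by (rule has_derivative_bounded_linear[OF \<Psi>d])
 define f' where "f' v = Blinfun (D v)" for v
 have f': "blinfun_apply (f' v) = D v" for v unfolding f'_def using bD by (rule bounded_linear_Blinfun_apply)
 have cXX: "continuous_on UNIV XX"
  by (intro continuous_at_imp_continuous_on ballI has_derivative_continuous[OF XXd])
 have contf: "continuous_on UNIV f'"
  by (rule continuous_on_blinfun_componentwise)
  (unfold f' D_def, intro continuous_intros bounded_bilinear.continuous_on[OF bounded_bilinear_bil] cXX)
 have XX0: "XX 0 = X0" unfolding XX_def LL_def by simp
 have "h = 0" if "D 0 h = 0" for h
 proof -
  have h: "fst h = 0" "fst (snd h) = 0" "bil Q X0 (LL h) = 0" "bil P X0 (LL h) = 0"
  using that unfolding D_def XX0 by (simp_all add: zero_prod_def)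
  define z w where "z = fst (snd (snd h))" and "w = snd (snd (snd h))"
  have e: "z * bil Q X0 Z1 + w * bil Q X0 Z2 = 0" "z * bil P X0 Z1 + w * bil P X0 Z2 = 0"
  using h unfolding LL_def z_def w_def by (simp_all add: bil_simps)
  have "z * (bil Q X0 Z1 * bil P X0 Z2 - bil Q X0 Z2 * bil P X0 Z1)
  = bil P X0 Z2 * (z * bil Q X0 Z1 + w * bil Q X0 Z2) - bil Q X0 Z2 * (z * bil P X0 Z1 + w * bil P X0 Z2)"
  "w * (bil Q X0 Z1 * bil P X0 Z2 - bil Q X0 Z2 * bil P X0 Z1)
  = bil Q X0 Z1 * (z * bil P X0 Z1 + w * bil P X0 Z2) - bil P X0 Z1 * (z * bil Q X0 Z1 + w * bil Q X0 Z2)"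
  by (simp_all add: algebra_simps)
  then have "z * (bil Q X0 Z1 * bil P X0 Z2 - bil Q X0 Z2 * bil P X0 Z1) = 0"
  "w * (bil Q X0 Z1 * bil P X0 Z2 - bil Q X0 Z2 * bil P X0 Z1) = 0" unfolding e by simp_all
  then have "z = 0" "w = 0" using d by simp_all
  then show ?thesis using h unfolding z_def w_def by (simp add: prod_eq_iff)
 qed
 then have "inj (D 0)" using linear_injective_0[OF bounded_linear.linear[OF bD]] by blast
 then obtain g0 where g0: "linear g0" "g0 \<circ> D 0 = id"
  using linear_injective_left_inverse[OF bounded_linear.linear[OF bD]] by blast
 have bg0: "bounded_linear g0" using g0(1) by (rule linear_conv_bounded_linear[THEN iffD1])
 have inv: "Blinfun g0 o\<^sub>L f' 0 = id_blinfun"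
 proof (rule blinfun_eqI)
  fix h
  have "g0 (D 0 h) = h" using g0(2) by (metis comp_apply id_apply)
  then show "blinfun_apply (Blinfun g0 o\<^sub>L f' 0) h = blinfun_apply id_blinfun h"
  by (simp add: f' bounded_linear_Blinfun_apply[OF bg0])
 qed
 have der: "\<And>v. v \<in> UNIV \<Longrightarrow> (\<Psi> has_derivative blinfun_apply (f' v)) (at v)" unfolding f' by (rule \<Psi>d)
 obtain U' V g g' where V: "open U'" "0 \<in> U'" "open V" "\<Psi> 0 \<in> V" and hom: "homeomorphism U' V \<Psi> g"
  and gd: "\<And>y. y \<in> V \<Longrightarrow> (g has_derivative g' y) (at y)"
  and g': "\<And>y. y \<in> V \<Longrightarrow> g' y = inv_into UNIV (blinfun_apply (f' (g y)))"
  and bij: "\<And>y. y \<in> V \<Longrightarrow> bij (blinfun_apply (f' (g y)))"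
  using inverse_function_theorem[OF open_UNIV der contf UNIV_I inv] by metis
 have g\<Psi>: "g (\<Psi> v) = v" "\<Psi> v \<in> V" if "v \<in> U'" for v using hom that unfolding homeomorphism_def by auto
 have \<Psi>g: "\<Psi> (g y) = y" "g y \<in> U'" if "y \<in> V" for y using hom that unfolding homeomorphism_def by auto
 define emb :: "complex \<times> complex \<Rightarrow> complex \<times> complex \<times> complex \<times> complex" where "emb q = (fst q, snd q, 0, 0)" for q
 define U where "U = emb -` V"
 define F where "F q = fst (snd (snd (g (emb q))))" for q
 define G where "G q = snd (snd (snd (g (emb q))))" for q
 have embd: "(emb has_derivative emb) (at q)" for q
  unfolding emb_def[abs_def]
  by (intro has_derivative_Pair has_derivative_fst has_derivative_snd has_derivative_ident has_derivative_const)
 have "continuous_on UNIV emb" unfolding emb_def[abs_def] by (intro continuous_intros)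
 then have oU: "open U" unfolding U_def using V(3) by (simp add: open_vimage)
 define sc :: "complex \<Rightarrow> complex \<times> complex \<times> complex \<times> complex \<Rightarrow> complex \<times> complex \<times> complex \<times> complex"
  where "sc c h = (c * fst h, c * fst (snd h), c * fst (snd (snd h)), c * snd (snd (snd h)))" for c h
 have "LL (sc c h) = c *s LL h" for c h
  unfolding LL_def sc_def by (simp add: cart_eq_iff algebra_simps)
 then have Dsc: "D v (sc c h) = sc c (D v h)" for c h v
  unfolding D_def by (simp add: bil_simps) (simp add: sc_def)
 \<comment> \<open>The inverse function theorem is a real statement; the derivative of the inverse
   is complex homogeneous since it inverts a complex homogeneous bijection.\<close>
 have g'sc: "g' y (sc c k) = sc c (g' y k)" if "y \<in> V" for y c k
 proof -
  have b: "bij (D (g y))" and i: "g' y = inv_into UNIV (D (g y))" using bij[OF that] g'[OF that] unfolding f' by auto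
  have "sc c k = D (g y) (sc c (g' y k))" unfolding Dsc unfolding i using b by (simp add: bij_is_surj surj_f_inv_f)
  then show ?thesis unfolding i using b by (simp add: bij_is_inj inv_f_f)
 qed
 have embsc: "emb (c * fst v, c * snd v) = sc c (emb v)" for c v unfolding emb_def sc_def by simp
 have gemb: "((\<lambda>q. g (emb q)) has_derivative (\<lambda>h. g' (emb q) (emb h))) (at q)" if "q \<in> U" for q
  using has_derivative_compose[OF embd gd] that unfolding U_def by auto
 have "holomorphic2_on F U"
 proof (rule holo2I[OF oU])
  fix q assume q: "q \<in> U"
  have "(F has_derivative (\<lambda>h. fst (snd (snd (g' (emb q) (emb h)))))) (at q)"
  unfolding F_def[abs_def] by (intro has_derivative_fst has_derivative_snd gemb q)
  moreover have "fst (snd (snd (g' (emb q) (emb (c * fst v, c * snd v))))) = c * fst (snd (snd (g' (emb q) (emb v))))" for c v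
  using g'sc[of "emb q" c "emb v"] q unfolding embsc U_def by (simp add: sc_def)
  ultimately show "\<exists>D. (F has_derivative D) (at q) \<and> (\<forall>c v. D (c * fst v, c * snd v) = c * D v)" by blast
 qed
 moreover have "holomorphic2_on G U"
 proof (rule holo2I[OF oU])
  fix q assume q: "q \<in> U"
  have "(G has_derivative (\<lambda>h. snd (snd (snd (g' (emb q) (emb h)))))) (at q)"
  unfolding G_def[abs_def] by (intro has_derivative_snd gemb q)
  moreover have "snd (snd (snd (g' (emb q) (emb (c * fst v, c * snd v))))) = c * snd (snd (snd (g' (emb q) (emb v))))" for c v
  using g'sc[of "emb q" c "emb v"] q unfolding embsc U_def by (simp add: sc_def)
  ultimately show "\<exists>D. (G has_derivative D) (at q) \<and> (\<forall>c v. D (c * fst v, c * snd v) = c * D v)" by blast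
 qed
 moreover have mem: "affine_pt A x y z w \<in> S \<longleftrightarrow> \<Psi> (x, y, z, w) = emb (x, y)" for x y z w
  unfolding affine_pt_def XX_A S pt_zero_locus[OF XX_nz] onS_def \<Psi>_def emb_def by simp
 have "{(x, y, z, w) \<in> U'. affine_pt A x y z w \<in> S} = {(x, y, z, w). (x, y) \<in> U \<and> z = F (x, y) \<and> w = G (x, y)}"
 proof (rule Set.set_eqI, rule iffI)
  fix v assume "v \<in> {(x, y, z, w) \<in> U'. affine_pt A x y z w \<in> S}"
  then obtain x y z w where v: "v = (x, y, z, w)" "v \<in> U'" "\<Psi> v = emb (x, y)" using mem by auto
  then have "emb (x, y) \<in> V" "g (emb (x, y)) = v" using g\<Psi>[OF v(2)] by auto
  then show "v \<in> {(x, y, z, w). (x, y) \<in> U \<and> z = F (x, y) \<and> w = G (x, y)}"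
  unfolding v(1) U_def F_def G_def by simp
 next
  fix v assume "v \<in> {(x, y, z, w). (x, y) \<in> U \<and> z = F (x, y) \<and> w = G (x, y)}"
  then obtain x y where v: "v = (x, y, F (x, y), G (x, y))" and xy: "emb (x, y) \<in> V" unfolding U_def by auto
  have p: "\<Psi> (g (emb (x, y))) = emb (x, y)" using \<Psi>g(1)[OF xy] .
  then have "fst (g (emb (x, y))) = x" "fst (snd (g (emb (x, y)))) = y" unfolding \<Psi>_def emb_def by simp_all
  then have "g (emb (x, y)) = v" unfolding v F_def G_def by (simp add: prod_eq_iff)
  then have "v \<in> U'" "\<Psi> v = emb (x, y)" using p \<Psi>g(2)[OF xy] by auto
  then show "v \<in> {(x, y, z, w) \<in> U'. affine_pt A x y z w \<in> S}" unfolding v using mem by auto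
 qed
 ultimately have "graph_chart S A U F G" unfolding graph_chart_def using invA V(1) by blast
 moreover have "\<Psi> 0 = emb (0, 0)" using X0(1) unfolding \<Psi>_def emb_def XX0 onS_def by simp
 then have "(0, 0) \<in> U" "g (emb (0, 0)) = 0" using V(4) g\<Psi>[OF V(2)] unfolding U_def by auto
 moreover from this(2) have "A *v vector [1, 0, 0, F (0, 0), G (0, 0)] = X0"
  unfolding XX_A F_def G_def using XX0 by (simp add: zero_prod_def)
 ultimately show thesis using that by blast
qed

end

text \<open>The quadratic term accommodates the parametrised curve which supplies the last tangent
  vector at a singular point; straight lines have \<open>u = 0\<close>.\<close>

lemma vholo_line: "vholo (\<lambda>r. v + fst r *s w + (fst r)\<^sup>2 *s u) UNIV"
  "vdx (\<lambda>r. v + fst r *s w + (fst r)\<^sup>2 *s u) (0, 0) = w"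
proof -
 have f: "holomorphic2_on fst UNIV" "holomorphic2_on (\<lambda>r. c) UNIV" for c
  by (simp_all add: holo2_fst holo2_const)
 show "vholo (\<lambda>r. v + fst r *s w + (fst r)\<^sup>2 *s u) UNIV"
  unfolding vholo_def by (auto intro!: holo2_add holo2_mult holo2_power f)
 have "((\<lambda>s. v $ i + s * w $ i + s\<^sup>2 * u $ i) has_field_derivative w $ i) (at 0)" for i
  by (auto intro!: derivative_eq_intros)
 from DERIV_imp_deriv[OF this] show "vdx (\<lambda>r. v + fst r *s w + (fst r)\<^sup>2 *s u) (0, 0) = w"
  unfolding vdx_def dx_def by (simp add: cart_eq_iff)
qed

text \<open>\<open>D v\<close> is the differential of \<open>f\<close> at \<open>v\<close>.
  Induction over the construction of \<open>f\<close> provides the chain rule along every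
  holomorphic map, and the directional derivative is its instance for a straight line.\<close>

lemma poly_derivative:
 fixes f :: "complex^5 \<Rightarrow> complex"
 assumes "f \<in> poly_funs (range (\<lambda>i v. v $ i))"
 obtains D where "\<And>v. lin (D v)" "\<And>v w. deriv (\<lambda>t. f (v + t *s w)) 0 = D v w"
  "\<And>Y U q. vholo Y U \<Longrightarrow> q \<in> U \<Longrightarrow> dx (\<lambda>q. f (Y q)) q = D (Y q) (vdx Y q)"
  "\<And>Y U q. vholo Y U \<Longrightarrow> q \<in> U \<Longrightarrow> dy (\<lambda>q. f (Y q)) q = D (Y q) (vdy Y q)"
proof -
 have "\<exists>D. (\<forall>v. lin (D v)) \<and> (\<forall>Y U q. vholo Y U \<longrightarrow> q \<in> U \<longrightarrow> holomorphic2_on (\<lambda>q. f (Y q)) U \<and>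
  dx (\<lambda>q. f (Y q)) q = D (Y q) (vdx Y q) \<and> dy (\<lambda>q. f (Y q)) q = D (Y q) (vdy Y q))"
  using assms
 proof (induction rule: poly_funs.induct)
  case (gen f)
  then obtain i where f: "f = (\<lambda>v. v $ i)" by blast
  show ?case
  by (rule exI[of _ "\<lambda>v w. w $ i"]) (auto simp: f lin_def vholo_def vdx_def vdy_def)
 next
  case (const c)
  show ?case
  by (rule exI[of _ "\<lambda>v w. 0"]) (auto simp: lin_def vholo_def dx_dy_const holo2_const)
 next
  case (add f g)
  obtain D1 where D1: "\<forall>v. lin (D1 v)"
  "\<forall>Y U q. vholo Y U \<longrightarrow> q \<in> U \<longrightarrow> holomorphic2_on (\<lambda>q. f (Y q)) U \<and>
  dx (\<lambda>q. f (Y q)) q = D1 (Y q) (vdx Y q) \<and> dy (\<lambda>q. f (Y q)) q = D1 (Y q) (vdy Y q)"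
  using add.IH(1) by (elim exE conjE)
  obtain D2 where D2: "\<forall>v. lin (D2 v)"
  "\<forall>Y U q. vholo Y U \<longrightarrow> q \<in> U \<longrightarrow> holomorphic2_on (\<lambda>q. g (Y q)) U \<and>
  dx (\<lambda>q. g (Y q)) q = D2 (Y q) (vdx Y q) \<and> dy (\<lambda>q. g (Y q)) q = D2 (Y q) (vdy Y q)"
  using add.IH(2) by (elim exE conjE)
  note D = D1(1) D2(1) D1(2)[rule_format] D2(2)[rule_format]
  show ?case
  proof (intro exI[of _ "\<lambda>v w. D1 v w + D2 v w"] conjI allI impI)
  show "lin (\<lambda>w. D1 v w + D2 v w)" for v using D(1,2) unfolding lin_def by (simp add: algebra_simps)
  fix Y U q assume Y: "vholo Y U" "q \<in> U"
  have h: "holomorphic2_on (\<lambda>q. f (Y q)) U" "holomorphic2_on (\<lambda>q. g (Y q)) U" using D(3,4)[OF Y] by auto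
  show "holomorphic2_on (\<lambda>q. f (Y q) + g (Y q)) U" by (rule holo2_add[OF h])
  show "dx (\<lambda>q. f (Y q) + g (Y q)) q = D1 (Y q) (vdx Y q) + D2 (Y q) (vdx Y q)"
  "dy (\<lambda>q. f (Y q) + g (Y q)) q = D1 (Y q) (vdy Y q) + D2 (Y q) (vdy Y q)"
  unfolding dx_dy_add[OF h Y(2)] using D(3,4)[OF Y] by auto
  qed
 next
  case (mult f g)
  obtain D1 where D1: "\<forall>v. lin (D1 v)"
  "\<forall>Y U q. vholo Y U \<longrightarrow> q \<in> U \<longrightarrow> holomorphic2_on (\<lambda>q. f (Y q)) U \<and>
  dx (\<lambda>q. f (Y q)) q = D1 (Y q) (vdx Y q) \<and> dy (\<lambda>q. f (Y q)) q = D1 (Y q) (vdy Y q)"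
  using mult.IH(1) by (elim exE conjE)
  obtain D2 where D2: "\<forall>v. lin (D2 v)"
  "\<forall>Y U q. vholo Y U \<longrightarrow> q \<in> U \<longrightarrow> holomorphic2_on (\<lambda>q. g (Y q)) U \<and>
  dx (\<lambda>q. g (Y q)) q = D2 (Y q) (vdx Y q) \<and> dy (\<lambda>q. g (Y q)) q = D2 (Y q) (vdy Y q)"
  using mult.IH(2) by (elim exE conjE)
  note D = D1(1) D2(1) D1(2)[rule_format] D2(2)[rule_format]
  show ?case
  proof (intro exI[of _ "\<lambda>v w. D1 v w * g v + f v * D2 v w"] conjI allI impI)
  show "lin (\<lambda>w. D1 v w * g v + f v * D2 v w)" for v using D(1,2) unfolding lin_def by (simp add: algebra_simps)
  fix Y U q assume Y: "vholo Y U" "q \<in> U"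
  have h: "holomorphic2_on (\<lambda>q. f (Y q)) U" "holomorphic2_on (\<lambda>q. g (Y q)) U" using D(3,4)[OF Y] by auto
  show "holomorphic2_on (\<lambda>q. f (Y q) * g (Y q)) U" by (rule holo2_mult[OF h])
  show "dx (\<lambda>q. f (Y q) * g (Y q)) q = D1 (Y q) (vdx Y q) * g (Y q) + f (Y q) * D2 (Y q) (vdx Y q)"
  "dy (\<lambda>q. f (Y q) * g (Y q)) q = D1 (Y q) (vdy Y q) * g (Y q) + f (Y q) * D2 (Y q) (vdy Y q)"
  unfolding dx_dy_mult[OF h Y(2)] using D(3,4)[OF Y] by auto
  qed
 qed
 then obtain D where D: "\<forall>v. lin (D v)" "\<And>Y U q. vholo Y U \<Longrightarrow> q \<in> U \<Longrightarrow>
  dx (\<lambda>q. f (Y q)) q = D (Y q) (vdx Y q) \<and> dy (\<lambda>q. f (Y q)) q = D (Y q) (vdy Y q)" by blast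
 have "deriv (\<lambda>t. f (v + t *s w)) 0 = D v w" for v w
  using D(2)[OF vholo_line(1), of "(0, 0)" v w 0] unfolding vholo_line(2) by (simp add: dx_def)
 then show thesis using that D by blast
qed

text \<open>The two quadrics bound the tangent space from above. Conversely, a form that vanishes on
  \<open>S\<close> vanishes along the chart, so its differential kills \<open>Xx\<close> and
  \<open>Xy\<close>, and it kills \<open>X\<close> because the form vanishes on multiples of
  \<open>X\<close>.\<close>

lemma (in pencil_chart) cone_tangent_space_X:
 assumes q: "q \<in> U" "dd q \<noteq> 0"
 shows "cone_tangent_space S (X q) = {w. bil Q (X q) w = 0 \<and> bil P (X q) w = 0}"
proof (rule Set.set_eqI, rule iffI)
 fix w assume w: "w \<in> cone_tangent_space S (X q)"
 have "bil M (X q) w = 0" if M: "M = Q \<or> M = P" for M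
 proof -
  have "S \<subseteq> zero_locus {quadratic_form M}" unfolding S_eq zero_locus_def using M by auto
  then have 0: "deriv (\<lambda>t. quadratic_form M (X q + t *s w)) 0 = 0"
  using w form_quadratic[of M] unfolding cone_tangent_space_def by blast
  have s: "bil M w (X q) = bil M (X q) w" using M bil_commute[OF symQ] bil_commute[OF symP] by auto
  have "quadratic_form M (X q + t *s w) = bil M (X q) (X q) + t * (2 * bil M (X q) w) + t\<^sup>2 * bil M w w" for t
  unfolding quadratic_form_bil by (simp add: bil_simps s power2_eq_square algebra_simps)
  moreover have "((\<lambda>t. bil M (X q) (X q) + t * (2 * bil M (X q) w) + t\<^sup>2 * bil M w w) has_field_derivative 2 * bil M (X q) w) (at 0)"
  by (auto intro!: derivative_eq_intros)
  ultimately have "deriv (\<lambda>t. quadratic_form M (X q + t *s w)) 0 = 2 * bil M (X q) w" by (simp add: DERIV_imp_deriv)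
  then show ?thesis using 0 by simp
 qed
 then show "w \<in> {w. bil Q (X q) w = 0 \<and> bil P (X q) w = 0}" by blast
next
 fix w assume "w \<in> {w. bil Q (X q) w = 0 \<and> bil P (X q) w = 0}"
 then obtain \<alpha> \<beta> \<gamma> where w: "w = \<alpha> *s X q + \<beta> *s Xx q + \<gamma> *s Xy q" using tangent_space[OF q] by blast
 show "w \<in> cone_tangent_space S (X q)" unfolding cone_tangent_space_def
 proof (intro CollectI allI impI, elim conjE)
  fix d f assume f: "form d f" "S \<subseteq> zero_locus {f}"
  have fX: "f (X r) = 0" if "r \<in> U" for r
  proof -
  have "pt (X r) \<in> zero_locus {f}" using onS_X[OF that] mem_S[OF X_nonzero] f(2) by blast
  then show ?thesis using mem_hcoords_pt[OF X_nonzero] unfolding zero_locus_def by blast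
  qed
  obtain D where D: "\<And>v. lin (D v)" "\<And>v w. deriv (\<lambda>t. f (v + t *s w)) 0 = D v w"
  "\<And>Y U q. vholo Y U \<Longrightarrow> q \<in> U \<Longrightarrow> dx (\<lambda>q. f (Y q)) q = D (Y q) (vdx Y q)"
  "\<And>Y U q. vholo Y U \<Longrightarrow> q \<in> U \<Longrightarrow> dy (\<lambda>q. f (Y q)) q = D (Y q) (vdy Y q)"
  using poly_derivative[of f] f(1) unfolding form_def by blast
  have z: "holomorphic2_on (\<lambda>_. 0) U" by (rule holo2_const[OF openU])
  have "dx (\<lambda>r. f (X r)) q = 0" "dy (\<lambda>r. f (X r)) q = 0"
  using dx_dy_cong[OF z, of "\<lambda>r. f (X r)" q] fX q(1) by (simp_all add: dx_dy_const)
  then have 1: "D (X q) (Xx q) = 0" "D (X q) (Xy q) = 0"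
  unfolding D(3)[OF vholo_X q(1)] D(4)[OF vholo_X q(1)] vdx_X[OF q(1)] vdy_X[OF q(1)] .
  have "f (X q + t *s X q) = 0" for t
  proof -
  have e: "X q + t *s X q = (1 + t) *s X q" by (simp add: vec.scale_left_distrib)
  have "f ((1 + t) *s X q) = (1 + t) ^ d * f (X q)" using f(1) unfolding form_def by blast
  then show ?thesis unfolding e using fX[OF q(1)] by simp
  qed
  then have 2: "D (X q) (X q) = 0" unfolding D(2)[symmetric] by simp
  show "deriv (\<lambda>t. f (X q + t *s w)) 0 = 0"
  unfolding D(2) w using D(1)[of "X q"] 1 2 unfolding lin_def by simp
 qed
qed

context pencil_roots
begin

lemma onS_scale: "onS v \<Longrightarrow> onS (c *s v)"
 unfolding onS_def by (simp add: bil_simps)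

lemma nonsing_scale:
 assumes "nonsing v" "c \<noteq> 0"
 shows "nonsing (c *s v)"
 unfolding nonsing_def
proof (intro allI impI)
 fix \<alpha> \<beta> assume "\<forall>w. \<alpha> * bil Q (c *s v) w + \<beta> * bil P (c *s v) w = 0"
 then have "\<forall>w. (\<alpha> * c) * bil Q v w + (\<beta> * c) * bil P v w = 0" by (simp add: bil_simps mult.assoc)
 then show "\<alpha> = 0 \<and> \<beta> = 0" using assms unfolding nonsing_def by (metis mult_eq_0_iff)
qed

lemma dim_cone_tangent_space:
 assumes X0: "onS X0" "nonsing X0" and S: "S = zero_locus {quadratic_form P, quadratic_form Q}"
 shows "vec.dim (cone_tangent_space S X0) = 3"
proof -
 obtain A U F G where c: "graph_chart S A U F G" and 0: "(0, 0) \<in> U" and A: "A *v vector [1, 0, 0, F (0, 0), G (0, 0)] = X0"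
  using chart_exists[OF assms] .
 interpret pencil_chart P Q \<Delta> \<phi> c0 E \<mu> S A U F G by unfold_locales (fact S c)+
 define z0 where "z0 = (0 :: complex, 0 :: complex)"
 have Xo: "X z0 = X0" unfolding X_def z0_def using A by simp
 have z0: "z0 \<in> U" "dd z0 \<noteq> 0" using 0 nonsing_dd[of z0] X0(2) unfolding Xo unfolding z0_def by auto
 define vf where "vf i = [X z0, Xx z0, Xy z0] ! i" for i
 have img: "vf ` {..<3} = {X z0, Xx z0, Xy z0}" by (auto simp: vf_def numeral_3_eq_3 lessThan_Suc)
 have ind: "\<forall>i<3. c i = 0" if "(\<Sum>i<3. c i *s vf i) = 0" for c
 proof -
  have "A *v vector [c 0, c 1, c 2, c 0 * F z0 + c 1 * dx F z0 + c 2 * dy F z0, c 0 * G z0 + c 1 * dx G z0 + c 2 * dy G z0] = (\<Sum>i<3. c i *s vf i)"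
  unfolding A_comb vector_5 vf_def X_comb Xx_def Xy_def z0_def
  by (simp add: numeral_3_eq_3 numeral_2_eq_2 algebra_simps cart_eq_iff)
  then have "vector [c 0, c 1, c 2, c 0 * F z0 + c 1 * dx F z0 + c 2 * dy F z0, c 0 * G z0 + c 1 * dx G z0 + c 2 * dy G z0] = (0 :: complex^5)"
  using A_inj that by metis
  then have "c 0 = 0" "c 1 = 0" "c 2 = 0" unfolding vec5_eq_iff vector_5 by simp_all
  then show ?thesis by (auto simp: numeral_3_eq_3 less_Suc_eq numeral_2_eq_2)
 qed
 have T: "cone_tangent_space S X0 = {w. bil Q (X z0) w = 0 \<and> bil P (X z0) w = 0}"
  using cone_tangent_space_X[OF z0] unfolding Xo .
 show ?thesis unfolding T
 proof (rule vec.dim_unique)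
  show "vec.independent (vf ` {..<3})" "card (vf ` {..<3}) = 3" using independent_family[where n = 3 and v = vf, OF ind] by auto
  show "vf ` {..<3} \<subseteq> {w. bil Q (X z0) w = 0 \<and> bil P (X z0) w = 0}" unfolding img using tangent[OF z0(1)] by auto
  show "{w. bil Q (X z0) w = 0 \<and> bil P (X z0) w = 0} \<subseteq> vec.span (vf ` {..<3})"
  proof
  fix w assume "w \<in> {w. bil Q (X z0) w = 0 \<and> bil P (X z0) w = 0}"
  then obtain \<alpha> \<beta> \<gamma> where w: "w = \<alpha> *s X z0 + \<beta> *s Xx z0 + \<gamma> *s Xy z0" using tangent_space[OF z0] by blast
  show "w \<in> vec.span (vf ` {..<3})" unfolding w img
  by (intro vec.span_add vec.span_scale vec.span_base) auto
  qed
 qed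
qed

lemma smooth_pt:
 assumes X0: "onS X0" "nonsing X0" and S: "S = zero_locus {quadratic_form P, quadratic_form Q}"
  and dim: "variety_dim S = 2"
 shows "pt X0 \<in> smooth_locus S"
proof -
 have nz: "X0 \<noteq> 0" using X0(2) unfolding nonsing_def by (auto simp: bil_simps)
 have "vec.dim (cone_tangent_space S v) = 3" if v: "v \<in> hcoords (pt X0)" for v
 proof -
  obtain c where "c \<noteq> 0" "v = c *s X0"
  using pt_eqD[OF pt_hcoords[OF v] nz hcoords_nonzero[OF v]] by blast
  then show ?thesis using dim_cone_tangent_space[OF onS_scale nonsing_scale S] X0 by blast
 qed
 moreover have "pt X0 \<in> S" unfolding S using pt_zero_locus[OF nz] X0(1) by blast
 moreover have "variety_dim S = enat 2" using dim by (simp add: numeral_eq_enat)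
 ultimately show ?thesis unfolding smooth_locus_def by auto
qed

lemma singular_locus_subset:
 assumes S: "S = zero_locus {quadratic_form P, quadratic_form Q}" and dim: "variety_dim S = 2"
 shows "singular_locus S \<subseteq> (\<lambda>a. pt (\<phi> (nn a))) ` E"
proof
 fix p assume p: "p \<in> singular_locus S"
 obtain X0 where X0: "X0 \<noteq> 0" "p = pt X0" by (rule proj_cases)
 then have "onS X0" using p pt_zero_locus S unfolding singular_locus_def by auto
 then have "\<not> nonsing X0" using p smooth_pt[OF _ _ S dim] X0 unfolding singular_locus_def by auto
 from sing_imp_nn[OF this X0(1)] obtain a c where a: "a \<in> E" "X0 = c *s \<phi> (nn a)" .
 then have "c \<noteq> 0" "\<phi> (nn a) \<noteq> 0" using X0 by auto
 then show "p \<in> (\<lambda>a. pt (\<phi> (nn a))) ` E" unfolding X0 using a pt_scale by auto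
qed

lemma l0_nn:
 assumes "a \<in> E"
 shows "l0 \<Delta> (nn a * z) = poly z a"
proof -
 have "coeff ([:-a, 1:] * nn a) 5 = 1" unfolding nn[OF assms] using monic deg\<Delta> by simp
 then have "coeff (nn a) 4 = 1" using degree_nn[OF assms] by (simp add: eval_nat_numeral coeff_eq_0)
 then have "l0 \<Delta> (nn a) = 1" using degree_nn[OF assms] deg\<Delta> by (simp add: l0_degree_le)
 then show ?thesis using l0_cong[OF nn_mult[OF assms, of z]] by (simp add: l0_smult)
qed

lemma l0_power:
 assumes "m \<le> 4"
 shows "l0 \<Delta> ([:-a, 1:] ^ m) = (if m = 4 then 1 else 0)"
proof -
 have d: "degree ([:-a, 1:] ^ m) = m" by (simp add: degree_linear_power)
 have "coeff ([:-a, 1:] ^ m) (degree ([:-a, 1:] ^ m)) = 1" unfolding lead_coeff_power by simp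
 then have "coeff ([:-a, 1:] ^ m) m = 1" unfolding d .
 then show ?thesis using d assms deg\<Delta> by (auto simp: l0_degree_le coeff_eq_0)
qed

lemma nn_square:
 assumes "a \<in> E" "\<mu> a \<ge> 2"
 shows "\<Delta> dvd nn a * nn a"
proof -
 have "poly (nn a) a = 0" unfolding N2_nn[OF assms] by simp
 then show ?thesis using nn_mult[OF assms(1), of "nn a"] by simp
qed

text \<open>Besides the tangent vector of the cone direction there are three more: two lines on the
 surface through the point, and a curve which is not a line.\<close>

lemma kind2_singular:
 assumes k: "kind2 a b" and S: "S = zero_locus {quadratic_form P, quadratic_form Q}" and dim: "variety_dim S = 2"
 shows "pt (\<phi> (nn a)) \<in> singular_locus S"
proof -
 have a: "a \<in> E" "\<mu> a \<ge> 2" and b: "b \<in> E" "\<mu> b \<ge> 2" "a \<noteq> b" using k unfolding kind2_def by auto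
 define s where "s = [:-a, 1:]"
 have ds: "degree s = 1" "s \<noteq> 0" "coeff s 1 = 1" unfolding s_def by auto
 \<comment> \<open>Chosen such that the t^4 coefficient of \<open>s * w\<close> below vanishes: the
   term from \<open>s ^ 5\<close> is cancelled by \<open>2 * k0\<close>.\<close>
 define k0 where "k0 = - (l0 \<Delta> (s ^ 5) / 2)"
 define kk where "kk = s * (s + [:k0:])"
 have nz: "\<phi> (nn a) \<noteq> 0" using nn_not_dvd[OF a(1)] by (simp add: \<phi>_eq_0)
 have mem: "onS v \<Longrightarrow> v \<noteq> 0 \<Longrightarrow> pt v \<in> S" for v using pt_zero_locus unfolding S by blast
 have na2: "\<Delta> dvd nn a * nn a" "\<Delta> dvd nn b * nn b" using nn_square a b by auto
 have nab: "\<Delta> dvd nn a * nn b"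
 proof -
  obtain M where M: "nn a = [:-b, 1:] * M" "nn b = [:-a, 1:] * M" "[:-a, 1:] * [:-b, 1:] * M = \<Delta>" using two_factor[OF k] .
  then have "nn a * nn b = \<Delta> * M" by (simp only: ac_simps)
  then show ?thesis by simp
 qed
 have nas: "\<Delta> dvd nn a * s" using nn[OF a(1)] unfolding s_def by (simp add: mult.commute)
 have dbl: "\<Delta> dvd 2 * x" if "\<Delta> dvd x" for x using that by (rule dvd_mult)
 have l1: "onS (\<phi> (nn a) + t *s \<phi> (nn b))" for t
 proof -
  have "\<Delta> dvd (nn a + Polynomial.smult t (nn b))\<^sup>2 - 0"
  unfolding smult_square using na2 nab by (simp add: dvd_add dvd_smult)
  from onS_\<phi>I(1)[OF this] show ?thesis by (simp add: \<phi>_add \<phi>_smult)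
 qed
 have l2: "onS (\<phi> (nn a) + t *s \<phi> s)" for t
 proof -
  have "(nn a + Polynomial.smult t s)\<^sup>2 - Polynomial.smult (t\<^sup>2) (s * s) = nn a * nn a + Polynomial.smult (2 * t) (nn a * s)"
  unfolding smult_square by simp
  then have "\<Delta> dvd (nn a + Polynomial.smult t s)\<^sup>2 - Polynomial.smult (t\<^sup>2) (s * s)" using na2 nas by (simp add: dvd_add dvd_smult)
  moreover have "degree (Polynomial.smult (t\<^sup>2) (s * s)) \<le> 2" using ds degree_mult_le[of s s] degree_smult_le[of "t\<^sup>2" "s * s"] by linarith
  ultimately have "onS (\<phi> (nn a + Polynomial.smult t s))" using onS_\<phi>I(1) by blast
  then show ?thesis by (simp add: \<phi>_add \<phi>_smult)
 qed
 \<comment> \<open>With \<open>m = kk + t\<close> the vector is the class of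
   \<open>nn a - 2 t m\<close>. As \<open>nn a\<close> has square zero and \<open>nn a * m\<close>
   is congruent to \<open>t * nn a\<close>, the square is congruent to
   \<open>4 t^2 (m^2 - nn a)\<close>. The terms of degree four cancel in \<open>m^2 - nn a\<close>,
   and \<open>k0\<close> takes care of the next condition.\<close>
 have l3: "onS (\<phi> (nn a) + t *s \<phi> (- (2 * kk)) + t\<^sup>2 *s \<phi> (- 2))" for t
 proof -
  define m where "m = kk + [:t:]"
  define v where "v = nn a + Polynomial.smult (- (2 * t)) m"
  have "\<phi> (nn a) + t *s \<phi> (- (2 * kk)) + t\<^sup>2 *s \<phi> (- 2) = \<phi> (nn a + Polynomial.smult t (- (2 * kk)) + Polynomial.smult (t\<^sup>2) (- 2))"
  by (simp only: \<phi>_add \<phi>_smult)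
  also have "nn a + Polynomial.smult t (- (2 * kk)) + Polynomial.smult (t\<^sup>2) (- 2) = v"
  unfolding v_def m_def by (rule poly_eqI) (simp add: power2_eq_square algebra_simps coeff_2_mult numeral_poly coeff_pCons split: nat.split)
  finally have V: "\<phi> (nn a) + t *s \<phi> (- (2 * kk)) + t\<^sup>2 *s \<phi> (- 2) = \<phi> v" .
  define w where "w = m * m - nn a"
  have "\<Delta> dvd nn a * m - Polynomial.smult (poly m a) (nn a)" by (rule nn_mult[OF a(1)])
  moreover have "poly m a = t" unfolding m_def kk_def s_def by simp
  ultimately have e: "\<Delta> dvd nn a * m - Polynomial.smult t (nn a)" by simp
  have "v\<^sup>2 - Polynomial.smult (4 * t\<^sup>2) w = nn a * nn a - Polynomial.smult (4 * t) (nn a * m - Polynomial.smult t (nn a))"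
  unfolding v_def w_def smult_square by (rule poly_eqI) (simp add: power2_eq_square algebra_simps)
  then have dv: "\<Delta> dvd v\<^sup>2 - Polynomial.smult (4 * t\<^sup>2) w" using na2(1) e by (simp add: dvd_diff dvd_smult)
  have ring: "(s * (s + c) + d) * (s * (s + c) + d) = s ^ 4 + (c + c) * s ^ 3 + (c * c + (d + d)) * s ^ 2 + ((d + d) * c) * s ^ 1 + (d * d) * s ^ 0" for c d
  by (simp add: eval_nat_numeral algebra_simps)
  have ring': "s * (x4 + y3 * s ^ 3 + y2 * s ^ 2 + y1 * s ^ 1 + y0 * s ^ 0 - n * 1) = s * x4 + y3 * s ^ 4 + y2 * s ^ 3 + y1 * s ^ 2 + y0 * s ^ 1 - n * s" for x4 y3 y2 y1 y0 n
  by (simp add: eval_nat_numeral algebra_simps)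
  have lx: "l0 \<Delta> (s ^ 0) = 0" "l0 \<Delta> (s ^ 1) = 0" "l0 \<Delta> (s ^ 2) = 0" "l0 \<Delta> (s ^ 3) = 0" "l0 \<Delta> (s ^ 4) = 1"
  using l0_power[of 0 a] l0_power[of 1 a] l0_power[of 2 a] l0_power[of 3 a] l0_power[of 4 a]
  unfolding s_def[symmetric] by simp_all
  have w: "w = s ^ 4 + [:2 * k0:] * s ^ 3 + [:k0\<^sup>2 + 2 * t:] * s ^ 2 + [:2 * t * k0:] * s ^ 1 + [:t\<^sup>2:] * s ^ 0 - nn a * 1"
  unfolding w_def m_def kk_def ring by (simp add: power2_eq_square, simp only: mult.commute mult.left_commute)
  have cst: "[:c:] * x = Polynomial.smult c x" for c and x :: "complex poly" by simp
  have w0: "l0 \<Delta> w = 0" unfolding w by (simp only: cst l0_add l0_diff l0_smult lx l0_nn[OF a(1)]) simp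
  have s5: "s * s ^ 4 = s ^ 5" by (simp add: eval_nat_numeral)
  have w1: "l0 \<Delta> (s * w) = 0" unfolding w ring' s5 by (simp only: cst l0_add l0_diff l0_smult lx l0_nn[OF a(1)]) (simp add: k0_def s_def)
  have "[:0, 1:] * w = s * w + Polynomial.smult a w" unfolding s_def by simp
  then have w2: "l0 \<Delta> ([:0, 1:] * w) = 0" using w0 w1 by (simp only: l0_add l0_smult) simp
  have "bil Q (\<phi> v) (\<phi> v) = l0 \<Delta> (Polynomial.smult (4 * t\<^sup>2) w)" unfolding bilQ power2_eq_square[symmetric] by (rule l0_cong[OF dv])
  moreover have "bil P (\<phi> v) (\<phi> v) = l0 \<Delta> ([:0, 1:] * Polynomial.smult (4 * t\<^sup>2) w)"
  unfolding bilP power2_eq_square[symmetric]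
  proof (rule l0_cong)
  show "\<Delta> dvd [:0, 1:] * v\<^sup>2 - [:0, 1:] * Polynomial.smult (4 * t\<^sup>2) w" unfolding right_diff_distrib[symmetric] using dv by (rule dvd_mult)
  qed
  moreover have "[:0, 1:] * Polynomial.smult (4 * t\<^sup>2) w = Polynomial.smult (4 * t\<^sup>2) ([:0, 1:] * w)" by (rule mult_smult_right)
  ultimately show ?thesis unfolding V onS_def using w0 w2 by (simp only: l0_smult) simp
 qed
 define vf where "vf i = [\<phi> (nn a), \<phi> (nn b), \<phi> s, \<phi> (- (2 * kk))] ! i" for i
 \<comment> \<open>A combination has degree at most four, so it is divisible by
   \<open>\<Delta>\<close> only if it is zero. The coefficients in degrees 4 and 3 separate
   \<open>nn a\<close> from \<open>nn b\<close>, those in degrees 2 and 1 separate \<open>kk\<close>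
   from \<open>s\<close>.\<close>
 have ind: "\<forall>i<4. c i = 0" if "(\<Sum>i<4. c i *s vf i) = 0" for c
 proof -
  obtain M where M: "nn a = [:-b, 1:] * M" "nn b = [:-a, 1:] * M" "[:-a, 1:] * [:-b, 1:] * M = \<Delta>" using two_factor[OF k] .
  define z where "z = Polynomial.smult (c 0) (nn a) + Polynomial.smult (c 1) (nn b) + Polynomial.smult (c 2) s + Polynomial.smult (c 3) (- (2 * kk))"
  have "(\<Sum>i<4. c i *s vf i) = \<phi> z" unfolding z_def vf_def by (simp only: \<phi>_add \<phi>_smult) (simp add: eval_nat_numeral)
  then have dz: "\<Delta> dvd z" using that by (simp add: \<phi>_eq_0)
  have dM: "degree M = 3"
  proof -
  have "M \<noteq> 0" using M(1) degree_nn[OF a(1)] by auto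
  then have "degree ([:-b, 1:] * M) = 1 + degree M" by (subst degree_mult_eq) auto
  then show ?thesis unfolding M(1)[symmetric] degree_nn[OF a(1)] by simp
  qed
  have c4: "coeff (nn x) 4 = 1" if "x \<in> E" for x
  proof -
  have "coeff ([:-x, 1:] * nn x) 5 = 1" unfolding nn[OF that] using monic deg\<Delta> by simp
  then show ?thesis using degree_nn[OF that] by (simp add: eval_nat_numeral coeff_eq_0)
  qed
  have "coeff ([:-b, 1:] * M) 4 = 1" unfolding M(1)[symmetric] using c4[OF a(1)] .
  then have M3: "coeff M 3 = 1" using dM by (simp add: eval_nat_numeral coeff_eq_0)
  have c3: "coeff (nn a) 3 = coeff M 2 - b" "coeff (nn b) 3 = coeff M 2 - a"
  unfolding M(1,2) using M3 by (simp_all add: eval_nat_numeral)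
  have ck: "coeff s 4 = 0" "coeff s 3 = 0" "coeff s 2 = 0" "coeff s 1 = 1" "coeff kk 4 = 0" "coeff kk 3 = 0" "coeff kk 2 = 1"
  unfolding kk_def s_def by (simp_all add: eval_nat_numeral)
  have dk: "degree s \<le> 4" "degree kk \<le> 4" unfolding kk_def s_def by (auto simp: degree_pCons_eq_if)
  have d2: "degree (- (2 * kk)) \<le> 4" unfolding degree_minus mult_2 by (intro degree_add_le dk(2))
  have dn: "degree (nn a) \<le> 4" "degree (nn b) \<le> 4" using degree_nn a b by auto
  have "degree z \<le> 4" unfolding z_def
  by (intro degree_add_le order_trans[OF degree_smult_le] dk(1) d2 dn)
  then have "z = 0" using dvd_imp_degree_le[OF dz] deg\<Delta> by linarith
  then have cz: "coeff z i = 0" for i by simp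
  have e1: "c 0 + c 1 = 0" using cz[of 4] unfolding z_def by (simp add: c4[OF a(1)] c4[OF b(1)] ck coeff_2_mult)
  have e2: "c 0 * (coeff M 2 - b) + c 1 * (coeff M 2 - a) = 0" using cz[of 3] unfolding z_def by (simp add: c3 ck coeff_2_mult)
  have e3: "c 1 = - c 0" using e1 by (simp add: eq_neg_iff_add_eq_0 add.commute)
  have "c 0 * (a - b) = 0" using e2 unfolding e3 by (simp add: algebra_simps)
  then have e4: "c 0 = 0" "c 1 = 0" using b(3) e3 by auto
  have e5: "c 3 = 0" using cz[of 2] unfolding z_def by (simp add: e4 ck coeff_2_mult del: One_nat_def)
  have "c 2 = 0" using cz[of 1] unfolding z_def by (simp add: e4 e5 ck coeff_2_mult del: One_nat_def)
  then show ?thesis using e4 e5 by (auto simp: eval_nat_numeral less_Suc_eq)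
 qed
 define v where "v = \<phi> (nn a)"
 have von: "onS v" using l1[of 0] unfolding v_def by simp
 have "vf ` {..<4} \<subseteq> cone_tangent_space S v"
 proof (rule image_subsetI)
  fix i :: nat assume "i \<in> {..<4}"
  then have i: "i = 0 \<or> i = 1 \<or> i = 2 \<or> i = 3" by auto
  show "vf i \<in> cone_tangent_space S v" unfolding cone_tangent_space_def
  proof (intro CollectI allI impI, elim conjE)
  fix d f assume f: "form d f" "S \<subseteq> zero_locus {f}"
  have f0': "f w = 0" if "onS w" "w \<noteq> 0" for w
  using subsetD[OF f(2) mem[OF that]] mem_hcoords_pt[OF that(2)] unfolding zero_locus_def by simp
  have f0: "f w = 0" if "onS w" for w
  proof (cases "w = 0")
  case True
  have "f (0 *s v) = 0 ^ d * f v" using f(1) unfolding form_def by blast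
  then show ?thesis using f0'[OF von] nz True unfolding v_def by simp
  next
  case False
  with that show ?thesis by (rule f0')
  qed
  obtain D where D: "\<And>v w. deriv (\<lambda>t. f (v + t *s w)) 0 = D v w"
  "\<And>Y U q. vholo Y U \<Longrightarrow> q \<in> U \<Longrightarrow> dx (\<lambda>q. f (Y q)) q = D (Y q) (vdx Y q)"
  using poly_derivative[OF f(1)[unfolded form_def, THEN conjunct1]] by metis
  from i show "deriv (\<lambda>t. f (v + t *s vf i)) 0 = 0"
  proof (elim disjE)
  assume i: "i = 0"
  have "onS (v + t *s v)" for t
  using onS_scale[OF von, of "1 + t"] by (simp add: vec.scale_left_distrib)
  then show ?thesis unfolding i vf_def by (simp add: f0 flip: v_def)
  next
  assume i: "i = 3"
  have "dx (\<lambda>r. f (v + fst r *s vf 3 + (fst r)\<^sup>2 *s \<phi> (- 2))) (0, 0) = D v (vf 3)"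
  using D(2)[OF vholo_line(1), of "(0, 0)" v "vf 3" "\<phi> (- 2)"] unfolding vholo_line(2) by simp
  moreover have "(\<lambda>r. f (v + fst r *s vf 3 + (fst r)\<^sup>2 *s \<phi> (- 2))) = (\<lambda>r :: complex \<times> complex. 0)"
  using l3 f0 unfolding v_def vf_def by (simp add: fun_eq_iff)
  ultimately show ?thesis unfolding i D(1) by (simp add: dx_dy_const)
  qed (use l1 l2 f0 in \<open>simp_all add: vf_def v_def\<close>)
  qed
 qed
 from vec.independent_card_le_dim[OF this independent_family(1)[where n = 4 and v = vf, OF ind]]
 have d4: "vec.dim (cone_tangent_space S v) \<ge> 4" using independent_family(2)[where n = 4 and v = vf, OF ind] by simp
 have "pt v \<notin> smooth_locus S"
 proof
  assume "pt v \<in> smooth_locus S"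
  then obtain d where d: "variety_dim S = enat d" "vec.dim (cone_tangent_space S v) = d + 1"
  using mem_hcoords_pt[of v] nz unfolding smooth_locus_def v_def by blast
  then have "d = 2" using dim by (metis enat.inject numeral_eq_enat)
  then show False using d d4 by simp
 qed
 then show ?thesis using mem[OF von] nz unfolding singular_locus_def v_def by blast
qed

end

section \<open>Taylor coefficients at the eigenvalues, and local equations\<close>

lemma order_along_positive:
 assumes "order_along q h f = enat k" "k > 0"
 obtains j N g where "j > 0" "q \<in> N" "holomorphic2_on g N" "\<And>r. r \<in> N \<Longrightarrow> f r = h r ^ j * g r"
proof (rule ccontr)
 assume no: "\<not> thesis"
 have "order_along q h f \<le> 0" unfolding order_along_def
 proof (rule Sup_least)
  fix x assume "x \<in> {enat k | k. \<exists>N g. q \<in> N \<and> holomorphic2_on g N \<and> (\<forall>r\<in>N. f r = h r ^ k * g r)}"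
  then obtain j N g where j: "x = enat j" "q \<in> N" "holomorphic2_on g N" "\<forall>r\<in>N. f r = h r ^ j * g r" by blast
  then have "j = 0" using no that by blast
  then show "x \<le> 0" using j(1) by (simp add: zero_enat_def)
 qed
 then show False using assms by (simp add: zero_enat_def)
qed

lemma lin_subspace_closed:
 fixes W :: "(complex^5) set"
 assumes "vec.subspace W"
 shows "closed W"
 by (rule closed_subspace, rule real_vector.subspaceI)
  (use assms in \<open>auto simp: vec.subspace_def scaleR_cvec\<close>)

lemma pcompose_power: "pcompose (p ^ n) q = pcompose p q ^ n"
 by (induction n) (simp_all add: pcompose_mult pcompose_1)

context pencil_roots
begin

definition cf :: "nat \<Rightarrow> complex^5 \<Rightarrow> complex^5 \<Rightarrow> complex" where
 "cf i v w = coeff ((rep v * rep w) mod \<Delta>) i"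

lemma coeff_sq: "coeff (sq v) i = cf i v v"
 unfolding cf_def sq_def power2_eq_square ..

lemma cf_commute: "cf i v w = cf i w v"
 unfolding cf_def by (simp add: mult.commute)

lemma lin_cf: "lin (cf i v)"
 unfolding lin_def cf_def by (simp add: rep_add rep_scale distrib_left poly_mod_add_left mod_smult_left)

definition cfm :: "nat \<Rightarrow> complex^5^5" where
 "cfm i = (\<chi> k l. cf i (axis k 1) (axis l 1))"

lemma cf_bil: "cf i v w = bil (cfm i) v w"
proof -
 have "cf i v w = (\<Sum>k\<in>UNIV. cf i w (axis k 1) * v $ k)"
  unfolding cf_commute[of i v w] by (rule lin_expand[OF lin_cf])
 also have "\<dots> = (\<Sum>k\<in>UNIV. cf i (axis k 1) w * v $ k)" by (simp only: cf_commute[of i w])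
 also have "\<dots> = (\<Sum>k\<in>UNIV. (\<Sum>l\<in>UNIV. cf i (axis k 1) (axis l 1) * w $ l) * v $ k)"
  by (subst lin_expand[OF lin_cf, of i _ w]) (rule refl)
 also have "\<dots> = bil (cfm i) v w"
  unfolding bil_def cfm_def by (simp add: sum_distrib_right sum_distrib_left ac_simps)
 finally show ?thesis .
qed

text \<open>The coefficient of \<open>(t - a) ^ i\<close> in the representing polynomial.\<close>

definition tay :: "complex \<Rightarrow> nat \<Rightarrow> complex^5 \<Rightarrow> complex" where
 "tay a i v = coeff (pcompose (rep v) [:a, 1:]) i"

lemma lin_tay: "lin (tay a i)"
 unfolding lin_def tay_def by (simp add: rep_add rep_scale pcompose_add pcompose_smult)

lemma tay_0: "tay a 0 v = poly (rep v) a"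
 unfolding tay_def by (simp flip: poly_0_coeff_0 add: poly_pcompose)

lemma tay_dvd:
 assumes "[:-a, 1:] ^ n dvd rep v - g" "i < n"
 shows "tay a i v = coeff (pcompose g [:a, 1:]) i"
proof -
 obtain k where k: "rep v - g = [:-a, 1:] ^ n * k" using assms(1) by (elim dvdE)
 have "pcompose (rep v - g) [:a, 1:] = pcompose ([:-a, 1:] ^ n) [:a, 1:] * pcompose k [:a, 1:]"
  unfolding k by (rule pcompose_mult)
 moreover have "pcompose ([:-a, 1:] ^ n) [:a, 1:] = monom 1 n"
  unfolding pcompose_power by (simp add: pcompose_pCons monom_altdef)
 ultimately have "monom 1 n dvd pcompose (rep v - g) [:a, 1:]" by simp
 then have "coeff (pcompose (rep v - g) [:a, 1:]) i = 0" using assms(2) monom_1_dvd_iff' by blast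
 then show ?thesis unfolding tay_def by (simp add: pcompose_diff)
qed

text \<open>The coefficients of \<open>f^2\<close> and \<open>sq v\<close> in powers of
  \<open>t - a\<close> agree below the order \<open>\<mu> a\<close>. On the surface
  \<open>sq v\<close> is quadratic, so from the third coefficient on the right side is zero.\<close>

lemma taylor_relations:
 assumes v: "onS v" and a: "a \<in> E"
 defines "f \<equiv> \<lambda>i. tay a i v" and "h \<equiv> \<lambda>i. coeff (sq v) i"
 shows "h 0 + a * h 1 + a\<^sup>2 * h 2 = (f 0)\<^sup>2"
  and "\<mu> a \<ge> 2 \<Longrightarrow> h 1 + 2 * a * h 2 = 2 * f 0 * f 1"
  and "\<mu> a \<ge> 3 \<Longrightarrow> h 2 = 2 * f 0 * f 2 + (f 1)\<^sup>2"
  and "\<mu> a \<ge> 4 \<Longrightarrow> f 0 * f 3 + f 1 * f 2 = 0"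
  and "\<mu> a \<ge> 5 \<Longrightarrow> 2 * f 0 * f 4 + 2 * f 1 * f 3 + (f 2)\<^sup>2 = 0"
proof -
 define F where "F = pcompose (rep v) [:a, 1:]"
 define H where "H = pcompose (sq v) [:a, 1:]"
 have fF: "f i = coeff F i" for i unfolding f_def F_def tay_def ..
 obtain c2 c1 c0' where s: "sq v = [:c0', c1, c2:]" using degree_le_2E v onS_iff by metis
 have h: "h 0 = c0'" "h 1 = c1" "h 2 = c2" unfolding h_def s by (simp_all add: eval_nat_numeral)
 have "H = [:c0' + a * c1 + a\<^sup>2 * c2, c1 + 2 * a * c2, c2:]"
  unfolding H_def s by (simp add: pcompose_pCons power2_eq_square algebra_simps)
 then have H: "coeff H 0 = c0' + a * c1 + a\<^sup>2 * c2" "coeff H 1 = c1 + 2 * a * c2" "coeff H 2 = c2" "coeff H 3 = 0" "coeff H 4 = 0"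
  by (simp_all add: eval_nat_numeral)
 have "\<Delta> dvd (rep v)\<^sup>2 - sq v" using sq_dvd[of "rep v"] unfolding \<phi>_rep .
 moreover have "[:-a, 1:] ^ \<mu> a dvd \<Delta>" using \<Delta>_split[OF a] by (metis dvd_triv_left)
 ultimately have "[:-a, 1:] ^ \<mu> a dvd (rep v)\<^sup>2 - sq v" by (rule dvd_trans[rotated])
 then obtain k where k: "(rep v)\<^sup>2 - sq v = [:-a, 1:] ^ \<mu> a * k" by (elim dvdE)
 have "pcompose ((rep v)\<^sup>2 - sq v) [:a, 1:] = pcompose ([:-a, 1:] ^ \<mu> a) [:a, 1:] * pcompose k [:a, 1:]"
  unfolding k by (rule pcompose_mult)
 moreover have "pcompose ([:-a, 1:] ^ \<mu> a) [:a, 1:] = monom 1 (\<mu> a)"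
  unfolding pcompose_power by (simp add: pcompose_pCons monom_altdef)
 moreover have "pcompose ((rep v)\<^sup>2 - sq v) [:a, 1:] = F * F - H"
  unfolding F_def H_def power2_eq_square by (simp add: pcompose_diff pcompose_mult)
 ultimately have "monom 1 (\<mu> a) dvd F * F - H" by simp
 then have e: "coeff (F * F) i = coeff H i" if "i < \<mu> a" for i using that monom_1_dvd_iff'[of "\<mu> a" "F * F - H"] by simp
 have FF: "coeff (F * F) 0 = f 0 * f 0" "coeff (F * F) 1 = f 0 * f 1 + f 1 * f 0"
  "coeff (F * F) 2 = f 0 * f 2 + f 1 * f 1 + f 2 * f 0"
  "coeff (F * F) 3 = f 0 * f 3 + f 1 * f 2 + f 2 * f 1 + f 3 * f 0"
  "coeff (F * F) 4 = f 0 * f 4 + f 1 * f 3 + f 2 * f 2 + f 3 * f 1 + f 4 * f 0"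
  unfolding coeff_mult fF by (simp_all add: eval_nat_numeral)
 show "h 0 + a * h 1 + a\<^sup>2 * h 2 = (f 0)\<^sup>2"
  using e[of 0] \<mu>_pos[OF a] unfolding FF H h by (simp add: power2_eq_square)
 show "\<mu> a \<ge> 2 \<Longrightarrow> h 1 + 2 * a * h 2 = 2 * f 0 * f 1" using e[of 1] unfolding FF H h by (simp add: algebra_simps)
 show "\<mu> a \<ge> 3 \<Longrightarrow> h 2 = 2 * f 0 * f 2 + (f 1)\<^sup>2" using e[of 2] unfolding FF H h by (simp add: power2_eq_square algebra_simps)
 show "f 0 * f 3 + f 1 * f 2 = 0" if "\<mu> a \<ge> 4"
 proof -
  have "2 * (f 0 * f 3 + f 1 * f 2) = 0" using e[of 3] that unfolding FF H by (simp add: algebra_simps)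
  then show ?thesis by (simp only: mult_eq_0_iff) simp
 qed
 show "\<mu> a \<ge> 5 \<Longrightarrow> 2 * f 0 * f 4 + 2 * f 1 * f 3 + (f 2)\<^sup>2 = 0" using e[of 4] unfolding FF H by (simp add: power2_eq_square algebra_simps)
qed

end

context pencil_chart
begin

lemma lin_X:
 assumes "lin \<psi>"
 shows "holomorphic2_on (\<lambda>q. \<psi> (X q)) U" "q \<in> U \<Longrightarrow> dx (\<lambda>q. \<psi> (X q)) q = \<psi> (Xx q)"
  "q \<in> U \<Longrightarrow> dy (\<lambda>q. \<psi> (X q)) q = \<psi> (Xy q)"
proof -
 have X: "(\<lambda>q. \<psi> (X q)) = (\<lambda>q. \<psi> (cl 1) + fst q * \<psi> (cl 2) + snd q * \<psi> (cl 3) + F q * \<psi> (cl 4) + G q * \<psi> (cl 5))"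
  unfolding X_comb using assms unfolding lin_def by simp
 have x: "\<psi> (Xx q) = \<psi> (cl 2) + dx F q * \<psi> (cl 4) + dx G q * \<psi> (cl 5)"
  "\<psi> (Xy q) = \<psi> (cl 3) + dy F q * \<psi> (cl 4) + dy G q * \<psi> (cl 5)" for q
  unfolding Xx_def Xy_def using assms unfolding lin_def by simp_all
 show "holomorphic2_on (\<lambda>q. \<psi> (X q)) U" "q \<in> U \<Longrightarrow> dx (\<lambda>q. \<psi> (X q)) q = \<psi> (Xx q)"
  "q \<in> U \<Longrightarrow> dy (\<lambda>q. \<psi> (X q)) q = \<psi> (Xy q)"
  unfolding X x using affine_comb_deriv[OF hF hG] by blast+
qed

text \<open>The conormal space at a transversal point is spanned by the differentials of the two
  quadrics, and Cramer's rule gives the coefficients.\<close>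

lemma conormal:
 assumes q: "q \<in> V" and \<psi>: "lin \<psi>" "\<psi> (X q) = 0" "\<psi> (Xx q) = 0" "\<psi> (Xy q) = 0"
 obtains \<alpha> \<beta> where "\<And>w. \<psi> w = \<alpha> * bil Q (X q) w + \<beta> * bil P (X q) w"
proof -
 have qU: "q \<in> U" and d: "dd q \<noteq> 0" using q unfolding V_def by auto
 define \<alpha> \<beta> where "\<alpha> = (\<psi> (cl 4) * qq q - \<psi> (cl 5) * pp q) / dd q" and "\<beta> = (\<psi> (cl 5) * rr q - \<psi> (cl 4) * ss q) / dd q"
 have "(\<psi> (cl 4) * qq q - \<psi> (cl 5) * pp q) * rr q + (\<psi> (cl 5) * rr q - \<psi> (cl 4) * ss q) * pp q = \<psi> (cl 4) * dd q"
  "(\<psi> (cl 4) * qq q - \<psi> (cl 5) * pp q) * ss q + (\<psi> (cl 5) * rr q - \<psi> (cl 4) * ss q) * qq q = \<psi> (cl 5) * dd q"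
  unfolding dd_def by (simp_all add: algebra_simps)
 then have ab: "\<alpha> * rr q + \<beta> * pp q = \<psi> (cl 4)" "\<alpha> * ss q + \<beta> * qq q = \<psi> (cl 5)"
  unfolding \<alpha>_def \<beta>_def using d by (simp_all add: divide_eq_eq flip: add_divide_distrib)
 have "\<psi> w = \<alpha> * bil Q (X q) w + \<beta> * bil P (X q) w" for w
 proof -
  obtain x0 x1 x2 x3 x4 where w: "w = x0 *s cl 4 + x1 *s cl 5 + x2 *s Xx q + x3 *s Xy q + x4 *s X q"
  using frame_basis by blast
  have "\<psi> w = x0 * \<psi> (cl 4) + x1 * \<psi> (cl 5)" unfolding w using \<psi> unfolding lin_def by simp
  also have "\<dots> = \<alpha> * (x0 * rr q + x1 * ss q) + \<beta> * (x0 * pp q + x1 * qq q)"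
  unfolding ab[symmetric] by (simp add: algebra_simps)
  also have "\<dots> = \<alpha> * bil Q (X q) w + \<beta> * bil P (X q) w"
  unfolding w by (simp add: bil_simps tangent[OF qU] rr_def ss_def pp_def qq_def)
  finally show ?thesis .
 qed
 then show thesis by (rule that)
qed

text \<open>If both partial derivatives of the functional vanished, it would be conormal, and the
  polynomial \<open>g\<close> that represents it would be congruent to a linear polynomial times
  \<open>rep (X q)\<close>. This is the test that a Taylor coefficient is a reduced local
  equation.\<close>

lemma lin_derivative_nonzero:
 assumes q: "q \<in> V" and \<psi>: "lin \<psi>" "\<psi> (X q) = 0" and g: "\<And>w. \<psi> w = l0 \<Delta> (g * rep w)"
  and no: "\<And>\<alpha> \<beta>. \<not> \<Delta> dvd [:\<alpha>, \<beta>:] * rep (X q) - g"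
 shows "dx (\<lambda>r. \<psi> (X r)) q \<noteq> 0 \<or> dy (\<lambda>r. \<psi> (X r)) q \<noteq> 0"
proof (rule ccontr)
 assume "\<not> ?thesis"
 moreover have qU: "q \<in> U" using q V_U by blast
 ultimately have "\<psi> (Xx q) = 0" "\<psi> (Xy q) = 0" using lin_X[OF \<psi>(1)] by auto
 from conormal[OF q \<psi> this] obtain \<alpha> \<beta> where ab: "\<And>w. \<psi> w = \<alpha> * bil Q (X q) w + \<beta> * bil P (X q) w" by blast
 define f where "f = rep (X q)"
 have Xf: "X q = \<phi> f" unfolding f_def by (simp add: \<phi>_rep)
 have "l0 \<Delta> (([:\<alpha>, \<beta>:] * f - g) * k) = 0" for k
 proof -
  have "\<psi> (\<phi> k) = l0 \<Delta> (g * k)"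
  proof -
  have "\<Delta> dvd g * rep (\<phi> k) - g * k"
  unfolding right_diff_distrib[symmetric] rep_\<phi> by (rule dvd_mult) (metis dvd_minus_mod minus_diff_eq dvd_minus_iff)
  then show ?thesis unfolding g using l0_cong by blast
  qed
  moreover have "\<psi> (\<phi> k) = l0 \<Delta> ([:\<alpha>, \<beta>:] * f * k)"
  proof -
  have "[:\<alpha>, \<beta>:] * f * k = Polynomial.smult \<alpha> (f * k) + Polynomial.smult \<beta> ([:0, 1:] * (f * k))"
  by (rule poly_eqI) (simp add: algebra_simps)
  then show ?thesis unfolding ab Xf bilQ bilP by (simp only: l0_add l0_smult)
  qed
  ultimately show ?thesis unfolding left_diff_distrib l0_diff by simp
 qed
 then have "\<Delta> dvd [:\<alpha>, \<beta>:] * f - g" by (rule l0_nondegenerate)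
 then show False using no unfolding f_def by blast
qed

lemma continuous_X: "continuous_on U X"
proof -
 have "continuous_on U (\<lambda>q. \<chi> i. X q $ i)"
  using vholo_X holo2_continuous unfolding vholo_def by (intro continuous_on_vec_lambda) auto
 then show ?thesis by simp
qed

lemma avoid_lines:
 assumes "finite \<L>" "\<And>M. M \<in> \<L> \<Longrightarrow> projective_line M" "q \<in> U" "\<And>M. M \<in> \<L> \<Longrightarrow> pt (X q) \<notin> M"
 obtains N where "open N" "q \<in> N" "N \<subseteq> U" "\<And>r M. r \<in> N \<Longrightarrow> M \<in> \<L> \<Longrightarrow> pt (X r) \<notin> M"
proof -
 have "open {r \<in> U. pt (X r) \<notin> M}" if M: "M \<in> \<L>" for M
 proof -
  obtain W where W: "vec.subspace W" "M = linear_subspace W" using assms(2)[OF M] unfolding projective_line_def by blast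
  have "open (U \<inter> X -` (- W))"
  using continuous_open_preimage[OF continuous_X openU] lin_subspace_closed[OF W(1)] by (simp add: open_Compl)
  moreover have "U \<inter> X -` (- W) = {r \<in> U. pt (X r) \<notin> M}" unfolding W(2) using mem_linear_subspace[OF W(1) X_nonzero] by auto
  ultimately show ?thesis by simp
 qed
 then have "open (U \<inter> (\<Inter>M\<in>\<L>. {r \<in> U. pt (X r) \<notin> M}))" using assms(1) openU by (intro open_Int open_INT) auto
 then show thesis using assms(3,4) by (intro that[of "U \<inter> (\<Inter>M\<in>\<L>. {r \<in> U. pt (X r) \<notin> M})"]) auto
qed

text \<open>The zero set of the discriminant is covered by the finitely many listed lines. Near a
  point on \<open>L\<close> alone the other lines stay away, so there the discriminant cuts out
  \<open>L\<close> as a set.\<close>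

lemma disc_X_iff_line:
 assumes q: "q \<in> U" and L: "L \<in> lines" "L \<subseteq> S" and only: "\<And>M. M \<in> lines \<Longrightarrow> pt (X q) \<in> M \<Longrightarrow> M = L"
  and kinds: known_kind
 obtains N where "open N" "q \<in> N" "N \<subseteq> U" "\<And>r. r \<in> N \<Longrightarrow> pt (X r) \<in> L \<longleftrightarrow> disc (sq (X r)) = 0"
proof -
 obtain N where N: "open N" "q \<in> N" "N \<subseteq> U" "\<And>r M. r \<in> N \<Longrightarrow> M \<in> lines - {L} \<Longrightarrow> pt (X r) \<notin> M"
  using avoid_lines[of "lines - {L}" q] finite_lines lines_projective only q by (metis Diff_iff finite_Diff singletonI)
 show thesis
 proof (rule that[OF N(1-3)])
  fix r assume r: "r \<in> N"
  obtain u v where uv: "indep2 u v" "L = join u v" using lines_projective[OF L(1)] projective_lineE by blast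
  have on: "onS (\<alpha> *s u + \<beta> *s v)" for \<alpha> \<beta>
  proof (cases "\<alpha> *s u + \<beta> *s v = 0")
  case False
  then have "pt (\<alpha> *s u + \<beta> *s v) \<in> L" unfolding uv(2) mem_join[OF False] by blast
  then show ?thesis using L(2) mem_S[OF False] by blast
  qed (simp add: onS_def bil_simps)
  show "pt (X r) \<in> L \<longleftrightarrow> disc (sq (X r)) = 0"
  proof
  assume "pt (X r) \<in> L"
  then obtain \<alpha> \<beta> where "X r = \<alpha> *s u + \<beta> *s v" unfolding uv(2) mem_join[OF X_nonzero] by blast
  then show "disc (sq (X r)) = 0" using line_disc[OF on uv(1)] by simp
  next
  assume "disc (sq (X r)) = 0"
  then obtain M where "M \<in> lines" "pt (X r) \<in> M" using disc_lines[OF kinds onS_X] X_nonzero r N(3) by blast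
  then show "pt (X r) \<in> L" using N(4)[OF r] by blast
  qed
 qed
qed

lemma H_eq:
 assumes q: "q \<in> V" and H: "H_coeffs F G = (Ha, Hb, Hc)"
  and c: "coeff (sq (X q)) 2 = k * a" "coeff (sq (X q)) 1 = k * b" "coeff (sq (X q)) 0 = k * c"
 shows "Ha q = k * (KK / dd q ^ 4 * (a * (qq q)\<^sup>2 + b * qq q * ss q + c * (ss q)\<^sup>2))"
  "Hb q = k * (- (KK / dd q ^ 4 * (2 * a * pp q * qq q + b * (pp q * ss q + qq q * rr q) + 2 * c * rr q * ss q)))"
  "Hc q = k * (KK / dd q ^ 4 * (a * (pp q)\<^sup>2 + b * pp q * rr q + c * (rr q)\<^sup>2))"
proof -
 define D where "D = dd q ^ 4"
 have D: "D \<noteq> 0" using q unfolding V_def D_def by simp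
 note h = H_formula[OF q H, unfolded c, folded D_def]
 have e: "y = z / D" if "D * y = z" for y z using that D by (simp add: field_simps)
 show "Ha q = k * (KK / dd q ^ 4 * (a * (qq q)\<^sup>2 + b * qq q * ss q + c * (ss q)\<^sup>2))"
  unfolding e[OF h(1)] D_def[symmetric] by (simp add: algebra_simps add_divide_distrib diff_divide_distrib)
 show "Hb q = k * (- (KK / dd q ^ 4 * (2 * a * pp q * qq q + b * (pp q * ss q + qq q * rr q) + 2 * c * rr q * ss q)))"
  unfolding e[OF h(2)] D_def[symmetric] by (simp add: algebra_simps add_divide_distrib diff_divide_distrib)
 show "Hc q = k * (KK / dd q ^ 4 * (a * (pp q)\<^sup>2 + b * pp q * rr q + c * (rr q)\<^sup>2))"
  unfolding e[OF h(3)] D_def[symmetric] by (simp add: algebra_simps add_divide_distrib diff_divide_distrib)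
qed

end

text \<open>Covariance of the discriminant: up to the sign of the middle one, the primed
  coefficients belong to the quadratic form after a linear substitution with determinant
  \<open>r * t - s * p\<close>. The second part is the injectivity of an invertible
  substitution.\<close>

lemma quadratic_transform_disc:
 fixes a b c r s p t :: complex
 defines "A' \<equiv> a * t\<^sup>2 + b * t * s + c * s\<^sup>2" and "B' \<equiv> 2 * a * p * t + b * (p * s + t * r) + 2 * c * r * s"
  and "C' \<equiv> a * p\<^sup>2 + b * p * r + c * r\<^sup>2"
 shows "(-(K * B'))\<^sup>2 - 4 * (K * A') * (K * C') = K\<^sup>2 * (r * t - s * p)\<^sup>2 * (b\<^sup>2 - 4 * a * c)"
  and "A' = 0 \<Longrightarrow> B' = 0 \<Longrightarrow> C' = 0 \<Longrightarrow> r * t - s * p \<noteq> 0 \<Longrightarrow> a = 0 \<and> b = 0 \<and> c = 0"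
proof -
 have "B'\<^sup>2 - 4 * A' * C' = (r * t - s * p)\<^sup>2 * (b\<^sup>2 - 4 * a * c)"
  unfolding A'_def B'_def C'_def by (simp add: power2_eq_square algebra_simps)
 then have "K\<^sup>2 * (B'\<^sup>2 - 4 * A' * C') = K\<^sup>2 * ((r * t - s * p)\<^sup>2 * (b\<^sup>2 - 4 * a * c))" by simp
 then show "(-(K * B'))\<^sup>2 - 4 * (K * A') * (K * C') = K\<^sup>2 * (r * t - s * p)\<^sup>2 * (b\<^sup>2 - 4 * a * c)"
  by (simp add: power2_eq_square algebra_simps)
 assume 0: "A' = 0" "B' = 0" "C' = 0" and d: "r * t - s * p \<noteq> 0"
 have "(r * t - s * p)\<^sup>2 * a = r\<^sup>2 * A' - r * s * B' + s\<^sup>2 * C'"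
  "(r * t - s * p)\<^sup>2 * c = t\<^sup>2 * C' - t * p * B' + p\<^sup>2 * A'"
  "(r * t - s * p)\<^sup>2 * b = (r * t + s * p) * B' - 2 * r * p * A' - 2 * s * t * C'"
  unfolding A'_def B'_def C'_def by (simp_all add: power2_eq_square algebra_simps)
 then show "a = 0 \<and> b = 0 \<and> c = 0" unfolding 0 using d by simp
qed

section \<open>Criteria for branching and for its absence\<close>

context pencil_chart
begin

text \<open>\<open>H0\<close>, \<open>H1\<close>, \<open>H2\<close> are coefficients in powers of
  \<open>t - a\<close>, a shift that preserves the discriminant. As they do not all vanish at
  \<open>q\<close> and the substitution leading to H is invertible, \<open>y ^ m\<close> is exactly
  the part belonging to the first divisor. The discriminant of \<open>sq X\<close> is
  \<open>y ^ (2 m + k)\<close> times a unit and cuts out \<open>L\<close> near \<open>q\<close>, so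
  \<open>y\<close> is an equation of \<open>L\<close>.\<close>

lemma branch_multiplicityI:
 assumes q: "q \<in> V" and L: "L \<in> lines" "L \<subseteq> S" "pt (X q) \<in> L" and only: "\<And>M. M \<in> lines \<Longrightarrow> pt (X q) \<in> M \<Longrightarrow> M = L"
  and kinds: known_kind
  and N: "q \<in> N" "N \<subseteq> V"
  and holo: "holomorphic2_on y N" "holomorphic2_on H0 N" "holomorphic2_on H1 N" "holomorphic2_on H2 N" "holomorphic2_on u N"
  and sqX: "\<And>r. r \<in> N \<Longrightarrow> coeff (sq (X r)) 2 = y r ^ m * H2 r"
  "\<And>r. r \<in> N \<Longrightarrow> coeff (sq (X r)) 1 = y r ^ m * (H1 r - 2 * a * H2 r)"
  "\<And>r. r \<in> N \<Longrightarrow> coeff (sq (X r)) 0 = y r ^ m * (H0 r - a * H1 r + a\<^sup>2 * H2 r)"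
  and d: "\<And>r. r \<in> N \<Longrightarrow> (H1 r)\<^sup>2 - 4 * H2 r * H0 r = y r ^ k * u r" and k: "k > 0" and u: "u q \<noteq> 0"
  and nz: "H0 q \<noteq> 0 \<or> H1 q \<noteq> 0 \<or> H2 q \<noteq> 0"
  and y: "y q = 0" "dx y q \<noteq> 0 \<or> dy y q \<noteq> 0"
 shows "has_branch_multiplicity_at S L (pt (X q)) k"
proof -
 define C2 C1 C0 where "C2 = H2" and "C1 = (\<lambda>r. H1 r - 2 * a * H2 r)" and "C0 = (\<lambda>r. H0 r - a * H1 r + a\<^sup>2 * H2 r)"
 have oN: "open N" by (rule holo2_open[OF holo(1)])
 have hC: "holomorphic2_on C2 N" "holomorphic2_on C1 N" "holomorphic2_on C0 N"
  unfolding C2_def C1_def C0_def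
  by (intro holo2_add holo2_diff holo2_mult holo2_const holo oN)+
 have dC: "(C1 r)\<^sup>2 - 4 * C2 r * C0 r = y r ^ k * u r" if "r \<in> N" for r
  unfolding d[OF that, symmetric] C2_def C1_def C0_def by (simp add: power2_eq_square algebra_simps)
 have nzC: "\<not> (C2 q = 0 \<and> C1 q = 0 \<and> C0 q = 0)" using nz unfolding C2_def C1_def C0_def by auto
 have NU: "N \<subseteq> U" using N(2) V_U by blast
 have hJ: "holomorphic2_on rr N" "holomorphic2_on ss N" "holomorphic2_on pp N" "holomorphic2_on qq N" "holomorphic2_on dd N"
  using holo_J holo2_subset[OF _ oN NU] by auto
 have ddN: "dd r \<noteq> 0" if "r \<in> N" for r using that N(2) unfolding V_def by auto
 obtain Ha Hb Hc where H: "H_coeffs F G = (Ha, Hb, Hc)" by (cases "H_coeffs F G") auto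
 define K where "K = (\<lambda>r. KK / dd r ^ 4)"
 have hK: "holomorphic2_on K N" unfolding K_def
  by (intro holo2_divide holo2_const holo2_power hJ oN) (use ddN in simp)
 define A' B' C' where "A' = (\<lambda>r. C2 r * (qq r)\<^sup>2 + C1 r * qq r * ss r + C0 r * (ss r)\<^sup>2)"
  and "B' = (\<lambda>r. 2 * C2 r * pp r * qq r + C1 r * (pp r * ss r + qq r * rr r) + 2 * C0 r * rr r * ss r)"
  and "C' = (\<lambda>r. C2 r * (pp r)\<^sup>2 + C1 r * pp r * rr r + C0 r * (rr r)\<^sup>2)"
 define da db dc where "da = (\<lambda>r. K r * A' r)" and "db = (\<lambda>r. - (K r * B' r))" and "dc = (\<lambda>r. K r * C' r)"
 have hD: "holomorphic2_on da N" "holomorphic2_on db N" "holomorphic2_on dc N"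
  unfolding da_def db_def dc_def A'_def B'_def C'_def
  by (intro holo2_add holo2_minus holo2_mult holo2_power holo2_const hJ hC hK oN)+
 have HD: "Ha r = y r ^ m * da r" "Hb r = y r ^ m * db r" "Hc r = y r ^ m * dc r" if "r \<in> N" for r
  using H_eq[OF subsetD[OF N(2) that] H, of "y r ^ m" "C2 r" "C1 r" "C0 r"] sqX[OF that]
  unfolding da_def db_def dc_def A'_def B'_def C'_def K_def C2_def C1_def C0_def by blast+
 have disc: "(db r)\<^sup>2 - 4 * da r * dc r = y r ^ k * ((K r)\<^sup>2 * (dd r)\<^sup>2 * u r)" if "r \<in> N" for r
  using quadratic_transform_disc(1)[of "K r" "C2 r" "pp r" "qq r" "C1 r" "ss r" "rr r" "C0 r"]
  unfolding da_def db_def dc_def A'_def B'_def C'_def dC[OF that] dd_def by (simp add: ac_simps)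
 have Kq: "K q \<noteq> 0" unfolding K_def using KK_nz ddN[OF N(1)] by simp
 have ge: "enat m \<le> order_along q y Ha" "enat m \<le> order_along q y Hb" "enat m \<le> order_along q y Hc"
  by (rule order_along_ge[OF N(1) hD(1) HD(1)] order_along_ge[OF N(1) hD(2) HD(2)] order_along_ge[OF N(1) hD(3) HD(3)]; assumption)+
 note oeq = order_along_eq[OF holo(1) N(1) y N(1)]
 have "\<not> (A' q = 0 \<and> B' q = 0 \<and> C' q = 0)"
  using quadratic_transform_disc(2)[of "C2 q" "qq q" "C1 q" "ss q" "C0 q" "pp q" "rr q"] nzC ddN[OF N(1)]
  unfolding A'_def B'_def C'_def dd_def by blast
 then have "da q \<noteq> 0 \<or> db q \<noteq> 0 \<or> dc q \<noteq> 0" unfolding da_def db_def dc_def using Kq by auto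
 then have "order_along q y Ha = enat m \<or> order_along q y Hb = enat m \<or> order_along q y Hc = enat m"
  using oeq[OF hD(1) HD(1)] oeq[OF hD(2) HD(2)] oeq[OF hD(3) HD(3)] by blast
 then have mult: "D1_multiplicity q y (H_coeffs F G) = enat m"
  unfolding H D1_multiplicity.simps using ge by (auto simp: min_def intro: antisym)
 have div: "divided_by_D1 q y (H_coeffs F G) (da, db, dc)"
  unfolding H divided_by_D1.simps using mult hD HD N(1) unfolding H by (intro exI[of _ m] exI[of _ N]) auto
 have ord: "order_along q y (discriminant (da, db, dc)) = enat k"
 proof (rule oeq)
  show "holomorphic2_on (\<lambda>r. (K r)\<^sup>2 * (dd r)\<^sup>2 * u r) N"
  by (intro holo2_mult holo2_power hK hJ holo)
  show "(K q)\<^sup>2 * (dd q)\<^sup>2 * u q \<noteq> 0" using Kq ddN[OF N(1)] u by simp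
 qed (simp add: disc)
 obtain N1 where N1: "open N1" "q \<in> N1" "N1 \<subseteq> U" "\<And>r. r \<in> N1 \<Longrightarrow> pt (X r) \<in> L \<longleftrightarrow> disc (sq (X r)) = 0"
  using disc_X_iff_line[OF _ L(1,2) only kinds] N(1) NU by blast
 define N2 where "N2 = N1 \<inter> {r \<in> N. u r \<noteq> 0}"
 have oN2: "open N2" unfolding N2_def
  using N1(1) open_nonzero[OF oN holo2_continuous[OF holo(5)]] by blast
 have dsq: "disc (sq (X r)) = y r ^ (2 * m) * (y r ^ k * u r)" if "r \<in> N" for r
  unfolding disc_def sqX[OF that] d[OF that, symmetric] by (simp add: power_mult power2_eq_square algebra_simps)
 have "curve_equation L A U F G q y" unfolding curve_equation_def
 proof (intro conjI exI[of _ N2] y ballI)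
  show "q \<in> N2" using N1(2) N(1) u unfolding N2_def by blast
  show "N2 \<subseteq> U" using N1(3) unfolding N2_def by blast
  show "holomorphic2_on y N2" by (rule holo2_subset[OF holo(1) oN2]) (auto simp: N2_def)
  fix r assume "r \<in> N2"
  then have r: "r \<in> N1" "r \<in> N" "u r \<noteq> 0" unfolding N2_def by auto
  show "graph_pt A F G r \<in> L \<longleftrightarrow> y r = 0"
  unfolding graph_pt_X N1(4)[OF r(1)] dsq[OF r(2)] using r(3) k by auto
 qed
 then show ?thesis unfolding has_branch_multiplicity_at_def
  using chart div ord graph_pt_X[of q] N(1) NU by (intro exI[of _ A] exI[of _ U] exI[of _ F] exI[of _ G] exI[of _ q] exI[of _ y] exI[of _ "(da, db, dc)"]) auto
qed

text \<open>If the discriminant of the divided form vanishes at \<open>q\<close>, so does that of H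
  itself, and covariance carries this over to \<open>sq (X q)\<close>.\<close>

lemma disc_zero_of_branch:
 assumes q: "q \<in> V" and curve: "curve_equation C A U F G q h" and div: "divided_by_D1 q h (H_coeffs F G) DS"
  and ord: "order_along q h (discriminant DS) = enat k" "k > 0"
 shows "disc (sq (X q)) = 0"
proof -
 obtain Ha Hb Hc where H: "H_coeffs F G = (Ha, Hb, Hc)" by (cases "H_coeffs F G") auto
 obtain a b c where DS: "DS = (a, b, c)" by (cases DS) auto
 obtain m N where m: "q \<in> N" "\<forall>r\<in>N. Ha r = h r ^ m * a r \<and> Hb r = h r ^ m * b r \<and> Hc r = h r ^ m * c r"
  using div unfolding H DS divided_by_D1.simps by blast
 obtain j N' g where j: "j > 0" "q \<in> N'" "\<And>r. r \<in> N' \<Longrightarrow> discriminant DS r = h r ^ j * g r"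
  using order_along_positive[OF ord] by metis
 have "h q = 0" using curve unfolding curve_equation_def by blast
 then have 0: "(b q)\<^sup>2 - 4 * a q * c q = 0" using j(3)[OF j(2)] j(1) unfolding DS by simp
 have "(Hb q)\<^sup>2 - 4 * Ha q * Hc q = (h q ^ m)\<^sup>2 * ((b q)\<^sup>2 - 4 * a q * c q)"
  using m by (simp add: power2_eq_square algebra_simps)
 then have "(Hb q)\<^sup>2 - 4 * Ha q * Hc q = 0" unfolding 0 by simp
 moreover have "(Hb q)\<^sup>2 - 4 * Ha q * Hc q = (KK / dd q ^ 4)\<^sup>2 * (dd q)\<^sup>2 * disc (sq (X q))"
  using quadratic_transform_disc(1)[of "KK / dd q ^ 4" "coeff (sq (X q)) 2" "pp q" "qq q" "coeff (sq (X q)) 1" "ss q" "rr q" "coeff (sq (X q)) 0"]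
  unfolding H_eq[OF q H, of 1 "coeff (sq (X q)) 2" "coeff (sq (X q)) 1" "coeff (sq (X q)) 0", simplified] disc_def dd_def by simp
 moreover have "dd q \<noteq> 0" using q unfolding V_def by simp
 ultimately show ?thesis using KK_nz by simp
qed

text \<open>If \<open>H\<close> is locally a possibly singular multiple of a form with non-vanishing discriminant,
 then the square of each coefficient of \<open>D\<^sub>S\<close> is a multiple of the discriminant of \<open>D\<^sub>S\<close>. So if the latter
 vanished on the curve, \<open>D\<^sub>S\<close> could be divided by another power of the equation.\<close>

lemma no_branch:
 assumes q: "q \<in> V" and N: "open N" "q \<in> N" "N \<subseteq> V"
  and cont: "continuous_on N g0" "continuous_on N g1" "continuous_on N g2"
  and sqX: "\<And>r. r \<in> N \<Longrightarrow> coeff (sq (X r)) 2 = \<kappa> r * g2 r" "\<And>r. r \<in> N \<Longrightarrow> coeff (sq (X r)) 1 = \<kappa> r * g1 r"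
  "\<And>r. r \<in> N \<Longrightarrow> coeff (sq (X r)) 0 = \<kappa> r * g0 r"
  and dnz: "\<And>r. r \<in> N \<Longrightarrow> (g1 r)\<^sup>2 - 4 * g2 r * g0 r \<noteq> 0"
  and curve: "curve_equation C A U F G q h" and div: "divided_by_D1 q h (H_coeffs F G) DS"
  and ord: "order_along q h (discriminant DS) = enat k" "k > 0"
 shows False
proof -
 obtain Ha Hb Hc where H: "H_coeffs F G = (Ha, Hb, Hc)" by (cases "H_coeffs F G") auto
 obtain a b c where DS: "DS = (a, b, c)" by (cases DS) auto
 obtain m N1 where m: "enat m = D1_multiplicity q h (Ha, Hb, Hc)" "q \<in> N1"
  "holomorphic2_on a N1" "holomorphic2_on b N1" "holomorphic2_on c N1"
  "\<And>r. r \<in> N1 \<Longrightarrow> Ha r = h r ^ m * a r" "\<And>r. r \<in> N1 \<Longrightarrow> Hb r = h r ^ m * b r" "\<And>r. r \<in> N1 \<Longrightarrow> Hc r = h r ^ m * c r"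
  using div unfolding H DS divided_by_D1.simps by blast
 obtain j N2 g where j: "j > 0" "q \<in> N2" "holomorphic2_on g N2" "\<And>r. r \<in> N2 \<Longrightarrow> discriminant DS r = h r ^ j * g r"
  using order_along_positive[OF ord] by metis
 obtain N3 where N3: "q \<in> N3" "holomorphic2_on h N3" and h: "h q = 0" "dx h q \<noteq> 0 \<or> dy h q \<noteq> 0"
  using curve unfolding curve_equation_def by blast
 have o: "open N1" "open N2" "open N3" using m(3) j(3) N3(2) holo2_open by blast+
 have "open {r \<in> N3. dx h r \<noteq> 0}" "open {r \<in> N3. dy h r \<noteq> 0}"
  using open_nonzero[OF o(3)] continuous_on_dx[OF N3(2)] continuous_on_dy[OF N3(2)] by auto
 then have o4: "open ({r \<in> N3. dx h r \<noteq> 0} \<union> {r \<in> N3. dy h r \<noteq> 0})" by blast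
 define M where "M = N \<inter> N1 \<inter> N2 \<inter> ({r \<in> N3. dx h r \<noteq> 0} \<union> {r \<in> N3. dy h r \<noteq> 0})"
 have oM: "open M" unfolding M_def using N(1) o o4 by blast
 have qM: "q \<in> M" unfolding M_def using N(2) m(2) j(2) N3(1) h(2) by blast
 have sub: "M \<subseteq> N" "M \<subseteq> N1" "M \<subseteq> N2" "M \<subseteq> N3" and dh: "\<And>r. r \<in> M \<Longrightarrow> dx h r \<noteq> 0 \<or> dy h r \<noteq> 0"
  unfolding M_def by auto
 have MV: "M \<subseteq> V" and MU: "M \<subseteq> U" using sub(1) N(3) V_U by auto
 have hM: "holomorphic2_on h M" "holomorphic2_on a M" "holomorphic2_on b M" "holomorphic2_on c M"
  using holo2_subset[OF _ oM] N3(2) m(3-5) sub by auto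
 have cJ: "continuous_on M rr" "continuous_on M ss" "continuous_on M pp" "continuous_on M qq" "continuous_on M dd"
  using holo_J[THEN holo2_continuous] continuous_on_subset[OF _ MU] by auto
 have cg: "continuous_on M g0" "continuous_on M g1" "continuous_on M g2" using cont continuous_on_subset[OF _ sub(1)] by auto
 have cD: "continuous_on M a" "continuous_on M b" "continuous_on M c" using hM holo2_continuous by auto
 \<comment> \<open>\<open>x\<close> stands for \<open>a\<close>, \<open>- b\<close> or
   \<open>c\<close>, and \<open>t\<close> for the matching transformed coefficient. Comparing
   squares gives \<open>x^2 dd^2 \<Theta> = disc(DS) t^2\<close> off the curve, where a power of
   \<open>h\<close> can be cancelled, and hence also on it, where the right side vanishes.\<close>
 have zero: "x r = 0"
  if cx: "continuous_on M x" and ct: "continuous_on M t" and Hx: "\<And>r. r \<in> M \<Longrightarrow> h r ^ m * x r = \<kappa> r * (KK / dd r ^ 4 * t r)"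
  and r: "r \<in> M" "h r = 0" for x t r
 proof -
  define \<Theta> where "\<Theta> = (\<lambda>r. (g1 r)\<^sup>2 - 4 * g2 r * g0 r)"
  have "(x r)\<^sup>2 * ((dd r)\<^sup>2 * \<Theta> r) - ((b r)\<^sup>2 - 4 * a r * c r) * (t r)\<^sup>2 = 0"
  proof (rule vanishes_by_density[OF hM(1) r(1) dh[OF r(1)] oM r(1)])
  show "continuous_on M (\<lambda>r. (x r)\<^sup>2 * ((dd r)\<^sup>2 * \<Theta> r) - ((b r)\<^sup>2 - 4 * a r * c r) * (t r)\<^sup>2)"
  unfolding \<Theta>_def by (intro continuous_intros cx ct cJ cg cD)
  fix r assume r: "r \<in> M" "h r \<noteq> 0"
  have dd0: "dd r \<noteq> 0" using r(1) MV unfolding V_def by blast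
  have rN: "r \<in> N" and r1: "r \<in> N1" using r(1) sub by auto
  define K where "K = KK / dd r ^ 4"
  note he = H_eq[OF subsetD[OF MV r(1)] H sqX[OF rN]]
  have "(Hb r)\<^sup>2 - 4 * Ha r * Hc r = (\<kappa> r)\<^sup>2 * (K\<^sup>2 * (dd r)\<^sup>2 * \<Theta> r)"
  proof -
  have f: "(k * y)\<^sup>2 - 4 * (k * x) * (k * z) = k\<^sup>2 * (y\<^sup>2 - 4 * x * z)" for k x y z :: complex
  by (simp add: power2_eq_square algebra_simps)
  show ?thesis unfolding he f quadratic_transform_disc(1) K_def \<Theta>_def dd_def ..
  qed
  moreover have "(Hb r)\<^sup>2 - 4 * Ha r * Hc r = (h r ^ m)\<^sup>2 * ((b r)\<^sup>2 - 4 * a r * c r)"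
  unfolding m(6-8)[OF r1] by (simp add: power2_eq_square algebra_simps)
  ultimately have e1: "(h r ^ m)\<^sup>2 * ((b r)\<^sup>2 - 4 * a r * c r) = (\<kappa> r)\<^sup>2 * (K\<^sup>2 * (dd r)\<^sup>2 * \<Theta> r)" by simp
  have e2: "(h r ^ m)\<^sup>2 * (x r)\<^sup>2 = (\<kappa> r)\<^sup>2 * (K\<^sup>2 * (t r)\<^sup>2)"
  using arg_cong[OF Hx[OF r(1)], of "\<lambda>z. z\<^sup>2"] unfolding power_mult_distrib K_def .
  have "(h r ^ m)\<^sup>2 * ((x r)\<^sup>2 * ((dd r)\<^sup>2 * \<Theta> r) - ((b r)\<^sup>2 - 4 * a r * c r) * (t r)\<^sup>2) =
  ((h r ^ m)\<^sup>2 * (x r)\<^sup>2) * ((dd r)\<^sup>2 * \<Theta> r) - ((h r ^ m)\<^sup>2 * ((b r)\<^sup>2 - 4 * a r * c r)) * (t r)\<^sup>2"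
  proof -
  have "k * (x' * A' - B' * T') = (k * x') * A' - (k * B') * T'" for k x' A' B' T' :: complex
  by (simp add: algebra_simps)
  then show ?thesis .
  qed
  also have "\<dots> = 0" unfolding e1 e2 by simp
  finally show "(x r)\<^sup>2 * ((dd r)\<^sup>2 * \<Theta> r) - ((b r)\<^sup>2 - 4 * a r * c r) * (t r)\<^sup>2 = 0" using r(2) by (simp only: mult_eq_0_iff) simp
  qed
  moreover have "(b r)\<^sup>2 - 4 * a r * c r = 0"
  using j(4)[OF subsetD[OF sub(3) r(1)]] j(1) unfolding DS discriminant.simps r(2) by simp
  moreover have "dd r \<noteq> 0" using r(1) MV unfolding V_def by blast
  moreover have "\<Theta> r \<noteq> 0" unfolding \<Theta>_def using dnz r(1) sub(1) by blast
  ultimately show "x r = 0" by simp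
 qed
 have z: "a r = 0" "b r = 0" "c r = 0" if "r \<in> M" "h r = 0" for r
 proof -
  note he = H_eq[OF subsetD[OF MV] H sqX[OF subsetD[OF sub(1)]]]
  have 1: "h r ^ m * a r = \<kappa> r * (KK / dd r ^ 4 * (g2 r * (qq r)\<^sup>2 + g1 r * qq r * ss r + g0 r * (ss r)\<^sup>2))" if "r \<in> M" for r
  unfolding m(6)[OF subsetD[OF sub(2) that], symmetric] by (rule he(1)[OF that that that that])
  have 2: "h r ^ m * - b r = \<kappa> r * (KK / dd r ^ 4 * (2 * g2 r * pp r * qq r + g1 r * (pp r * ss r + qq r * rr r) + 2 * g0 r * rr r * ss r))" if "r \<in> M" for r
  unfolding mult_minus_right m(7)[OF subsetD[OF sub(2) that], symmetric] he(2)[OF that that that that] minus_minus ..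
  have 3: "h r ^ m * c r = \<kappa> r * (KK / dd r ^ 4 * (g2 r * (pp r)\<^sup>2 + g1 r * pp r * rr r + g0 r * (rr r)\<^sup>2))" if "r \<in> M" for r
  unfolding m(8)[OF subsetD[OF sub(2) that], symmetric] by (rule he(3)[OF that that that that])
  show "a r = 0" by (rule zero[OF cD(1) _ 1 that]) (auto intro!: continuous_intros cJ cg)
  have "- b r = 0" by (rule zero[OF continuous_on_minus[OF cD(2)] _ 2 that]) (auto intro!: continuous_intros cJ cg)
  then show "b r = 0" by simp
  show "c r = 0" by (rule zero[OF cD(3) _ 3 that]) (auto intro!: continuous_intros cJ cg)
 qed
 have ge: "enat (Suc m) \<le> order_along q h Hx"
  if x: "holomorphic2_on x M" and x0: "\<And>r. r \<in> M \<Longrightarrow> h r = 0 \<Longrightarrow> x r = 0" and e: "\<And>r. r \<in> M \<Longrightarrow> Hx r = h r ^ m * x r" for x Hx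
 proof -
  obtain N' v where N': "q \<in> N'" "N' \<subseteq> M" "holomorphic2_on v N'" "\<And>r. r \<in> N' \<Longrightarrow> x r = h r * v r"
  using holomorphic2_division[OF x hM(1) qM h x0] by blast
  show ?thesis by (rule order_along_ge[OF N'(1,3)]) (use e N' in auto)
 qed
 have "enat (Suc m) \<le> D1_multiplicity q h (Ha, Hb, Hc)"
  unfolding D1_multiplicity.simps
  using ge[OF hM(2) z(1) m(6)[OF subsetD[OF sub(2)]]] ge[OF hM(3) z(2) m(7)[OF subsetD[OF sub(2)]]]
  ge[OF hM(4) z(3) m(8)[OF subsetD[OF sub(2)]]] by simp
 then show False unfolding m(1)[symmetric] by simp
qed

end

section \<open>Identities between Taylor coefficients\<close>

lemma disc_order_3:
 fixes f0 :: complex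
 assumes "h = 2 * f0 * f2 + f1\<^sup>2"
 shows "(2 * f0 * f1)\<^sup>2 - 4 * h * f0\<^sup>2 = f0 ^ 3 * (- 8 * f2)"
 unfolding assms by (simp add: power2_eq_square power3_eq_cube algebra_simps)

text \<open>The relation of order three makes \<open>f2\<close> a multiple of \<open>f0\<close>,
  which contributes one more factor \<open>f0\<close>.\<close>

lemma disc_order_4:
 fixes f0 :: complex
 assumes "h = 2 * f0 * f2 + f1\<^sup>2" "f0 * f3 + f1 * f2 = 0" "f1 \<noteq> 0"
 shows "(2 * f0 * f1)\<^sup>2 - 4 * h * f0\<^sup>2 = f0 ^ 4 * (8 * f3 / f1)"
proof -
 define g where "g = f3 / f1"
 have f3: "f3 = g * f1" unfolding g_def using assms(3) by simp
 have "f1 * (f0 * g + f2) = 0" using assms(2) unfolding f3 by (simp add: algebra_simps)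
 then have "f0 * g + f2 = 0" using assms(3) by (simp only: mult_eq_0_iff) simp
 then have f2: "f2 = - (f0 * g)" by (simp add: eq_neg_iff_add_eq_0 add.commute)
 have "8 * f3 / f1 = 8 * g" unfolding g_def by simp
 then show ?thesis unfolding disc_order_3[OF assms(1)] f2 by (simp add: power3_eq_cube power4_eq_xxxx algebra_simps)
qed

text \<open>After \<open>f2\<close> has been replaced by a multiple of \<open>f0\<close>, the
  relation of order four makes \<open>f3\<close> a multiple of \<open>f0\<close> as well, which
  raises the order once more.\<close>

lemma disc_order_5:
 fixes f0 :: complex
 assumes "h = 2 * f0 * f2 + f1\<^sup>2" "f0 * f3 + f1 * f2 = 0" "2 * f0 * f4 + 2 * f1 * f3 + f2\<^sup>2 = 0" "f1 \<noteq> 0"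
 shows "(2 * f0 * f1)\<^sup>2 - 4 * h * f0\<^sup>2 = f0 ^ 5 * (- 4 * (2 * f4 + f0 * (f3 / f1)\<^sup>2) / f1\<^sup>2)"
proof -
 define g where "g = f3 / f1"
 have f3: "f3 = g * f1" unfolding g_def using assms(4) by simp
 have "f1 * (f0 * g + f2) = 0" using assms(2) unfolding f3 by (simp add: algebra_simps)
 then have "f0 * g + f2 = 0" using assms(4) by (simp only: mult_eq_0_iff) simp
 then have f2: "f2 = - (f0 * g)" by (simp add: eq_neg_iff_add_eq_0 add.commute)
 have "f0 * (2 * f4 + f0 * g\<^sup>2) = - (2 * f1\<^sup>2 * g)"
  using assms(3) unfolding f3 f2 by (simp add: power2_eq_square eq_neg_iff_add_eq_0 algebra_simps)
 then have Z: "f0 * (2 * f4 + f0 * g\<^sup>2) = - (2 * f1\<^sup>2 * g)" .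
 have f5: "f0 ^ 5 = f0 ^ 4 * f0" by (simp add: eval_nat_numeral)
 have "f0 ^ 5 * (- 4 * (2 * f4 + f0 * g\<^sup>2) / f1\<^sup>2) = f0 ^ 4 * (- 4 * (f0 * (2 * f4 + f0 * g\<^sup>2)) / f1\<^sup>2)"
  unfolding f5 by (simp only: mult.assoc mult.left_commute times_divide_eq_right)
 also have "\<dots> = f0 ^ 4 * (- 4 * (- (2 * f1\<^sup>2 * g)) / f1\<^sup>2)" unfolding Z ..
 also have "\<dots> = f0 ^ 4 * (8 * g)" using assms(4) by simp
 finally show ?thesis unfolding disc_order_4[OF assms(1,2,4)] g_def by simp
qed

text \<open>Along the nilpotent line of a fivefold root, \<open>f3\<close> is a unit and
  \<open>y\<close> is the coefficient \<open>f2\<close>. The relations give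
  \<open>f1 = m y^2\<close> and \<open>f0 = - m y^3 / f3\<close>. So the three coefficients have
  orders 6, 5, 4 in \<open>y\<close>, and after division by \<open>y^4\<close> the discriminant has
  order two.\<close>

lemma nil_5_identities:
 fixes y :: complex
 assumes e: "f0 * f3 + f1 * y = 0" "2 * f0 * f4 + 2 * f1 * f3 + y\<^sup>2 = 0" and nz: "f3 \<noteq> 0" "f3 - y * f4 / f3 \<noteq> 0"
 defines "m \<equiv> - 1 / (2 * (f3 - y * f4 / f3))"
 shows "f0\<^sup>2 = y ^ 4 * (y\<^sup>2 * m\<^sup>2 / f3\<^sup>2)" "2 * f0 * f1 = y ^ 4 * (- 2 * y * m\<^sup>2 / f3)"
  "2 * f0 * y + f1\<^sup>2 = y ^ 4 * (m\<^sup>2 - 2 * m / f3)"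
  "(- 2 * y * m\<^sup>2 / f3)\<^sup>2 - 4 * (m\<^sup>2 - 2 * m / f3) * (y\<^sup>2 * m\<^sup>2 / f3\<^sup>2) = y\<^sup>2 * (8 * m ^ 3 / f3 ^ 3)"
proof -
 define i where "i = 1 / f3"
 define D where "D = f3 - y * f4 * i"
 have i: "i * f3 = 1" unfolding i_def using nz by simp
 have D: "D \<noteq> 0" "m = - 1 / (2 * D)" using nz unfolding D_def m_def i_def by simp_all
 have mD: "2 * m * D = - 1" unfolding D(2) using D(1) by simp
 have f0: "f0 = - (f1 * y * i)"
 proof -
  have "f0 = f0 * (i * f3)" unfolding i by simp
  also have "\<dots> = i * (f0 * f3)" by simp
  also have "f0 * f3 = - (f1 * y)" using e(1) by (simp add: eq_neg_iff_add_eq_0)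
  finally show ?thesis by simp
 qed
 have "2 * f1 * D + y\<^sup>2 = 2 * f0 * f4 + 2 * f1 * f3 + y\<^sup>2" unfolding f0 D_def by (simp add: algebra_simps)
 then have "2 * f1 * D = - y\<^sup>2" unfolding e(2) by (simp add: eq_neg_iff_add_eq_0)
 then have "m * (2 * f1 * D) = - m * y\<^sup>2" by simp
 moreover have "m * (2 * f1 * D) = f1 * (2 * m * D)" by simp
 ultimately have f1: "f1 = m * y\<^sup>2" unfolding mD by simp
 have dv: "x / f3 = x * i" "x / f3\<^sup>2 = x * i\<^sup>2" "x / f3 ^ 3 = x * i ^ 3" for x unfolding i_def by (simp_all add: power_divide)
 show "f0\<^sup>2 = y ^ 4 * (y\<^sup>2 * m\<^sup>2 / f3\<^sup>2)" "2 * f0 * f1 = y ^ 4 * (- 2 * y * m\<^sup>2 / f3)"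
  "2 * f0 * y + f1\<^sup>2 = y ^ 4 * (m\<^sup>2 - 2 * m / f3)"
  "(- 2 * y * m\<^sup>2 / f3)\<^sup>2 - 4 * (m\<^sup>2 - 2 * m / f3) * (y\<^sup>2 * m\<^sup>2 / f3\<^sup>2) = y\<^sup>2 * (8 * m ^ 3 / f3 ^ 3)"
  unfolding dv f0 f1 by (simp_all add: power2_eq_square power3_eq_cube power4_eq_xxxx algebra_simps)
qed

text \<open>Here \<open>f2\<close> is a unit, and \<open>f1\<close> is a multiple of
  \<open>f0\<close>, so \<open>f0\<close> divides all three coefficients. The value
  \<open>y^2\<close> of the square at the further root, at distance \<open>d\<close>, equals
  \<open>f0 t\<close> with a unit \<open>t\<close>; hence \<open>f0\<close> has order two in
  \<open>y\<close>.\<close>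

lemma nil_4_identities:
 fixes y d :: complex
 assumes e: "f0 * f3 + f1 * f2 = 0" and nz: "f2 \<noteq> 0"
 defines "t \<equiv> f0 - 2 * f0 * f3 * d / f2 + (2 * f2 + f0 * f3\<^sup>2 / f2\<^sup>2) * d\<^sup>2"
 assumes y: "y\<^sup>2 = f0\<^sup>2 + 2 * f0 * f1 * d + (2 * f0 * f2 + f1\<^sup>2) * d\<^sup>2" and t: "t \<noteq> 0"
 shows "f0\<^sup>2 = y\<^sup>2 * (f0 / t)" "2 * f0 * f1 = y\<^sup>2 * (- 2 * f0 * f3 / (f2 * t))"
  "2 * f0 * f2 + f1\<^sup>2 = y\<^sup>2 * ((2 * f2 + f0 * f3\<^sup>2 / f2\<^sup>2) / t)"
  "(- 2 * f0 * f3 / (f2 * t))\<^sup>2 - 4 * ((2 * f2 + f0 * f3\<^sup>2 / f2\<^sup>2) / t) * (f0 / t) = y\<^sup>2 * (- 8 * f2 / t ^ 3)"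
proof -
 define i where "i = 1 / f2"
 define k where "k = 1 / t"
 have i: "i * f2 = 1" unfolding i_def using nz by simp
 have k: "t * k = 1" unfolding k_def using t by simp
 have f1: "f1 = - (f0 * f3 * i)"
 proof -
  have "f1 = f1 * (i * f2)" unfolding i by simp
  also have "\<dots> = i * (f1 * f2)" by simp
  also have "f1 * f2 = - (f0 * f3)" using e by (simp add: eq_neg_iff_add_eq_0 add.commute)
  finally show ?thesis by simp
 qed
 have dv: "x / f2 = x * i" "x / f2\<^sup>2 = x * i\<^sup>2" "x / t = x * k" "x / (f2 * t) = x * i * k" "x / t ^ 3 = x * k ^ 3" for x
  unfolding i_def k_def by (simp_all add: power_divide)
 have y2: "y\<^sup>2 = f0 * t"
  unfolding y t_def dv f1 by (simp add: power2_eq_square algebra_simps)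
 have yk: "y\<^sup>2 * (x * k) = f0 * x" for x
 proof -
  have "y\<^sup>2 * (x * k) = f0 * x * (t * k)" unfolding y2 by simp
  then show ?thesis unfolding k by simp
 qed
 show "f0\<^sup>2 = y\<^sup>2 * (f0 / t)" "2 * f0 * f1 = y\<^sup>2 * (- 2 * f0 * f3 / (f2 * t))"
  "2 * f0 * f2 + f1\<^sup>2 = y\<^sup>2 * ((2 * f2 + f0 * f3\<^sup>2 / f2\<^sup>2) / t)"
  unfolding dv yk f1 by (simp_all add: power2_eq_square algebra_simps)
 have "y\<^sup>2 * (- 8 * f2 / t ^ 3) = y\<^sup>2 * ((- 8 * f2 * k\<^sup>2) * k)" unfolding dv by (simp add: power2_eq_square power3_eq_cube)
 also have "\<dots> = - 8 * f0 * f2 * k\<^sup>2" unfolding yk by simp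
 finally have r: "y\<^sup>2 * (- 8 * f2 / t ^ 3) = - 8 * f0 * f2 * k\<^sup>2" .
 show "(- 2 * f0 * f3 / (f2 * t))\<^sup>2 - 4 * ((2 * f2 + f0 * f3\<^sup>2 / f2\<^sup>2) / t) * (f0 / t) = y\<^sup>2 * (- 8 * f2 / t ^ 3)"
  unfolding r unfolding dv by (simp add: power2_eq_square algebra_simps)
qed

section \<open>Multiplicities along the families of branch lines\<close>

context pencil_roots
begin

lemma E_nonempty: "E \<noteq> {}"
 using deg\<Delta> \<Delta>_prod by auto

lemma not_dvd_small: "degree g < 5 \<Longrightarrow> \<Delta> dvd g \<Longrightarrow> g = 0"
 using dvd_imp_degree_le[of \<Delta> g] deg\<Delta> by auto

lemma sq_nonzero:
 assumes "e \<in> E" "poly (rep v) e \<noteq> 0"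
 shows "sq v \<noteq> 0"
proof
 assume "sq v = 0"
 then have "\<Delta> dvd (rep v)\<^sup>2 - 0" using sq_dvd[of "rep v"] unfolding \<phi>_rep by simp
 from root_eval[OF this assms(1)] show False using assms(2) by simp
qed

end

context pencil_chart
begin

lemma holo_coeff: "holomorphic2_on (\<lambda>r. coeff (sq (X r)) i) U"
 unfolding coeff_sq cf_bil by (rule bil_holo[OF vholo_X vholo_X])

lemma holo_tay: "holomorphic2_on (\<lambda>r. tay a i (X r)) U"
 by (rule lin_X(1)[OF lin_tay])

lemma dx_dy_coeff:
 assumes "q \<in> U"
 shows "dx (\<lambda>r. coeff (sq (X r)) i) q = 2 * cf i (X q) (Xx q)" "dy (\<lambda>r. coeff (sq (X r)) i) q = 2 * cf i (X q) (Xy q)"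
 unfolding coeff_sq unfolding cf_bil bil_deriv[OF vholo_X vholo_X assms] vdx_X[OF assms] vdy_X[OF assms]
 unfolding cf_bil[symmetric] by (simp_all add: cf_commute[of i _ "X q"])

text \<open>The discriminant itself serves as the equation of the line; what has to be shown is that
  its differential is not zero. Since \<open>rep (X q)\<close> is a unit, products of it with
  tangent vectors produce all polynomials of degree at most two, and the gradient of the
  discriminant at a nonzero quadratic is not zero on these.\<close>

lemma line0_multiplicity:
 assumes q: "q \<in> V" and L: "L \<in> lines" "L \<subseteq> S" "pt (X q) \<in> L" and only: "\<And>M. M \<in> lines \<Longrightarrow> pt (X q) \<in> M \<Longrightarrow> M = L"
  and kinds: known_kind
  and unit: "\<And>e. e \<in> E \<Longrightarrow> poly (rep (X q)) e \<noteq> 0"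
 shows "has_branch_multiplicity_at S L (pt (X q)) 1"
proof -
 have qU: "q \<in> U" using q V_U by blast
 define c where "c = (\<lambda>i r. coeff (sq (X r)) i)"
 have hc: "holomorphic2_on (c i) V" for i unfolding c_def by (rule holo2_subset[OF holo_coeff openV V_U])
 have cst: "holomorphic2_on (\<lambda>_. x) V" for x by (rule holo2_const[OF openV])
 define y where "y = (\<lambda>r. c 1 r * c 1 r + (- 4) * (c 2 r * c 0 r))"
 have y_disc: "y r = disc (sq (X r))" for r unfolding y_def c_def disc_def by (simp add: power2_eq_square)
 have y0: "y q = 0"
  using disc_X_iff_line[OF qU L(1,2) only kinds] L(3) unfolding y_disc by blast
 have onS: "degree (sq (X q)) \<le> 2" using onS_X[OF qU] onS_iff by blast
 obtain e where e: "e \<in> E" using E_nonempty by blast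
 have nz: "c 0 q \<noteq> 0 \<or> c 1 q \<noteq> 0 \<or> c 2 q \<noteq> 0"
 proof (rule ccontr)
  assume "\<not> ?thesis"
  moreover obtain x2 x1 x0 where "sq (X q) = [:x0, x1, x2:]" using degree_le_2E[OF onS] .
  ultimately have "sq (X q) = 0" unfolding c_def by (simp add: eval_nat_numeral)
  then show False using sq_nonzero[OF e unit[OF e]] by blast
 qed
 define \<psi> where "\<psi> w = c 1 q * cf 1 (X q) w - 2 * (c 0 q * cf 2 (X q) w + c 2 q * cf 0 (X q) w)" for w
 have lin: "lin \<psi>" using lin_cf unfolding lin_def \<psi>_def by (simp add: algebra_simps)
 have "dx y q = 4 * \<psi> (Xx q)" "dy y q = 4 * \<psi> (Xy q)"
  unfolding y_def dx_dy_add[OF holo2_mult[OF hc hc] holo2_mult[OF cst holo2_mult[OF hc hc]] q]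
  dx_dy_mult[OF hc hc q] dx_dy_mult[OF cst holo2_mult[OF hc hc] q] dx_dy_const \<psi>_def
  unfolding c_def dx_dy_coeff[OF qU] by (simp_all add: algebra_simps)
 moreover have "\<psi> (Xx q) \<noteq> 0 \<or> \<psi> (Xy q) \<noteq> 0"
 proof (rule ccontr)
  assume "\<not> ?thesis"
  moreover have "\<psi> (X q) = 0" using y0 unfolding \<psi>_def coeff_sq[symmetric] y_def c_def by (simp add: algebra_simps)
  ultimately obtain \<alpha> \<beta> where ab: "\<And>w. \<psi> w = \<alpha> * bil Q (X q) w + \<beta> * bil P (X q) w"
  using conormal[OF q lin] by blast
  have "\<And>x. poly \<Delta> x = 0 \<Longrightarrow> poly (rep (X q)) x \<noteq> 0" using unit root_iff by blast
  then obtain s' where s': "\<Delta> dvd rep (X q) * s' - 1" using poly_inverse_mod[OF \<Delta>_nz] by blast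
  \<comment> \<open>\<open>w\<close> is \<open>\<delta>\<close> divided by \<open>rep (X q)\<close>.
    It is tangent, since \<open>\<delta>\<close> and \<open>t * \<delta>\<close> have degree below
    four.\<close>
  have *: "c 1 q * coeff \<delta> 1 - 2 * (c 0 q * coeff \<delta> 2 + c 2 q * coeff \<delta> 0) = 0" if \<delta>: "degree \<delta> \<le> 2" for \<delta>
  proof -
  define w where "w = \<phi> (s' * \<delta>)"
  have Xq: "X q = \<phi> (rep (X q))" by (simp add: \<phi>_rep)
  have d1: "\<Delta> dvd rep (X q) * (s' * \<delta>) - \<delta>"
  proof -
  have "rep (X q) * (s' * \<delta>) - \<delta> = (rep (X q) * s' - 1) * \<delta>" by (simp add: algebra_simps)
  then show ?thesis using s' by simp
  qed
  have "bil Q (X q) w = l0 \<Delta> (rep (X q) * (s' * \<delta>))" unfolding w_def by (subst Xq) (rule bilQ)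
  also have "\<dots> = l0 \<Delta> \<delta>" by (rule l0_cong[OF d1])
  also have "\<dots> = 0" using \<delta> deg\<Delta> by (simp add: l0_degree_le coeff_eq_0)
  finally have b1: "bil Q (X q) w = 0" .
  have "bil P (X q) w = l0 \<Delta> ([:0, 1:] * (rep (X q) * (s' * \<delta>)))" unfolding w_def by (subst Xq) (rule bilP)
  also have "\<dots> = l0 \<Delta> ([:0, 1:] * \<delta>)"
  by (rule l0_cong) (use d1 in \<open>simp only: right_diff_distrib[symmetric] dvd_mult\<close>)
  also have "\<dots> = 0"
  proof -
  have "degree ([:0, 1:] * \<delta>) \<le> 3" using \<delta> degree_mult_le[of "[:0, 1:]" \<delta>] by simp
  then show ?thesis using deg\<Delta> by (simp add: l0_degree_le coeff_eq_0 del: mult_pCons_left)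
  qed
  finally have b2: "bil P (X q) w = 0" .
  have "(rep (X q) * rep w) mod \<Delta> = \<delta>"
  proof -
  have "(rep (X q) * rep w) mod \<Delta> = (rep (X q) * (s' * \<delta>)) mod \<Delta>" unfolding w_def rep_\<phi> by (simp add: mod_mult_right_eq)
  also have "\<dots> = \<delta> mod \<Delta>" using d1 by (simp add: mod_eq_dvd_iff)
  also have "\<dots> = \<delta>" using \<delta> deg\<Delta> by (intro mod_poly_less) auto
  finally show ?thesis .
  qed
  then have "cf i (X q) w = coeff \<delta> i" for i unfolding cf_def by simp
  then show ?thesis using ab[of w] unfolding b1 b2 \<psi>_def by simp
  qed
  have "c 2 q = 0" "c 1 q = 0" "c 0 q = 0"
  using *[of 1] *[of "[:0, 1:]"] *[of "[:0, 0, 1:]"] by (simp_all add: eval_nat_numeral)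
  then show False using nz by blast
 qed
 ultimately have dy: "dx y q \<noteq> 0 \<or> dy y q \<noteq> 0" by simp
 show ?thesis
 proof (rule branch_multiplicityI[where N = V and y = y and ?H0.0 = "c 0" and ?H1.0 = "c 1" and ?H2.0 = "c 2" and u = "\<lambda>_. 1" and m = 0 and a = 0,
  OF q L only kinds q order_refl _ hc hc hc cst _ _ _ _ _ _ nz y0 dy])
  show "holomorphic2_on y V" unfolding y_def by (intro holo2_add holo2_mult hc cst)
 qed (simp_all add: c_def y_def power2_eq_square)
qed

text \<open>In powers of \<open>t - a\<close> the square is
  \<open>f0^2 + 2 f0 f1 (t - a) + h (t - a)^2\<close> with discriminant
  \<open>4 f0^2 (f1^2 - h)\<close>. Each further Taylor relation yields another factor
  \<open>f0\<close>, so the order along \<open>f0 = 0\<close> is \<open>\<mu> a\<close>.\<close>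

lemma line2_multiplicity:
 assumes q: "q \<in> V" and L: "L \<in> lines" "L \<subseteq> S" "pt (X q) \<in> L" and only: "\<And>M. M \<in> lines \<Longrightarrow> pt (X q) \<in> M \<Longrightarrow> M = L"
  and kinds: known_kind
  and a: "a \<in> E" "\<mu> a \<in> {2, 3, 4, 5}" and f0: "tay a 0 (X q) = 0" and f1: "tay a 1 (X q) \<noteq> 0"
  and unit: "\<And>e. e \<in> E - {a} \<Longrightarrow> poly (rep (X q)) e \<noteq> 0" and h2: "coeff (sq (X q)) 2 \<noteq> 0"
  and c2: "\<mu> a = 2 \<Longrightarrow> tay a 1 (X q) * tay a 1 (X q) - coeff (sq (X q)) 2 \<noteq> 0" and c3: "\<mu> a \<ge> 3 \<Longrightarrow> tay a (\<mu> a - 1) (X q) \<noteq> 0"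
 shows "has_branch_multiplicity_at S L (pt (X q)) (\<mu> a)"
proof -
 have qU: "q \<in> U" using q V_U by blast
 define f where "f = (\<lambda>i r. tay a i (X r))"
 define h where "h = (\<lambda>r. coeff (sq (X r)) 2)"
 define N where "N = {r \<in> V. f 1 r \<noteq> 0}"
 have hfV: "holomorphic2_on (f i) V" for i unfolding f_def by (rule holo2_subset[OF holo_tay openV V_U])
 have oN: "open N" unfolding N_def using open_nonzero[OF openV holo2_continuous[OF hfV]] .
 have qN: "q \<in> N" using q f1 unfolding N_def f_def by simp
 have NV: "N \<subseteq> V" and f1N: "\<And>r. r \<in> N \<Longrightarrow> f 1 r \<noteq> 0" unfolding N_def by auto
 have hf: "holomorphic2_on (f i) N" for i by (rule holo2_subset[OF hfV oN NV])
 have hh: "holomorphic2_on h N" unfolding h_def using NV V_U by (intro holo2_subset[OF holo_coeff oN]) auto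
 have cst: "holomorphic2_on (\<lambda>_. x) N" for x by (rule holo2_const[OF oN])
 have rel: "coeff (sq (X r)) 0 = (f 0 r)\<^sup>2 - a * (2 * f 0 r * f 1 r) + a\<^sup>2 * h r"
  "coeff (sq (X r)) 1 = 2 * f 0 r * f 1 r - 2 * a * h r"
  "\<mu> a \<ge> 3 \<Longrightarrow> h r = 2 * f 0 r * f 2 r + (f 1 r)\<^sup>2"
  "\<mu> a \<ge> 4 \<Longrightarrow> f 0 r * f 3 r + f 1 r * f 2 r = 0"
  "\<mu> a \<ge> 5 \<Longrightarrow> 2 * f 0 r * f 4 r + 2 * f 1 r * f 3 r + (f 2 r)\<^sup>2 = 0" if "r \<in> N" for r
 proof -
  have on: "onS (X r)" using that NV V_U onS_X by blast
  have m2: "\<mu> a \<ge> 2" using a(2) by auto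
  have t': "tay a i (X r) = f i r" for i unfolding f_def ..
  have hr: "h r = coeff (sq (X r)) 2" unfolding h_def ..
  note t = taylor_relations[OF on a(1), unfolded t', folded hr]
  have e: "2 * f 0 r * f 1 r = coeff (sq (X r)) 1 + 2 * a * h r" using t(2)[OF m2] by simp
  show "coeff (sq (X r)) 1 = 2 * f 0 r * f 1 r - 2 * a * h r" unfolding e by simp
  show "coeff (sq (X r)) 0 = (f 0 r)\<^sup>2 - a * (2 * f 0 r * f 1 r) + a\<^sup>2 * h r"
  unfolding e t(1)[symmetric] by (simp add: power2_eq_square algebra_simps)
  show "\<mu> a \<ge> 3 \<Longrightarrow> h r = 2 * f 0 r * f 2 r + (f 1 r)\<^sup>2"
  "\<mu> a \<ge> 4 \<Longrightarrow> f 0 r * f 3 r + f 1 r * f 2 r = 0"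
  "\<mu> a \<ge> 5 \<Longrightarrow> 2 * f 0 r * f 4 r + 2 * f 1 r * f 3 r + (f 2 r)\<^sup>2 = 0" using t(3-5) by blast+
 qed
 \<comment> \<open>On the line \<open>rep (X q) = s * g\<close> with a unit \<open>g\<close>. A
   congruence of \<open>nn a\<close> with a linear multiple of it would, multiplied by
   \<open>s\<close> and divided by \<open>g\<close>, make \<open>s * s\<close> times a linear
   polynomial divisible by \<open>\<Delta>\<close>. By degree the linear polynomial is zero, but
   \<open>nn a\<close> is not divisible by \<open>\<Delta>\<close>.\<close>
 have dy: "dx (f 0) q \<noteq> 0 \<or> dy (f 0) q \<noteq> 0" unfolding f_def
 proof (rule lin_derivative_nonzero[OF q lin_tay f0])
  show "tay a 0 w = l0 \<Delta> (nn a * rep w)" for w unfolding tay_0 l0_nn[OF a(1)] ..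
  fix \<alpha> \<beta>
  show "\<not> \<Delta> dvd [:\<alpha>, \<beta>:] * rep (X q) - nn a"
  proof
  define s where "s = [:-a, 1:]"
  assume *: "\<Delta> dvd [:\<alpha>, \<beta>:] * rep (X q) - nn a"
  have "poly (rep (X q)) a = 0" using f0 unfolding tay_0 .
  then obtain g where g: "rep (X q) = s * g" unfolding s_def by (elim root_factorE)
  have "tay a 1 (X q) = poly g a"
  proof -
  have sc: "pcompose s [:a, 1:] = [:0, 1:]" unfolding s_def by (simp add: pcompose_pCons)
  have "coeff ([:0, 1:] * G) 1 = coeff G 0" for G :: "complex poly" by simp
  then have "tay a 1 (X q) = coeff (pcompose g [:a, 1:]) 0" unfolding tay_def g pcompose_mult sc .
  then show ?thesis by (simp flip: poly_0_coeff_0 add: poly_pcompose)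
  qed
  then have ga: "poly g a \<noteq> 0" using f1 by simp
  have ge: "poly g x \<noteq> 0" if "poly \<Delta> x = 0" for x
  proof (cases "x = a")
  case False
  then have "poly (s * g) x \<noteq> 0" using unit[of x] that unfolding root_iff g by blast
  then show ?thesis by auto
  qed (use ga in simp)
  have sn: "s * nn a = \<Delta>" using nn[OF a(1)] unfolding s_def .
  have "s * (x - n) + s * n = s * x" for x n by (simp add: algebra_simps)
  from this[of _ "nn a"] have sx: "s * (x - nn a) + \<Delta> = s * x" for x unfolding sn .
  have "\<Delta> dvd s * ([:\<alpha>, \<beta>:] * rep (X q) - nn a) + \<Delta>" using * by (intro dvd_add dvd_mult) auto
  then have "\<Delta> dvd s * ([:\<alpha>, \<beta>:] * rep (X q))" unfolding sx .
  moreover have gx: "s * (x * (s * g)) = g * (x * (s * s))" for x by (simp only: ac_simps)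
  have "s * ([:\<alpha>, \<beta>:] * rep (X q)) = g * ([:\<alpha>, \<beta>:] * (s * s))" unfolding g by (rule gx)
  ultimately have "\<Delta> dvd g * ([:\<alpha>, \<beta>:] * (s * s))" by (rule subst[rotated])
  from dvd_cancel_unit[OF \<Delta>_nz ge this] have d: "\<Delta> dvd [:\<alpha>, \<beta>:] * (s * s)" .
  have "degree ([:\<alpha>, \<beta>:] * (s * s)) \<le> 1 + (1 + 1)"
  by (intro order_trans[OF degree_mult_le] add_mono) (auto simp: s_def)
  then have "[:\<alpha>, \<beta>:] * (s * s) = 0" using not_dvd_small[OF _ d] by simp
  then have "[:\<alpha>, \<beta>:] = 0" unfolding s_def by (simp only: mult_eq_0_iff) simp
  then have "\<Delta> dvd nn a" using * by simp
  then show False using nn_not_dvd[OF a(1)] by blast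
  qed
 qed
 define u where "u = (\<lambda>r. if \<mu> a = 2 then 4 * (f 1 r * f 1 r - h r) else if \<mu> a = 3 then - 8 * f 2 r
  else if \<mu> a = 4 then 8 * f 3 r / f 1 r else - 4 * (2 * f 4 r + f 0 r * (f 3 r / f 1 r)\<^sup>2) / (f 1 r)\<^sup>2)"
 have hu: "holomorphic2_on u N"
 proof -
  have "holomorphic2_on (\<lambda>r. 4 * (f 1 r * f 1 r - h r)) N" "holomorphic2_on (\<lambda>r. - 8 * f 2 r) N"
  by (intro holo2_diff holo2_mult cst hf hh)+
  moreover have "holomorphic2_on (\<lambda>r. 8 * f 3 r / f 1 r) N"
  by (intro holo2_mult holo2_divide cst hf) (use f1N in auto)
  moreover have "holomorphic2_on (\<lambda>r. - 4 * (2 * f 4 r + f 0 r * (f 3 r / f 1 r)\<^sup>2) / (f 1 r)\<^sup>2) N"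
  by (intro holo2_add holo2_mult holo2_divide holo2_power cst hf) (use f1N in auto)
  ultimately show ?thesis unfolding u_def by (cases "\<mu> a = 2"; cases "\<mu> a = 3"; cases "\<mu> a = 4") auto
 qed
 have f0q: "f 0 q = 0" using f0 unfolding f_def .
 have f1q: "f 1 q \<noteq> 0" using f1 unfolding f_def .
 have uq: "u q \<noteq> 0" using a(2) c2 c3 f1q f0q unfolding u_def by (auto simp: f_def h_def)
 have du: "(2 * f 0 r * f 1 r)\<^sup>2 - 4 * h r * (f 0 r)\<^sup>2 = f 0 r ^ \<mu> a * u r" if r: "r \<in> N" for r
 proof -
  consider "\<mu> a = 2" | "\<mu> a = 3" | "\<mu> a = 4" | "\<mu> a = 5" using a(2) by auto
  then show ?thesis
  proof cases
  case 1
  then show ?thesis unfolding u_def by (simp add: power2_eq_square algebra_simps)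
  next
  case 2
  then show ?thesis unfolding u_def using disc_order_3[OF rel(3)[OF r]] by simp
  next
  case 3
  then show ?thesis unfolding u_def using disc_order_4[OF rel(3)[OF r] rel(4)[OF r] f1N[OF r]] by simp
  next
  case 4
  then show ?thesis unfolding u_def using disc_order_5[OF rel(3)[OF r] rel(4)[OF r] rel(5)[OF r] f1N[OF r]] by simp
  qed
 qed
 show ?thesis
 proof (rule branch_multiplicityI[where N = N and y = "f 0" and ?H0.0 = "\<lambda>r. (f 0 r)\<^sup>2" and ?H1.0 = "\<lambda>r. 2 * f 0 r * f 1 r" and ?H2.0 = h and u = u and m = 0 and a = a,
  OF q L only kinds qN NV hf _ _ hh hu _ _ _ du _ uq _ f0q dy])
  show "holomorphic2_on (\<lambda>r. (f 0 r)\<^sup>2) N" "holomorphic2_on (\<lambda>r. 2 * f 0 r * f 1 r) N"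
  by (intro holo2_mult holo2_power hf cst)+
  show "\<mu> a > 0" using \<mu>_pos[OF a(1)] .
  show "(f 0 q)\<^sup>2 \<noteq> 0 \<or> 2 * f 0 q * f 1 q \<noteq> 0 \<or> h q \<noteq> 0" using h2 unfolding h_def by blast
 qed (simp_all add: rel h_def del: One_nat_def)
qed

lemma coeffs_taylor:
 assumes r: "r \<in> U" and a: "a \<in> E" "\<mu> a \<ge> 2"
 shows "coeff (sq (X r)) 0 = (tay a 0 (X r))\<^sup>2 - a * (2 * tay a 0 (X r) * tay a 1 (X r)) + a\<^sup>2 * coeff (sq (X r)) 2"
  "coeff (sq (X r)) 1 = 2 * tay a 0 (X r) * tay a 1 (X r) - 2 * a * coeff (sq (X r)) 2"
proof -
 note t = taylor_relations(1,2)[OF onS_X[OF r] a(1)]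
 have e: "2 * tay a 0 (X r) * tay a 1 (X r) = coeff (sq (X r)) 1 + 2 * a * coeff (sq (X r)) 2" using t(2)[OF a(2)] by simp
 show "coeff (sq (X r)) 1 = 2 * tay a 0 (X r) * tay a 1 (X r) - 2 * a * coeff (sq (X r)) 2" unfolding e by simp
 show "coeff (sq (X r)) 0 = (tay a 0 (X r))\<^sup>2 - a * (2 * tay a 0 (X r) * tay a 1 (X r)) + a\<^sup>2 * coeff (sq (X r)) 2"
  unfolding e t(1)[symmetric] by (simp add: power2_eq_square algebra_simps)
qed

end

context pencil_roots
begin

lemma taylor_factor:
 obtains k where "rep w = [:tay a 0 w:] + [:-a, 1:] * ([:tay a 1 w:] + [:-a, 1:] * ([:tay a 2 w:] + [:-a, 1:] * k))"
proof -
 define s where "s = [:-a, 1:]"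
 have fac: "\<exists>c k. p = [:c:] + s * k" for p
 proof -
  have "poly (p - [:poly p a:]) a = 0" by simp
  then obtain k where "p - [:poly p a:] = s * k" unfolding s_def by (elim root_factorE)
  then have "p = [:poly p a:] + s * k" by (simp add: diff_eq_eq add.commute)
  then show ?thesis by blast
 qed
 obtain c0 k0 where 0: "rep w = [:c0:] + s * k0" using fac by blast
 obtain c1 k1 where 1: "k0 = [:c1:] + s * k1" using fac by blast
 obtain c2 k where 2: "k1 = [:c2:] + s * k" using fac by blast
 define g where "g = [:c0:] + s * ([:c1:] + s * [:c2:])"
 have "rep w - g = s ^ 3 * k" unfolding g_def 0 1 2 by (simp add: power3_eq_cube algebra_simps)
 then have d: "[:-a, 1:] ^ 3 dvd rep w - g" unfolding s_def by (metis dvd_triv_left)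
 have sc: "pcompose s [:a, 1:] = [:0, 1:]" unfolding s_def by (simp add: pcompose_pCons)
 have "pcompose g [:a, 1:] = [:c0, c1, c2:]"
  unfolding g_def pcompose_add pcompose_mult sc by (simp add: pcompose_const)
 then have "tay a 0 w = c0" "tay a 1 w = c1" "tay a 2 w = c2"
  using tay_dvd[OF d, of 0] tay_dvd[OF d, of 1] tay_dvd[OF d, of 2] by (simp_all add: eval_nat_numeral)
 then show thesis using that[of k] unfolding 0 1 2 s_def by simp
qed

lemma \<Delta>_power5:
 assumes "a \<in> E" "\<mu> a = 5"
 shows "\<Delta> = [:-a, 1:] ^ 5"
proof -
 obtain \<Delta>1 where D: "\<Delta> = [:-a, 1:] ^ \<mu> a * \<Delta>1" "\<Delta>1 \<noteq> 0" using \<Delta>_split[OF assms(1)] by metis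
 have "degree \<Delta> = 5 + degree \<Delta>1" unfolding D(1) assms(2) using D(2) by (subst degree_mult_eq) (auto simp: degree_linear_power)
 then obtain c where c: "\<Delta>1 = [:c:]" using deg\<Delta> by (metis add_cancel_right_right degree_eq_zeroE)
 have "lead_coeff ([:-a, 1:] ^ \<mu> a * \<Delta>1) = lead_coeff ([:-a, 1:] ^ \<mu> a) * lead_coeff \<Delta>1" by (rule lead_coeff_mult)
 then have "lead_coeff \<Delta> = lead_coeff ([:-a, 1:] ^ \<mu> a) * lead_coeff \<Delta>1" unfolding D(1)[symmetric] .
 then have "c = 1" using monic unfolding c lead_coeff_power by simp
 then show ?thesis using D(1) unfolding c assms(2) by simp
qed

end

context pencil_chart
begin

lemma nil5_multiplicity:
 assumes q: "q \<in> V" and L: "L \<in> lines" "L \<subseteq> S" "pt (X q) \<in> L" and only: "\<And>M. M \<in> lines \<Longrightarrow> pt (X q) \<in> M \<Longrightarrow> M = L"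
  and kinds: known_kind
  and a: "a \<in> E" "\<mu> a = 5" and f0: "tay a 0 (X q) = 0" "tay a 1 (X q) = 0" "tay a 2 (X q) = 0" and f3: "tay a 3 (X q) \<noteq> 0"
 shows "has_branch_multiplicity_at S L (pt (X q)) 2"
proof -
 define f where "f = (\<lambda>i r. tay a i (X r))"
 have fi: "tay a i (X r) = f i r" for i r unfolding f_def ..
 define N0 where "N0 = {r \<in> V. f 3 r \<noteq> 0}"
 have hfV: "holomorphic2_on (f i) V" for i unfolding f_def by (rule holo2_subset[OF holo_tay openV V_U])
 have oN0: "open N0" unfolding N0_def using open_nonzero[OF openV holo2_continuous[OF hfV]] .
 have hf0: "holomorphic2_on (f i) N0" for i by (rule holo2_subset[OF hfV oN0]) (auto simp: N0_def)
 define D where "D = (\<lambda>r. f 3 r - f 2 r * f 4 r / f 3 r)"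
 have hD0: "holomorphic2_on D N0" unfolding D_def
  by (intro holo2_diff holo2_mult holo2_divide hf0) (auto simp: N0_def)
 define N where "N = {r \<in> N0. D r \<noteq> 0}"
 have oN: "open N" unfolding N_def using open_nonzero[OF oN0 holo2_continuous[OF hD0]] .
 have qN: "q \<in> N" using q f3 f0(3) unfolding N_def N0_def D_def fi by simp
 have NV: "N \<subseteq> V" and f3N: "\<And>r. r \<in> N \<Longrightarrow> f 3 r \<noteq> 0" and DN: "\<And>r. r \<in> N \<Longrightarrow> D r \<noteq> 0" unfolding N_def N0_def by auto
 have hf: "holomorphic2_on (f i) N" for i by (rule holo2_subset[OF hfV oN NV])
 have hD: "holomorphic2_on D N" by (rule holo2_subset[OF hD0 oN]) (auto simp: N_def)
 have cst: "holomorphic2_on (\<lambda>_. x) N" for x by (rule holo2_const[OF oN])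
 define m where "m = (\<lambda>r. - 1 / (2 * D r))"
 have hm: "holomorphic2_on m N" unfolding m_def by (intro holo2_divide holo2_mult cst hD) (use DN in simp)
 define H0 H1 H2 u where "H0 = (\<lambda>r. (f 2 r)\<^sup>2 * (m r)\<^sup>2 / (f 3 r)\<^sup>2)" and "H1 = (\<lambda>r. - 2 * f 2 r * (m r)\<^sup>2 / f 3 r)"
  and "H2 = (\<lambda>r. (m r)\<^sup>2 - 2 * m r / f 3 r)" and "u = (\<lambda>r. 8 * m r ^ 3 / f 3 r ^ 3)"
 have hH: "holomorphic2_on H0 N" "holomorphic2_on H1 N" "holomorphic2_on H2 N" "holomorphic2_on u N"
  unfolding H0_def H1_def H2_def u_def
  by (intro holo2_diff holo2_mult holo2_divide holo2_power hf hm cst; simp add: f3N)+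
 have id: "(f 0 r)\<^sup>2 = f 2 r ^ 4 * H0 r" "2 * f 0 r * f 1 r = f 2 r ^ 4 * H1 r" "coeff (sq (X r)) 2 = f 2 r ^ 4 * H2 r"
  "(H1 r)\<^sup>2 - 4 * H2 r * H0 r = (f 2 r)\<^sup>2 * u r" if "r \<in> N" for r
 proof -
  have on: "onS (X r)" using that NV V_U onS_X by blast
  have h: "coeff (sq (X r)) 2 = 2 * f 0 r * f 2 r + (f 1 r)\<^sup>2" and e: "f 0 r * f 3 r + f 1 r * f 2 r = 0"
  "2 * f 0 r * f 4 r + 2 * f 1 r * f 3 r + (f 2 r)\<^sup>2 = 0"
  using taylor_relations(3-5)[OF on a(1)] a(2) unfolding fi by simp_all
  note n = nil_5_identities[OF e f3N[OF that] DN[OF that, unfolded D_def]]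
  show "(f 0 r)\<^sup>2 = f 2 r ^ 4 * H0 r" "2 * f 0 r * f 1 r = f 2 r ^ 4 * H1 r" "coeff (sq (X r)) 2 = f 2 r ^ 4 * H2 r"
  "(H1 r)\<^sup>2 - 4 * H2 r * H0 r = (f 2 r)\<^sup>2 * u r"
  unfolding h H0_def H1_def H2_def u_def m_def D_def by (rule n)+
 qed
 have s5: "\<Delta> = [:-a, 1:] ^ 5" by (rule \<Delta>_power5[OF a])
 \<comment> \<open>For \<open>\<Delta> = (t - a)^5\<close> the functional \<open>tay a 2\<close> is
   represented by \<open>(t - a)^2\<close>, whereas \<open>rep (X q)\<close> is divisible by
   \<open>(t - a)^3\<close>.\<close>
 have dy: "dx (f 2) q \<noteq> 0 \<or> dy (f 2) q \<noteq> 0" unfolding f_def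
 proof (rule lin_derivative_nonzero[OF q lin_tay f0(3)])
  define s where "s = [:-a, 1:]"
  show "tay a 2 w = l0 \<Delta> ([:-a, 1:]\<^sup>2 * rep w)" for w
  proof -
  obtain k where k: "rep w = [:tay a 0 w:] + s * ([:tay a 1 w:] + s * ([:tay a 2 w:] + s * k))"
  unfolding s_def using taylor_factor .
  have "s\<^sup>2 * ([:x:] + s * ([:y:] + s * ([:z:] + s * k))) = [:x:] * s ^ 2 + [:y:] * s ^ 3 + [:z:] * s ^ 4 + s ^ 5 * k" for x y z
  by (simp add: eval_nat_numeral algebra_simps)
  then have e: "s\<^sup>2 * rep w = Polynomial.smult (tay a 0 w) (s ^ 2) + Polynomial.smult (tay a 1 w) (s ^ 3) + Polynomial.smult (tay a 2 w) (s ^ 4) + s ^ 5 * k"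
  unfolding k by simp
  have "l0 \<Delta> (s ^ 5 * k) = 0" unfolding s_def s5[symmetric] by (rule l0_dvd) simp
  then show ?thesis unfolding s_def[symmetric] e l0_add l0_smult unfolding s_def by (simp only: l0_power) simp
  qed
  fix \<alpha> \<beta>
  show "\<not> \<Delta> dvd [:\<alpha>, \<beta>:] * rep (X q) - [:-a, 1:]\<^sup>2"
  proof
  assume "\<Delta> dvd [:\<alpha>, \<beta>:] * rep (X q) - [:-a, 1:]\<^sup>2"
  then have *: "s ^ 5 dvd [:\<alpha>, \<beta>:] * rep (X q) - s\<^sup>2" unfolding s5 s_def .
  have "s ^ 3 dvd s ^ 5" by (rule le_imp_power_dvd) simp
  then have 1: "s ^ 3 dvd [:\<alpha>, \<beta>:] * rep (X q) - s\<^sup>2" using * dvd_trans by blast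
  obtain k where "rep (X q) = [:tay a 0 (X q):] + s * ([:tay a 1 (X q):] + s * ([:tay a 2 (X q):] + s * k))"
  unfolding s_def using taylor_factor .
  then have "rep (X q) = s ^ 3 * k" unfolding f0 by (simp add: power3_eq_cube ac_simps)
  then have "s ^ 3 dvd [:\<alpha>, \<beta>:] * rep (X q)" by (metis dvd_mult dvd_triv_left)
  moreover have "s ^ 3 dvd y" if "s ^ 3 dvd x" "s ^ 3 dvd x - y" for x y using dvd_diff[OF that] by simp
  ultimately have "s ^ 3 dvd s\<^sup>2" using 1 by blast
  moreover have "s\<^sup>2 \<noteq> 0" unfolding s_def by simp
  ultimately have "degree (s ^ 3) \<le> degree (s\<^sup>2)" by (rule dvd_imp_degree_le)
  then show False unfolding s_def by (simp add: degree_linear_power)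
  qed
 qed
 have f2q: "f 2 q = 0" using f0(3) unfolding fi .
 have mq: "m q \<noteq> 0" using DN[OF qN] unfolding m_def by simp
 have f3q: "f 3 q \<noteq> 0" by (rule f3N[OF qN])
 have H2q: "H2 q \<noteq> 0"
 proof -
  have "D q = f 3 q" unfolding D_def f2q by simp
  then have "H2 q = (1 / 4 + 1) / (f 3 q)\<^sup>2" unfolding H2_def m_def using f3q by (simp add: power2_eq_square field_simps)
  then show ?thesis using f3q by simp
 qed
 show ?thesis
 proof (rule branch_multiplicityI[where N = N and y = "f 2" and ?H0.0 = H0 and ?H1.0 = H1 and ?H2.0 = H2 and u = u and m = 4 and a = a,
  OF q L only kinds qN NV hf hH _ _ _ id(4) _ _ _ f2q dy])
  fix r assume r: "r \<in> N"
  then have "r \<in> U" using NV V_U by blast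
  note c = coeffs_taylor[OF this a(1), unfolded fi id(1,2,3)[OF r]]
  show "coeff (sq (X r)) 2 = f 2 r ^ 4 * H2 r" by (rule id(3)[OF r])
  show "coeff (sq (X r)) 1 = f 2 r ^ 4 * (H1 r - 2 * a * H2 r)" "coeff (sq (X r)) 0 = f 2 r ^ 4 * (H0 r - a * H1 r + a\<^sup>2 * H2 r)"
  using c a(2) by (simp_all add: algebra_simps)
 qed (use mq f3q H2q in \<open>auto simp: u_def\<close>)
qed

text \<open>The first Taylor coefficient at the fourfold root has order two along this line, so a
  reduced equation is taken from the simple root \<open>e\<close> instead: the value of the
  representative there.\<close>

lemma nil4_multiplicity:
 assumes q: "q \<in> V" and L: "L \<in> lines" "L \<subseteq> S" "pt (X q) \<in> L" and only: "\<And>M. M \<in> lines \<Longrightarrow> pt (X q) \<in> M \<Longrightarrow> M = L"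
  and kinds: known_kind
  and a: "a \<in> E" "\<mu> a = 4" and e: "e \<in> E" "e \<noteq> a" "\<mu> e = 1"
  and f0: "tay a 0 (X q) = 0" and y0: "tay e 0 (X q) = 0" and f2: "tay a 2 (X q) \<noteq> 0"
 shows "has_branch_multiplicity_at S L (pt (X q)) 2"
proof -
 define f where "f = (\<lambda>i r. tay a i (X r))"
 define y where "y = (\<lambda>r. tay e 0 (X r))"
 define d where "d = e - a"
 have fi: "tay a i (X r) = f i r" for i r unfolding f_def ..
 have yi: "tay e 0 (X r) = y r" for r unfolding y_def ..
 define N0 where "N0 = {r \<in> V. f 2 r \<noteq> 0}"
 have hfV: "holomorphic2_on (f i) V" for i unfolding f_def by (rule holo2_subset[OF holo_tay openV V_U])
 have oN0: "open N0" unfolding N0_def using open_nonzero[OF openV holo2_continuous[OF hfV]] .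
 have hf0: "holomorphic2_on (f i) N0" for i by (rule holo2_subset[OF hfV oN0]) (auto simp: N0_def)
 have cst0: "holomorphic2_on (\<lambda>_. x) N0" for x by (rule holo2_const[OF oN0])
 define t where "t = (\<lambda>r. f 0 r - 2 * f 0 r * f 3 r * d / f 2 r + (2 * f 2 r + f 0 r * (f 3 r)\<^sup>2 / (f 2 r)\<^sup>2) * d\<^sup>2)"
 have ht0: "holomorphic2_on t N0" unfolding t_def
  by (intro holo2_add holo2_diff holo2_mult holo2_divide holo2_power hf0 cst0) (auto simp: N0_def)
 define N where "N = {r \<in> N0. t r \<noteq> 0}"
 have oN: "open N" unfolding N_def using open_nonzero[OF oN0 holo2_continuous[OF ht0]] .
 have f0q: "f 0 q = 0" using f0 unfolding fi .
 have f2q: "f 2 q \<noteq> 0" using f2 unfolding fi .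
 have d0: "d \<noteq> 0" unfolding d_def using e(2) by simp
 have qN: "q \<in> N" using q f2q d0 f0q unfolding N_def N0_def t_def by simp
 have NV: "N \<subseteq> V" and f2N: "\<And>r. r \<in> N \<Longrightarrow> f 2 r \<noteq> 0" and tN: "\<And>r. r \<in> N \<Longrightarrow> t r \<noteq> 0" unfolding N_def N0_def by auto
 have hf: "holomorphic2_on (f i) N" for i by (rule holo2_subset[OF hfV oN NV])
 have ht: "holomorphic2_on t N" by (rule holo2_subset[OF ht0 oN]) (auto simp: N_def)
 have hy: "holomorphic2_on y N" unfolding y_def using NV V_U by (intro holo2_subset[OF holo_tay oN]) auto
 have cst: "holomorphic2_on (\<lambda>_. x) N" for x by (rule holo2_const[OF oN])
 define H0 H1 H2 u where "H0 = (\<lambda>r. f 0 r / t r)" and "H1 = (\<lambda>r. - 2 * f 0 r * f 3 r / (f 2 r * t r))"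
  and "H2 = (\<lambda>r. (2 * f 2 r + f 0 r * (f 3 r)\<^sup>2 / (f 2 r)\<^sup>2) / t r)" and "u = (\<lambda>r. - 8 * f 2 r / t r ^ 3)"
 have hH: "holomorphic2_on H0 N" "holomorphic2_on H1 N" "holomorphic2_on H2 N" "holomorphic2_on u N"
  unfolding H0_def H1_def H2_def u_def
  by (intro holo2_add holo2_mult holo2_divide holo2_power hf ht cst; simp add: f2N tN)+
 have id: "(f 0 r)\<^sup>2 = (y r)\<^sup>2 * H0 r" "2 * f 0 r * f 1 r = (y r)\<^sup>2 * H1 r" "coeff (sq (X r)) 2 = (y r)\<^sup>2 * H2 r"
  "(H1 r)\<^sup>2 - 4 * H2 r * H0 r = (y r)\<^sup>2 * u r" if "r \<in> N" for r
 proof -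
  have rU: "r \<in> U" using that NV V_U by blast
  have on: "onS (X r)" using onS_X[OF rU] .
  have h: "coeff (sq (X r)) 2 = 2 * f 0 r * f 2 r + (f 1 r)\<^sup>2" and e': "f 0 r * f 3 r + f 1 r * f 2 r = 0"
  using taylor_relations(3,4)[OF on a(1)] a(2) unfolding fi by simp_all
  have c: "coeff (sq (X r)) 0 = (f 0 r)\<^sup>2 - a * (2 * f 0 r * f 1 r) + a\<^sup>2 * coeff (sq (X r)) 2"
  "coeff (sq (X r)) 1 = 2 * f 0 r * f 1 r - 2 * a * coeff (sq (X r)) 2"
  using coeffs_taylor[OF rU a(1)] a(2) unfolding fi by simp_all
  have "(y r)\<^sup>2 = (f 0 r)\<^sup>2 + 2 * f 0 r * f 1 r * d + (2 * f 0 r * f 2 r + (f 1 r)\<^sup>2) * d\<^sup>2"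
  unfolding taylor_relations(1)[OF on e(1), unfolded yi, symmetric] unfolding c unfolding h d_def
  by (simp add: power2_eq_square algebra_simps)
  note n = nil_4_identities[OF e' f2N[OF that] this tN[OF that, unfolded t_def]]
  show "(f 0 r)\<^sup>2 = (y r)\<^sup>2 * H0 r" "2 * f 0 r * f 1 r = (y r)\<^sup>2 * H1 r" "coeff (sq (X r)) 2 = (y r)\<^sup>2 * H2 r"
  "(H1 r)\<^sup>2 - 4 * H2 r * H0 r = (y r)\<^sup>2 * u r"
  unfolding h H0_def H1_def H2_def u_def t_def by (rule n)+
 qed
 \<comment> \<open>Evaluation at \<open>e\<close> is represented by \<open>nn e\<close>, which is
   nonzero at the simple root \<open>e\<close>, while \<open>rep (X q)\<close> vanishes
   there.\<close>
 have dy: "dx y q \<noteq> 0 \<or> dy y q \<noteq> 0" unfolding y_def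
 proof (rule lin_derivative_nonzero[OF q lin_tay y0])
  show "tay e 0 w = l0 \<Delta> (nn e * rep w)" for w unfolding tay_0 l0_nn[OF e(1)] ..
  fix \<alpha> \<beta>
  obtain \<Delta>1 where D: "\<Delta> = [:-e, 1:] ^ \<mu> e * \<Delta>1" "poly \<Delta>1 e \<noteq> 0" using \<Delta>_split[OF e(1)] by metis
  have "[:-e, 1:] * nn e = [:-e, 1:] * \<Delta>1" unfolding nn[OF e(1)] using D(1) unfolding e(3) by simp
  then have "nn e = \<Delta>1" by (subst (asm) mult_left_cancel) auto
  then have "poly (nn e) e \<noteq> 0" using D(2) by simp
  moreover have "poly ([:\<alpha>, \<beta>:] * rep (X q)) e = 0" using y0 unfolding tay_0 by simp
  ultimately show "\<not> \<Delta> dvd [:\<alpha>, \<beta>:] * rep (X q) - nn e" using root_eval[OF _ e(1)] by metis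
 qed
 have yq: "y q = 0" using y0 unfolding yi .
 have tq: "t q \<noteq> 0" by (rule tN[OF qN])
 have H2q: "H2 q \<noteq> 0" unfolding H2_def f0q using tq f2q by simp
 show ?thesis
 proof (rule branch_multiplicityI[where N = N and y = y and ?H0.0 = H0 and ?H1.0 = H1 and ?H2.0 = H2 and u = u and m = 2 and a = a,
  OF q L only kinds qN NV hy hH _ _ _ id(4) _ _ _ yq dy])
  fix r assume r: "r \<in> N"
  then have "r \<in> U" using NV V_U by blast
  note c = coeffs_taylor[OF this a(1), unfolded fi id(1,2,3)[OF r]]
  show "coeff (sq (X r)) 2 = (y r)\<^sup>2 * H2 r" by (rule id(3)[OF r])
  show "coeff (sq (X r)) 1 = (y r)\<^sup>2 * (H1 r - 2 * a * H2 r)" "coeff (sq (X r)) 0 = (y r)\<^sup>2 * (H0 r - a * H1 r + a\<^sup>2 * H2 r)"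
  using c a(2) by (simp_all add: algebra_simps)
 qed (use tq f2q H2q in \<open>auto simp: u_def\<close>)
qed

end

section \<open>The line joining two singular points\<close>

context pencil_chart
begin

text \<open>Divided by its leading coefficient, \<open>sq X\<close> becomes a monic quadratic with
  the values \<open>e1\<close> and \<open>e2\<close> at \<open>a\<close> and \<open>b\<close>. It
  extends continuously to the curve and equals \<open>(t - a) (t - b)\<close> at \<open>q\<close>,
  where its discriminant is \<open>(a - b)^2\<close>.\<close>

lemma no_branch_of_small:
 assumes q: "q \<in> V" and ab: "a \<noteq> b" and N0: "open N0" "q \<in> N0" "N0 \<subseteq> V"
  and cont: "continuous_on N0 e1" "continuous_on N0 e2" and e0: "e1 q = 0" "e2 q = 0"
  and va: "\<And>r. r \<in> N0 \<Longrightarrow> coeff (sq (X r)) 0 + a * coeff (sq (X r)) 1 + a\<^sup>2 * coeff (sq (X r)) 2 = coeff (sq (X r)) 2 * e1 r"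
  and vb: "\<And>r. r \<in> N0 \<Longrightarrow> coeff (sq (X r)) 0 + b * coeff (sq (X r)) 1 + b\<^sup>2 * coeff (sq (X r)) 2 = coeff (sq (X r)) 2 * e2 r"
  and curve: "curve_equation C A U F G q h" and div: "divided_by_D1 q h (H_coeffs F G) DS"
  and ord: "order_along q h (discriminant DS) = enat k" "k > 0"
 shows False
proof -
 define d where "d = b - a"
 have d: "d \<noteq> 0" using ab unfolding d_def by simp
 define g1 where "g1 = (\<lambda>r. (e2 r - e1 r) / d - (a + b))"
 define g0 where "g0 = (\<lambda>r. e1 r - a * g1 r - a\<^sup>2)"
 have c1: "continuous_on N0 g1" unfolding g1_def using d by (intro continuous_intros cont) auto
 have c0: "continuous_on N0 g0" unfolding g0_def by (intro continuous_intros cont c1)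
 define N where "N = {r \<in> N0. (g1 r)\<^sup>2 - 4 * 1 * g0 r \<noteq> 0}"
 have cD: "continuous_on N0 (\<lambda>r. (g1 r)\<^sup>2 - 4 * 1 * g0 r)" by (intro continuous_intros c1 c0)
 have oN: "open N" unfolding N_def by (rule open_nonzero[OF N0(1) cD])
 have eq: "(g1 q)\<^sup>2 - 4 * 1 * g0 q = (a - b)\<^sup>2" unfolding g1_def g0_def e0 by (simp add: power2_eq_square algebra_simps)
 have "(g1 q)\<^sup>2 - 4 * 1 * g0 q \<noteq> 0" unfolding eq using ab by simp
 then have qN: "q \<in> N" using N0(2) unfolding N_def by blast
 have NN: "N \<subseteq> N0" unfolding N_def by blast
 show False
 proof (rule no_branch[OF q oN qN _ _ _ _ _ _ _ _ curve div ord, where ?g0.0 = g0 and ?g1.0 = g1 and ?g2.0 = "\<lambda>_. 1" and \<kappa> = "\<lambda>r. coeff (sq (X r)) 2"])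
  show "N \<subseteq> V" using NN N0(3) by blast
  show "continuous_on N g0" "continuous_on N g1" using c0 c1 continuous_on_subset NN by blast+
  show "continuous_on N (\<lambda>_. 1)" by (rule continuous_on_const)
  fix r assume r: "r \<in> N"
  define x0 x1 x2 where "x0 = coeff (sq (X r)) 0" and "x1 = coeff (sq (X r)) 1" and "x2 = coeff (sq (X r)) 2"
  have e: "x0 + a * x1 + a\<^sup>2 * x2 = x2 * e1 r" "x0 + b * x1 + b\<^sup>2 * x2 = x2 * e2 r"
  using va[OF subsetD[OF NN r]] vb[OF subsetD[OF NN r]] unfolding x0_def x1_def x2_def .
  have "d * (x1 + (a + b) * x2) = (x0 + b * x1 + b\<^sup>2 * x2) - (x0 + a * x1 + a\<^sup>2 * x2)"
  unfolding d_def by (simp add: power2_eq_square algebra_simps)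
  also have "\<dots> = x2 * (e2 r - e1 r)" unfolding e by (simp add: algebra_simps)
  finally have "x1 + (a + b) * x2 = x2 * (e2 r - e1 r) / d" using d by (simp add: eq_divide_eq mult.commute)
  then have X1: "x1 = x2 * g1 r" unfolding g1_def by (simp add: algebra_simps)
  have "x0 = x2 * e1 r - a * x1 - a\<^sup>2 * x2" using e(1) by (simp add: algebra_simps)
  then have X0: "x0 = x2 * g0 r" unfolding X1 g0_def by (simp add: algebra_simps)
  show "coeff (sq (X r)) 2 = coeff (sq (X r)) 2 * 1" by simp
  show "coeff (sq (X r)) 1 = coeff (sq (X r)) 2 * g1 r" using X1 unfolding x1_def x2_def .
  show "coeff (sq (X r)) 0 = coeff (sq (X r)) 2 * g0 r" using X0 unfolding x0_def x2_def .
  show "(g1 r)\<^sup>2 - 4 * 1 * g0 r \<noteq> 0" using r unfolding N_def by blast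
 qed
qed

text \<open>Values and slopes of the quadratic \<open>sq X\<close> at \<open>a\<close> and
  \<open>b\<close> are four data for three coefficients. Their compatibility is the first relation;
  the others are the divided differences with a double node at \<open>a\<close> and at
  \<open>b\<close>.\<close>

lemma two_point_relations:
 assumes r: "r \<in> U" and ab: "a \<in> E" "b \<in> E" "\<mu> a \<ge> 2" "\<mu> b \<ge> 2" "a \<noteq> b"
 defines "f0 \<equiv> tay a 0 (X r)" and "f1 \<equiv> tay a 1 (X r)" and "g0 \<equiv> tay b 0 (X r)" and "g1 \<equiv> tay b 1 (X r)"
  and "i \<equiv> 1 / (b - a)"
 shows "g0 * (i * g0 - g1) = f0 * (f1 + i * f0)"
  and "coeff (sq (X r)) 2 = i * (i * (g0\<^sup>2 - f0\<^sup>2) - 2 * f0 * f1)"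
  and "coeff (sq (X r)) 2 = i * (2 * g0 * g1 - i * (g0\<^sup>2 - f0\<^sup>2))"
proof -
 define x0 x1 x2 d where "x0 = coeff (sq (X r)) 0" and "x1 = coeff (sq (X r)) 1" and "x2 = coeff (sq (X r)) 2" and "d = b - a"
 have d: "d * i = 1" unfolding i_def d_def using ab(5) by simp
 note t = taylor_relations(1,2)[OF onS_X[OF r] ab(1), folded f0_def f1_def] taylor_relations(1,2)[OF onS_X[OF r] ab(2), folded g0_def g1_def]
 have e: "x0 + a * x1 + a\<^sup>2 * x2 = f0\<^sup>2" "x1 + 2 * a * x2 = 2 * f0 * f1" "x0 + b * x1 + b\<^sup>2 * x2 = g0\<^sup>2" "x1 + 2 * b * x2 = 2 * g0 * g1"
  using t ab(3,4) unfolding x0_def x1_def x2_def by simp_all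
 have "g0\<^sup>2 - f0\<^sup>2 = d * (x1 + (a + b) * x2)"
  unfolding e(1)[symmetric] e(3)[symmetric] d_def by (simp add: power2_eq_square algebra_simps)
 then have "i * (g0\<^sup>2 - f0\<^sup>2) = (d * i) * (x1 + (a + b) * x2)" by simp
 then have D: "i * (g0\<^sup>2 - f0\<^sup>2) = x1 + (a + b) * x2" unfolding d by simp
 have 1: "i * (g0\<^sup>2 - f0\<^sup>2) - 2 * f0 * f1 = d * x2" unfolding D e(2)[symmetric] d_def by (simp add: algebra_simps)
 have 2: "2 * g0 * g1 - i * (g0\<^sup>2 - f0\<^sup>2) = d * x2" unfolding D e(4)[symmetric] d_def by (simp add: algebra_simps)
 have "2 * (g0 * (i * g0 - g1) - f0 * (f1 + i * f0)) = (i * (g0\<^sup>2 - f0\<^sup>2) - 2 * f0 * f1) - (2 * g0 * g1 - i * (g0\<^sup>2 - f0\<^sup>2))"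
  by (simp add: power2_eq_square algebra_simps)
 also have "\<dots> = 0" unfolding 1 2 by simp
 finally show "g0 * (i * g0 - g1) = f0 * (f1 + i * f0)" by (simp only: mult_eq_0_iff) simp
 have "i * (d * x2) = (d * i) * x2" by simp
 then have "i * (d * x2) = x2" unfolding d by simp
 then show "coeff (sq (X r)) 2 = i * (i * (g0\<^sup>2 - f0\<^sup>2) - 2 * f0 * f1)" "coeff (sq (X r)) 2 = i * (2 * g0 * g1 - i * (g0\<^sup>2 - f0\<^sup>2))"
  unfolding 1 2 x2_def by simp_all
qed

text \<open>Near \<open>q\<close> the slopes \<open>f1\<close>, \<open>g1\<close> are units, so
  \<open>g0\<close> is a multiple of \<open>f0\<close>, and the leading coefficient is
  \<open>f0\<close> times a unit. The values \<open>f0^2\<close>, \<open>g0^2\<close> of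
  \<open>sq X\<close> at \<open>a\<close> and \<open>b\<close> have order two in \<open>f0\<close>,
  hence are small compared with the leading coefficient.\<close>

lemma no_branch_22:
 assumes q: "q \<in> V" and ab: "a \<in> E" "b \<in> E" "\<mu> a \<ge> 2" "\<mu> b \<ge> 2" "a \<noteq> b"
  and 0: "tay a 0 (X q) = 0" "tay b 0 (X q) = 0" and nz: "tay a 1 (X q) \<noteq> 0" "tay b 1 (X q) \<noteq> 0"
  and curve: "curve_equation C A U F G q h" and div: "divided_by_D1 q h (H_coeffs F G) DS"
  and ord: "order_along q h (discriminant DS) = enat k" "k > 0"
 shows False
proof -
 define i where "i = 1 / (b - a)"
 have i0: "i \<noteq> 0" unfolding i_def using ab(5) by simp
 define f0 f1 g0 g1 where "f0 = (\<lambda>r. tay a 0 (X r))" and "f1 = (\<lambda>r. tay a 1 (X r))" and "g0 = (\<lambda>r. tay b 0 (X r))" and "g1 = (\<lambda>r. tay b 1 (X r))"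
 note defs = f0_def f1_def g0_def g1_def
 have c: "continuous_on V f0" "continuous_on V f1" "continuous_on V g0" "continuous_on V g1"
  unfolding defs using holo2_continuous[OF holo_tay] continuous_on_subset[OF _ V_U] by auto
 define p where "p = (\<lambda>r. i * g0 r - g1 r)"
 have cp: "continuous_on V p" unfolding p_def by (intro continuous_intros c)
 define N1 where "N1 = {r \<in> V. p r \<noteq> 0}"
 have oN1: "open N1" unfolding N1_def by (rule open_nonzero[OF openV cp])
 have N1V: "N1 \<subseteq> V" and p0: "\<And>r. r \<in> N1 \<Longrightarrow> p r \<noteq> 0" unfolding N1_def by auto
 have c1: "continuous_on N1 f0" "continuous_on N1 f1" "continuous_on N1 g0" "continuous_on N1 g1" "continuous_on N1 p"
  using c cp continuous_on_subset[OF _ N1V] by auto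
 define w where "w = (\<lambda>r. (f1 r + i * f0 r) / p r)"
 have cw: "continuous_on N1 w" unfolding w_def by (intro continuous_intros c1) (use p0 in auto)
 define k' where "k' = (\<lambda>r. i * (i * f0 r * ((w r)\<^sup>2 - 1) - 2 * f1 r))"
 have ck: "continuous_on N1 k'" unfolding k'_def by (intro continuous_intros c1 cw)
 define N0 where "N0 = {r \<in> N1. k' r \<noteq> 0}"
 have oN0: "open N0" unfolding N0_def by (rule open_nonzero[OF oN1 ck])
 have N0: "N0 \<subseteq> N1" and k0: "\<And>r. r \<in> N0 \<Longrightarrow> k' r \<noteq> 0" unfolding N0_def by auto
 have q0: "f0 q = 0" "g0 q = 0" "f1 q \<noteq> 0" "g1 q \<noteq> 0" using 0 nz unfolding defs by auto
 have qN0: "q \<in> N0" using q i0 q0 unfolding N0_def N1_def p_def k'_def by simp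
 have c0: "continuous_on N0 f0" "continuous_on N0 w" "continuous_on N0 k'" using c1 cw ck continuous_on_subset[OF _ N0] by auto
 have id: "coeff (sq (X r)) 2 = f0 r * k' r" "g0 r = f0 r * w r" if r: "r \<in> N0" for r
 proof -
  have rU: "r \<in> U" using r N0 N1V V_U by blast
  have pr: "p r \<noteq> 0" using p0 r N0 by blast
  note t = two_point_relations[OF rU ab, folded i_def]
  have "g0 r * p r = f0 r * (f1 r + i * f0 r)" using t(1) unfolding p_def defs .
  then show g: "g0 r = f0 r * w r" unfolding w_def using pr by (simp add: eq_divide_eq)
  have "coeff (sq (X r)) 2 = i * (i * ((g0 r)\<^sup>2 - (f0 r)\<^sup>2) - 2 * f0 r * f1 r)" using t(2) unfolding defs .
  then show "coeff (sq (X r)) 2 = f0 r * k' r" unfolding g k'_def by (simp add: power2_eq_square algebra_simps)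
 qed
 show False
 proof (rule no_branch_of_small[OF q ab(5) oN0 qN0 _ _ _ _ _ _ _ curve div ord, where ?e1.0 = "\<lambda>r. f0 r / k' r" and ?e2.0 = "\<lambda>r. f0 r * (w r)\<^sup>2 / k' r"])
  show "N0 \<subseteq> V" using N0 N1V by blast
  show "continuous_on N0 (\<lambda>r. f0 r / k' r)" "continuous_on N0 (\<lambda>r. f0 r * (w r)\<^sup>2 / k' r)"
  by (intro continuous_intros c0; use k0 in auto)+
  show "f0 q / k' q = 0" "f0 q * (w q)\<^sup>2 / k' q = 0" using q0 by simp_all
  fix r assume r: "r \<in> N0"
  have on: "onS (X r)" using r N0 N1V V_U onS_X by blast
  have "(f0 r)\<^sup>2 = coeff (sq (X r)) 2 * (f0 r / k' r)" unfolding id(1)[OF r] using k0[OF r] by (simp add: power2_eq_square)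
  then show "coeff (sq (X r)) 0 + a * coeff (sq (X r)) 1 + a\<^sup>2 * coeff (sq (X r)) 2 = coeff (sq (X r)) 2 * (f0 r / k' r)"
  by (intro trans[OF taylor_relations(1)[OF on ab(1)]]) (simp only: f0_def)
  have "(g0 r)\<^sup>2 = coeff (sq (X r)) 2 * (f0 r * (w r)\<^sup>2 / k' r)" unfolding id[OF r] using k0[OF r] by (simp add: power2_eq_square)
  then show "coeff (sq (X r)) 0 + b * coeff (sq (X r)) 1 + b\<^sup>2 * coeff (sq (X r)) 2 = coeff (sq (X r)) 2 * (f0 r * (w r)\<^sup>2 / k' r)"
  by (intro trans[OF taylor_relations(1)[OF on ab(2)]]) (simp only: g0_def)
 qed
qed

text \<open>At the triple root \<open>g2\<close> is a unit, which makes \<open>g0\<close> equal to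
  \<open>g1^2\<close> up to a unit. With \<open>f0\<close> a multiple of \<open>g0\<close>, the
  leading coefficient has order three in \<open>g1\<close>, while the values \<open>f0^2\<close>,
  \<open>g0^2\<close> have order at least four.\<close>

lemma no_branch_23:
 assumes q: "q \<in> V" and ab: "a \<in> E" "b \<in> E" "\<mu> a \<ge> 2" "\<mu> b \<ge> 3" "a \<noteq> b"
  and 0: "tay a 0 (X q) = 0" "tay b 0 (X q) = 0" "tay b 1 (X q) = 0" and nz: "tay a 1 (X q) \<noteq> 0" "tay b 2 (X q) \<noteq> 0"
  and curve: "curve_equation C A U F G q h" and div: "divided_by_D1 q h (H_coeffs F G) DS"
  and ord: "order_along q h (discriminant DS) = enat k" "k > 0"
 shows False
proof -
 define i where "i = 1 / (b - a)"
 have i0: "i \<noteq> 0" unfolding i_def using ab(5) by simp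
 define f0 f1 g0 g1 g2 where "f0 = (\<lambda>r. tay a 0 (X r))" and "f1 = (\<lambda>r. tay a 1 (X r))"
  and "g0 = (\<lambda>r. tay b 0 (X r))" and "g1 = (\<lambda>r. tay b 1 (X r))" and "g2 = (\<lambda>r. tay b 2 (X r))"
 note defs = f0_def f1_def g0_def g1_def g2_def
 have c: "continuous_on V f0" "continuous_on V f1" "continuous_on V g0" "continuous_on V g1" "continuous_on V g2"
  unfolding defs using holo2_continuous[OF holo_tay] continuous_on_subset[OF _ V_U] by auto
 define p where "p = (\<lambda>r. f1 r + i * f0 r)"
 have cp: "continuous_on V p" unfolding p_def by (intro continuous_intros c)
 define N1 where "N1 = {r \<in> V. p r \<noteq> 0}"
 have oN1: "open N1" unfolding N1_def by (rule open_nonzero[OF openV cp])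
 have N1V: "N1 \<subseteq> V" and p0: "\<And>r. r \<in> N1 \<Longrightarrow> p r \<noteq> 0" unfolding N1_def by auto
 have c1: "continuous_on N1 f0" "continuous_on N1 f1" "continuous_on N1 g0" "continuous_on N1 g1" "continuous_on N1 g2" "continuous_on N1 p"
  using c cp continuous_on_subset[OF _ N1V] by auto
 define w where "w = (\<lambda>r. (i * g0 r - g1 r) / p r)"
 have cw: "continuous_on N1 w" unfolding w_def by (intro continuous_intros c1) (use p0 in auto)
 define t where "t = (\<lambda>r. i * (2 * g1 r - i * g0 r * (1 - (w r)\<^sup>2)) - 2 * g2 r)"
 have ct: "continuous_on N1 t" unfolding t_def by (intro continuous_intros c1 cw)
 define N2 where "N2 = {r \<in> N1. t r \<noteq> 0}"
 have oN2: "open N2" unfolding N2_def by (rule open_nonzero[OF oN1 ct])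
 have N2: "N2 \<subseteq> N1" and t0: "\<And>r. r \<in> N2 \<Longrightarrow> t r \<noteq> 0" unfolding N2_def by auto
 have c2: "continuous_on N2 g1" "continuous_on N2 w" "continuous_on N2 t" using c1 cw ct continuous_on_subset[OF _ N2] by auto
 define z where "z = (\<lambda>r. 2 - i * (g1 r / t r) * (1 - (w r)\<^sup>2))"
 have cz: "continuous_on N2 z" unfolding z_def by (intro continuous_intros c2) (use t0 in auto)
 define N0 where "N0 = {r \<in> N2. z r \<noteq> 0}"
 have oN0: "open N0" unfolding N0_def by (rule open_nonzero[OF oN2 cz])
 have N0: "N0 \<subseteq> N2" and z0: "\<And>r. r \<in> N0 \<Longrightarrow> z r \<noteq> 0" unfolding N0_def by auto
 have q0: "f0 q = 0" "g0 q = 0" "g1 q = 0" "f1 q \<noteq> 0" "g2 q \<noteq> 0" using 0 nz unfolding defs by auto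
 have qN0: "q \<in> N0" using q i0 q0 unfolding N0_def N2_def N1_def p_def t_def z_def by simp
 have c0: "continuous_on N0 g1" "continuous_on N0 w" "continuous_on N0 t" "continuous_on N0 z" using c2 cz continuous_on_subset[OF _ N0] by auto
 define e2 where "e2 = (\<lambda>r. g1 r / (i * t r * z r))"
 have id: "coeff (sq (X r)) 2 * e2 r = (g0 r)\<^sup>2" "f0 r = g0 r * w r" if r: "r \<in> N0" for r
 proof -
  have rU: "r \<in> U" using r N0 N2 N1V V_U by blast
  have pr: "p r \<noteq> 0" using p0 r N0 N2 by blast
  have tr: "t r \<noteq> 0" using t0 r N0 by blast
  have m: "2 \<le> \<mu> b" using ab(4) by simp
  note T = two_point_relations[OF rU ab(1-3) m ab(5), folded i_def]
  have "f0 r * p r = g0 r * (i * g0 r - g1 r)" using T(1) unfolding p_def defs by simp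
  then show f: "f0 r = g0 r * w r" unfolding w_def using pr by (simp add: eq_divide_eq)
  have "coeff (sq (X r)) 2 = i * (2 * g0 r * g1 r - i * ((g0 r)\<^sup>2 - (f0 r)\<^sup>2))" using T(3) unfolding defs .
  then have h: "coeff (sq (X r)) 2 = g0 r * (i * (2 * g1 r - i * g0 r * (1 - (w r)\<^sup>2)))" unfolding f by (simp add: power2_eq_square algebra_simps)
  have "coeff (sq (X r)) 2 = 2 * g0 r * g2 r + (g1 r)\<^sup>2"
  using taylor_relations(3)[OF onS_X[OF rU] ab(2,4)] unfolding defs .
  then have "(g1 r)\<^sup>2 = g0 r * t r" unfolding h t_def by (simp add: algebra_simps)
  then have g: "g0 r = (g1 r)\<^sup>2 / t r" using tr by (simp add: eq_divide_eq)
  have g': "i * g0 r = g1 r * (i * (g1 r / t r))" unfolding g by (simp add: power2_eq_square)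
  have ring: "2 * x - x * (i * y) * v = x * (2 - i * y * v)" for x y v :: complex by (simp add: algebra_simps)
  have "2 * g1 r - i * g0 r * (1 - (w r)\<^sup>2) = g1 r * z r" unfolding g' z_def by (rule ring)
  then have "coeff (sq (X r)) 2 = g0 r * (i * (g1 r * z r))" unfolding h by simp
  then have "coeff (sq (X r)) 2 * e2 r = g0 r * ((g1 r)\<^sup>2 / t r)" unfolding e2_def using i0 z0[OF r] tr by (simp add: power2_eq_square)
  then show "coeff (sq (X r)) 2 * e2 r = (g0 r)\<^sup>2" unfolding g[symmetric] by (simp add: power2_eq_square)
 qed
 have ce2: "continuous_on N0 e2" unfolding e2_def by (intro continuous_intros c0) (use i0 z0 t0 N0 in auto)
 show False
 proof (rule no_branch_of_small[OF q ab(5) oN0 qN0 _ _ ce2 _ _ _ _ curve div ord, where ?e1.0 = "\<lambda>r. e2 r * (w r)\<^sup>2"])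
  show "N0 \<subseteq> V" using N0 N2 N1V by blast
  show "continuous_on N0 (\<lambda>r. e2 r * (w r)\<^sup>2)" by (intro continuous_intros ce2 c0)
  show "e2 q = 0" "e2 q * (w q)\<^sup>2 = 0" unfolding e2_def using q0 by simp_all
  fix r assume r: "r \<in> N0"
  have on: "onS (X r)" using r N0 N2 N1V V_U onS_X by blast
  have "(f0 r)\<^sup>2 = coeff (sq (X r)) 2 * e2 r * (w r)\<^sup>2" unfolding id(1)[OF r] id(2)[OF r] by (simp add: power_mult_distrib)
  then show "coeff (sq (X r)) 0 + a * coeff (sq (X r)) 1 + a\<^sup>2 * coeff (sq (X r)) 2 = coeff (sq (X r)) 2 * (e2 r * (w r)\<^sup>2)"
  unfolding taylor_relations(1)[OF on ab(1)] f0_def by simp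
  show "coeff (sq (X r)) 0 + b * coeff (sq (X r)) 1 + b\<^sup>2 * coeff (sq (X r)) 2 = coeff (sq (X r)) 2 * e2 r"
  unfolding taylor_relations(1)[OF on ab(2)] id(1)[OF r] g0_def ..
 qed
qed

end

section \<open>Generic points of the lines\<close>

lemma form_zeros_finite:
 assumes \<psi>: "form d \<psi>" and "indep2 a b" "\<psi> a \<noteq> 0 \<or> \<psi> b \<noteq> 0"
 shows "finite {p \<in> join a b. \<exists>v\<in>hcoords p. \<psi> v = 0}"
proof -
 have "{p \<in> join a b. \<exists>v\<in>hcoords p. \<psi> v = 0} \<subseteq> zero_locus {\<psi>} \<inter> join a b"
  using mem_zero_locus[of "{\<psi>}"] \<psi> pt_hcoords hcoords_nonzero by fastforce
 moreover have "finite (zero_locus {\<psi>} \<inter> join a b)"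
 proof (cases "\<psi> a = 0")
  case False
  then show ?thesis using linear_comb_form_finite[OF \<psi> _ assms(2)] by blast
 next
  case True
  then show ?thesis using linear_comb_form_finite[OF \<psi> _ indep2_swap[OF assms(2)]] assms(3)
  unfolding join_def by (simp add: insert_commute)
 qed
 ultimately show ?thesis using finite_subset by blast
qed

lemma form_diff: "form d f \<Longrightarrow> form d g \<Longrightarrow> form d (\<lambda>v. f v - g v)"
proof -
 assume f: "form d f" and g: "form d g"
 have "(\<lambda>v. f v + (- 1) * g v) \<in> poly_funs (range (\<lambda>i v. v $ i))"
  using f g unfolding form_def by (intro poly_funs.add poly_funs.mult poly_funs.const) auto
 then show ?thesis using f g unfolding form_def by (simp add: right_diff_distrib)
qed

context pencil_roots
begin

text \<open>The exceptional points are those on other listed lines, the points given by some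
  \<open>nn a\<close>, and the zeros of the forms in \<open>\<Psi>\<close>. Each of these sets meets
  \<open>L\<close> in finitely many points; for a form it suffices to be nonzero at one spanning
  vector.\<close>

lemma generic_points:
 assumes L: "L \<in> lines" "L = join u v" "indep2 u v" and \<Psi>: "finite \<Psi>" "\<And>\<psi>. \<psi> \<in> \<Psi> \<Longrightarrow> (\<exists>d. form d \<psi>) \<and> (\<psi> u \<noteq> 0 \<or> \<psi> v \<noteq> 0)"
 obtains E0 where "finite E0" "\<forall>p\<in>L - E0. \<exists>X0 \<alpha> \<beta>. X0 = \<alpha> *s u + \<beta> *s v \<and> X0 \<noteq> 0 \<and> p = pt X0 \<and> nonsing X0 \<and>
  (\<forall>M\<in>lines. p \<in> M \<longrightarrow> M = L) \<and> (\<forall>\<psi>\<in>\<Psi>. \<psi> X0 \<noteq> 0)"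
proof -
 define E0 where "E0 = (\<Union>M\<in>lines - {L}. L \<inter> M) \<union> (\<lambda>a. pt (\<phi> (nn a))) ` E \<union> (\<Union>\<psi>\<in>\<Psi>. {p \<in> L. \<exists>w\<in>hcoords p. \<psi> w = 0})"
 have "finite (L \<inter> M)" if "M \<in> lines - {L}" for M using that distinct_lines_Int lines_projective L(1) by blast
 moreover have "finite {p \<in> L. \<exists>w\<in>hcoords p. \<psi> w = 0}" if \<psi>: "\<psi> \<in> \<Psi>" for \<psi>
 proof -
  obtain d where d: "form d \<psi>" "\<psi> u \<noteq> 0 \<or> \<psi> v \<noteq> 0" using \<Psi>(2)[OF \<psi>] by blast
  show ?thesis unfolding L(2) by (rule form_zeros_finite[OF d(1) L(3) d(2)])
 qed
 ultimately have "finite E0" unfolding E0_def using finite_lines finE \<Psi>(1) by blast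
 then show thesis
 proof (rule that, intro ballI)
  fix p assume p: "p \<in> L - E0"
  then obtain \<alpha> \<beta> where ab: "\<alpha> *s u + \<beta> *s v \<noteq> 0" "p = pt (\<alpha> *s u + \<beta> *s v)" using joinE L(2) by blast
  define X0 where "X0 = \<alpha> *s u + \<beta> *s v"
  have X0: "X0 \<noteq> 0" "p = pt X0" using ab unfolding X0_def by auto
  have "nonsing X0"
  proof (rule ccontr)
  assume "\<not> nonsing X0"
  from sing_imp_nn[OF this X0(1)] obtain a c where a: "a \<in> E" "X0 = c *s \<phi> (nn a)" .
  then have "c \<noteq> 0" "\<phi> (nn a) \<noteq> 0" using X0(1) by auto
  then have "p = pt (\<phi> (nn a))" unfolding X0(2) a(2) by (rule pt_scale)
  then show False using p a(1) unfolding E0_def by blast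
  qed
  moreover have "\<psi> X0 \<noteq> 0" if "\<psi> \<in> \<Psi>" for \<psi>
  using p that mem_hcoords_pt[OF X0(1)] unfolding E0_def X0(2) by blast
  moreover have "M = L" if "M \<in> lines" "p \<in> M" for M using p that unfolding E0_def by blast
  ultimately show "\<exists>X0 \<alpha> \<beta>. X0 = \<alpha> *s u + \<beta> *s v \<and> X0 \<noteq> 0 \<and> p = pt X0 \<and> nonsing X0 \<and>
  (\<forall>M\<in>lines. p \<in> M \<longrightarrow> M = L) \<and> (\<forall>\<psi>\<in>\<Psi>. \<psi> X0 \<noteq> 0)" using X0 X0_def by blast
 qed
qed

lemma tay_\<phi>:
 assumes "a \<in> E" "i < \<mu> a"
 shows "tay a i (\<phi> f) = coeff (pcompose f [:a, 1:]) i"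
proof (rule tay_dvd[OF _ assms(2)])
 have "[:-a, 1:] ^ \<mu> a dvd \<Delta>" using \<Delta>_split[OF assms(1)] by (metis dvd_triv_left)
 moreover have "\<Delta> dvd f mod \<Delta> - f" by (metis dvd_minus_mod dvd_minus_iff minus_diff_eq)
 ultimately show "[:-a, 1:] ^ \<mu> a dvd rep (\<phi> f) - f" unfolding rep_\<phi> by (rule dvd_trans)
qed

lemma tay_power:
 assumes "a \<in> E" "i < \<mu> a" "i \<le> n"
 shows "tay a i (\<phi> ([:-a, 1:] ^ n * g)) = (if i < n then 0 else poly g a)"
proof -
 have "pcompose ([:-a, 1:] ^ n) [:a, 1:] = monom 1 n"
  unfolding pcompose_power by (simp add: pcompose_pCons monom_altdef)
 then have "tay a i (\<phi> ([:-a, 1:] ^ n * g)) = coeff (monom 1 n * pcompose g [:a, 1:]) i"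
  unfolding tay_\<phi>[OF assms(1,2)] by (simp only: pcompose_mult)
 then show ?thesis unfolding coeff_monom_mult using assms(3) by (simp flip: poly_0_coeff_0 add: poly_pcompose)
qed

lemma poly_rep_\<phi>: "e \<in> E \<Longrightarrow> poly (rep (\<phi> f)) e = poly f e"
 using tay_power[of e 0 0 f] \<mu>_pos[of e] unfolding tay_0 by simp

lemma form_tay: "form 1 (tay a i)"
 by (rule form_lin[OF lin_tay])

lemma form_coeff_sq: "form 2 (\<lambda>v. coeff (sq v) i)"
 using form_quadratic[of "cfm i"] unfolding coeff_sq cf_bil quadratic_form_bil[abs_def] .

lemma nn_power:
 assumes "a \<in> E" "\<mu> a \<ge> k" "k \<ge> 1"
 obtains \<Delta>1 where "\<Delta> div [:-a, 1:] ^ k = [:-a, 1:] ^ (\<mu> a - k) * \<Delta>1" "poly \<Delta>1 a \<noteq> 0" "\<Delta> = [:-a, 1:] ^ \<mu> a * \<Delta>1"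
proof -
 obtain \<Delta>1 where D: "\<Delta> = [:-a, 1:] ^ \<mu> a * \<Delta>1" "poly \<Delta>1 a \<noteq> 0" using \<Delta>_split[OF assms(1)] by metis
 have "[:-a, 1:] ^ \<mu> a = [:-a, 1:] ^ k * [:-a, 1:] ^ (\<mu> a - k)" using assms(2) by (simp flip: power_add)
 then have "\<Delta> = [:-a, 1:] ^ k * ([:-a, 1:] ^ (\<mu> a - k) * \<Delta>1)" using D(1) by (simp only: mult.assoc)
 moreover have "[:-a, 1:] ^ k \<noteq> 0" by simp
 ultimately have "\<Delta> div [:-a, 1:] ^ k = [:-a, 1:] ^ (\<mu> a - k) * \<Delta>1" by (metis nonzero_mult_div_cancel_left)
 then show thesis using that D by blast
qed

lemma tay_nn:
 assumes "a \<in> E"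
 shows "tay a (\<mu> a - 1) (\<phi> (nn a)) \<noteq> 0" "i < \<mu> a - 1 \<Longrightarrow> tay a i (\<phi> (nn a)) = 0"
proof -
 obtain \<Delta>1 where D: "nn a = [:-a, 1:] ^ (\<mu> a - 1) * \<Delta>1" "poly \<Delta>1 a \<noteq> 0"
  using nn_power[OF assms, of 1] \<mu>_pos[OF assms] unfolding nn_def by (auto simp: Suc_le_eq)
 show "tay a (\<mu> a - 1) (\<phi> (nn a)) \<noteq> 0" "i < \<mu> a - 1 \<Longrightarrow> tay a i (\<phi> (nn a)) = 0"
  unfolding D(1) using tay_power[OF assms, of _ "\<mu> a - 1" \<Delta>1] \<mu>_pos[OF assms] D(2) by auto
qed

lemma tay_N2:
 assumes "a \<in> E" "\<mu> a \<ge> 2"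
 shows "tay a (\<mu> a - 2) (\<phi> (N2 a)) \<noteq> 0" "i < \<mu> a - 2 \<Longrightarrow> tay a i (\<phi> (N2 a)) = 0"
proof -
 obtain \<Delta>1 where D: "N2 a = [:-a, 1:] ^ (\<mu> a - 2) * \<Delta>1" "poly \<Delta>1 a \<noteq> 0"
  using nn_power[OF assms] unfolding N2_def by auto
 show "tay a (\<mu> a - 2) (\<phi> (N2 a)) \<noteq> 0" "i < \<mu> a - 2 \<Longrightarrow> tay a i (\<phi> (N2 a)) = 0"
  unfolding D(1) using tay_power[OF assms(1), of _ "\<mu> a - 2" \<Delta>1] assms(2) D(2) by auto
qed

lemma tay_nn_other:
 assumes "a \<in> E" "b \<in> E" "a \<noteq> b" "i < \<mu> a"
 shows "tay a i (\<phi> (nn b)) = 0"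
proof -
 obtain \<Delta>1 where D: "\<Delta> = [:-a, 1:] ^ \<mu> a * \<Delta>1" using \<Delta>_split[OF assms(1)] by metis
 have "poly \<Delta> b = 0" using assms(2) root_iff by blast
 then have "poly \<Delta>1 b = 0" unfolding D using assms(3) by simp
 then obtain \<Delta>2 where D2: "\<Delta>1 = [:-b, 1:] * \<Delta>2" by (elim root_factorE)
 have "[:-b, 1:] * nn b = [:-b, 1:] * ([:-a, 1:] ^ \<mu> a * \<Delta>2)"
  unfolding nn[OF assms(2)] by (subst D, subst D2) (simp only: ac_simps)
 then have "nn b = [:-a, 1:] ^ \<mu> a * \<Delta>2" by (subst (asm) mult_left_cancel) auto
 then show ?thesis using tay_power[OF assms(1,4), of "\<mu> a" \<Delta>2] assms(4) by simp
qed

lemma \<mu>_le_5: "a \<in> E \<Longrightarrow> \<mu> a \<le> 5"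
proof -
 assume a: "a \<in> E"
 obtain \<Delta>1 where "\<Delta> = [:-a, 1:] ^ \<mu> a * \<Delta>1" using \<Delta>_split[OF a] by metis
 then have "[:-a, 1:] ^ \<mu> a dvd \<Delta>" by simp
 from dvd_imp_degree_le[OF this \<Delta>_nz] show ?thesis using deg\<Delta> by (simp add: degree_linear_power)
qed

context
 fixes S :: "5 proj set"
 assumes S: "S = zero_locus {quadratic_form P, quadratic_form Q}"
  and kinds: known_kind
begin

text \<open>Moves a local computation to all generic points: a chart is placed around each of them,
  and the nonvanishing conditions needed there are collected in \<open>\<Psi>\<close>.\<close>

lemma multiplicity_generic:
 assumes L: "L \<in> lines" "L = join u v" "indep2 u v" "L \<subseteq> S"
  and \<Psi>: "finite \<Psi>" "\<And>\<psi>. \<psi> \<in> \<Psi> \<Longrightarrow> (\<exists>d. form d \<psi>) \<and> (\<psi> u \<noteq> 0 \<or> \<psi> v \<noteq> 0)"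
  and mult: "\<And>A U F G q \<alpha> \<beta>. pencil_chart P Q \<Delta> \<phi> c0 E \<mu> S A U F G \<Longrightarrow> q \<in> pencil_chart.V P Q A U F G \<Longrightarrow>
  pt (pencil_chart.X A F G q) \<in> L \<Longrightarrow> (\<And>M. M \<in> lines \<Longrightarrow> pt (pencil_chart.X A F G q) \<in> M \<Longrightarrow> M = L) \<Longrightarrow>
  pencil_chart.X A F G q = \<alpha> *s u + \<beta> *s v \<Longrightarrow> (\<And>\<psi>. \<psi> \<in> \<Psi> \<Longrightarrow> \<psi> (pencil_chart.X A F G q) \<noteq> 0) \<Longrightarrow>
  has_branch_multiplicity_at S L (pt (pencil_chart.X A F G q)) k"
 shows "has_branch_multiplicity S L k"
proof -
 obtain E0 where E0: "finite E0" "\<forall>p\<in>L - E0. \<exists>X0 \<alpha> \<beta>. X0 = \<alpha> *s u + \<beta> *s v \<and> X0 \<noteq> 0 \<and> p = pt X0 \<and> nonsing X0 \<and>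
  (\<forall>M\<in>lines. p \<in> M \<longrightarrow> M = L) \<and> (\<forall>\<psi>\<in>\<Psi>. \<psi> X0 \<noteq> 0)" using generic_points[OF L(1-3) \<Psi>] .
 have "has_branch_multiplicity_at S L p k" if p: "p \<in> L - E0" for p
 proof -
  obtain X0 \<alpha> \<beta> where X0: "X0 = \<alpha> *s u + \<beta> *s v" "X0 \<noteq> 0" "p = pt X0" "nonsing X0" and only: "\<forall>M\<in>lines. p \<in> M \<longrightarrow> M = L"
  and nz: "\<forall>\<psi>\<in>\<Psi>. \<psi> X0 \<noteq> 0" using bspec[OF E0(2) p] by blast
  have on: "onS X0" using p L(4) pt_zero_locus[OF X0(2)] S X0(3) by blast
  obtain A U F G where c: "graph_chart S A U F G" and 0: "(0, 0) \<in> U" and A: "A *v vector [1, 0, 0, F (0, 0), G (0, 0)] = X0"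
  using chart_exists[OF on X0(4) S] .
  interpret pc: pencil_chart P Q \<Delta> \<phi> c0 E \<mu> S A U F G by unfold_locales (fact S c)+
  have Xo: "pc.X (0, 0) = X0" unfolding pc.X_def using A by simp
  have q: "(0, 0) \<in> pc.V" using pc.nonsing_dd[OF 0] X0(4) 0 unfolding Xo pc.V_def by simp
  show ?thesis using mult[OF pc.pencil_chart_axioms q] only nz X0(1) p unfolding Xo X0(3) by blast
 qed
 then show ?thesis unfolding has_branch_multiplicity_def using E0(1) by blast
qed

lemma line0_has_multiplicity:
 assumes j: "j \<in> sqrt1 \<Delta>" and L: "line0 j \<subseteq> S"
 shows "has_branch_multiplicity S (line0 j) 1"
proof (rule multiplicity_generic[OF _ line0_def line0_indep[OF j] L, of "(\<lambda>e. tay e 0) ` E"])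
 show mem: "line0 j \<in> lines" unfolding lines_def using j by blast
 show "finite ((\<lambda>e. tay e 0) ` E)" using finE by blast
 show "(\<exists>d. form d \<psi>) \<and> (\<psi> (\<phi> j) \<noteq> 0 \<or> \<psi> (\<phi> ([:0, 1:] * j)) \<noteq> 0)" if \<psi>: "\<psi> \<in> (\<lambda>e. tay e 0) ` E" for \<psi>
 proof -
  obtain e where e: "e \<in> E" "\<psi> = tay e 0" using \<psi> by blast
  have "(poly j e)\<^sup>2 = 1" using sqrt1_eval[OF j] e(1) root_iff by blast
  then have "\<psi> (\<phi> j) \<noteq> 0" unfolding e(2) tay_0 poly_rep_\<phi>[OF e(1)] by auto
  then show ?thesis unfolding e(2) using form_tay by blast
 qed
 fix A U F G q \<alpha> \<beta>
 assume "pencil_chart P Q \<Delta> \<phi> c0 E \<mu> S A U F G"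
 then interpret pc: pencil_chart P Q \<Delta> \<phi> c0 E \<mu> S A U F G .
 assume q: "q \<in> pc.V" "pt (pc.X q) \<in> line0 j" "\<And>M. M \<in> lines \<Longrightarrow> pt (pc.X q) \<in> M \<Longrightarrow> M = line0 j"
  and nz: "\<And>\<psi>. \<psi> \<in> (\<lambda>e. tay e 0) ` E \<Longrightarrow> \<psi> (pc.X q) \<noteq> 0"
 show "has_branch_multiplicity_at S (line0 j) (pt (pc.X q)) 1"
 proof (rule pc.line0_multiplicity[OF q(1) mem L q(2,3) kinds])
  show "poly (rep (pc.X q)) e \<noteq> 0" if "e \<in> E" for e using nz[OF imageI[OF that]] unfolding tay_0 .
 qed
qed

lemma line2_has_multiplicity:
 assumes a: "a \<in> E" "\<mu> a \<ge> 2" and j: "j \<in> sqrt1 (N2 a)" and L: "line2 a j \<subseteq> S"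
 shows "has_branch_multiplicity S (line2 a j) (\<mu> a)"
proof -
 \<comment> \<open>The nonvanishing conditions of the local computation. The quadratic one belongs
   to \<open>\<mu> a = 2\<close>; for larger \<open>\<mu> a\<close> the second Taylor relation makes
   both of its terms equal on the line.\<close>
 define \<Psi> where "\<Psi> = (\<lambda>e. tay e 0) ` (E - {a}) \<union> {tay a 1, tay a (\<mu> a - 1), \<lambda>v. coeff (sq v) 2} \<union>
  (if \<mu> a = 2 then {\<lambda>v. tay a 1 v * tay a 1 v - coeff (sq v) 2} else {})"
 have sq1: "coeff (sq (\<phi> ([:-a, 1:] * j))) 2 = 1" "coeff (sq (\<phi> (nn a))) 2 = 0"
  using line2_sq(2)[OF a j, of 1 0] line2_sq(2)[OF a j, of 0 1] by (simp_all add: power2_eq_square eval_nat_numeral)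
 have N2s: "poly (N2 a) e = 0 \<Longrightarrow> poly j e \<noteq> 0" for e using sqrt1_eval[OF j, of e] by auto
 have t1: "tay a 1 (\<phi> ([:-a, 1:] * j)) = poly j a" using tay_power[OF a(1), of 1 1 j] a(2) by simp
 have t0: "tay a 0 (\<phi> ([:-a, 1:] * j)) = 0" "tay a 0 (\<phi> (nn a)) = 0"
  using tay_power[OF a(1), of 0 1 j] tay_nn(2)[OF a(1), of 0] a(2) by simp_all
 have mem: "line2 a j \<in> lines" unfolding lines_def using a j by blast
 show ?thesis
 proof (rule multiplicity_generic[OF mem line2_def line2_indep[OF a j] L, of \<Psi>])
  show "finite \<Psi>" unfolding \<Psi>_def using finE by simp
  show "(\<exists>d. form d \<psi>) \<and> (\<psi> (\<phi> ([:-a, 1:] * j)) \<noteq> 0 \<or> \<psi> (\<phi> (nn a)) \<noteq> 0)" if \<psi>: "\<psi> \<in> \<Psi>" for \<psi>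
  proof -
  consider e where "e \<in> E - {a}" "\<psi> = tay e 0" | "\<psi> = tay a 1" | "\<psi> = tay a (\<mu> a - 1)" | "\<psi> = (\<lambda>v. coeff (sq v) 2)"
  | "\<mu> a = 2" "\<psi> = (\<lambda>v. tay a 1 v * tay a 1 v - coeff (sq v) 2)"
  using \<psi> unfolding \<Psi>_def by (auto split: if_splits)
  then show ?thesis
  proof cases
  case 1
  have "poly ([:-a, 1:]\<^sup>2 * N2 a) e = 0" unfolding N2[OF a] using 1(1) root_iff by blast
  then have "poly (N2 a) e = 0" using 1(1) by simp
  then have "poly ([:-a, 1:] * j) e \<noteq> 0" using N2s[of e] 1(1) by simp
  then have "\<psi> (\<phi> ([:-a, 1:] * j)) \<noteq> 0" unfolding 1(2) tay_0 using poly_rep_\<phi>[of e] 1(1) by simp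
  then show ?thesis unfolding 1(2) using form_tay by blast
  next
  case 2
  show ?thesis
  proof (cases "\<mu> a = 2")
  case True
  then have "\<psi> (\<phi> (nn a)) \<noteq> 0" unfolding 2 using tay_nn(1)[OF a(1)] by simp
  then show ?thesis unfolding 2 using form_tay by blast
  next
  case False
  obtain \<Delta>1 where D: "N2 a = [:-a, 1:] ^ (\<mu> a - 2) * \<Delta>1" using nn_power[OF a] unfolding N2_def by auto
  have "poly (N2 a) a = 0" unfolding D using False a(2) by (simp add: poly_power)
  then have "\<psi> (\<phi> ([:-a, 1:] * j)) \<noteq> 0" unfolding 2 t1 by (rule N2s)
  then show ?thesis unfolding 2 using form_tay by blast
  qed
  next
  case 3
  then show ?thesis using tay_nn(1)[OF a(1)] form_tay by blast
  next
  case 4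
  then show ?thesis using sq1 form_coeff_sq by auto
  next
  case 5
  have "form (1 + 1) (\<lambda>v. tay a 1 v * tay a 1 v)" by (intro form_mult form_tay)
  then have "form 2 (\<lambda>v. tay a 1 v * tay a 1 v)" by (simp add: numeral_2_eq_2)
  then have "form 2 \<psi>" unfolding 5(2) by (intro form_diff form_coeff_sq)
  moreover have "\<psi> (\<phi> (nn a)) \<noteq> 0" unfolding 5(2) sq1 using tay_nn(1)[OF a(1)] 5(1) by simp
  ultimately show ?thesis by blast
  qed
  qed
  fix A U F G q \<alpha> \<beta>
  assume "pencil_chart P Q \<Delta> \<phi> c0 E \<mu> S A U F G"
  then interpret pc: pencil_chart P Q \<Delta> \<phi> c0 E \<mu> S A U F G .
  assume q: "q \<in> pc.V" "pt (pc.X q) \<in> line2 a j" "\<And>M. M \<in> lines \<Longrightarrow> pt (pc.X q) \<in> M \<Longrightarrow> M = line2 a j"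
  and X: "pc.X q = \<alpha> *s \<phi> ([:-a, 1:] * j) + \<beta> *s \<phi> (nn a)" and nz: "\<And>\<psi>. \<psi> \<in> \<Psi> \<Longrightarrow> \<psi> (pc.X q) \<noteq> 0"
  have x0: "tay a 0 (pc.X q) = 0" unfolding X using lin_tay[of a 0] t0 unfolding lin_def by simp
  have \<mu>: "\<mu> a \<in> {2, 3, 4, 5}" using a(2) \<mu>_le_5[OF a(1)] by auto
  show "has_branch_multiplicity_at S (line2 a j) (pt (pc.X q)) (\<mu> a)"
  proof (rule pc.line2_multiplicity[OF q(1) mem L q(2,3) kinds a(1) \<mu> x0])
  show "tay a 1 (pc.X q) \<noteq> 0" "coeff (sq (pc.X q)) 2 \<noteq> 0" "tay a (\<mu> a - 1) (pc.X q) \<noteq> 0"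
  using nz unfolding \<Psi>_def by blast+
  show "poly (rep (pc.X q)) e \<noteq> 0" if "e \<in> E - {a}" for e using nz[of "tay e 0"] that unfolding \<Psi>_def tay_0 by blast
  show "tay a 1 (pc.X q) * tay a 1 (pc.X q) - coeff (sq (pc.X q)) 2 \<noteq> 0" if "\<mu> a = 2"
  using nz[of "\<lambda>v. tay a 1 v * tay a 1 v - coeff (sq v) 2"] that unfolding \<Psi>_def by simp
  qed
 qed
qed

lemma nil_has_multiplicity:
 assumes k: "kind3 a" and L: "join (\<phi> (N2 a)) (\<phi> (nn a)) \<subseteq> S"
 shows "has_branch_multiplicity S (join (\<phi> (N2 a)) (\<phi> (nn a))) 2"
proof -
 have a: "a \<in> E" "\<mu> a = 4 \<or> \<mu> a = 5" "\<mu> a \<ge> 2" and simple: "\<And>e. e \<in> E - {a} \<Longrightarrow> \<mu> e = 1" using k unfolding kind3_def by auto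
 define \<psi>0 where "\<psi>0 = tay a (\<mu> a - 2)"
 have mem: "join (\<phi> (N2 a)) (\<phi> (nn a)) \<in> lines" unfolding lines_def using k a(1) by blast
 show ?thesis
 proof (rule multiplicity_generic[OF mem refl indep2_N2[OF a(1,3)] L, of "{\<psi>0}"])
  show "(\<exists>d. form d \<psi>) \<and> (\<psi> (\<phi> (N2 a)) \<noteq> 0 \<or> \<psi> (\<phi> (nn a)) \<noteq> 0)" if "\<psi> \<in> {\<psi>0}" for \<psi>
  using that tay_N2(1)[OF a(1,3)] form_tay unfolding \<psi>0_def by blast
  fix A U F G q \<alpha> \<beta>
  assume "pencil_chart P Q \<Delta> \<phi> c0 E \<mu> S A U F G"
  then interpret pc: pencil_chart P Q \<Delta> \<phi> c0 E \<mu> S A U F G .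
  assume q: "q \<in> pc.V" "pt (pc.X q) \<in> join (\<phi> (N2 a)) (\<phi> (nn a))" "\<And>M. M \<in> lines \<Longrightarrow> pt (pc.X q) \<in> M \<Longrightarrow> M = join (\<phi> (N2 a)) (\<phi> (nn a))"
  and X: "pc.X q = \<alpha> *s \<phi> (N2 a) + \<beta> *s \<phi> (nn a)" and nz: "\<And>\<psi>. \<psi> \<in> {\<psi>0} \<Longrightarrow> \<psi> (pc.X q) \<noteq> 0"
  have low: "tay a i (pc.X q) = 0" if "i < \<mu> a - 2" for i
  unfolding X using lin_tay[of a i] tay_N2(2)[OF a(1,3) that] tay_nn(2)[OF a(1), of i] that unfolding lin_def by simp
  have top: "tay a (\<mu> a - 2) (pc.X q) \<noteq> 0" using nz unfolding \<psi>0_def by blast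
  from a(2) show "has_branch_multiplicity_at S (join (\<phi> (N2 a)) (\<phi> (nn a))) (pt (pc.X q)) 2"
  proof
  assume \<mu>: "\<mu> a = 5"
  show ?thesis by (rule pc.nil5_multiplicity[OF q(1) mem L q(2,3) kinds a(1) \<mu>]) (use low top \<mu> in auto)
  next
  assume \<mu>: "\<mu> a = 4"
  \<comment> \<open>A fourfold root leaves a cofactor of degree one, whose root is the simple
    eigenvalue \<open>e\<close> required by the local computation.\<close>
  obtain \<Delta>1 where D: "\<Delta> = [:-a, 1:] ^ \<mu> a * \<Delta>1" "\<Delta>1 \<noteq> 0" "\<And>x. poly \<Delta>1 x = 0 \<Longrightarrow> x \<in> E - {a}" using \<Delta>_split[OF a(1)] by metis
  have "degree ([:-a, 1:] ^ \<mu> a * \<Delta>1) = 4 + degree \<Delta>1" using D(2) \<mu> by (subst degree_mult_eq) (auto simp: degree_linear_power)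
  then have "degree \<Delta>1 \<noteq> 0" using deg\<Delta> unfolding D(1)[symmetric] by simp
  then obtain e where "poly \<Delta>1 e = 0" using Fundamental_Theorem_Algebra.fundamental_theorem_of_algebra constant_degree by metis
  then have e: "e \<in> E - {a}" by (rule D(3))
  have m2: "a \<noteq> e" "0 < \<mu> e" using e \<mu>_pos by auto
  have "tay e 0 (\<phi> (N2 a)) = 0" unfolding tay_0
  proof -
  have "poly ([:-a, 1:]\<^sup>2 * N2 a) e = 0" unfolding N2[OF a(1,3)] using e root_iff by blast
  then have "poly (N2 a) e = 0" using e by simp
  then show "poly (rep (\<phi> (N2 a))) e = 0" using poly_rep_\<phi>[of e] e by simp
  qed
  then have y0: "tay e 0 (pc.X q) = 0"
  unfolding X using lin_tay[of e 0] tay_nn_other[of e a 0] e a(1) m2 unfolding lin_def by simp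
  show ?thesis
  by (rule pc.nil4_multiplicity[OF q(1) mem L q(2,3) kinds a(1) \<mu> _ _ simple[OF e] _ y0]) (use low top \<mu> e in auto)
  qed
 qed simp
qed

text \<open>Outside finitely many points, branching forces a zero of the discriminant, hence a point
  on one of the finitely many lines; an irreducible curve covered in this way is one of
  them.\<close>

lemma branch_curve_in_lines:
 assumes C: "irreducible_curve C" and mult: "has_branch_multiplicity S C k" "k > 0"
 shows "C \<in> lines"
proof -
 obtain E0 where E0: "finite E0" "\<And>p. p \<in> C - E0 \<Longrightarrow> has_branch_multiplicity_at S C p k"
  using mult(1) unfolding has_branch_multiplicity_def by blast
 have "C - (E0 \<union> (\<lambda>a. pt (\<phi> (nn a))) ` E) \<subseteq> \<Union>lines"
 proof
  fix p assume p: "p \<in> C - (E0 \<union> (\<lambda>a. pt (\<phi> (nn a))) ` E)"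
  then obtain A U F G q h DS where c: "graph_chart S A U F G" and q: "q \<in> U" "p = graph_pt A F G q"
  and b: "curve_equation C A U F G q h" "divided_by_D1 q h (H_coeffs F G) DS" "order_along q h (discriminant DS) = enat k"
  using E0(2)[of p] unfolding has_branch_multiplicity_at_def by blast
  interpret pc: pencil_chart P Q \<Delta> \<phi> c0 E \<mu> S A U F G by unfold_locales (fact S c)+
  have pX: "p = pt (pc.X q)" using q(2) unfolding pc.graph_pt_X .
  have "nonsing (pc.X q)"
  proof (rule ccontr)
  assume "\<not> nonsing (pc.X q)"
  from sing_imp_nn[OF this pc.X_nonzero] obtain a c where a: "a \<in> E" "pc.X q = c *s \<phi> (nn a)" .
  then have "c \<noteq> 0" "\<phi> (nn a) \<noteq> 0" using pc.X_nonzero[of q] by auto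
  then have "p = pt (\<phi> (nn a))" unfolding pX a(2) by (rule pt_scale)
  then show False using p a(1) by blast
  qed
  then have "q \<in> pc.V" using pc.nonsing_dd[OF q(1)] q(1) unfolding pc.V_def by blast
  from pc.disc_zero_of_branch[OF this b mult(2)] show "p \<in> \<Union>lines"
  using disc_lines[OF kinds pc.onS_X[OF q(1)] _ pc.X_nonzero] unfolding pX by blast
 qed
 then show ?thesis using irreducible_curve_in_lines[OF C _ _ finite_lines lines_projective] E0(1) finE by (metis finite_UnI finite_imageI)
qed

lemma kind2_line_no_branch_aux:
 assumes k: "kind2 a b" "\<mu> a = 2" and L: "join (\<phi> (nn a)) (\<phi> (nn b)) \<subseteq> S"
 shows "\<not> (has_branch_multiplicity S (join (\<phi> (nn a)) (\<phi> (nn b))) k \<and> k > 0)"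
proof
 define C where "C = join (\<phi> (nn a)) (\<phi> (nn b))"
 assume "has_branch_multiplicity S (join (\<phi> (nn a)) (\<phi> (nn b))) k \<and> k > 0"
 then obtain E0 where E0: "finite E0" "\<And>p. p \<in> C - E0 \<Longrightarrow> has_branch_multiplicity_at S C p k" and k0: "k > 0"
  unfolding has_branch_multiplicity_def C_def by blast
 have ab: "a \<in> E" "b \<in> E" "a \<noteq> b" "\<mu> a \<ge> 2" "\<mu> b \<ge> 2" "\<mu> b = 2 \<or> \<mu> b = 3" using k unfolding kind2_def by auto
 have mem: "C \<in> lines" unfolding lines_def C_def using k(1) ab by blast
 define \<Psi> where "\<Psi> = {tay a 1, tay b (\<mu> b - 1)}"
 have fin\<Psi>: "finite \<Psi>" unfolding \<Psi>_def by simp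
 have form\<Psi>: "(\<exists>d. form d \<psi>) \<and> (\<psi> (\<phi> (nn a)) \<noteq> 0 \<or> \<psi> (\<phi> (nn b)) \<noteq> 0)" if "\<psi> \<in> \<Psi>" for \<psi>
  using that tay_nn(1)[OF ab(1)] tay_nn(1)[OF ab(2)] form_tay k(2) unfolding \<Psi>_def by auto
 obtain E1 where E1: "finite E1" "\<forall>p\<in>C - E1. \<exists>X0 \<alpha> \<beta>. X0 = \<alpha> *s \<phi> (nn a) + \<beta> *s \<phi> (nn b) \<and> X0 \<noteq> 0 \<and> p = pt X0 \<and> nonsing X0 \<and>
  (\<forall>M\<in>lines. p \<in> M \<longrightarrow> M = C) \<and> (\<forall>\<psi>\<in>\<Psi>. \<psi> X0 \<noteq> 0)"
  using generic_points[OF mem C_def indep2_nn[OF k(1)] fin\<Psi> form\<Psi>] .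
 \<comment> \<open>A multiplicity is claimed at all but finitely many points, so a single generic
   point is enough for the contradiction.\<close>
 have "infinite (C - (E0 \<union> E1))" using infinite_join[OF indep2_nn[OF k(1)]] E0(1) E1(1) unfolding C_def by simp
 then obtain p where p: "p \<in> C - (E0 \<union> E1)" by (metis finite.emptyI equals0I)
 then obtain A U F G q h DS where c: "graph_chart S A U F G" and q: "q \<in> U" "p = graph_pt A F G q"
  and b: "curve_equation C A U F G q h" "divided_by_D1 q h (H_coeffs F G) DS" "order_along q h (discriminant DS) = enat k"
  using E0(2)[of p] unfolding has_branch_multiplicity_at_def by blast
 have "p \<in> C - E1" using p by blast
 from bspec[OF E1(2) this] obtain X0 \<alpha> \<beta> where X: "X0 = \<alpha> *s \<phi> (nn a) + \<beta> *s \<phi> (nn b) \<and> X0 \<noteq> 0 \<and> p = pt X0 \<and> nonsing X0 \<and>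
  (\<forall>M\<in>lines. p \<in> M \<longrightarrow> M = C) \<and> (\<forall>\<psi>\<in>\<Psi>. \<psi> X0 \<noteq> 0)" by (elim exE)
 note X0 = X[THEN conjunct1] X[THEN conjunct2, THEN conjunct1] X[THEN conjunct2, THEN conjunct2, THEN conjunct1]
  X[THEN conjunct2, THEN conjunct2, THEN conjunct2, THEN conjunct1]
  X[THEN conjunct2, THEN conjunct2, THEN conjunct2, THEN conjunct2, THEN conjunct2]
 interpret pc: pencil_chart P Q \<Delta> \<phi> c0 E \<mu> S A U F G by unfold_locales (fact S c)+
 have "pt X0 = pt (pc.X q)" using q(2) X0(3) unfolding pc.graph_pt_X by simp
 then obtain z where z: "z \<noteq> 0" "pc.X q = z *s X0" using pt_eqD[OF _ X0(2) pc.X_nonzero] by blast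
 have qV: "q \<in> pc.V" using pc.nonsing_dd[OF q(1)] nonsing_scale[OF X0(4) z(1)] q(1) unfolding z(2) pc.V_def by blast
 have tz: "tay x i (pc.X q) = z * tay x i X0" for x i unfolding z(2) using lin_tay[of x i] unfolding lin_def by blast
 have tX: "tay x i X0 = \<alpha> * tay x i (\<phi> (nn a)) + \<beta> * tay x i (\<phi> (nn b))" for x i
  unfolding X0(1) using lin_tay[of x i] unfolding lin_def by simp
 have za: "tay a i (pc.X q) = 0" if "i < \<mu> a - 1" for i
  unfolding tz tX using tay_nn(2)[OF ab(1) that] tay_nn_other[OF ab(1,2,3), of i] that by simp
 have zb: "tay b i (pc.X q) = 0" if "i < \<mu> b - 1" for i
  unfolding tz tX using tay_nn(2)[OF ab(2) that] tay_nn_other[OF ab(2,1) ab(3)[symmetric], of i] that by simp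
 have na: "tay a 1 (pc.X q) \<noteq> 0" "tay b (\<mu> b - 1) (pc.X q) \<noteq> 0" unfolding tz using X0(5) z(1) unfolding \<Psi>_def by auto
 from ab(6) show False
 proof
  assume "\<mu> b = 2"
  then show False using pc.no_branch_22[OF qV ab(1,2,4,5,3) za zb na(1) _ b k0] na k(2) by simp
 next
  assume \<mu>: "\<mu> b = 3"
  then have "\<mu> b \<ge> 3" by simp
  from pc.no_branch_23[OF qV ab(1,2,4) this ab(3) za zb zb na(1) _ b k0] show False using na k(2) \<mu> by simp
 qed
qed

text \<open>Two triple roots would exceed the degree five of \<open>\<Delta>\<close>. So one of the
  multiplicities is 2 and, by symmetry, may be placed first.\<close>

lemma kind2_line_no_branch:
 assumes k: "kind2 a b" and L: "join (\<phi> (nn a)) (\<phi> (nn b)) \<subseteq> S"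
 shows "\<not> (has_branch_multiplicity S (join (\<phi> (nn a)) (\<phi> (nn b))) k \<and> k > 0)"
proof (cases "\<mu> a = 2")
 case True
 then show ?thesis using kind2_line_no_branch_aux[OF k _ L] by blast
next
 case False
 have ab: "a \<in> E" "b \<in> E" "a \<noteq> b" "\<mu> a = 3" "\<mu> b = 2 \<or> \<mu> b = 3" using k False unfolding kind2_def by auto
 have "\<mu> b = 2"
 proof (rule ccontr)
  assume "\<mu> b \<noteq> 2"
  then have "\<mu> b = 3" using ab(5) by simp
  have "degree ([:-a, 1:] ^ \<mu> a * [:-b, 1:] ^ \<mu> b) = 6" using ab(4) \<open>\<mu> b = 3\<close> by (subst degree_mult_eq) (auto simp: degree_linear_power)
  moreover have "[:-a, 1:] ^ \<mu> a * [:-b, 1:] ^ \<mu> b dvd \<Delta>"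
  proof (rule coprime_mult_dvd)
  show "[:-a, 1:] ^ \<mu> a dvd \<Delta>" "[:-b, 1:] ^ \<mu> b dvd \<Delta>"
  using \<Delta>_split[OF ab(1)] \<Delta>_split[OF ab(2)] by (metis dvd_triv_left)+
  show "poly ([:-b, 1:] ^ \<mu> b) x \<noteq> 0" if "poly ([:-a, 1:] ^ \<mu> a) x = 0" for x using that ab(3) by (auto simp: poly_power)
  qed auto
  ultimately show False using dvd_imp_degree_le[OF _ \<Delta>_nz] deg\<Delta> by fastforce
 qed
 moreover have "kind2 b a" using k unfolding kind2_def by (auto simp: insert_commute)
 moreover have "join (\<phi> (nn a)) (\<phi> (nn b)) = join (\<phi> (nn b)) (\<phi> (nn a))" unfolding join_def by (simp add: insert_commute)
 ultimately show ?thesis using kind2_line_no_branch_aux[of b a] L by metis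
qed

end

end

section \<open>From the Segre symbol to the kinds, and the conclusion\<close>

context pencil_roots
begin

text \<open>\<open>Q\<close> takes the value \<open>poly (nn a) a\<close> at the eigenvector, which
  is nonzero at a simple root. So singular points on the surface come from multiple roots.\<close>

lemma onS_nn:
 assumes a: "a \<in> E" and on: "onS (\<phi> (nn a))"
 shows "\<mu> a \<ge> 2"
proof (rule ccontr)
 assume "\<not> \<mu> a \<ge> 2"
 then have "\<mu> a = 1" using \<mu>_pos[OF a] by simp
 then have "tay a 0 (\<phi> (nn a)) \<noteq> 0" using tay_nn(1)[OF a] by simp
 then have p: "poly (nn a) a \<noteq> 0" unfolding tay_0 poly_rep_\<phi>[OF a] .
 have "bil Q (\<phi> (nn a)) (\<phi> (nn a)) = poly (nn a) a" unfolding bilQ l0_nn[OF a] ..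
 then show False using on p unfolding onS_def by simp
qed

lemma two_double_roots:
 assumes kinds: known_kind
  and ab: "a \<in> E" "b \<in> E" "a \<noteq> b" "\<mu> a \<ge> 2" "\<mu> b \<ge> 2"
 shows "kind2 a b"
 using kinds
proof (elim disjE exE)
 assume "kind1"
 then show ?thesis using ab unfolding kind1_def by blast
next
 fix x y assume k: "kind2 x y"
 then have "a \<in> {x, y}" "b \<in> {x, y}" using ab unfolding kind2_def by force+
 then have "(a = x \<and> b = y) \<or> (a = y \<and> b = x)" using ab(3) by blast
 then show ?thesis using k unfolding kind2_def by (auto simp: insert_commute)
next
 fix x assume k: "kind3 x"
 then have "a = x" "b = x" using ab unfolding kind3_def by force+
 then show ?thesis using ab(3) by simp
qed

lemma kinds_of_blocks:
 assumes blocks: "image_mset \<mu> (mset_set E) = mset ks"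
  and ks: "ks \<in> {[1,1,1,1,1], [1,1,1,2], [1,1,3], [1,2,2], [1,4], [2,3], [5]}"
 shows known_kind
proof -
 have "\<mu> ` E = set ks" using arg_cong[OF blocks, of set_mset] finE by simp
 then have mem: "\<mu> e \<in> set ks" if "e \<in> E" for e using that by blast
 have "count (image_mset \<mu> (mset_set E)) n = card {e \<in> E. \<mu> e = n}" for n
 proof -
  have "{x. x \<in># mset_set E \<and> n = \<mu> x} = {e \<in> E. \<mu> e = n}" using finE by auto
  then show ?thesis unfolding count_image_mset' using finE by simp
 qed
 then have cnt: "card {e \<in> E. \<mu> e = n} = count (mset ks) n" for n unfolding blocks by simp
 have uniq: "a = b" if c: "count (mset ks) n = 1" and ab: "a \<in> E" "b \<in> E" "\<mu> a = n" "\<mu> b = n" for a b n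
 proof -
  have "card {e \<in> E. \<mu> e = n} = 1" using cnt[of n] c by simp
  then obtain x where x: "{e \<in> E. \<mu> e = n} = {x}" by (rule card_1_singletonE)
  have "a \<in> {e \<in> E. \<mu> e = n}" "b \<in> {e \<in> E. \<mu> e = n}" using ab by blast+
  then show ?thesis unfolding x by simp
 qed
 have ex: "\<exists>a\<in>E. \<mu> a = n" if "count (mset ks) n = 1" for n
  using cnt[of n] that by (metis (mono_tags, lifting) card.empty empty_Collect_eq zero_neq_one)
 consider "ks = [1,1,1,1,1]" | "ks = [1,1,1,2]" | "ks = [1,1,3]" | "ks = [1,2,2]" | "ks = [1,4]" | "ks = [2,3]" | "ks = [5]"
  using ks by auto
 then show ?thesis
 proof cases
  case 1
  then have "kind1" unfolding kind1_def using mem by fastforce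
  then show ?thesis by blast
 next
  case 2
  have m: "\<mu> e = 1 \<or> \<mu> e = 2" if "e \<in> E" for e using mem[OF that] unfolding 2 by auto
  have "a = b" if ab: "a \<in> E" "b \<in> E" "\<mu> a \<ge> 2" "\<mu> b \<ge> 2" for a b
  proof (rule uniq[of 2, OF _ ab(1,2)])
  show "\<mu> a = 2" "\<mu> b = 2" using m[OF ab(1)] m[OF ab(2)] ab by auto
  qed (simp add: 2)
  moreover have "\<mu> e \<le> 3" if "e \<in> E" for e using m[OF that] by auto
  ultimately have "kind1" unfolding kind1_def by blast
  then show ?thesis by blast
 next
  case 3
  have m: "\<mu> e = 1 \<or> \<mu> e = 3" if "e \<in> E" for e using mem[OF that] unfolding 3 by auto
  have "a = b" if ab: "a \<in> E" "b \<in> E" "\<mu> a \<ge> 2" "\<mu> b \<ge> 2" for a b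
  proof (rule uniq[of 3, OF _ ab(1,2)])
  show "\<mu> a = 3" "\<mu> b = 3" using m[OF ab(1)] m[OF ab(2)] ab by auto
  qed (simp add: 3)
  moreover have "\<mu> e \<le> 3" if "e \<in> E" for e using m[OF that] by auto
  ultimately have "kind1" unfolding kind1_def by blast
  then show ?thesis by blast
 next
  case 4
  have m: "\<mu> e = 1 \<or> \<mu> e = 2" if "e \<in> E" for e using mem[OF that] unfolding 4 by auto
  have "card {e \<in> E. \<mu> e = 2} = 2" unfolding cnt 4 by simp
  then obtain a b where ab: "{e \<in> E. \<mu> e = 2} = {a, b}" "a \<noteq> b" using card_2_iff by metis
  then have "a \<in> E" "\<mu> a = 2" "b \<in> E" "\<mu> b = 2" by blast+
  moreover have "\<mu> e = 1" if "e \<in> E - {a, b}" for e using m[of e] ab(1) that by blast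
  ultimately have "kind2 a b" unfolding kind2_def using ab(2) by blast
  then show ?thesis by blast
 next
  case 5
  obtain a where a: "a \<in> E" "\<mu> a = 4" using ex[of 4] unfolding 5 by auto
  have "\<mu> e = 1" if "e \<in> E - {a}" for e
  using mem[of e] uniq[of 4 e a] a that unfolding 5 by auto
  then have "kind3 a" unfolding kind3_def using a by blast
  then show ?thesis by blast
 next
  case 6
  obtain a where a: "a \<in> E" "\<mu> a = 2" using ex[of 2] unfolding 6 by auto
  obtain b where b: "b \<in> E" "\<mu> b = 3" using ex[of 3] unfolding 6 by auto
  have "\<mu> e = 1" if "e \<in> E - {a, b}" for e
  using mem[of e] uniq[of 2 e a] uniq[of 3 e b] a b that unfolding 6 by auto
  moreover have "a \<noteq> b" using a b by auto
  ultimately have "kind2 a b" unfolding kind2_def using a b by blast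
  then show ?thesis by blast
 next
  case 7
  obtain a where a: "a \<in> E" "\<mu> a = 5" using ex[of 5] unfolding 7 by auto
  have "\<mu> e = 1" if "e \<in> E - {a}" for e
  using mem[of e] uniq[of 5 e a] a that unfolding 7 by auto
  then have "kind3 a" unfolding kind3_def using a by blast
  then show ?thesis by blast
 qed
qed

end

theorem proposition5p3:
  fixes S :: "5 proj set" and ks :: "nat list"
  assumes "segre_surface S"
    and "has_segre_symbol S (ungrouped ks)"
    and "ks \<in> {[1,1,1,1,1], [1,1,1,2], [1,1,3], [1,2,2], [1,4], [2,3], [5]}"
  shows "branch_divisor_components S =
    {L. projective_line L \<and> L \<subseteq> S \<and>
        (\<forall>p q. p \<in> L \<inter> singular_locus S \<and> q \<in> L \<inter> singular_locus S \<longrightarrow> p = q)}"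
proof -
 have sum: "sum_list ks = 5" using assms(3) by auto
 show ?thesis
 proof (rule pencil_normal_form[OF assms(2) sum])
 fix P Q \<Delta> \<phi> c0 E \<mu>
 assume pencil: "pencil P Q \<Delta> \<phi> c0" and S: "S = zero_locus {quadratic_form P, quadratic_form Q}"
  and E: "finite E" "\<And>e. e \<in> E \<Longrightarrow> \<mu> e > 0" "\<Delta> = (\<Prod>e\<in>E. [:-e, 1:] ^ \<mu> e)" and blocks: "image_mset \<mu> (mset_set E) = mset ks"
 interpret pencil P Q \<Delta> \<phi> c0 by (rule pencil)
 interpret pencil_roots P Q \<Delta> \<phi> c0 E \<mu> by unfold_locales (use E in auto)
 have dim: "variety_dim S = 2" using assms(1) unfolding segre_surface_def irreducible_surface_def by blast
 have kinds: known_kind by (rule kinds_of_blocks[OF blocks assms(3)])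
 \<comment> \<open>The discriminant vanishes along a line on the surface, so each of its points lies
   on a listed line; as the list is finite, the line is on it.\<close>
 have line_in_lines: "L \<in> lines" if L: "projective_line L" "L \<subseteq> S" for L
 proof -
  obtain u v where uv: "indep2 u v" "L = join u v" using L(1) projective_lineE by blast
  have on: "onS (\<alpha> *s u + \<beta> *s v)" for \<alpha> \<beta>
  proof (cases "\<alpha> *s u + \<beta> *s v = 0")
  case False
  then have "pt (\<alpha> *s u + \<beta> *s v) \<in> L" unfolding uv(2) mem_join[OF False] by blast
  then show ?thesis using L(2) pt_zero_locus[OF False] S by blast
  qed (simp add: onS_def bil_simps)
  have "L - {} \<subseteq> \<Union>lines"
  proof
  fix p assume "p \<in> L - {}"
  then obtain \<alpha> \<beta> where p: "\<alpha> *s u + \<beta> *s v \<noteq> 0" "p = pt (\<alpha> *s u + \<beta> *s v)" using joinE uv(2) by blast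
  show "p \<in> \<Union>lines" unfolding p(2) using disc_lines[OF kinds on line_disc[OF on uv(1)] p(1)] by blast
  qed
  then show ?thesis
  using irreducible_curve_in_lines[OF irreducible_curve_join[OF uv(1)] finite.emptyI _ finite_lines lines_projective] unfolding uv(2) by blast
 qed
 \<comment> \<open>Two distinct points determine a line, so a line through both singular points is
   the one without branching.\<close>
 have nn_line: "L = join (\<phi> (nn a)) (\<phi> (nn b))"
  if L: "projective_line L" "pt (\<phi> (nn a)) \<in> L" "pt (\<phi> (nn b)) \<in> L" and k: "kind2 a b" for L a b
 proof -
  obtain u v where uv: "indep2 u v" "L = join u v" using L(1) projective_lineE by blast
  have i: "indep2 (\<phi> (nn a)) (\<phi> (nn b))" using indep2_nn[OF k] .
  obtain x1 x2 y1 y2 where xy: "\<phi> (nn a) = x1 *s u + x2 *s v" "\<phi> (nn b) = y1 *s u + y2 *s v"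
  using L(2,3) mem_join indep2_nonzero'[OF i] unfolding uv(2) by metis
  have "join (\<phi> (nn a)) (\<phi> (nn b)) \<subseteq> L"
  proof
  fix p assume "p \<in> join (\<phi> (nn a)) (\<phi> (nn b))"
  then obtain \<alpha> \<beta> where p: "\<alpha> *s \<phi> (nn a) + \<beta> *s \<phi> (nn b) \<noteq> 0" "p = pt (\<alpha> *s \<phi> (nn a) + \<beta> *s \<phi> (nn b))" using joinE by blast
  have "\<alpha> *s \<phi> (nn a) + \<beta> *s \<phi> (nn b) = (\<alpha> * x1 + \<beta> * y1) *s u + (\<alpha> * x2 + \<beta> * y2) *s v"
  unfolding xy by (simp add: cart_eq_iff algebra_simps)
  then show "p \<in> L" unfolding uv(2) p(2) mem_join[OF p(1)] by blast
  qed
  from zariski_closed_in_line[OF zariski_closed_join this[unfolded uv(2)] uv(1)] show ?thesis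
  using infinite_join[OF i] uv(2) by blast
 qed
 show ?thesis
 proof (intro subset_antisym subsetI)
  fix C assume "C \<in> branch_divisor_components S"
  then obtain k where C: "irreducible_curve C" "C \<subseteq> S" "k > 0" "has_branch_multiplicity S C k"
  unfolding branch_divisor_components_def by blast
  have line: "projective_line C" using lines_projective[OF branch_curve_in_lines[OF S kinds C(1,4,3)]] .
  have "p = q" if pq: "p \<in> C \<inter> singular_locus S" "q \<in> C \<inter> singular_locus S" for p q
  proof (rule ccontr)
  assume "p \<noteq> q"
  obtain a where a: "a \<in> E" "p = pt (\<phi> (nn a))" using pq(1) singular_locus_subset[OF S dim] by blast
  obtain b where b: "b \<in> E" "q = pt (\<phi> (nn b))" using pq(2) singular_locus_subset[OF S dim] by blast
  have "\<mu> a \<ge> 2" using a pq(1) onS_nn[OF a(1)] pt_zero_locus nn_not_dvd[OF a(1)] S C(2) unfolding \<phi>_eq_0[symmetric] by blast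
  moreover have "\<mu> b \<ge> 2" using b pq(2) onS_nn[OF b(1)] pt_zero_locus nn_not_dvd[OF b(1)] S C(2) unfolding \<phi>_eq_0[symmetric] by blast
  ultimately have k2: "kind2 a b" using two_double_roots[OF kinds] a b \<open>p \<noteq> q\<close> by blast
  have "C = join (\<phi> (nn a)) (\<phi> (nn b))" using nn_line[OF line _ _ k2] pq a(2) b(2) by blast
  then show False using kind2_line_no_branch[OF S kinds k2] C(2-4) by blast
  qed
  then show "C \<in> {L. projective_line L \<and> L \<subseteq> S \<and> (\<forall>p q. p \<in> L \<inter> singular_locus S \<and> q \<in> L \<inter> singular_locus S \<longrightarrow> p = q)}"
  using line C(2) by blast
 next
  fix L assume "L \<in> {L. projective_line L \<and> L \<subseteq> S \<and> (\<forall>p q. p \<in> L \<inter> singular_locus S \<and> q \<in> L \<inter> singular_locus S \<longrightarrow> p = q)}"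
  then have L: "projective_line L" "L \<subseteq> S" and one: "\<And>p q. p \<in> L \<inter> singular_locus S \<Longrightarrow> q \<in> L \<inter> singular_locus S \<Longrightarrow> p = q" by blast+
  have "\<exists>k>0. has_branch_multiplicity S L k"
  proof -
  consider j where "j \<in> sqrt1 \<Delta>" "L = line0 j" | a j where "a \<in> E" "\<mu> a \<ge> 2" "j \<in> sqrt1 (N2 a)" "L = line2 a j"
  | a b where "kind2 a b" "L = join (\<phi> (nn a)) (\<phi> (nn b))" | a where "kind3 a" "L = join (\<phi> (N2 a)) (\<phi> (nn a))"
  using line_in_lines[OF L] unfolding lines_def by blast
  then show ?thesis
  proof cases
  case 1
  then have "has_branch_multiplicity S L 1" using line0_has_multiplicity[OF S kinds] L(2) by blast
  then show ?thesis by (intro exI[of _ 1]) simp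
  next
  case 2
  then show ?thesis using line2_has_multiplicity[OF S kinds] L(2) \<mu>_pos by blast
  next
  \<comment> \<open>Both spanning points are singular and distinct, which the assumption on
    \<open>L\<close> excludes.\<close>
  case 3
  have i: "indep2 (\<phi> (nn a)) (\<phi> (nn b))" using indep2_nn[OF 3(1)] .
  note nz = indep2_nonzero'[OF i]
  have "\<phi> (nn a) = 1 *s \<phi> (nn a) + 0 *s \<phi> (nn b)" "\<phi> (nn b) = 0 *s \<phi> (nn a) + 1 *s \<phi> (nn b)" by simp_all
  then have "pt (\<phi> (nn a)) \<in> L" "pt (\<phi> (nn b)) \<in> L" unfolding 3(2) mem_join[OF nz(1)] mem_join[OF nz(2)] by blast+
  moreover have "kind2 b a" using 3(1) unfolding kind2_def by (auto simp: insert_commute)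
  ultimately have "pt (\<phi> (nn a)) = pt (\<phi> (nn b))"
  using one kind2_singular[OF 3(1) S dim] kind2_singular[OF _ S dim] by blast
  then obtain c where "\<phi> (nn b) = c *s \<phi> (nn a)" using pt_eqD nz by blast
  then have "c *s \<phi> (nn a) + (- 1) *s \<phi> (nn b) = 0" by simp
  then show ?thesis using i unfolding indep2_def by (metis neg_equal_0_iff_equal one_neq_zero)
  next
  case 4
  then have "has_branch_multiplicity S L 2" using nil_has_multiplicity[OF S kinds] L(2) by blast
  then show ?thesis by (intro exI[of _ 2]) simp
  qed
  qed
  moreover have "irreducible_curve L" using L(1) projective_lineE irreducible_curve_join by metis
  ultimately show "L \<in> branch_divisor_components S" using L(2) unfolding branch_divisor_components_def by blast
 qed
qed
qed

end
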